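(* Let $L>0$, $\mu>0$, $\alpha>1/2$ and $f\in V^{\alpha}$. There exists $\nu_0>0$ such that for every viscosity $\nu\ge\nu_0$ there are $R,\rho>0$ for which the discrete dynamical system $U$ associated to the linearized 3D Navier-Stokes equations possesses a local attractor $\mathcal A$ relative to the ball $B_{\mathcal X^\mu_\alpha}(R;\rho)$.
   Context: Spaces. $\mathbb T^3_L$ is the 3-dimensional torus of side length $L$. For $s\in\mathbb R$, $V^s$ is the closed subspace of the periodic Sobolev space $H^s(\mathbb T^3_L)^3$ of real, zero-mean, divergence-free vector fields. $A=-\Delta$ is the Stokes operator (positive, selfadjoint on $V^0$), with norms $\|u\|_s=\|A^{s/2}u\|_0$, where $\|\cdot\|_0$ is the $L^2$ norm on $V^0$. $V^{-s}$ is the dual of $V^s$, with duality pairing $\langle\cdot,\cdot\rangle$ extending the $L^2$ inner product. The bilinear operator $B$ is defined by $\langle B(u,v),w\rangle=b(u,v,w)=\sum_{i,j=1}^3\int_{\mathbb T^3_L}u_j\,\partial_{x_j}v_i\,w_i\,dx$, extended by continuity. Phase space. $\mathcal X^\mu_\alpha=L_2(0,\mu,V^{1+\alpha})\times V^\alpha$, and for $R,\rho>0$, $B_{\mathcal X^\mu_\alpha}(R;\rho)=B_{L_2(0,\mu,V^{1+\alpha})}(0,R)\times B_{V^\alpha}(0,\rho)$ (product of closed balls centered at $0$). Linearized system. For $(\psi,u_0)\in\mathcal X^\mu_\alpha$, let $u\in C([0,\mu],V^\alpha)\cap L_2(0,\mu,V^{1+\alpha})$ be the unique weak solution (known to exist)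 of $$\frac{du}{dt}(t)+\nu Au(t)+B(\psi(t),u(t))=f\ (t\in[0,\mu]),\qquad u(0)=u_0,$$ the equation being understood weakly in time and tested against $v\in V^{1+\alpha}$. Define $U(1,(\psi,u_0))=(u,u(\mu))$, a continuous map of $\mathcal X^\mu_\alpha$ into itself, and let $U(n,\cdot)$ be its $n$-fold composition, $n\in\mathbb N$. Local attractor. A local attractor of $U$ relative to a ball $B=B_{\mathcal X^\mu_\alpha}(R;\rho)$ is a nonempty compact set $\mathcal A\subset B$ with $U(1,\mathcal A)=\mathcal A$ and $\lim_{n\to\infty}\sup_{x\in B}\mathrm{dist}_{\mathcal X^\mu_\alpha}(U(n,x),\mathcal A)=0$. *)

theory Defs
  imports "HOL-Analysis.Analysis"
begin

section \<open>Periodic vector fields\<close>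

text \<open>
  A (generalised) periodic vector field on the torus of side length \<open>L\<close>,
  \<open>u(x) = (\<Sum>k. u k * exp (2 * pi * \<i> * (k \<bullet> x) / L))\<close>,
  is identified with the family of its Fourier coefficients, so that fields of arbitrary (also
  negative) Sobolev order live in one type and no a.e. quotient in the space variable is needed.
\<close>

type_synonym vfield = "int ^ 3 \<Rightarrow> complex ^ 3"

definition freq :: "real \<Rightarrow> int ^ 3 \<Rightarrow> real ^ 3" where
  "freq L k = (\<chi> j. 2 * pi * of_int (k $ j) / L)"

definition vdiff :: "vfield \<Rightarrow> vfield \<Rightarrow> vfield" where
  "vdiff u v = (\<lambda>k. u k - v k)"

definition Hsob :: "real \<Rightarrow> real \<Rightarrow> vfield set" where
  "Hsob L s = {u. (\<lambda>k. (1 + (norm (freq L k))\<^sup>2) powr s * (norm (u k))\<^sup>2) summable_on UNIV}"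

definition real_field :: "vfield \<Rightarrow> bool" where
  "real_field u \<longleftrightarrow> (\<forall>k i. u (- k) $ i = cnj (u k $ i))"

definition zero_mean :: "vfield \<Rightarrow> bool" where
  "zero_mean u \<longleftrightarrow> u 0 = 0"

definition divergence :: "real \<Rightarrow> vfield \<Rightarrow> int ^ 3 \<Rightarrow> complex" where
  "divergence L u k = (\<Sum>j\<in>UNIV. \<i> * of_real (freq L k $ j) * u k $ j)"

definition Vsp :: "real \<Rightarrow> real \<Rightarrow> vfield set" where
  "Vsp L s = {u \<in> Hsob L s. real_field u \<and> zero_mean u \<and> (\<forall>k. divergence L u k = 0)}"

text \<open>
  The duality pairing of \<open>V\<^sup>-\<^sup>s\<close> and \<open>V\<^sup>s\<close>; on \<open>V\<^sup>0\<close> it is the inner product of \<open>L\<^sup>2\<close> over one period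
  cell, by Parseval. Here \<open>\<bullet>\<close> is the real inner product on \<open>complex ^ 3\<close>, the real
  part of the Hermitian one; the sum over all \<open>k\<close> of the imaginary parts vanishes for real fields.
\<close>

definition pairing :: "real \<Rightarrow> vfield \<Rightarrow> vfield \<Rightarrow> real" where
  "pairing L u v = L ^ 3 * (\<Sum>\<^sub>\<infinity>k. u k \<bullet> v k)"

definition norm0 :: "real \<Rightarrow> vfield \<Rightarrow> real" where
  "norm0 L u = sqrt (pairing L u u)"

text \<open>The Stokes operator \<open>A = - \<Delta>\<close> and its (spectrally defined) real powers \<open>A\<^sup>r\<close>.\<close>

definition stokes :: "real \<Rightarrow> vfield \<Rightarrow> vfield" where
  "stokes L u = (\<lambda>k. (norm (freq L k))\<^sup>2 *\<^sub>R u k)"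

definition stokes_pow :: "real \<Rightarrow> real \<Rightarrow> vfield \<Rightarrow> vfield" where
  "stokes_pow L r u = (\<lambda>k. ((norm (freq L k))\<^sup>2 powr r) *\<^sub>R u k)"

definition Vnorm :: "real \<Rightarrow> real \<Rightarrow> vfield \<Rightarrow> real" where
  "Vnorm L s u = norm0 L (stokes_pow L (s / 2) u)"

definition Vdist :: "real \<Rightarrow> real \<Rightarrow> vfield \<Rightarrow> vfield \<Rightarrow> real" where
  "Vdist L s u v = Vnorm L s (vdiff u v)"


section \<open>The trilinear form\<close>

text \<open>
  For trigonometric polynomials the trilinear form is the integral over a period cell. It is
  extended by continuity: the Fourier truncations \<open>trunc N u\<close> converge to \<open>u\<close> in every \<open>V\<^sup>s\<close> that
  contains \<open>u\<close>. The real part in \<open>field_val\<close> only changes the type: the sum is real for real fields.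
\<close>

definition field_val :: "real \<Rightarrow> vfield \<Rightarrow> real ^ 3 \<Rightarrow> real ^ 3" where
  "field_val L u x = (\<chi> i. Re (\<Sum>\<^sub>\<infinity>k. u k $ i * cis (freq L k \<bullet> x)))"

definition partial :: "3 \<Rightarrow> (real ^ 3 \<Rightarrow> real) \<Rightarrow> real ^ 3 \<Rightarrow> real" where
  "partial j g x = frechet_derivative g (at x) (axis j 1)"

definition b_trig :: "real \<Rightarrow> vfield \<Rightarrow> vfield \<Rightarrow> vfield \<Rightarrow> real" where
  "b_trig L u v w = (\<Sum>i\<in>UNIV. \<Sum>j\<in>UNIV.
     LINT x:cbox 0 (\<chi> i. L)|lborel.
       field_val L u x $ j * partial j (\<lambda>y. field_val L v y $ i) x * field_val L w x $ i)"

definition trunc :: "nat \<Rightarrow> vfield \<Rightarrow> vfield" where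
  "trunc N u = (\<lambda>k. if \<forall>j. \<bar>k $ j\<bar> \<le> int N then u k else 0)"

definition b_form :: "real \<Rightarrow> vfield \<Rightarrow> vfield \<Rightarrow> vfield \<Rightarrow> real" where
  "b_form L u v w = lim (\<lambda>N. b_trig L (trunc N u) (trunc N v) (trunc N w))"

text \<open>\<open>B(u,v)\<close> as a functional: \<open>Bop L u v w\<close> is the duality bracket of \<open>B(u,v)\<close> with \<open>w\<close>.\<close>

definition Bop :: "real \<Rightarrow> vfield \<Rightarrow> vfield \<Rightarrow> (vfield \<Rightarrow> real)" where
  "Bop L u v = (\<lambda>w. b_form L u v w)"


section \<open>Bochner spaces and the phase space\<close>

definition time :: "real \<Rightarrow> real measure" where
  "time \<mu> = lebesgue_on {0..\<mu>}"

definition strongly_measurable :: "real \<Rightarrow> real \<Rightarrow> real \<Rightarrow> (real \<Rightarrow> vfield) \<Rightarrow> bool" where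
  "strongly_measurable L \<mu> s \<psi> \<longleftrightarrow>
     (\<exists>S. (\<forall>n. simple_function (time \<mu>) (S n) \<and> (\<forall>t\<in>{0..\<mu>}. S n t \<in> Vsp L s)) \<and>
          (AE t in time \<mu>. (\<lambda>n. Vdist L s (S n t) (\<psi> t)) \<longlonglongrightarrow> 0))"

text \<open>Square integrable functions; the values are required to lie in \<open>V\<^sup>s\<close> almost everywhere only.\<close>

definition L2fun :: "real \<Rightarrow> real \<Rightarrow> real \<Rightarrow> (real \<Rightarrow> vfield) set" where
  "L2fun L \<mu> s = {\<psi>. (AE t in time \<mu>. \<psi> t \<in> Vsp L s) \<and> strongly_measurable L \<mu> s \<psi> \<and>
                      integrable (time \<mu>) (\<lambda>t. (Vnorm L s (\<psi> t))\<^sup>2)}"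

definition L2rel :: "real \<Rightarrow> real \<Rightarrow> real \<Rightarrow> ((real \<Rightarrow> vfield) \<times> (real \<Rightarrow> vfield)) set" where
  "L2rel L \<mu> s = {(\<phi>, \<psi>). \<phi> \<in> L2fun L \<mu> s \<and> \<psi> \<in> L2fun L \<mu> s \<and> (AE t in time \<mu>. \<phi> t = \<psi> t)}"

definition L2sp :: "real \<Rightarrow> real \<Rightarrow> real \<Rightarrow> (real \<Rightarrow> vfield) set set" where
  "L2sp L \<mu> s = L2fun L \<mu> s // L2rel L \<mu> s"

definition L2class :: "real \<Rightarrow> real \<Rightarrow> real \<Rightarrow> (real \<Rightarrow> vfield) \<Rightarrow> (real \<Rightarrow> vfield) set" where
  "L2class L \<mu> s \<psi> = L2rel L \<mu> s `` {\<psi>}"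

text \<open>
  The distance of two classes and the solution of the linearised system do not depend on the chosen
  representatives.
\<close>

definition rep :: "(real \<Rightarrow> vfield) set \<Rightarrow> real \<Rightarrow> vfield" where
  "rep \<Psi> = (SOME \<psi>. \<psi> \<in> \<Psi>)"

definition L2dist ::
  "real \<Rightarrow> real \<Rightarrow> real \<Rightarrow> (real \<Rightarrow> vfield) set \<Rightarrow> (real \<Rightarrow> vfield) set \<Rightarrow> real" where
  "L2dist L \<mu> s \<Psi> \<Phi> = sqrt (LINT t|time \<mu>. (Vdist L s (rep \<Psi> t) (rep \<Phi> t))\<^sup>2)"

type_synonym phase = "(real \<Rightarrow> vfield) set \<times> vfield"

definition Xsp :: "real \<Rightarrow> real \<Rightarrow> real \<Rightarrow> phase set" where
  "Xsp L \<mu> \<alpha> = L2sp L \<mu> (1 + \<alpha>) \<times> Vsp L \<alpha>"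

definition Xdist :: "real \<Rightarrow> real \<Rightarrow> real \<Rightarrow> phase \<Rightarrow> phase \<Rightarrow> real" where
  "Xdist L \<mu> \<alpha> = prod_dist (L2dist L \<mu> (1 + \<alpha>)) (Vdist L \<alpha>)"

definition Xball :: "real \<Rightarrow> real \<Rightarrow> real \<Rightarrow> real \<Rightarrow> real \<Rightarrow> phase set" where
  "Xball L \<mu> \<alpha> R \<rho> =
     Metric_space.mcball (L2sp L \<mu> (1 + \<alpha>)) (L2dist L \<mu> (1 + \<alpha>))
       (L2class L \<mu> (1 + \<alpha>) (\<lambda>t k. 0)) R \<times>
     Metric_space.mcball (Vsp L \<alpha>) (Vdist L \<alpha>) (\<lambda>k. 0) \<rho>"


section \<open>The linearised Navier--Stokes equations\<close>

definition test_function :: "real \<Rightarrow> (real \<Rightarrow> real) \<Rightarrow> bool" where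
  "test_function \<mu> \<phi> \<longleftrightarrow>
     (\<forall>n t. (deriv ^^ n) \<phi> field_differentiable (at t)) \<and> closure {t. \<phi> t \<noteq> 0} \<subseteq> {0<..<\<mu>}"

text \<open>
  The equation holds in the sense of distributions on \<open>(0,\<mu>)\<close> after pairing with any \<open>v\<close> in
  \<open>V\<^sup>1\<^sup>+\<^sup>\<alpha>\<close>: the time derivative is moved to the scalar test function \<open>\<phi>\<close>.
\<close>

definition weak_solution ::
  "real \<Rightarrow> real \<Rightarrow> real \<Rightarrow> real \<Rightarrow> vfield \<Rightarrow> (real \<Rightarrow> vfield) \<Rightarrow> vfield \<Rightarrow> (real \<Rightarrow> vfield) \<Rightarrow> bool" where
  "weak_solution L \<mu> \<nu> \<alpha> f \<psi> u0 u \<longleftrightarrow>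
     continuous_map (top_of_set {0..\<mu>}) (Metric_space.mtopology (Vsp L \<alpha>) (Vdist L \<alpha>)) u \<and>
     u \<in> L2fun L \<mu> (1 + \<alpha>) \<and>
     u 0 = u0 \<and>
     (\<forall>v \<in> Vsp L (1 + \<alpha>). \<forall>\<phi>. test_function \<mu> \<phi> \<longrightarrow>
        - (LINT t|time \<mu>. pairing L (u t) v * deriv \<phi> t)
        + (LINT t|time \<mu>. (\<nu> * pairing L (stokes L (u t)) v + Bop L (\<psi> t) (u t) v) * \<phi> t)
        = (LINT t|time \<mu>. pairing L f v * \<phi> t))"

text \<open>
  Functions on \<open>[0,\<mu>]\<close> are taken to be extensional, so that the solution is unique as a HOL function.
\<close>

definition solution ::
  "real \<Rightarrow> real \<Rightarrow> real \<Rightarrow> real \<Rightarrow> vfield \<Rightarrow> (real \<Rightarrow> vfield) \<Rightarrow> vfield \<Rightarrow> (real \<Rightarrow> vfield)" where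
  "solution L \<mu> \<nu> \<alpha> f \<psi> u0 = (THE u. u \<in> extensional {0..\<mu>} \<and> weak_solution L \<mu> \<nu> \<alpha> f \<psi> u0 u)"

definition U1 :: "real \<Rightarrow> real \<Rightarrow> real \<Rightarrow> real \<Rightarrow> vfield \<Rightarrow> phase \<Rightarrow> phase" where
  "U1 L \<mu> \<nu> \<alpha> f = (\<lambda>(\<Psi>, u0).
     let u = solution L \<mu> \<nu> \<alpha> f (rep \<Psi>) u0 in (L2class L \<mu> (1 + \<alpha>) u, u \<mu>))"

definition U :: "real \<Rightarrow> real \<Rightarrow> real \<Rightarrow> real \<Rightarrow> vfield \<Rightarrow> nat \<Rightarrow> phase \<Rightarrow> phase" where
  "U L \<mu> \<nu> \<alpha> f n = U1 L \<mu> \<nu> \<alpha> f ^^ n"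


section \<open>Local attractors\<close>

text \<open>
  The supremum over the ball and the distance to the attractor are formed in \<open>[0,\<infinity>]\<close>, where they
  always exist.
\<close>

definition local_attractor ::
  "'a set \<Rightarrow> ('a \<Rightarrow> 'a \<Rightarrow> real) \<Rightarrow> (nat \<Rightarrow> 'a \<Rightarrow> 'a) \<Rightarrow> 'a set \<Rightarrow> 'a set \<Rightarrow> bool" where
  "local_attractor X d S B \<A> \<longleftrightarrow>
     \<A> \<noteq> {} \<and> compactin (Metric_space.mtopology X d) \<A> \<and> \<A> \<subseteq> B \<and> S 1 ` \<A> = \<A> \<and>
     (\<lambda>n. SUP x\<in>B. INF a\<in>\<A>. ennreal (d (S n x) a)) \<longlonglongrightarrow> 0"

end

theory Submission
  imports Defs "HOL-Computational_Algebra.Polynomial"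
begin

text \<open>
  The attractor is a single point, a steady state. If \<open>\<nu>\<close> is large, the stationary equation
  \<open>\<nu> A w + B(w,w) = f\<close> has a small solution \<open>w\<close>. The constant curve \<open>w\<close> solves the linearised system
  with drift \<open>w\<close> and initial value \<open>w\<close>, so the point \<open>p = (w, w)\<close> of the phase space is fixed by \<open>U\<close>.
  Let \<open>u\<close> be the solution with a drift \<open>\<psi>\<close> and an initial value \<open>u\<^sub>0\<close> from the unit balls. Then
  \<open>z = u - w\<close> satisfies \<open>z' + \<nu> A z = - B(\<psi>, z) - B(\<psi> - w, w)\<close>. Its initial value is damped by a factor
  that is exponentially small in \<open>\<nu>\<close>, and parabolic smoothing yields negative powers of \<open>\<nu>\<close> in
  front of both terms on the right: the first one is absorbed by the left-hand side, the second one
  is a small multiple of the distance of \<open>\<psi>\<close> to \<open>w\<close>. For large \<open>\<nu>\<close> one step of \<open>U\<close> therefore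
  divides the distance to \<open>p\<close> by at least four (\<open>U1_contraction\<close>, resting on \<open>distance_to_steady_state\<close>), and
  since \<open>p\<close> is close to \<open>0\<close> the unit ball is mapped into itself. A map with these properties has the
  local attractor \<open>{p}\<close> (\<open>local_attractor_fixed_point\<close>).

  All estimates are made on Fourier coefficients. The form \<open>b\<close> is represented by the Leray projection
  of a convolution (\<open>b_form_eq\<close>). The bound of \<open>B\<close> from \<open>V\<^sup>1\<^sup>+\<^sup>\<alpha> \<times> V\<^sup>\<alpha>\<close> into \<open>V\<^sup>\<alpha>\<^sup>-\<^sup>1\<close>
  (\<open>convection_estimate\<close>) comes from Young's inequality and the lattice sum of \<open>\<bar>k\<bar>\<^sup>-\<^sup>2\<^sup>(\<^sup>1\<^sup>+\<^sup>\<alpha>\<^sup>)\<close>, which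
  converges because \<open>2 (1 + \<alpha>) > 3\<close>.

  The map \<open>U\<close> is defined by the unique solution of the weak equation, so existence and uniqueness must
  be established for the drifts in the ball. Testing with single Fourier modes turns the weak equation
  into scalar equations \<open>a' + c a = g\<close> in the sense of distributions, whose continuous solutions are
  given by Duhamel's formula. Weak solutions are thus the bounded fixed points of the Duhamel map
  \<open>evolve\<close> (\<open>weak_solution_imp_fixed_point\<close>, \<open>fixed_point_imp_weak_solution\<close>). This map is a contraction
  in the supremum norm of \<open>V\<^sup>\<alpha>\<close> if the drift is small compared with \<open>\<nu>\<close>, which gives
  \<open>solution_fixed_point\<close>.
\<close>

section \<open>Sums and integrals of squares\<close>

lemma summable_on_iff_integrable:
  fixes f :: "'a \<Rightarrow> real"
  shows "f summable_on UNIV \<longleftrightarrow> integrable (count_space UNIV) f"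
  using abs_summable_equivalent[of f UNIV] summable_on_iff_abs_summable_on_real[of f UNIV]
  unfolding abs_summable_on_def by blast

lemma infsum_eq_LINT:
  fixes f :: "'a \<Rightarrow> real"
  shows "infsum f UNIV = (LINT k|count_space UNIV. f k)"
proof (cases "f summable_on UNIV")
  case True
  then show ?thesis
    using infsetsum_infsum[of f UNIV] unfolding summable_on_iff_integrable infsetsum_def abs_summable_on_def
    by simp
next
  case False
  then show ?thesis
    using summable_on_iff_integrable[of f] by (simp add: infsum_not_exists not_integrable_integral_eq)
qed

lemma summable_iff_nn_integral_finite:
  fixes f :: "'a \<Rightarrow> real"
  assumes "\<And>k. 0 \<le> f k"
  shows "f summable_on UNIV \<longleftrightarrow> (\<integral>\<^sup>+k. ennreal (f k) \<partial>count_space UNIV) < \<infinity>"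
  using assms unfolding summable_on_iff_integrable by (simp add: integrable_iff_bounded)

lemma real_square_add_le: "((a::real) + b)\<^sup>2 \<le> 2 * a\<^sup>2 + 2 * b\<^sup>2"
  using sum_squares_bound[of a b] by (simp add: power2_sum)

lemma ennreal_square_add_le: "((a::ennreal) + b)\<^sup>2 \<le> 2 * a\<^sup>2 + 2 * b\<^sup>2"
proof (cases a)
  case (real x)
  note x = this
  show ?thesis
  proof (cases b)
    case (real y)
    have "ennreal ((x + y)\<^sup>2) \<le> ennreal (2 * x\<^sup>2 + 2 * y\<^sup>2)"
      by (rule ennreal_leI[OF real_square_add_le])
    then show ?thesis
      using x real by (simp add: ennreal_plus ennreal_mult ennreal_power[symmetric])
  qed (simp add: power2_eq_square)
qed (simp add: power2_eq_square)

lemma norm_add_square_le: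
  fixes x y :: "'a::real_normed_vector"
  shows "(norm (x + y))\<^sup>2 \<le> 2 * (norm x)\<^sup>2 + 2 * (norm y)\<^sup>2"
  by (rule order_trans[OF power_mono[OF norm_triangle_ineq] real_square_add_le]) simp

lemma Cauchy_Schwarz_integral:
  fixes g h :: "'a \<Rightarrow> real"
  assumes [measurable]: "g \<in> borel_measurable M" "h \<in> borel_measurable M"
    and g2: "integrable M (\<lambda>x. (g x)\<^sup>2)" and h2: "integrable M (\<lambda>x. (h x)\<^sup>2)"
  shows "integrable M (\<lambda>x. g x * h x)"
    and "(LINT x|M. \<bar>g x * h x\<bar>)\<^sup>2 \<le> (LINT x|M. (g x)\<^sup>2) * (LINT x|M. (h x)\<^sup>2)"
proof -
  show i: "integrable M (\<lambda>x. g x * h x)"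
  proof (rule Bochner_Integration.integrable_bound)
    show "integrable M (\<lambda>x. (g x)\<^sup>2 + (h x)\<^sup>2)" using g2 h2 by simp
    show "AE x in M. norm (g x * h x) \<le> norm ((g x)\<^sup>2 + (h x)\<^sup>2)"
    proof (rule AE_I2)
      fix x
      have "0 \<le> \<bar>g x\<bar> * \<bar>h x\<bar>" by simp
      moreover have "2 * (\<bar>g x\<bar> * \<bar>h x\<bar>) \<le> (g x)\<^sup>2 + (h x)\<^sup>2"
        using sum_squares_bound[of "\<bar>g x\<bar>" "\<bar>h x\<bar>"] by simp
      ultimately have "\<bar>g x\<bar> * \<bar>h x\<bar> \<le> (g x)\<^sup>2 + (h x)\<^sup>2" by linarith
      then show "norm (g x * h x) \<le> norm ((g x)\<^sup>2 + (h x)\<^sup>2)"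
        by (simp add: abs_mult)
    qed
  qed auto
  have "(\<integral>\<^sup>+x. ennreal \<bar>g x\<bar> * ennreal \<bar>h x\<bar> \<partial>M)\<^sup>2 \<le> (\<integral>\<^sup>+x. (ennreal \<bar>g x\<bar>)\<^sup>2 \<partial>M) * (\<integral>\<^sup>+x. (ennreal \<bar>h x\<bar>)\<^sup>2 \<partial>M)"
    by (rule Cauchy_Schwarz_nn_integral) auto
  also have "(\<integral>\<^sup>+x. ennreal \<bar>g x\<bar> * ennreal \<bar>h x\<bar> \<partial>M) = ennreal (LINT x|M. \<bar>g x * h x\<bar>)"
    using integrable_abs[OF i] by (subst nn_integral_eq_integral[symmetric]) (auto simp: abs_mult ennreal_mult)
  also have "(\<integral>\<^sup>+x. (ennreal \<bar>g x\<bar>)\<^sup>2 \<partial>M) = ennreal (LINT x|M. (g x)\<^sup>2)"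
    using g2 by (subst nn_integral_eq_integral[symmetric]) (auto simp: ennreal_power)
  also have "(\<integral>\<^sup>+x. (ennreal \<bar>h x\<bar>)\<^sup>2 \<partial>M) = ennreal (LINT x|M. (h x)\<^sup>2)"
    using h2 by (subst nn_integral_eq_integral[symmetric]) (auto simp: ennreal_power)
  finally show "(LINT x|M. \<bar>g x * h x\<bar>)\<^sup>2 \<le> (LINT x|M. (g x)\<^sup>2) * (LINT x|M. (h x)\<^sup>2)"
    by (simp add: ennreal_power ennreal_le_iff flip: ennreal_mult)
qed

text \<open>
  The triangle inequality of the \<open>L\<^sup>2\<close> norm with a pointwise domination \<open>\<bar>f\<bar> \<le> \<bar>g\<bar> + \<bar>h\<bar>\<close> instead of a
  sum. It serves twice: for sums over Fourier modes and for integrals over the time interval.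
\<close>

lemma Minkowski_integral:
  fixes f g h :: "'a \<Rightarrow> real"
  assumes [measurable]: "f \<in> borel_measurable M" "g \<in> borel_measurable M" "h \<in> borel_measurable M"
    and g2: "integrable M (\<lambda>x. (g x)\<^sup>2)" and h2: "integrable M (\<lambda>x. (h x)\<^sup>2)"
    and le: "AE x in M. \<bar>f x\<bar> \<le> \<bar>g x\<bar> + \<bar>h x\<bar>"
  shows "integrable M (\<lambda>x. (f x)\<^sup>2)"
    and "sqrt (LINT x|M. (f x)\<^sup>2) \<le> sqrt (LINT x|M. (g x)\<^sup>2) + sqrt (LINT x|M. (h x)\<^sup>2)"
proof -
  have f2: "AE x in M. (f x)\<^sup>2 \<le> (g x)\<^sup>2 + 2 * \<bar>g x * h x\<bar> + (h x)\<^sup>2"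
    using le
  proof eventually_elim
    case (elim x)
    then have "\<bar>f x\<bar>\<^sup>2 \<le> (\<bar>g x\<bar> + \<bar>h x\<bar>)\<^sup>2" by (rule power_mono) auto
    then show ?case by (simp add: power2_sum abs_mult)
  qed
  have i: "integrable M (\<lambda>x. g x * h x)"
    by (rule Cauchy_Schwarz_integral) (use g2 h2 in auto)
  then have i': "integrable M (\<lambda>x. (g x)\<^sup>2 + 2 * \<bar>g x * h x\<bar> + (h x)\<^sup>2)"
    using g2 h2 by (intro Bochner_Integration.integrable_add integrable_mult_right integrable_abs) auto
  show fi: "integrable M (\<lambda>x. (f x)\<^sup>2)"
    by (rule Bochner_Integration.integrable_bound[OF i']) (use f2 in auto)
  let ?G = "LINT x|M. (g x)\<^sup>2" let ?H = "LINT x|M. (h x)\<^sup>2"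
  have "(LINT x|M. \<bar>g x * h x\<bar>) \<le> sqrt (?G * ?H)"
    by (rule real_le_rsqrt, rule Cauchy_Schwarz_integral(2)) (use g2 h2 in auto)
  then have "(LINT x|M. (f x)\<^sup>2) \<le> ?G + 2 * sqrt (?G * ?H) + ?H"
    using integral_mono_AE[OF fi i' f2] i g2 h2 by simp
  also have "\<dots> = (sqrt ?G + sqrt ?H)\<^sup>2"
    by (simp add: power2_sum real_sqrt_mult)
  finally show "sqrt (LINT x|M. (f x)\<^sup>2) \<le> sqrt ?G + sqrt ?H"
    by (rule real_le_lsqrt[rotated]) (auto intro!: add_nonneg_nonneg)
qed

section \<open>Sobolev norms\<close>

text \<open>
  The wave number, that is, the length of the wave vector.
\<close>

definition wn :: "real \<Rightarrow> int ^ 3 \<Rightarrow> real" where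
  "wn L k = norm (freq L k)"

text \<open>
  The square of the homogeneous Sobolev norm without the volume factor \<open>L\<^sup>3\<close>. As an extended
  nonnegative number it is defined for every field, so that sums over modes and integrals over time
  can be interchanged before finiteness is known.
\<close>

definition sob :: "real \<Rightarrow> real \<Rightarrow> vfield \<Rightarrow> ennreal" where
  "sob L s u = (\<integral>\<^sup>+k. ennreal (wn L k powr (2 * s) * (norm (u k))\<^sup>2) \<partial>count_space UNIV)"

lemma wn_nonneg [simp]: "0 \<le> wn L k"
  by (simp add: wn_def)

lemma freq_0 [simp]: "freq L 0 = 0"
  by (simp add: freq_def vec_eq_iff)

lemma wn_0 [simp]: "wn L 0 = 0"
  by (simp add: wn_def)

lemma freq_uminus: "freq L (- k) = - freq L k"
  by (simp add: freq_def vec_eq_iff)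

lemma freq_add: "freq L (k + l) = freq L k + freq L l"
  by (simp add: freq_def vec_eq_iff add_divide_distrib ring_distribs)

lemma freq_diff: "freq L (k - l) = freq L k - freq L l"
  by (simp add: freq_def vec_eq_iff diff_divide_distrib ring_distribs)

lemma wn_uminus [simp]: "wn L (- k) = wn L k"
  by (simp add: wn_def freq_uminus)

lemma wn_component_ge:
  assumes "0 < L" shows "2 * pi / L * \<bar>real_of_int (k $ j)\<bar> \<le> wn L k"
  using component_le_norm_cart[of "freq L k" j] assms
  by (simp add: wn_def freq_def abs_mult)

lemma wn_ge:
  assumes "0 < L" "k \<noteq> 0" shows "2 * pi / L \<le> wn L k"
proof -
  obtain j where "k $ j \<noteq> 0" using assms(2) by (auto simp: vec_eq_iff)
  then have "1 \<le> \<bar>real_of_int (k $ j)\<bar>" by linarith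
  then have "2 * pi / L * 1 \<le> 2 * pi / L * \<bar>real_of_int (k $ j)\<bar>"
    using assms by (intro mult_left_mono) auto
  with wn_component_ge[OF assms(1), of k j] show ?thesis by simp
qed

lemma wn_pos: "0 < L \<Longrightarrow> k \<noteq> 0 \<Longrightarrow> 0 < wn L k"
  using wn_ge[of L k] by (meson divide_pos_pos less_le_trans mult_pos_pos pi_gt_zero zero_less_numeral)

lemma square_powr: "0 \<le> x \<Longrightarrow> (x\<^sup>2) powr s = x powr (2 * s)" for x :: real
  using powr_powr[of x 2 s] by (cases "x = 0") simp_all

lemma powr_square: "0 \<le> x \<Longrightarrow> (x powr s)\<^sup>2 = x powr (2 * s)" for x :: real
  using powr_powr[of x s 2] by (cases "x = 0") (simp_all add: mult.commute)

lemma Vnorm_eq: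
  "Vnorm L s u = sqrt (L ^ 3 * enn2real (sob L s u))"
proof -
  have *: "((norm (freq L k))\<^sup>2 powr (s / 2))\<^sup>2 = wn L k powr (2 * s)" for k
    by (simp add: square_powr powr_square wn_def)
  have "pairing L (stokes_pow L (s / 2) u) (stokes_pow L (s / 2) u)
      = L ^ 3 * (LINT k|count_space UNIV. wn L k powr (2 * s) * (norm (u k))\<^sup>2)"
    unfolding pairing_def stokes_pow_def infsum_eq_LINT
    by (simp add: * dot_square_norm power_mult_distrib)
  also have "(LINT k|count_space UNIV. wn L k powr (2 * s) * (norm (u k))\<^sup>2) = enn2real (sob L s u)"
    unfolding sob_def by (rule integral_eq_nn_integral) auto
  finally show ?thesis by (simp add: Vnorm_def norm0_def)
qed

text \<open>
  The nonzero wave numbers are at least \<open>2 * pi / L\<close>, and the mode \<open>0\<close> has weight \<open>0\<close> on both sides.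
\<close>

lemma sob_mono:
  assumes "0 < L" "s \<le> s'"
  shows "sob L s u \<le> ennreal ((2 * pi / L) powr (2 * (s - s'))) * sob L s' u"
proof -
  have "wn L k powr (2 * s) \<le> (2 * pi / L) powr (2 * (s - s')) * wn L k powr (2 * s')" for k
  proof (cases "k = 0")
    case False
    have "wn L k powr (2 * (s - s')) \<le> (2 * pi / L) powr (2 * (s - s'))"
      using assms by (intro powr_mono2' wn_ge False) auto
    then have "wn L k powr (2 * (s - s')) * wn L k powr (2 * s') \<le> (2 * pi / L) powr (2 * (s - s')) * wn L k powr (2 * s')"
      by (intro mult_right_mono) auto
    also have "wn L k powr (2 * (s - s')) * wn L k powr (2 * s') = wn L k powr (2 * s)"
      by (subst powr_add[symmetric]) (simp add: algebra_simps)
    finally show ?thesis .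
  qed auto
  then show ?thesis unfolding sob_def
    by (subst nn_integral_cmult[symmetric])
      (auto intro!: nn_integral_mono ennreal_leI mult_right_mono simp: mult.assoc[symmetric] simp flip: ennreal_mult')
qed

lemma sob_finite_mono:
  "0 < L \<Longrightarrow> s \<le> s' \<Longrightarrow> sob L s' u < \<infinity> \<Longrightarrow> sob L s u < \<infinity>"
  by (rule le_less_trans[OF sob_mono]) (auto simp: ennreal_mult_less_top)

lemma sob_add_le:
  "sob L s (\<lambda>k. u k + v k) \<le> 2 * sob L s u + 2 * sob L s v"
proof -
  have "wn L k powr (2 * s) * (norm (u k + v k))\<^sup>2
      \<le> 2 * (wn L k powr (2 * s) * (norm (u k))\<^sup>2) + 2 * (wn L k powr (2 * s) * (norm (v k))\<^sup>2)" for k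
    using mult_left_mono[OF norm_add_square_le[of "u k" "v k"], of "wn L k powr (2 * s)"]
    by (simp add: algebra_simps)
  then have "sob L s (\<lambda>k. u k + v k) \<le> (\<integral>\<^sup>+k. 2 * ennreal (wn L k powr (2 * s) * (norm (u k))\<^sup>2)
      + 2 * ennreal (wn L k powr (2 * s) * (norm (v k))\<^sup>2) \<partial>count_space UNIV)"
    unfolding sob_def
    by (intro nn_integral_mono) (simp flip: ennreal_numeral ennreal_mult' ennreal_plus)
  also have "\<dots> = 2 * sob L s u + 2 * sob L s v"
    by (simp add: sob_def nn_integral_add nn_integral_cmult)
  finally show ?thesis .
qed

lemma sob_uminus [simp]: "sob L s (\<lambda>k. - u k) = sob L s u"
  by (simp add: sob_def)

lemma sob_commute: "sob L s (\<lambda>k. u k - v k) = sob L s (\<lambda>k. v k - u k)"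
  by (simp add: sob_def norm_minus_commute)

lemma sob_diff_le:
  "sob L s (\<lambda>k. u k - v k) \<le> 2 * sob L s u + 2 * sob L s v"
  using sob_add_le[of L s u "\<lambda>k. - v k"] by simp

lemma sob_zero [simp]: "sob L s (\<lambda>k. 0) = 0"
  by (simp add: sob_def)

lemma sob_diff_finite:
  "sob L s u < \<infinity> \<Longrightarrow> sob L s v < \<infinity> \<Longrightarrow> sob L s (\<lambda>k. u k - v k) < \<infinity>"
  by (rule le_less_trans[OF sob_diff_le]) (auto simp: ennreal_mult_less_top)

lemma sob_coefficient_le:
  "ennreal (wn L k powr (2 * s) * (norm (u k))\<^sup>2) \<le> sob L s u"
  unfolding sob_def
  by (rule nn_integral_ge_point[where A = UNIV and x = k and p = "\<lambda>k. ennreal (wn L k powr (2 * s) * (norm (u k))\<^sup>2)"]) simp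

lemma sob_eq_0_iff:
  assumes "0 < L" "u 0 = 0"
  shows "sob L s u = 0 \<longleftrightarrow> u = (\<lambda>k. 0)"
proof
  assume "sob L s u = 0"
  then have "wn L k powr (2 * s) * (norm (u k))\<^sup>2 \<le> 0" for k
    using sob_coefficient_le[of L k s u] by (simp add: ennreal_eq_0_iff)
  then have "u k = 0" if "k \<noteq> 0" for k
    using wn_pos[OF assms(1) that] by (smt (verit) mult_pos_pos powr_gt_zero zero_less_norm_iff zero_less_power)
  then show "u = (\<lambda>k. 0)" using assms(2) by (intro ext) metis
qed auto

lemma sob_integrable:
  "sob L s u < \<infinity> \<longleftrightarrow> integrable (count_space UNIV) (\<lambda>k. (wn L k powr s * norm (u k))\<^sup>2)"
proof -
  have "wn L k powr (2 * s) * (norm (u k))\<^sup>2 = (wn L k powr s * norm (u k))\<^sup>2" for k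
    by (simp add: power_mult_distrib powr_square)
  then show ?thesis by (simp add: sob_def integrable_iff_bounded)
qed

lemma sob_LINT:
  "enn2real (sob L s u) = (LINT k|count_space UNIV. (wn L k powr s * norm (u k))\<^sup>2)"
proof -
  have "wn L k powr (2 * s) * (norm (u k))\<^sup>2 = (wn L k powr s * norm (u k))\<^sup>2" for k
    by (simp add: power_mult_distrib powr_square)
  then show ?thesis unfolding sob_def by (simp add: integral_eq_nn_integral)
qed

lemma Vnorm_add_le:
  assumes "0 \<le> L" "sob L s u < \<infinity>" "sob L s v < \<infinity>"
  shows "Vnorm L s (\<lambda>k. u k + v k) \<le> Vnorm L s u + Vnorm L s v"
proof -
  have "sqrt (LINT k|count_space UNIV. (wn L k powr s * norm (u k + v k))\<^sup>2)
     \<le> sqrt (LINT k|count_space UNIV. (wn L k powr s * norm (u k))\<^sup>2)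
       + sqrt (LINT k|count_space UNIV. (wn L k powr s * norm (v k))\<^sup>2)"
  proof (rule Minkowski_integral)
    show "AE k in count_space UNIV. \<bar>wn L k powr s * norm (u k + v k)\<bar>
        \<le> \<bar>wn L k powr s * norm (u k)\<bar> + \<bar>wn L k powr s * norm (v k)\<bar>"
      by (intro AE_I2) (simp add: abs_mult norm_triangle_ineq mult_left_mono flip: distrib_left)
  qed (use assms(2,3)[unfolded sob_integrable] in auto)
  then have "sqrt (L ^ 3) * sqrt (enn2real (sob L s (\<lambda>k. u k + v k)))
     \<le> sqrt (L ^ 3) * (sqrt (enn2real (sob L s u)) + sqrt (enn2real (sob L s v)))"
    using assms(1) by (intro mult_left_mono) (simp_all add: sob_LINT)
  then show ?thesis
    by (simp add: Vnorm_eq real_sqrt_mult distrib_left)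
qed

text \<open>
  For a field without mean the inhomogeneous weight \<open>(1 + \<bar>k\<bar>\<^sup>2)\<^sup>s\<close> may be replaced by \<open>\<bar>k\<bar>\<^sup>2\<^sup>s\<close>,
  because the quotient of the bases lies between \<open>1\<close> and a constant for all nonzero wave numbers.
\<close>

lemma Hsob_iff:
  assumes "0 < L" "u 0 = 0"
  shows "u \<in> Hsob L s \<longleftrightarrow> sob L s u < \<infinity>"
proof -
  define K where "K = 1 + (L / (2 * pi))\<^sup>2"
  have K: "1 \<le> K" by (simp add: K_def)
  have cmp: "(1 + (wn L k)\<^sup>2) powr s \<le> K powr \<bar>s\<bar> * (wn L k)\<^sup>2 powr s"
            "(wn L k)\<^sup>2 powr s \<le> K powr \<bar>s\<bar> * (1 + (wn L k)\<^sup>2) powr s" if "k \<noteq> 0" for k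
  proof -
    have p: "0 < (wn L k)\<^sup>2" using wn_pos[OF assms(1) that] by simp
    have "(2 * pi / L)\<^sup>2 \<le> (wn L k)\<^sup>2"
      using wn_ge[OF assms(1) that] assms(1) by (intro power_mono) auto
    then have "1 \<le> (L / (2 * pi))\<^sup>2 * (wn L k)\<^sup>2"
      using assms(1) by (simp add: power_divide field_simps)
    then have le: "1 + (wn L k)\<^sup>2 \<le> K * (wn L k)\<^sup>2" by (simp add: K_def algebra_simps)
    have q1: "1 \<le> (1 + (wn L k)\<^sup>2) / (wn L k)\<^sup>2" "(1 + (wn L k)\<^sup>2) / (wn L k)\<^sup>2 \<le> K"
      using p le by (simp_all add: field_simps)
    let ?q = "(1 + (wn L k)\<^sup>2) / (wn L k)\<^sup>2"
    have "?q powr s \<le> ?q powr \<bar>s\<bar>" "?q powr - s \<le> ?q powr \<bar>s\<bar>"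
      using q1 by (auto intro!: powr_mono)
    moreover have "?q powr \<bar>s\<bar> \<le> K powr \<bar>s\<bar>"
      using q1 by (intro powr_mono2) auto
    ultimately have q2: "?q powr s \<le> K powr \<bar>s\<bar>" "?q powr - s \<le> K powr \<bar>s\<bar>" by linarith+
    have e1: "(1 + (wn L k)\<^sup>2) powr s = ?q powr s * (wn L k)\<^sup>2 powr s"
      using p by (simp add: powr_divide)
    have e2: "(wn L k)\<^sup>2 powr s = ?q powr - s * (1 + (wn L k)\<^sup>2) powr s"
      using p add_pos_pos[OF zero_less_one p] by (simp add: powr_divide powr_minus field_simps)
    show "(1 + (wn L k)\<^sup>2) powr s \<le> K powr \<bar>s\<bar> * (wn L k)\<^sup>2 powr s"
      by (subst e1) (intro mult_right_mono q2, simp)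
    show "(wn L k)\<^sup>2 powr s \<le> K powr \<bar>s\<bar> * (1 + (wn L k)\<^sup>2) powr s"
      by (subst e2) (intro mult_right_mono q2, simp)
  qed
  have e: "wn L k powr (2 * s) = (wn L k)\<^sup>2 powr s" for k
    by (simp add: square_powr)
  have "u \<in> Hsob L s \<longleftrightarrow> (\<integral>\<^sup>+k. ennreal ((1 + (wn L k)\<^sup>2) powr s * (norm (u k))\<^sup>2) \<partial>count_space UNIV) < \<infinity>"
    (is "_ \<longleftrightarrow> ?I < \<infinity>")
    unfolding Hsob_def mem_Collect_eq wn_def by (rule summable_iff_nn_integral_finite) simp
  moreover have le1: "?I \<le> ennreal (K powr \<bar>s\<bar>) * sob L s u"
  proof -
    have "(1 + (wn L k)\<^sup>2) powr s * (norm (u k))\<^sup>2 \<le> K powr \<bar>s\<bar> * ((wn L k)\<^sup>2 powr s * (norm (u k))\<^sup>2)" for k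
      using mult_right_mono[OF cmp(1)[of k], of "(norm (u k))\<^sup>2"] assms(2)
      by (cases "k = 0") (simp_all add: mult.assoc)
    then show ?thesis
      unfolding sob_def e
      by (subst nn_integral_cmult[symmetric]) (auto intro!: nn_integral_mono ennreal_leI simp flip: ennreal_mult')
  qed
  moreover have le2: "sob L s u \<le> ennreal (K powr \<bar>s\<bar>) * ?I"
  proof -
    have "(wn L k)\<^sup>2 powr s * (norm (u k))\<^sup>2 \<le> K powr \<bar>s\<bar> * ((1 + (wn L k)\<^sup>2) powr s * (norm (u k))\<^sup>2)" for k
      using mult_right_mono[OF cmp(2)[of k], of "(norm (u k))\<^sup>2"] assms(2)
      by (cases "k = 0") (simp_all add: mult.assoc)
    then show ?thesis
      unfolding sob_def e
      by (subst nn_integral_cmult[symmetric]) (auto intro!: nn_integral_mono ennreal_leI simp flip: ennreal_mult')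
  qed
  moreover have "sob L s u < \<infinity>" if "?I < \<infinity>"
    by (rule le_less_trans[OF le2]) (use that in \<open>auto simp: ennreal_mult_less_top\<close>)
  moreover have "?I < \<infinity>" if "sob L s u < \<infinity>"
    by (rule le_less_trans[OF le1]) (use that in \<open>auto simp: ennreal_mult_less_top\<close>)
  ultimately show ?thesis by blast
qed

text \<open>
  The conditions in the definition of \<open>V\<^sup>s\<close> that do not depend on the order \<open>s\<close>.
\<close>

definition solenoidal :: "real \<Rightarrow> vfield \<Rightarrow> bool" where
  "solenoidal L u \<longleftrightarrow> real_field u \<and> zero_mean u \<and> (\<forall>k. divergence L u k = 0)"

lemma Vsp_iff:
  assumes "0 < L"
  shows "u \<in> Vsp L s \<longleftrightarrow> sob L s u < \<infinity> \<and> solenoidal L u"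
  using Hsob_iff[OF assms, of u s] by (auto simp: Vsp_def solenoidal_def zero_mean_def)

lemma sol_zero_mean: "solenoidal L u \<Longrightarrow> u 0 = 0"
  by (simp add: solenoidal_def zero_mean_def)

lemma divergence_diff: "divergence L (\<lambda>k. u k - v k) k = divergence L u k - divergence L v k"
  by (simp add: divergence_def algebra_simps sum_subtractf)

lemma sol_diff: "solenoidal L u \<Longrightarrow> solenoidal L v \<Longrightarrow> solenoidal L (\<lambda>k. u k - v k)"
  by (simp add: solenoidal_def real_field_def zero_mean_def divergence_diff)

lemma sol_zero: "solenoidal L (\<lambda>k. 0)"
  by (simp add: solenoidal_def real_field_def zero_mean_def divergence_def)

lemma Metric_space_Vsp:
  assumes "0 < L"
  shows "Metric_space (Vsp L s) (Vdist L s)"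
proof
  show "0 \<le> Vdist L s x y" for x y
    using assms by (simp add: Vdist_def Vnorm_eq)
  show "Vdist L s x y = Vdist L s y x" for x y
    using sob_commute[of L s x y] by (simp add: Vdist_def Vnorm_eq vdiff_def)
  fix x y z assume x: "x \<in> Vsp L s" and y: "y \<in> Vsp L s"
  have fin: "sob L s (vdiff x y) < \<infinity>"
    unfolding vdiff_def using x y sob_diff_finite Vsp_iff[OF assms] by blast
  have "Vdist L s x y = 0 \<longleftrightarrow> sob L s (vdiff x y) = 0"
    using fin assms by (auto simp: Vdist_def Vnorm_eq enn2real_eq_0_iff)
  also have "\<dots> \<longleftrightarrow> x = y"
    using x y Vsp_iff[OF assms]
    by (subst sob_eq_0_iff) (auto simp: assms vdiff_def sol_zero_mean fun_eq_iff)
  finally show "Vdist L s x y = 0 \<longleftrightarrow> x = y" .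
  assume z: "z \<in> Vsp L s"
  have "Vnorm L s (\<lambda>k. vdiff x y k + vdiff y z k) \<le> Vdist L s x y + Vdist L s y z"
    unfolding Vdist_def
    by (rule Vnorm_add_le) (use assms x y z Vsp_iff[OF assms] sob_diff_finite vdiff_def in auto)
  then show "Vdist L s x z \<le> Vdist L s x y + Vdist L s y z"
    by (simp add: Vdist_def vdiff_def)
qed

section \<open>A lattice sum\<close>

lemma nn_integral_translate:
  fixes f :: "int ^ 3 \<Rightarrow> ennreal"
  shows "(\<integral>\<^sup>+k. f (k - l) \<partial>count_space UNIV) = (\<integral>\<^sup>+k. f k \<partial>count_space UNIV)"
  by (rule nn_integral_bij_count_space) (rule bij_betwI[where g = "\<lambda>k. k + l"], auto)

lemma nn_integral_reflect:
  fixes f :: "int ^ 3 \<Rightarrow> ennreal"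
  shows "(\<integral>\<^sup>+l. f (k - l) \<partial>count_space UNIV) = (\<integral>\<^sup>+l. f l \<partial>count_space UNIV)"
  by (rule nn_integral_bij_count_space) (rule bij_betwI[where g = "\<lambda>l. k - l"], auto)

lemma nn_integral_swap:
  fixes f :: "int ^ 3 \<Rightarrow> int ^ 3 \<Rightarrow> ennreal"
  shows "(\<integral>\<^sup>+x. \<integral>\<^sup>+i. f i x \<partial>count_space UNIV \<partial>count_space UNIV) = (\<integral>\<^sup>+i. \<integral>\<^sup>+x. f i x \<partial>count_space UNIV \<partial>count_space UNIV)"
  by (rule nn_integral_count_space_nn_integral) auto

text \<open>
  The sum over the integers is reduced to one over the natural numbers by the enumeration
  \<open>0, -1, 1, -2, 2, \<dots>\<close>, along which the absolute value grows at half the speed of the index.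
\<close>

lemma int_powr_sum_finite:
  assumes "1 < (q::real)"
  shows "(\<integral>\<^sup>+n. ennreal ((max 1 \<bar>real_of_int n\<bar>) powr - q) \<partial>count_space UNIV) < \<infinity>"
proof -
  have s: "summable (\<lambda>n. (max 1 (real n)) powr - q)"
  proof (rule summable_comparison_test_ev)
    show "summable (\<lambda>n. real n powr - q)" using assms by (simp add: summable_real_powr_iff)
    show "\<forall>\<^sub>F n in sequentially. norm ((max 1 (real n)) powr - q) \<le> real n powr - q"
      using eventually_ge_at_top[of 1] by eventually_elim (auto simp: max_def)
  qed
  have n: "(\<integral>\<^sup>+n. ennreal ((max 1 (real n)) powr - q) \<partial>count_space UNIV) < \<infinity>"
    using s integrable_count_space_nat_iff[of "\<lambda>n. (max 1 (real n)) powr - q"]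
    by (simp add: integrable_iff_bounded)
  have "(\<integral>\<^sup>+n. ennreal ((max 1 \<bar>real_of_int n\<bar>) powr - q) \<partial>count_space UNIV)
     = (\<integral>\<^sup>+b. ennreal ((max 1 \<bar>real_of_int (int_decode b)\<bar>) powr - q) \<partial>count_space UNIV)"
    by (rule nn_integral_bij_count_space[symmetric]) (rule bij_int_decode)
  also have "\<dots> \<le> (\<integral>\<^sup>+b. ennreal (4 powr q) * ennreal ((max 1 (real b)) powr - q) \<partial>count_space UNIV)"
  proof (rule nn_integral_mono)
    fix b :: nat
    have "max 1 (real b) \<le> 4 * max 1 \<bar>real_of_int (int_decode b)\<bar>"
      by (auto simp: int_decode_def sum_decode_def max_def)
    then have "(4 * max 1 \<bar>real_of_int (int_decode b)\<bar>) powr - q \<le> (max 1 (real b)) powr - q"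
      using assms by (intro powr_mono2') auto
    then have "4 powr - q * (max 1 \<bar>real_of_int (int_decode b)\<bar>) powr - q \<le> (max 1 (real b)) powr - q"
      by (simp add: powr_mult)
    then have "(max 1 \<bar>real_of_int (int_decode b)\<bar>) powr - q \<le> 4 powr q * (max 1 (real b)) powr - q"
      by (simp add: powr_minus field_simps)
    then show "ennreal ((max 1 \<bar>real_of_int (int_decode b)\<bar>) powr - q)
        \<le> ennreal (4 powr q) * ennreal ((max 1 (real b)) powr - q)"
      by (simp flip: ennreal_mult')
  qed
  also have "\<dots> < \<infinity>"
    using n by (simp add: nn_integral_cmult ennreal_mult_less_top)
  finally show ?thesis .
qed

text \<open>
  The wave number dominates each component of the frequency, so \<open>\<bar>k\<bar>\<^sup>-\<^sup>p\<close> is at most a product of three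
  one-dimensional weights of exponent \<open>p / 3\<close>, and these are summable because \<open>p / 3 > 1\<close>.
\<close>

lemma lattice_sum_finite:
  assumes "0 < L" "3 < p"
  shows "(\<integral>\<^sup>+k. ennreal (wn L k powr - p) \<partial>count_space UNIV) < \<infinity>"
proof -
  define c where "c = 2 * pi / L"
  have c: "0 < c" using assms by (simp add: c_def)
  define a :: "int \<Rightarrow> real" where "a n = (max 1 \<bar>real_of_int n\<bar>) powr - (p / 3)" for n
  have a0: "0 \<le> a n" for n by (simp add: a_def)
  define I where "I = (\<integral>\<^sup>+n. ennreal (a n) \<partial>count_space UNIV)"
  have I: "I < \<infinity>" unfolding I_def a_def using assms by (intro int_powr_sum_finite) auto
  have le: "wn L k powr - p \<le> c powr - p * (a (k $ 1) * (a (k $ 2) * a (k $ 3)))" for k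
  proof (cases "k = 0")
    case True then show ?thesis using a0 by simp
  next
    case False
    have m: "c * max 1 \<bar>real_of_int (k $ j)\<bar> \<le> wn L k" for j
      using wn_ge[OF assms(1) False] wn_component_ge[OF assms(1), of k j] by (auto simp: c_def max_def)
    have "wn L k powr - (p / 3) \<le> c powr - (p / 3) * a (k $ j)" for j
    proof -
      have "wn L k powr - (p / 3) \<le> (c * max 1 \<bar>real_of_int (k $ j)\<bar>) powr - (p / 3)"
        using m[of j] c assms by (intro powr_mono2') auto
      then show ?thesis using c by (simp add: a_def powr_mult)
    qed
    then have "wn L k powr - (p / 3) * (wn L k powr - (p / 3) * wn L k powr - (p / 3))
        \<le> (c powr - (p / 3) * a (k $ 1)) * ((c powr - (p / 3) * a (k $ 2)) * (c powr - (p / 3) * a (k $ 3)))"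
      by (intro mult_mono) (auto simp: a0)
    also have "\<dots> = (c powr - (p / 3) * (c powr - (p / 3) * c powr - (p / 3))) * (a (k $ 1) * (a (k $ 2) * a (k $ 3)))"
      by (simp add: algebra_simps)
    finally show ?thesis by (simp flip: powr_add)
  qed
  let ?F = "\<lambda>z :: int \<times> int \<times> int. ennreal (a (fst z)) * (ennreal (a (fst (snd z))) * ennreal (a (snd (snd z))))"
  have inj: "bij_betw (\<lambda>k :: int ^ 3. (k $ 1, k $ 2, k $ 3)) UNIV UNIV"
    by (rule bij_betwI[where g = "\<lambda>(x, y, z). vector [x, y, z]"]) (auto simp: vec_eq_iff forall_3)
  have "(\<integral>\<^sup>+k. ennreal (wn L k powr - p) \<partial>count_space UNIV)
      \<le> (\<integral>\<^sup>+(k :: int ^ 3). ennreal (c powr - p) * ?F (k $ 1, k $ 2, k $ 3) \<partial>count_space UNIV)"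
    using le by (intro nn_integral_mono) (simp add: a0 flip: ennreal_mult')
  also have "\<dots> = ennreal (c powr - p) * (\<integral>\<^sup>+z. ?F z \<partial>count_space UNIV)"
    using nn_integral_bij_count_space[OF inj, of ?F] by (simp add: nn_integral_cmult)
  also have "(\<integral>\<^sup>+z. ?F z \<partial>count_space UNIV) = I * (I * I)"
    by (subst nn_integral_fst_count_space[symmetric], subst nn_integral_fst_count_space[symmetric])
      (simp add: nn_integral_cmult nn_integral_multc I_def)
  finally show ?thesis by (rule le_less_trans) (use I in \<open>auto simp: ennreal_mult_less_top\<close>)
qed

section \<open>The convective term in Fourier space\<close>

text \<open>
  Bilinear, without conjugation: the product of a Fourier coefficient with a (real) wave vector.
\<close>

definition cdot :: "complex ^ 3 \<Rightarrow> real ^ 3 \<Rightarrow> complex" where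
  "cdot x a = (\<Sum>j\<in>UNIV. x $ j * of_real (a $ j))"

definition cvec :: "real ^ 3 \<Rightarrow> complex ^ 3" where
  "cvec a = (\<chi> j. of_real (a $ j))"

definition vcnj :: "complex ^ 3 \<Rightarrow> complex ^ 3" where
  "vcnj x = (\<chi> j. cnj (x $ j))"

lemma norm_smult_vec: "norm (c *s x) = norm c * norm x" for x :: "complex ^ 3"
  by (simp add: norm_vec_def L2_set_def norm_mult power_mult_distrib sum_distrib_left[symmetric] real_sqrt_mult)

lemma norm_cvec [simp]: "norm (cvec a) = norm a"
  by (simp add: norm_vec_def cvec_def L2_set_def)

lemma norm_vcnj [simp]: "norm (vcnj x) = norm x"
  by (simp add: norm_vec_def vcnj_def L2_set_def)

lemma norm_cdot_le: "norm (cdot x a) \<le> norm x * norm a"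
proof -
  have "norm (cdot x a) \<le> (\<Sum>j\<in>UNIV. norm (x $ j) * norm (a $ j))"
    unfolding cdot_def by (rule order_trans[OF norm_sum]) (simp add: norm_mult)
  also have "\<dots> \<le> norm x * norm a"
    using L2_set_mult_ineq[of "\<lambda>j. norm (x $ j)" "\<lambda>j. norm (a $ j)" UNIV] by (simp add: norm_vec_def)
  finally show ?thesis .
qed

lemma cdot_add: "cdot (x + y) a = cdot x a + cdot y a"
  by (simp add: cdot_def algebra_simps sum.distrib)

lemma cdot_diff: "cdot (x - y) a = cdot x a - cdot y a"
  by (simp add: cdot_def algebra_simps sum_subtractf)

lemma cdot_scaleR: "cdot (r *\<^sub>R x) a = r *\<^sub>R cdot x a"
  by (simp add: cdot_def scaleR_sum_right)

lemma cdot_smult: "cdot (c *s x) a = c * cdot x a"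
  by (simp add: cdot_def sum_distrib_left mult.assoc)

lemma cdot_zero [simp]: "cdot 0 a = 0" "cdot x 0 = 0"
  by (simp_all add: cdot_def)

lemma cdot_uminus_right: "cdot x (- a) = - cdot x a"
  by (simp add: cdot_def sum_negf)

lemma cdot_diff_right: "cdot x (a - b) = cdot x a - cdot x b"
  by (simp add: cdot_def algebra_simps sum_subtractf)

lemma cdot_vcnj: "cdot (vcnj x) a = cnj (cdot x a)"
  by (simp add: cdot_def vcnj_def)

lemma cdot_cvec: "cdot (cvec a) a = of_real ((norm a)\<^sup>2)"
  by (simp add: cdot_def cvec_def power2_norm_eq_inner inner_vec_def)

lemma bounded_linear_cdot: "bounded_linear (\<lambda>x. cdot x a)"
  by (rule bounded_linear_intro[where K = "norm a"]) (simp_all add: cdot_add cdot_scaleR norm_cdot_le)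

lemma bounded_linear_vcnj: "bounded_linear vcnj"
  by (rule bounded_linear_intro[where K = 1]) (simp_all, simp_all add: vcnj_def vec_eq_iff)

lemma divergence_cdot: "divergence L u k = \<i> * cdot (u k) (freq L k)"
  by (simp add: divergence_def cdot_def sum_distrib_left ac_simps)

lemma real_field_vcnj: "real_field u \<longleftrightarrow> (\<forall>k. u (- k) = vcnj (u k))"
  by (simp add: real_field_def vcnj_def vec_eq_iff)

lemma sol_iff: "solenoidal L u \<longleftrightarrow> (\<forall>k. u (- k) = vcnj (u k)) \<and> u 0 = 0 \<and> (\<forall>k. cdot (u k) (freq L k) = 0)"
  by (simp add: solenoidal_def real_field_vcnj zero_mean_def divergence_cdot)

text \<open>
  The symbol of the Leray projection: it removes the component along the wave vector, the gradient
  part, and the mean.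
\<close>

definition leray :: "real \<Rightarrow> int ^ 3 \<Rightarrow> complex ^ 3 \<Rightarrow> complex ^ 3" where
  "leray L k x = (if k = 0 then 0 else x - (cdot x (freq L k) / of_real ((wn L k)\<^sup>2)) *s cvec (freq L k))"

lemma leray_0 [simp]: "leray L 0 x = 0"
  by (simp add: leray_def)

lemma norm_leray_le:
  assumes "0 < L" shows "norm (leray L k x) \<le> 2 * norm x"
proof (cases "k = 0")
  case False
  have w: "0 < wn L k" by (rule wn_pos[OF assms False])
  have "norm ((cdot x (freq L k) / of_real ((wn L k)\<^sup>2)) *s cvec (freq L k)) \<le> norm x"
    using norm_cdot_le[of x "freq L k"] w
    by (simp add: norm_smult_vec norm_divide norm_power norm_mult power2_eq_square field_simps flip: wn_def)
  with norm_triangle_ineq4[of x "(cdot x (freq L k) / of_real ((wn L k)\<^sup>2)) *s cvec (freq L k)"] False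
  show ?thesis by (simp add: leray_def)
qed simp

lemma leray_diff: "leray L k (x - y) = leray L k x - leray L k y"
  by (simp add: leray_def cdot_diff vec_eq_iff algebra_simps diff_divide_distrib)

lemma leray_add: "leray L k (x + y) = leray L k x + leray L k y"
  by (simp add: leray_def cdot_add vec_eq_iff algebra_simps add_divide_distrib)

lemma leray_scaleR: "leray L k (r *\<^sub>R x) = r *\<^sub>R leray L k x"
  by (simp add: leray_def cdot_scaleR vec_eq_iff algebra_simps scaleR_conv_of_real[where 'a = complex])

lemma bounded_linear_leray: "0 < L \<Longrightarrow> bounded_linear (leray L k)"
  by (rule bounded_linear_intro[where K = 2])
    (simp_all only: leray_add leray_scaleR, metis norm_leray_le mult.commute)

lemma cdot_leray: assumes "0 < L" shows "cdot (leray L k x) (freq L k) = 0"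
  using wn_pos[OF assms, of k] by (auto simp: leray_def cdot_diff cdot_smult cdot_cvec wn_def[symmetric])

lemma leray_id: "k \<noteq> 0 \<Longrightarrow> cdot x (freq L k) = 0 \<Longrightarrow> leray L k x = x"
  by (simp add: leray_def)

lemma leray_vcnj: "leray L (- k) (vcnj x) = vcnj (leray L k x)"
  by (simp add: leray_def freq_uminus cdot_uminus_right cdot_vcnj)
    (simp add: vcnj_def vec_eq_iff cvec_def)

lemma inner_gradient:
  assumes "cdot y a = 0" shows "(c *s cvec a) \<bullet> y = 0"
proof -
  have "(c *s cvec a) \<bullet> y = Re (c * cnj (cdot y a))"
    by (simp add: inner_vec_def cvec_def cdot_def inner_complex_def sum_distrib_left algebra_simps sum.distrib sum_subtractf)
  with assms show ?thesis by simp
qed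

text \<open>
  Gradients are orthogonal to divergence-free fields. Hence the projection is invisible to
  divergence-free test fields, and the convective term may be replaced by its projection.
\<close>

lemma inner_leray:
  assumes "k \<noteq> 0" "cdot y (freq L k) = 0" shows "leray L k x \<bullet> y = x \<bullet> y"
  using assms inner_gradient[OF assms(2)] by (simp add: leray_def inner_diff_left)

text \<open>
  The Fourier coefficients of \<open>(u \<bullet> \<nabla>) v\<close>. The derivative would contribute the wave vector of \<open>k - l\<close>;
  for divergence-free \<open>u\<close> it may be replaced by that of \<open>k\<close>, which amounts to writing the term as
  the divergence of \<open>u \<otimes> v\<close>. In this form the convolution needs no derivative of \<open>v\<close>.
\<close>

definition conv :: "real \<Rightarrow> vfield \<Rightarrow> vfield \<Rightarrow> vfield" where
  "conv L u v k = (LINT l|count_space UNIV. (\<i> * cdot (u l) (freq L k)) *s v (k - l))"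

lemma conv_0 [simp]: "conv L u v 0 = 0"
  by (simp add: conv_def)

lemma norm_conv_term_le:
  fixes u v :: vfield
  shows "norm ((\<i> * cdot (u l) (freq L k)) *s v (k - l)) \<le> wn L k * (norm (u l) * norm (v (k - l)))"
  using mult_right_mono[OF norm_cdot_le[of "u l" "freq L k"], of "norm (v (k - l))"]
  by (simp add: norm_smult_vec norm_mult wn_def algebra_simps)

lemma norm_LINT_le_nn_integral:
  fixes f :: "'a \<Rightarrow> 'b::{banach, second_countable_topology}"
  shows "ennreal (norm (integral\<^sup>L M f)) \<le> (\<integral>\<^sup>+x. ennreal (norm (f x)) \<partial>M)"
  by (cases "integrable M f") (simp_all add: integral_norm_bound_ennreal not_integrable_integral_eq)

definition majorant :: "vfield \<Rightarrow> vfield \<Rightarrow> int ^ 3 \<Rightarrow> ennreal" where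
  "majorant u v k = (\<integral>\<^sup>+l. ennreal (norm (u l) * norm (v (k - l))) \<partial>count_space UNIV)"

lemma norm_conv_le: "ennreal (norm (conv L u v k)) \<le> ennreal (wn L k) * majorant u v k"
proof -
  have "ennreal (norm (conv L u v k)) \<le> (\<integral>\<^sup>+l. ennreal (wn L k * (norm (u l) * norm (v (k - l)))) \<partial>count_space UNIV)"
    unfolding conv_def
    by (rule order_trans[OF norm_LINT_le_nn_integral]) (intro nn_integral_mono ennreal_leI norm_conv_term_le)
  then show ?thesis by (simp add: majorant_def ennreal_mult nn_integral_cmult)
qed

text \<open>
  Young's inequality for \<open>\<ell>\<^sup>1 * \<ell>\<^sup>2\<close>. The factor \<open>a l\<close> is split into two square roots and the
  Cauchy--Schwarz inequality is applied with respect to the weight \<open>a\<close>.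
\<close>

lemma Young_convolution:
  fixes a b :: "int ^ 3 \<Rightarrow> real"
  assumes a: "\<And>l. 0 \<le> a l" and b: "\<And>l. 0 \<le> b l"
  shows "(\<integral>\<^sup>+k. (\<integral>\<^sup>+l. ennreal (a l * b (k - l)) \<partial>count_space UNIV)\<^sup>2 \<partial>count_space UNIV)
    \<le> (\<integral>\<^sup>+l. ennreal (a l) \<partial>count_space UNIV)\<^sup>2 * (\<integral>\<^sup>+l. ennreal ((b l)\<^sup>2) \<partial>count_space UNIV)"
proof -
  let ?A = "\<integral>\<^sup>+l. ennreal (a l) \<partial>count_space UNIV"
  have "(\<integral>\<^sup>+l. ennreal (a l * b (k - l)) \<partial>count_space UNIV)\<^sup>2
      \<le> ?A * (\<integral>\<^sup>+l. ennreal (a l) * ennreal ((b (k - l))\<^sup>2) \<partial>count_space UNIV)" for k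
  proof -
    have "(\<integral>\<^sup>+l. ennreal (a l * b (k - l)) \<partial>count_space UNIV)
      = (\<integral>\<^sup>+l. ennreal (sqrt (a l)) * ennreal (sqrt (a l) * b (k - l)) \<partial>count_space UNIV)"
      using a b by (simp add: mult.assoc[symmetric] flip: ennreal_mult)
    also have "\<dots>\<^sup>2 \<le> (\<integral>\<^sup>+l. (ennreal (sqrt (a l)))\<^sup>2 \<partial>count_space UNIV)
        * (\<integral>\<^sup>+l. (ennreal (sqrt (a l) * b (k - l)))\<^sup>2 \<partial>count_space UNIV)"
      by (rule Cauchy_Schwarz_nn_integral) auto
    finally show ?thesis
      using a b by (simp add: ennreal_power power_mult_distrib flip: ennreal_mult)
  qed
  then have "(\<integral>\<^sup>+k. (\<integral>\<^sup>+l. ennreal (a l * b (k - l)) \<partial>count_space UNIV)\<^sup>2 \<partial>count_space UNIV)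
     \<le> (\<integral>\<^sup>+k. ?A * (\<integral>\<^sup>+l. ennreal (a l) * ennreal ((b (k - l))\<^sup>2) \<partial>count_space UNIV) \<partial>count_space UNIV)"
    by (rule nn_integral_mono)
  also have "\<dots> = ?A * (\<integral>\<^sup>+l. (\<integral>\<^sup>+k. ennreal (a l) * ennreal ((b (k - l))\<^sup>2) \<partial>count_space UNIV) \<partial>count_space UNIV)"
    by (subst nn_integral_swap[symmetric]) (simp add: nn_integral_cmult)
  also have "\<dots> = ?A * (\<integral>\<^sup>+l. ennreal (a l) * (\<integral>\<^sup>+k. ennreal ((b k)\<^sup>2) \<partial>count_space UNIV) \<partial>count_space UNIV)"
    using nn_integral_translate[of "\<lambda>k. ennreal ((b k)\<^sup>2)"] by (simp add: nn_integral_cmult)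
  also have "\<dots> = ?A\<^sup>2 * (\<integral>\<^sup>+l. ennreal ((b l)\<^sup>2) \<partial>count_space UNIV)"
    by (simp add: nn_integral_multc power2_eq_square mult.assoc)
  finally show ?thesis .
qed

text \<open>
  One of the frequencies \<open>l\<close> and \<open>k - l\<close> has at least half the size of \<open>k\<close> and takes over the weight
  \<open>\<bar>k\<bar>\<^sup>\<alpha>\<close>. In either case the weight \<open>1 + \<alpha>\<close> on \<open>u\<close> and \<open>\<alpha>\<close> on \<open>v\<close> leaves the factor
  \<open>\<bar>j\<bar>\<^sup>-\<^sup>(\<^sup>1\<^sup>+\<^sup>\<alpha>\<^sup>)\<close> at the smaller one \<open>j\<close> of the two frequencies; it is square summable.
\<close>

lemma product_weight_le:
  assumes L: "0 < L" and \<alpha>: "0 \<le> \<alpha>" and u0: "u 0 = 0" and v0: "v 0 = 0"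
  shows "wn L k powr \<alpha> * (norm (u l) * norm (v (k - l)))
    \<le> 2 powr \<alpha> * ((wn L l powr - (1 + \<alpha>) * (wn L l powr (1 + \<alpha>) * norm (u l))) * (wn L (k - l) powr \<alpha> * norm (v (k - l))))
     + 2 powr \<alpha> * ((wn L l powr (1 + \<alpha>) * norm (u l)) * (wn L (k - l) powr - (1 + \<alpha>) * (wn L (k - l) powr \<alpha> * norm (v (k - l)))))"
    (is "?lhs \<le> ?t1 + ?t2")
proof (cases "l = 0 \<or> k - l = 0")
  case True
  then have "norm (u l) * norm (v (k - l)) = 0" using u0 v0 by (auto simp: mult_eq_0_iff)
  then show ?thesis by (simp only: mult_zero_right) (intro add_nonneg_nonneg mult_nonneg_nonneg, auto)
next
  case False
  let ?x = "wn L l" let ?y = "wn L (k - l)"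
  have x: "0 < ?x" and y: "0 < ?y" using False wn_pos[OF L] by auto
  have tri: "wn L k \<le> ?x + ?y"
    using norm_triangle_ineq[of "freq L l" "freq L (k - l)"] by (simp add: wn_def freq_diff)
  have n: "0 \<le> ?t1" "0 \<le> ?t2" by auto
  show ?thesis
  proof (cases "?x \<le> ?y")
    case True
    have "wn L k powr \<alpha> \<le> (2 * ?y) powr \<alpha>" using tri True \<alpha> by (intro powr_mono2) auto
    then have "?lhs \<le> (2 * ?y) powr \<alpha> * (norm (u l) * norm (v (k - l)))" by (intro mult_right_mono) auto
    also have "\<dots> = ?t1"
      using x y powr_add[of ?x "- (1 + \<alpha>)" "1 + \<alpha>"] by (simp add: powr_mult mult.assoc[symmetric])
    finally show ?thesis using n by linarith
  next
    case False
    have "wn L k powr \<alpha> \<le> (2 * ?x) powr \<alpha>" using tri False \<alpha> by (intro powr_mono2) auto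
    then have "?lhs \<le> (2 * ?x) powr \<alpha> * (norm (u l) * norm (v (k - l)))" by (intro mult_right_mono) auto
    also have "\<dots> = 2 powr \<alpha> * (?x powr \<alpha> * ?y * (?y powr - 1 * (norm (u l) * norm (v (k - l)))))"
      using x y by (simp add: powr_mult powr_minus)
    also have "\<dots> \<le> 2 powr \<alpha> * (?x powr \<alpha> * ?x * (?y powr - 1 * (norm (u l) * norm (v (k - l)))))"
      using False by (intro mult_left_mono mult_right_mono) auto
    also have "\<dots> = ?t2"
    proof -
      have "?x powr \<alpha> * ?x = ?x powr (1 + \<alpha>)" using x by (simp add: powr_add)
      moreover have "?y powr - (1 + \<alpha>) * ?y powr \<alpha> = ?y powr - 1" by (simp flip: powr_add)
      ultimately show ?thesis by (simp add: algebra_simps)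
    qed
    finally show ?thesis using n by linarith
  qed
qed

text \<open>
  Both products that result from \<open>product_weight_le\<close> are convolutions of an \<open>\<ell>\<^sup>2\<close> sequence with the
  product of an \<open>\<ell>\<^sup>2\<close> sequence and the square summable weight \<open>w\<close>. The latter product is in \<open>\<ell>\<^sup>1\<close>, so
  Young's inequality applies. The same majorant controls \<open>B(u,v)\<close> and the trilinear form.
\<close>

lemma majorant_estimate:
  assumes L: "0 < L" and \<alpha>: "1 / 2 < \<alpha>"
  obtains K where "0 < K" and
    "\<And>u v. u 0 = 0 \<Longrightarrow> v 0 = 0 \<Longrightarrow>
       (\<integral>\<^sup>+k. (ennreal (wn L k powr \<alpha>) * majorant u v k)\<^sup>2 \<partial>count_space UNIV)
         \<le> ennreal K * (sob L (1 + \<alpha>) u * sob L \<alpha> v)"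
proof -
  define W where "W = (\<integral>\<^sup>+k. ennreal (wn L k powr - (2 * (1 + \<alpha>))) \<partial>count_space UNIV)"
  have W: "W < \<infinity>" unfolding W_def using \<alpha> by (intro lattice_sum_finite[OF L]) auto
  define w where "w l = wn L l powr - (1 + \<alpha>)" for l
  \<comment> \<open>The summand \<open>1\<close> only makes the constant positive.\<close>
  define K where "K = 4 * (2 powr \<alpha>)\<^sup>2 * enn2real W + 1"
  have K: "0 < K" by (simp add: K_def add_nonneg_pos)
  have WK: "4 * (ennreal (2 powr \<alpha>))\<^sup>2 * W \<le> ennreal K"
  proof -
    have "4 * (ennreal (2 powr \<alpha>))\<^sup>2 * W = ennreal (4 * (2 powr \<alpha>)\<^sup>2 * enn2real W)"
      using W by (cases W) (simp_all add: ennreal_mult ennreal_power)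
    also have "\<dots> \<le> ennreal K" by (rule ennreal_leI) (simp add: K_def)
    finally show ?thesis .
  qed
  have w2: "(\<integral>\<^sup>+l. (ennreal (w l))\<^sup>2 \<partial>count_space UNIV) = W"
    unfolding W_def w_def by (simp add: ennreal_power powr_square)
  have "(\<integral>\<^sup>+k. (ennreal (wn L k powr \<alpha>) * majorant u v k)\<^sup>2 \<partial>count_space UNIV)
         \<le> ennreal K * (sob L (1 + \<alpha>) u * sob L \<alpha> v)" if u0: "u 0 = 0" and v0: "v 0 = 0" for u v
  proof -
    define a where "a l = wn L l powr (1 + \<alpha>) * norm (u l)" for l
    define b where "b l = wn L l powr \<alpha> * norm (v l)" for l
    have nn: "0 \<le> a l" "0 \<le> b l" "0 \<le> w l" for l by (simp_all add: a_def b_def w_def)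
    have a2: "(\<integral>\<^sup>+l. ennreal ((a l)\<^sup>2) \<partial>count_space UNIV) = sob L (1 + \<alpha>) u"
      unfolding sob_def a_def by (simp add: power_mult_distrib powr_square)
    have b2: "(\<integral>\<^sup>+l. ennreal ((b l)\<^sup>2) \<partial>count_space UNIV) = sob L \<alpha> v"
      unfolding sob_def b_def by (simp add: power_mult_distrib powr_square)
    have wS: "(\<integral>\<^sup>+l. ennreal (w l * c l) \<partial>count_space UNIV)\<^sup>2 \<le> W * (\<integral>\<^sup>+l. ennreal ((c l)\<^sup>2) \<partial>count_space UNIV)"
      if "\<And>l. 0 \<le> c l" for c
      using Cauchy_Schwarz_nn_integral[of "\<lambda>l. ennreal (w l)" "count_space UNIV" "\<lambda>l. ennreal (c l)"] that nn
      by (simp add: ennreal_mult flip: w2 ennreal_power)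
    define S where "S k = (\<integral>\<^sup>+l. ennreal ((w l * a l) * b (k - l)) \<partial>count_space UNIV)" for k
    define T where "T k = (\<integral>\<^sup>+l. ennreal ((w l * b l) * a (k - l)) \<partial>count_space UNIV)" for k
    have T_eq: "T k = (\<integral>\<^sup>+l. ennreal (a l * (w (k - l) * b (k - l))) \<partial>count_space UNIV)" for k
      unfolding T_def
      by (subst nn_integral_reflect[symmetric, where k = k]) (simp add: mult.commute)
    have "ennreal (wn L k powr \<alpha>) * majorant u v k \<le> ennreal (2 powr \<alpha>) * S k + ennreal (2 powr \<alpha>) * T k" for k
    proof -
      have "ennreal (wn L k powr \<alpha>) * majorant u v k
        = (\<integral>\<^sup>+l. ennreal (wn L k powr \<alpha> * (norm (u l) * norm (v (k - l)))) \<partial>count_space UNIV)"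
        unfolding majorant_def by (simp add: ennreal_mult nn_integral_cmult)
      also have "\<dots> \<le> (\<integral>\<^sup>+l. ennreal (2 powr \<alpha>) * ennreal ((w l * a l) * b (k - l))
           + ennreal (2 powr \<alpha>) * ennreal (a l * (w (k - l) * b (k - l))) \<partial>count_space UNIV)"
      proof (rule nn_integral_mono)
        fix l
        have "wn L k powr \<alpha> * (norm (u l) * norm (v (k - l)))
            \<le> 2 powr \<alpha> * ((w l * a l) * b (k - l)) + 2 powr \<alpha> * (a l * (w (k - l) * b (k - l)))"
          using product_weight_le[where \<alpha> = \<alpha> and k = k and l = l and u = u and v = v, OF L _ u0 v0] \<alpha> unfolding a_def b_def w_def by simp
        from ennreal_leI[OF this]
        show "ennreal (wn L k powr \<alpha> * (norm (u l) * norm (v (k - l))))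
          \<le> ennreal (2 powr \<alpha>) * ennreal ((w l * a l) * b (k - l))
           + ennreal (2 powr \<alpha>) * ennreal (a l * (w (k - l) * b (k - l)))"
          using nn by (simp add: ennreal_mult ennreal_plus)
      qed
      also have "\<dots> = ennreal (2 powr \<alpha>) * S k + ennreal (2 powr \<alpha>) * T k"
        unfolding T_eq S_def by (simp add: nn_integral_add nn_integral_cmult)
      finally show ?thesis .
    qed
    then have "(ennreal (wn L k powr \<alpha>) * majorant u v k)\<^sup>2
        \<le> 2 * (ennreal (2 powr \<alpha>))\<^sup>2 * (S k)\<^sup>2 + 2 * (ennreal (2 powr \<alpha>))\<^sup>2 * (T k)\<^sup>2" for k
      using order_trans[OF power_mono[of _ _ 2] ennreal_square_add_le] by (fastforce simp: power_mult_distrib mult.assoc)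
    then have "(\<integral>\<^sup>+k. (ennreal (wn L k powr \<alpha>) * majorant u v k)\<^sup>2 \<partial>count_space UNIV)
      \<le> (\<integral>\<^sup>+k. 2 * (ennreal (2 powr \<alpha>))\<^sup>2 * (S k)\<^sup>2 + 2 * (ennreal (2 powr \<alpha>))\<^sup>2 * (T k)\<^sup>2 \<partial>count_space UNIV)"
      by (rule nn_integral_mono)
    also have "\<dots> = 2 * (ennreal (2 powr \<alpha>))\<^sup>2 * (\<integral>\<^sup>+k. (S k)\<^sup>2 \<partial>count_space UNIV)
        + 2 * (ennreal (2 powr \<alpha>))\<^sup>2 * (\<integral>\<^sup>+k. (T k)\<^sup>2 \<partial>count_space UNIV)"
      by (simp add: nn_integral_add nn_integral_cmult)
    also have "\<dots> \<le> 2 * (ennreal (2 powr \<alpha>))\<^sup>2 * (W * (sob L (1 + \<alpha>) u * sob L \<alpha> v))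
        + 2 * (ennreal (2 powr \<alpha>))\<^sup>2 * (W * (sob L (1 + \<alpha>) u * sob L \<alpha> v))"
    proof (intro add_mono mult_left_mono)
      have "(\<integral>\<^sup>+k. (S k)\<^sup>2 \<partial>count_space UNIV)
          \<le> (\<integral>\<^sup>+l. ennreal (w l * a l) \<partial>count_space UNIV)\<^sup>2 * (\<integral>\<^sup>+l. ennreal ((b l)\<^sup>2) \<partial>count_space UNIV)"
        unfolding S_def by (rule Young_convolution) (simp_all add: nn)
      also have "\<dots> \<le> (W * sob L (1 + \<alpha>) u) * sob L \<alpha> v"
        using wS[of a] nn by (simp add: a2 b2 mult_right_mono)
      finally show "(\<integral>\<^sup>+k. (S k)\<^sup>2 \<partial>count_space UNIV) \<le> W * (sob L (1 + \<alpha>) u * sob L \<alpha> v)"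
        by (simp add: mult.assoc)
      have "(\<integral>\<^sup>+k. (T k)\<^sup>2 \<partial>count_space UNIV)
          \<le> (\<integral>\<^sup>+l. ennreal (w l * b l) \<partial>count_space UNIV)\<^sup>2 * (\<integral>\<^sup>+l. ennreal ((a l)\<^sup>2) \<partial>count_space UNIV)"
        unfolding T_def by (rule Young_convolution) (simp_all add: nn)
      also have "\<dots> \<le> (W * sob L \<alpha> v) * sob L (1 + \<alpha>) u"
        using wS[of b] nn by (simp add: a2 b2 mult_right_mono)
      finally show "(\<integral>\<^sup>+k. (T k)\<^sup>2 \<partial>count_space UNIV) \<le> W * (sob L (1 + \<alpha>) u * sob L \<alpha> v)"
        by (simp add: ac_simps)
    qed auto
    also have "\<dots> = (4 * (ennreal (2 powr \<alpha>))\<^sup>2 * W) * (sob L (1 + \<alpha>) u * sob L \<alpha> v)"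
    proof -
      have "2 * x * (W * y) + 2 * x * (W * y) = (4 * x * W) * y" for x y :: ennreal
        by (simp add: mult.assoc flip: distrib_right mult_2)
      then show ?thesis .
    qed
    also have "\<dots> \<le> ennreal K * (sob L (1 + \<alpha>) u * sob L \<alpha> v)"
      by (intro mult_right_mono WK) auto
    finally show ?thesis .
  qed
  with that K show ?thesis by blast
qed

text \<open>
  The divergence in front of the convolution costs the factor \<open>\<bar>k\<bar>\<close>, which is why one order is lost.
\<close>

lemma sob_conv_le:
  assumes L: "0 < L"
  shows "sob L (\<alpha> - 1) (conv L u v) \<le> (\<integral>\<^sup>+k. (ennreal (wn L k powr \<alpha>) * majorant u v k)\<^sup>2 \<partial>count_space UNIV)"
  unfolding sob_def
proof (rule nn_integral_mono)
  fix k
  show "ennreal (wn L k powr (2 * (\<alpha> - 1)) * (norm (conv L u v k))\<^sup>2) \<le> (ennreal (wn L k powr \<alpha>) * majorant u v k)\<^sup>2"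
  proof (cases "k = 0")
    case False
    have w: "0 < wn L k" by (rule wn_pos[OF L False])
    have "ennreal (wn L k powr (2 * (\<alpha> - 1)) * (norm (conv L u v k))\<^sup>2)
      = (ennreal (wn L k powr (\<alpha> - 1)) * ennreal (norm (conv L u v k)))\<^sup>2"
      by (simp add: ennreal_mult ennreal_power power_mult_distrib powr_square)
    also have "\<dots> \<le> (ennreal (wn L k powr (\<alpha> - 1)) * (ennreal (wn L k) * majorant u v k))\<^sup>2"
      by (intro power_mono mult_left_mono norm_conv_le) auto
    also have "ennreal (wn L k powr (\<alpha> - 1)) * (ennreal (wn L k) * majorant u v k)
       = ennreal (wn L k powr \<alpha>) * majorant u v k"
      using w powr_add[of "wn L k" "\<alpha> - 1" 1] by (simp add: mult.assoc[symmetric] flip: ennreal_mult)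
    finally show ?thesis .
  qed simp
qed

lemma sob_0_integrable:
  assumes L: "0 < L" and u: "u 0 = 0" "sob L 0 u < \<infinity>"
  shows "integrable (count_space UNIV) (\<lambda>l. (norm (u l))\<^sup>2)"
proof -
  have "(wn L l powr 0 * norm (u l))\<^sup>2 = (norm (u l))\<^sup>2" for l
    using u(1) wn_pos[OF L, of l] by (cases "l = 0") auto
  with u(2) show ?thesis unfolding sob_integrable by (simp only:)
qed

lemma integrable_norm_product:
  assumes L: "0 < L" and u: "u 0 = 0" "sob L 0 u < \<infinity>" and v: "v 0 = 0" "sob L 0 v < \<infinity>"
  shows "integrable (count_space UNIV) (\<lambda>l. norm (u l) * norm (v (k - l)))"
proof (rule Cauchy_Schwarz_integral(1))
  show "integrable (count_space UNIV) (\<lambda>l. (norm (u l))\<^sup>2)" by (rule sob_0_integrable[OF L u])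
  have bij: "bij_betw (\<lambda>l. k - l) UNIV UNIV"
    by (rule bij_betwI[where g = "\<lambda>l. k - l"]) auto
  show "integrable (count_space UNIV) (\<lambda>l. (norm (v (k - l)))\<^sup>2)"
    using sob_0_integrable[OF L v] integrable_bij_count_space[OF bij, of "\<lambda>l. (norm (v l))\<^sup>2"] by simp
qed auto

lemma conv_integrable:
  assumes L: "0 < L" and u: "u 0 = 0" "sob L 0 u < \<infinity>" and v: "v 0 = 0" "sob L 0 v < \<infinity>"
  shows "integrable (count_space UNIV) (\<lambda>l. (\<i> * cdot (u l) (freq L k)) *s v (k - l))"
proof (rule Bochner_Integration.integrable_bound)
  show "integrable (count_space UNIV) (\<lambda>l. wn L k * (norm (u l) * norm (v (k - l))))"
    by (intro integrable_mult_right integrable_norm_product[OF L u v])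
  show "AE l in count_space UNIV. norm ((\<i> * cdot (u l) (freq L k)) *s v (k - l))
      \<le> norm (wn L k * (norm (u l) * norm (v (k - l))))"
    using norm_conv_term_le[of u _ L k v] by (intro AE_I2) (simp add: abs_mult)
qed simp

lemma conv_difference:
  assumes L: "0 < L"
    and "u 0 = 0" "sob L 0 u < \<infinity>" "v 0 = 0" "sob L 0 v < \<infinity>"
    and "u' 0 = 0" "sob L 0 u' < \<infinity>" "v' 0 = 0" "sob L 0 v' < \<infinity>"
  shows "conv L u v k - conv L u' v' k
    = conv L u (\<lambda>k. v k - v' k) k + conv L (\<lambda>k. u k - u' k) v' k"
proof -
  have i: "integrable (count_space UNIV) (\<lambda>l. (\<i> * cdot (u l) (freq L k)) *s v (k - l))"
    "integrable (count_space UNIV) (\<lambda>l. (\<i> * cdot (u' l) (freq L k)) *s v' (k - l))"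
    "integrable (count_space UNIV) (\<lambda>l. (\<i> * cdot (u l) (freq L k)) *s (v (k - l) - v' (k - l)))"
    "integrable (count_space UNIV) (\<lambda>l. (\<i> * cdot (u l - u' l) (freq L k)) *s v' (k - l))"
    using assms conv_integrable[OF L, of u v k] conv_integrable[OF L, of u' v' k]
      conv_integrable[OF L, of u "\<lambda>k. v k - v' k" k, OF _ _ _ sob_diff_finite]
      conv_integrable[OF L, of "\<lambda>k. u k - u' k" v' k, OF _ sob_diff_finite]
    by simp_all
  have "conv L u v k - conv L u' v' k = (LINT l|count_space UNIV. (\<i> * cdot (u l) (freq L k)) *s v (k - l)
      - (\<i> * cdot (u' l) (freq L k)) *s v' (k - l))"
    unfolding conv_def using i by simp
  also have "\<dots> = (LINT l|count_space UNIV. (\<i> * cdot (u l) (freq L k)) *s (v (k - l) - v' (k - l))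
      + (\<i> * cdot (u l - u' l) (freq L k)) *s v' (k - l))"
    by (rule Bochner_Integration.integral_cong) (simp_all add: vec_eq_iff cdot_diff algebra_simps)
  also have "\<dots> = conv L u (\<lambda>k. v k - v' k) k + conv L (\<lambda>k. u k - u' k) v' k"
    unfolding conv_def using i by simp
  finally show ?thesis .
qed

lemma conv_vcnj:
  assumes L: "0 < L" and u: "solenoidal L u" "sob L 0 u < \<infinity>" and v: "solenoidal L v" "sob L 0 v < \<infinity>"
  shows "conv L u v (- k) = vcnj (conv L u v k)"
proof -
  have bij: "bij_betw (\<lambda>l :: int ^ 3. - l) UNIV UNIV"
    by (rule bij_betwI[where g = "\<lambda>l. - l"]) auto
  have "conv L u v (- k)
      = (LINT l|count_space UNIV. (\<i> * cdot (u (- l)) (freq L (- k))) *s v (- k - - l))"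
    unfolding conv_def by (rule integral_bij_count_space[OF bij, symmetric])
  also have "\<dots> = (LINT l|count_space UNIV. vcnj ((\<i> * cdot (u l) (freq L k)) *s v (k - l)))"
  proof (rule Bochner_Integration.integral_cong)
    fix l
    have "u (- l) = vcnj (u l)" "v (- k - - l) = vcnj (v (k - l))"
      using u v unfolding sol_iff by (simp, metis minus_diff_eq minus_diff_minus)
    then show "(\<i> * cdot (u (- l)) (freq L (- k))) *s v (- k - - l) = vcnj ((\<i> * cdot (u l) (freq L k)) *s v (k - l))"
      by (simp add: freq_uminus cdot_uminus_right cdot_vcnj) (simp add: vcnj_def vec_eq_iff)
  qed simp
  also have "\<dots> = vcnj (conv L u v k)"
    unfolding conv_def
    by (rule integral_bounded_linear[OF bounded_linear_vcnj])
      (use u v in \<open>auto intro!: conv_integrable[OF L] simp: sol_zero_mean\<close>)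
  finally show ?thesis .
qed

definition convection :: "real \<Rightarrow> vfield \<Rightarrow> vfield \<Rightarrow> vfield" where
  "convection L u v k = leray L k (conv L u v k)"

lemma convection_0 [simp]: "convection L u v 0 = 0"
  by (simp add: convection_def)

lemma convection_difference:
  assumes L: "0 < L"
    and "u 0 = 0" "sob L 0 u < \<infinity>" "v 0 = 0" "sob L 0 v < \<infinity>"
    and "u' 0 = 0" "sob L 0 u' < \<infinity>" "v' 0 = 0" "sob L 0 v' < \<infinity>"
  shows "convection L u v k - convection L u' v' k
    = convection L u (\<lambda>k. v k - v' k) k + convection L (\<lambda>k. u k - u' k) v' k"
  unfolding convection_def leray_diff[symmetric] leray_add[symmetric] conv_difference[OF assms] ..

lemma sol_convection:
  assumes L: "0 < L" and u: "solenoidal L u" "sob L 0 u < \<infinity>" and v: "solenoidal L v" "sob L 0 v < \<infinity>"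
  shows "solenoidal L (convection L u v)"
  unfolding sol_iff convection_def
  by (simp add: conv_vcnj[OF assms] leray_vcnj cdot_leray[OF L])

lemma sob_convection_le:
  assumes L: "0 < L"
  shows "sob L s (convection L u v) \<le> 4 * sob L s (conv L u v)"
proof -
  have "wn L k powr (2 * s) * (norm (convection L u v k))\<^sup>2 \<le> 4 * (wn L k powr (2 * s) * (norm (conv L u v k))\<^sup>2)" for k
  proof -
    have "(norm (convection L u v k))\<^sup>2 \<le> (2 * norm (conv L u v k))\<^sup>2"
      unfolding convection_def by (intro power_mono norm_leray_le[OF L]) simp
    then have "wn L k powr (2 * s) * (norm (convection L u v k))\<^sup>2 \<le> wn L k powr (2 * s) * (2 * norm (conv L u v k))\<^sup>2"
      by (intro mult_left_mono) auto
    then show ?thesis by (simp add: power_mult_distrib)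
  qed
  from ennreal_leI[OF this] show ?thesis
    unfolding sob_def
    by (subst nn_integral_cmult[symmetric]) (auto intro!: nn_integral_mono simp: ennreal_mult)
qed

text \<open>
  The bound for the nonlinearity on which all estimates of the evolution rest. Up to a constant,
  the norm of \<open>B(u,v)\<close> in \<open>V\<^sup>\<alpha>\<^sup>-\<^sup>1\<close> is at most the product of the norm of \<open>u\<close> in \<open>V\<^sup>1\<^sup>+\<^sup>\<alpha>\<close> and
  the norm of \<open>v\<close> in \<open>V\<^sup>\<alpha>\<close>: a drift that is square integrable in time is paired with a solution that is
  bounded in time.
\<close>

lemma convection_estimate:
  assumes L: "0 < L" and \<alpha>: "1 / 2 < \<alpha>"
  obtains K where "0 < K" and
    "\<And>u v. u 0 = 0 \<Longrightarrow> v 0 = 0 \<Longrightarrow>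
       sob L (\<alpha> - 1) (convection L u v) \<le> ennreal K * (sob L (1 + \<alpha>) u * sob L \<alpha> v)"
proof -
  obtain K where K: "0 < K" and
    le: "\<And>u v. u 0 = 0 \<Longrightarrow> v 0 = 0 \<Longrightarrow>
       (\<integral>\<^sup>+k. (ennreal (wn L k powr \<alpha>) * majorant u v k)\<^sup>2 \<partial>count_space UNIV)
         \<le> ennreal K * (sob L (1 + \<alpha>) u * sob L \<alpha> v)"
    using majorant_estimate[OF assms] by blast
  have "sob L (\<alpha> - 1) (convection L u v) \<le> ennreal (4 * K) * (sob L (1 + \<alpha>) u * sob L \<alpha> v)"
    if "u 0 = 0" "v 0 = 0" for u v
  proof -
    have "sob L (\<alpha> - 1) (convection L u v) \<le> 4 * (ennreal K * (sob L (1 + \<alpha>) u * sob L \<alpha> v))"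
      by (rule order_trans[OF sob_convection_le[OF L] mult_left_mono])
        (rule order_trans[OF sob_conv_le[OF L] le[where u = u and v = v, OF that]], simp)
    then show ?thesis using K by (simp add: ennreal_mult mult.assoc)
  qed
  then show ?thesis using that[of "4 * K"] K by simp
qed

section \<open>The trilinear form as a Fourier series\<close>

lemma integral_cis_interval:
  assumes L: "0 < L"
  shows "(LINT t|lborel. indicator {0..L} t *\<^sub>R cis (2 * pi * of_int n / L * t)) = (if n = 0 then of_real L else 0)"
proof (cases "n = 0")
  case True
  then show ?thesis using L by (simp add: scaleR_conv_of_real)
next
  case False
  define c where "c = 2 * pi * of_int n / L"
  have c: "c \<noteq> 0" "c * L = 2 * pi * of_int n" using False L by (auto simp: c_def)
  have "(LINT t|lborel. indicator {0..L} t *\<^sub>R cis (c * t)) = cis (c * L) / (\<i> * of_real c) - cis (c * 0) / (\<i> * of_real c)"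
  proof (rule integral_FTC_Icc)
    show "((\<lambda>t. cis (c * t) / (\<i> * of_real c)) has_vector_derivative cis (c * x)) (at x within {0..L})" for x
      unfolding has_vector_derivative_def
      by (rule derivative_eq_intros refl | simp add: c scaleR_conv_of_real fun_eq_iff complex_eq_iff)+
    show "continuous_on {0..L} (\<lambda>t. cis (c * t))" by (intro continuous_intros)
  qed (use L in auto)
  then show ?thesis using False c(2) by (simp add: c_def[symmetric])
qed

lemma cis_sum: "finite S \<Longrightarrow> cis (\<Sum>i\<in>S. f i) = (\<Prod>i\<in>S. cis (f i))"
  by (induction rule: finite_induct) (simp_all flip: cis_mult)

text \<open>
  Orthogonality of the Fourier modes. The integral over the cell factors into one-dimensional ones.
\<close>

lemma integral_cis_cube:
  assumes L: "0 < L"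
  shows "(LINT x:cbox 0 (\<chi> i. L)|lborel. cis (freq L k \<bullet> x)) = (if k = 0 then of_real (L ^ 3) else 0)"
proof -
  interpret product_sigma_finite "\<lambda>b :: real ^ 3. lborel :: real measure" ..
  let ?F = "\<lambda>b t. indicator {0..L} t *\<^sub>R cis ((freq L k \<bullet> b) * t)"
  have F: "integrable lborel (?F b)" for b
    by (intro borel_integrable_compact continuous_intros compact_Icc)
  have "(LINT x:cbox 0 (\<chi> i. L)|lborel. cis (freq L k \<bullet> x)) = (LINT x|lborel. (\<Prod>b\<in>Basis. ?F b (x \<bullet> b)))"
    unfolding set_lebesgue_integral_def
  proof (rule Bochner_Integration.integral_cong)
    fix x :: "real ^ 3"
    have "(indicator (cbox 0 (\<chi> i. L)) x :: real) = (\<Prod>b\<in>Basis. indicator {0..L} (x \<bullet> b))"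
    proof (cases "x \<in> cbox 0 (\<chi> i. L)")
      case True
      then have "\<forall>b\<in>Basis. x \<bullet> b \<in> {0..L}" by (auto simp: mem_box Basis_vec_def inner_axis)
      with True show ?thesis by (subst prod.neutral) auto
    next
      case False
      then obtain j where "x $ j \<notin> {0..L}"
        by (auto simp: mem_box Basis_vec_def inner_axis)
      then have "x \<bullet> axis j 1 \<notin> {0..L}" by (simp add: inner_axis)
      moreover have "(axis j 1 :: real ^ 3) \<in> Basis" by (simp add: axis_in_Basis_iff)
      ultimately obtain b where "b \<in> Basis" "x \<bullet> b \<notin> {0..L}" by blast
      then have "(\<Prod>b\<in>Basis. indicator {0..L} (x \<bullet> b) :: real) = 0"
        by (intro prod_zero) (auto intro!: bexI[of _ b])
      with False show ?thesis by simp
    qed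
    moreover have "cis (freq L k \<bullet> x) = (\<Prod>b\<in>Basis. cis ((freq L k \<bullet> b) * (x \<bullet> b)))"
      by (subst euclidean_inner) (simp add: cis_sum)
    ultimately show "indicator (cbox 0 (\<chi> i. L)) x *\<^sub>R cis (freq L k \<bullet> x) = (\<Prod>b\<in>Basis. ?F b (x \<bullet> b))"
      by (simp add: scaleR_conv_of_real prod.distrib)
  qed simp
  also have "\<dots> = (LINT f|(\<Pi>\<^sub>M b\<in>Basis. lborel). (\<Prod>b\<in>Basis. ?F b ((\<Sum>b\<in>Basis. f b *\<^sub>R b) \<bullet> b)))"
    by (subst lborel_eq, rule integral_distr)
      (auto intro!: borel_measurable_prod measurable_compose[OF _ borel_measurable_integrable[OF F], simplified])
  also have "\<dots> = (LINT f|(\<Pi>\<^sub>M b\<in>Basis. lborel). (\<Prod>b\<in>Basis. ?F b (f b)))"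
    by (intro Bochner_Integration.integral_cong prod.cong) (simp_all add: inner_sum_left_Basis)
  also have "\<dots> = (\<Prod>b\<in>Basis. LINT t|lborel. ?F b t)"
    by (rule product_integral_prod) (use F in auto)
  also have "\<dots> = (\<Prod>b\<in>(Basis :: (real ^ 3) set). if freq L k \<bullet> b = 0 then of_real L else 0)"
  proof (rule prod.cong)
    fix b :: "real ^ 3" assume "b \<in> Basis"
    then obtain j where b: "b = axis j 1" by (auto simp: Basis_vec_def)
    have "freq L k \<bullet> b = 2 * pi * of_int (k $ j) / L" by (simp add: b inner_axis freq_def)
    then show "(LINT t|lborel. ?F b t) = (if freq L k \<bullet> b = 0 then of_real L else 0)"
      using integral_cis_interval[OF L, of "k $ j"] L by auto
  qed simp
  also have "\<dots> = (if k = 0 then of_real (L ^ 3) else 0)"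
  proof (cases "k = 0")
    case False
    then obtain j where "k $ j \<noteq> 0" by (auto simp: vec_eq_iff)
    then have "freq L k \<bullet> axis j 1 \<noteq> 0" using L by (simp add: inner_axis freq_def)
    moreover have "(axis j 1 :: real ^ 3) \<in> Basis" by (simp add: axis_in_Basis_iff)
    ultimately show ?thesis using False by (force simp: prod_zero_iff)
  qed simp
  finally show ?thesis .
qed

text \<open>
  The complex-valued sum behind \<open>field_val\<close>, before the real part is taken.
\<close>

definition trigpoly :: "real \<Rightarrow> (int ^ 3) set \<Rightarrow> (int ^ 3 \<Rightarrow> complex) \<Rightarrow> real ^ 3 \<Rightarrow> complex" where
  "trigpoly L S c x = (\<Sum>k\<in>S. c k * cis (freq L k \<bullet> x))"

text \<open>
  Taking the real part is harmless for real fields. Products of real parts can therefore be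
  multiplied out as products of complex exponentials.
\<close>

lemma trigpoly_real:
  assumes S: "uminus ` S = S" and c: "\<And>k. c (- k) = cnj (c k)"
  shows "complex_of_real (Re (trigpoly L S c x)) = trigpoly L S c x"
proof -
  have "cnj (trigpoly L S c x) = (\<Sum>k\<in>S. c (- k) * cis (freq L (- k) \<bullet> x))"
    by (simp add: trigpoly_def c freq_uminus cis_cnj)
  also have "\<dots> = (\<Sum>k\<in>uminus ` S. c k * cis (freq L k \<bullet> x))"
    by (subst sum.reindex) (auto simp: inj_on_def)
  finally have "cnj (trigpoly L S c x) = trigpoly L S c x" by (simp add: S trigpoly_def)
  then show ?thesis by (metis Reals_cnj_iff of_real_Re)
qed

lemma field_val_trigpoly:
  assumes "finite S" "\<And>k. k \<notin> S \<Longrightarrow> u k = 0"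
  shows "field_val L u x $ i = Re (trigpoly L S (\<lambda>k. u k $ i) x)"
proof -
  have "(\<Sum>\<^sub>\<infinity>k. u k $ i * cis (freq L k \<bullet> x)) = (\<Sum>\<^sub>\<infinity>k\<in>S. u k $ i * cis (freq L k \<bullet> x))"
    by (rule infsum_cong_neutral) (use assms(2) in auto)
  with assms(1) show ?thesis by (simp add: field_val_def trigpoly_def)
qed

lemma partial_field_val:
  assumes "finite S" "\<And>k. k \<notin> S \<Longrightarrow> u k = 0"
  shows "partial j (\<lambda>y. field_val L u y $ i) x
     = Re (trigpoly L S (\<lambda>k. \<i> * of_real (freq L k $ j) * u k $ i) x)"
proof -
  have D: "((\<lambda>y. Re (trigpoly L S (\<lambda>k. u k $ i) y)) has_derivative
     (\<lambda>h. Re (\<Sum>k\<in>S. u k $ i * ((freq L k \<bullet> h) *\<^sub>R (\<i> * cis (freq L k \<bullet> x)))))) (at x)"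
    unfolding trigpoly_def
    by (rule derivative_eq_intros refl | simp)+
  have "frechet_derivative (\<lambda>y. Re (trigpoly L S (\<lambda>k. u k $ i) y)) (at x) (axis j 1)
    = Re (\<Sum>k\<in>S. u k $ i * ((freq L k \<bullet> axis j 1) *\<^sub>R (\<i> * cis (freq L k \<bullet> x))))"
    by (rule fun_cong[OF frechet_derivative_at[OF D], symmetric])
  moreover have "field_val L u y $ i = Re (trigpoly L S (\<lambda>k. u k $ i) y)" for y
    by (rule field_val_trigpoly[OF assms(1)]) (simp add: assms(2))
  ultimately show ?thesis
    unfolding partial_def
    by (simp only: trigpoly_def inner_axis scaleR_conv_of_real) (simp add: ac_simps)
qed

lemma triple_sum_product:
  fixes f g h :: "'a \<Rightarrow> complex"
  shows "(\<Sum>l\<in>S. f l) * (\<Sum>m\<in>S. g m) * (\<Sum>n\<in>S. h n) = (\<Sum>l\<in>S. \<Sum>m\<in>S. \<Sum>n\<in>S. f l * g m * h n)"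
  unfolding sum_product[of f] by (simp only: sum_distrib_right) (simp only: sum_distrib_left)

lemma integral_trigpoly_product:
  assumes L: "0 < L" and S: "finite S"
  shows "(LINT x:cbox 0 (\<chi> i. L)|lborel. trigpoly L S a x * trigpoly L S b x * trigpoly L S c x)
    = of_real (L ^ 3) * (\<Sum>l\<in>S. \<Sum>m\<in>S. \<Sum>n\<in>S. if l + m + n = 0 then a l * b m * c n else 0)"
proof -
  have "integrable lborel (\<lambda>x. indicator (cbox 0 (\<chi> i. L)) x *\<^sub>R cis (freq L k \<bullet> x))" for k
    by (intro borel_integrable_compact continuous_intros compact_cbox)
  then have i: "integrable lborel (\<lambda>x. d * (indicator (cbox 0 (\<chi> i. L)) x *\<^sub>R cis (freq L k \<bullet> x)))" for d :: complex and k
    by (rule integrable_mult_right)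
  have "(LINT x:cbox 0 (\<chi> i. L)|lborel. trigpoly L S a x * trigpoly L S b x * trigpoly L S c x)
    = (LINT x|lborel. (\<Sum>l\<in>S. \<Sum>m\<in>S. \<Sum>n\<in>S. indicator (cbox 0 (\<chi> i. L)) x *\<^sub>R (a l * b m * c n * cis (freq L (l + m + n) \<bullet> x))))"
    unfolding set_lebesgue_integral_def
  proof (intro Bochner_Integration.integral_cong)
    fix x :: "real ^ 3"
    have e: "a l * cis (freq L l \<bullet> x) * (b m * cis (freq L m \<bullet> x)) * (c n * cis (freq L n \<bullet> x))
        = a l * b m * c n * cis (freq L (l + m + n) \<bullet> x)" for l m n
      by (simp add: freq_add inner_add_left flip: cis_mult)
    show "indicator (cbox 0 (\<chi> i. L)) x *\<^sub>R (trigpoly L S a x * trigpoly L S b x * trigpoly L S c x)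
      = (\<Sum>l\<in>S. \<Sum>m\<in>S. \<Sum>n\<in>S. indicator (cbox 0 (\<chi> i. L)) x *\<^sub>R (a l * b m * c n * cis (freq L (l + m + n) \<bullet> x)))"
      unfolding trigpoly_def triple_sum_product e[symmetric] scaleR_sum_right ..
  qed simp
  also have "\<dots> = (\<Sum>l\<in>S. \<Sum>m\<in>S. \<Sum>n\<in>S. a l * b m * c n *
      (LINT x:cbox 0 (\<chi> i. L)|lborel. cis (freq L (l + m + n) \<bullet> x)))"
    by (simp only: set_lebesgue_integral_def Bochner_Integration.integral_sum Bochner_Integration.integrable_sum i
        mult_scaleR_right[symmetric] integral_mult_right_zero)
  also have "\<dots> = of_real (L ^ 3) * (\<Sum>l\<in>S. \<Sum>m\<in>S. \<Sum>n\<in>S. if l + m + n = 0 then a l * b m * c n else 0)"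
    unfolding integral_cis_cube[OF L] sum_distrib_left by (intro sum.cong refl) auto
  finally show ?thesis .
qed

lemma Re_complex_mult_of_real_left: "Re (of_real r * z) = r * Re z"
  by simp

lemma inner_smult_vec: "(c *s x) \<bullet> y = Re (c * (\<Sum>i\<in>UNIV. x $ i * cnj (y $ i)))" for x y :: "complex ^ 3"
  by (simp add: inner_vec_def inner_complex_def sum_distrib_left algebra_simps sum.distrib sum_subtractf)

text \<open>
  Multiplying out the three sums and integrating, only the triples of frequencies with sum \<open>0\<close> survive.
  Reality of \<open>w\<close> turns the third factor into a conjugate, and the remaining double sum is the real
  inner product of the convolution with \<open>w\<close>.
\<close>

lemma b_trig_eq:
  assumes L: "0 < L" and S: "finite S" "uminus ` S = S"
    and u: "solenoidal L u" "\<And>k. k \<notin> S \<Longrightarrow> u k = 0"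
    and v: "solenoidal L v" "\<And>k. k \<notin> S \<Longrightarrow> v k = 0"
    and w: "solenoidal L w" "\<And>k. k \<notin> S \<Longrightarrow> w k = 0"
  shows "b_trig L u v w
    = L ^ 3 * (\<Sum>k\<in>S. \<Sum>l\<in>S. ((\<i> * cdot (u l) (freq L k)) *s v (k - l)) \<bullet> w k)"
proof -
  have real: "u (- k) $ i = cnj (u k $ i)" "v (- k) $ i = cnj (v k $ i)" "w (- k) $ i = cnj (w k $ i)" for k i
    using u v w by (auto simp: solenoidal_def real_field_def)
  have rr: "complex_of_real (Re (trigpoly L S (\<lambda>k. u k $ i) x)) = trigpoly L S (\<lambda>k. u k $ i) x"
    "complex_of_real (Re (trigpoly L S (\<lambda>k. w k $ i) x)) = trigpoly L S (\<lambda>k. w k $ i) x"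
    "complex_of_real (Re (trigpoly L S (\<lambda>k. \<i> * of_real (freq L k $ j) * v k $ i) x))
      = trigpoly L S (\<lambda>k. \<i> * of_real (freq L k $ j) * v k $ i) x" for i j x
    by (rule trigpoly_real[OF S(2)], simp add: real freq_uminus)+
  have one: "complex_of_real (LINT x:cbox 0 (\<chi> i. L)|lborel.
       field_val L u x $ j * partial j (\<lambda>y. field_val L v y $ i) x * field_val L w x $ i)
    = of_real (L ^ 3) * (\<Sum>l\<in>S. \<Sum>m\<in>S. \<Sum>n\<in>S. if l + m + n = 0
         then u l $ j * (\<i> * of_real (freq L m $ j) * v m $ i) * w n $ i else 0)" for i j
  proof -
    have f: "field_val L u x $ j = Re (trigpoly L S (\<lambda>k. u k $ j) x)"
      "field_val L w x $ i = Re (trigpoly L S (\<lambda>k. w k $ i) x)"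
      "partial j (\<lambda>y. field_val L v y $ i) x = Re (trigpoly L S (\<lambda>k. \<i> * of_real (freq L k $ j) * v k $ i) x)" for x
      by (rule field_val_trigpoly[OF S(1)] partial_field_val[OF S(1)]; simp add: u v w)+
    show ?thesis
      unfolding set_integral_complex_of_real[symmetric] integral_trigpoly_product[OF L S(1), symmetric]
        f of_real_mult rr ..
  qed
  have "complex_of_real (b_trig L u v w) = of_real (L ^ 3) * (\<Sum>i\<in>UNIV. \<Sum>j\<in>UNIV. \<Sum>l\<in>S. \<Sum>m\<in>S. \<Sum>n\<in>S.
      if l + m + n = 0 then u l $ j * (\<i> * of_real (freq L m $ j) * v m $ i) * w n $ i else 0)"
    unfolding b_trig_def of_real_sum one sum_distrib_left ..
  also have "(\<Sum>i\<in>UNIV. \<Sum>j\<in>UNIV. \<Sum>l\<in>S. \<Sum>m\<in>S. \<Sum>n\<in>S.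
      if l + m + n = 0 then u l $ j * (\<i> * of_real (freq L m $ j) * v m $ i) * w n $ i else 0)
    = (\<Sum>l\<in>S. \<Sum>m\<in>S. \<Sum>n\<in>S. \<Sum>i\<in>UNIV. \<Sum>j\<in>UNIV.
      if l + m + n = 0 then u l $ j * (\<i> * of_real (freq L m $ j) * v m $ i) * w n $ i else 0)"
    by (simp only: sum.swap[of _ UNIV S])
  also have "\<dots> = (\<Sum>l\<in>S. \<Sum>m\<in>S. \<Sum>n\<in>S. if l + m + n = 0
      then \<i> * cdot (u l) (freq L m) * (\<Sum>i\<in>UNIV. v m $ i * w n $ i) else 0)"
    by (intro sum.cong refl) (simp add: cdot_def sum_distrib_left sum_distrib_right ac_simps, intro impI, rule sum.swap)
  also have "\<dots> = (\<Sum>l\<in>S. \<Sum>n\<in>S. \<Sum>m\<in>S. if m = - n - l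
      then \<i> * cdot (u l) (freq L m) * (\<Sum>i\<in>UNIV. v m $ i * w n $ i) else 0)"
  proof (rule sum.cong[OF refl], subst sum.swap, intro sum.cong refl if_cong)
    fix l n m :: "int ^ 3"
    show "(l + m + n = 0) = (m = - n - l)" 
    proof
      assume "l + m + n = 0"
      moreover have "m = (l + m + n) - n - l" by simp
      ultimately show "m = - n - l" by simp
    qed simp
  qed
  also have "\<dots> = (\<Sum>l\<in>S. \<Sum>n\<in>S. \<i> * cdot (u l) (freq L (- n - l)) * (\<Sum>i\<in>UNIV. v (- n - l) $ i * w n $ i))"
    by (intro sum.cong refl) (auto simp: sum.delta[OF S(1)] v(2))
  also have "\<dots> = (\<Sum>l\<in>S. \<Sum>k\<in>S. \<i> * cdot (u l) (freq L (k - l)) * (\<Sum>i\<in>UNIV. v (k - l) $ i * cnj (w k $ i)))"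
  proof (rule sum.cong[OF refl])
    fix l
    have "(\<Sum>n\<in>S. \<i> * cdot (u l) (freq L (- n - l)) * (\<Sum>i\<in>UNIV. v (- n - l) $ i * w n $ i))
      = (\<Sum>n\<in>uminus ` S. \<i> * cdot (u l) (freq L (- n - l)) * (\<Sum>i\<in>UNIV. v (- n - l) $ i * w n $ i))"
      by (simp add: S(2))
    also have "\<dots> = (\<Sum>k\<in>S. \<i> * cdot (u l) (freq L (k - l)) * (\<Sum>i\<in>UNIV. v (k - l) $ i * cnj (w k $ i)))"
      by (subst sum.reindex) (auto simp: inj_on_def real)
    finally show "(\<Sum>n\<in>S. \<i> * cdot (u l) (freq L (- n - l)) * (\<Sum>i\<in>UNIV. v (- n - l) $ i * w n $ i))
      = (\<Sum>k\<in>S. \<i> * cdot (u l) (freq L (k - l)) * (\<Sum>i\<in>UNIV. v (k - l) $ i * cnj (w k $ i)))" .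
  qed
  \<comment> \<open>Here \<open>u\<close> is divergence-free: the wave vector of \<open>l\<close> is orthogonal to \<open>u l\<close>.\<close>
  also have "\<dots> = (\<Sum>k\<in>S. \<Sum>l\<in>S. \<i> * cdot (u l) (freq L k) * (\<Sum>i\<in>UNIV. v (k - l) $ i * cnj (w k $ i)))"
    using u(1) by (subst sum.swap) (simp add: freq_diff cdot_diff_right sol_iff)
  finally have "complex_of_real (b_trig L u v w) = of_real (L ^ 3) *
      (\<Sum>k\<in>S. \<Sum>l\<in>S. \<i> * cdot (u l) (freq L k) * (\<Sum>i\<in>UNIV. v (k - l) $ i * cnj (w k $ i)))" .
  from arg_cong[OF this, of Re] show ?thesis
    unfolding inner_smult_vec Re_complex_of_real Re_complex_mult_of_real_left Re_sum .
qed

text \<open>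
  The set of frequencies that the truncation \<open>trunc N\<close> keeps.
\<close>

definition mode_box :: "nat \<Rightarrow> (int ^ 3) set" where
  "mode_box N = {k. \<forall>j. \<bar>k $ j\<bar> \<le> int N}"

lemma finite_mode_box: "finite (mode_box N)"
proof -
  have "mode_box N \<subseteq> (\<lambda>f. \<chi> j. f j) ` (UNIV \<rightarrow>\<^sub>E {- int N .. int N})"
  proof
    fix k assume "k \<in> mode_box N"
    then have "k = (\<chi> j. (\<lambda>j. k $ j) j)" "(\<lambda>j. k $ j) \<in> UNIV \<rightarrow>\<^sub>E {- int N .. int N}"
      by (auto simp: mode_box_def abs_le_iff PiE_def) (metis minus_le_iff)
    then show "k \<in> (\<lambda>f. \<chi> j. f j) ` (UNIV \<rightarrow>\<^sub>E {- int N .. int N})" by blast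
  qed
  then show ?thesis by (rule finite_subset) (intro finite_imageI finite_PiE, auto)
qed

lemma uminus_mode_box: "uminus ` mode_box N = mode_box N"
proof -
  have "k \<in> uminus ` mode_box N" if "k \<in> mode_box N" for k
    using that by (intro image_eqI[of _ _ "- k"]) (auto simp: mode_box_def)
  then show ?thesis by (auto simp: mode_box_def)
qed

lemma trunc_mode_box: "trunc N u k = (if k \<in> mode_box N then u k else 0)"
  by (simp add: trunc_def mode_box_def)

lemma eventually_mode_box: "\<forall>\<^sub>F N in sequentially. k \<in> mode_box N"
proof -
  have "\<bar>k $ j\<bar> \<le> int N" if "nat (\<Sum>j\<in>UNIV. \<bar>k $ j\<bar>) \<le> N" for j N
    using member_le_sum[of j UNIV "\<lambda>j. \<bar>k $ j\<bar>"] that by simp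
  then show ?thesis unfolding mode_box_def eventually_sequentially by auto
qed

lemma eventually_trunc: "\<forall>\<^sub>F N in sequentially. trunc N u k = u k"
  using eventually_mode_box[of k] by eventually_elim (simp add: trunc_mode_box)

lemma norm_trunc_le: "norm (trunc N u k) \<le> norm (u k)"
  by (simp add: trunc_mode_box)

lemma sol_trunc: "solenoidal L u \<Longrightarrow> solenoidal L (trunc N u)"
  using uminus_mode_box[of N]
  by (auto simp: sol_iff trunc_def vcnj_def vec_eq_iff)

text \<open>
  The weight \<open>\<bar>k\<bar>\<close> is distributed as \<open>\<bar>k\<bar>\<^sup>\<alpha>\<close> on the convolution and \<open>\<bar>k\<bar>\<^sup>1\<^sup>-\<^sup>\<alpha>\<close> on \<open>w\<close>. The latter
  is controlled by the norm of order \<open>1 + \<alpha>\<close>, since \<open>1 - \<alpha> \<le> 1 + \<alpha>\<close>.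
\<close>

lemma b_form_majorant_finite:
  assumes L: "0 < L" and \<alpha>: "1 / 2 < \<alpha>"
    and u: "u 0 = 0" "sob L (1 + \<alpha>) u < \<infinity>"
    and v: "v 0 = 0" "sob L \<alpha> v < \<infinity>"
    and w: "sob L (1 + \<alpha>) w < \<infinity>"
  shows "(\<integral>\<^sup>+k. \<integral>\<^sup>+l. ennreal (wn L k * (norm (u l) * norm (v (k - l))) * norm (w k)) \<partial>count_space UNIV \<partial>count_space UNIV) < \<infinity>"
    (is "?I < \<infinity>")
proof -
  obtain K where
    le: "\<And>u v. u 0 = 0 \<Longrightarrow> v 0 = 0 \<Longrightarrow>
       (\<integral>\<^sup>+k. (ennreal (wn L k powr \<alpha>) * majorant u v k)\<^sup>2 \<partial>count_space UNIV)
         \<le> ennreal K * (sob L (1 + \<alpha>) u * sob L \<alpha> v)"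
    using majorant_estimate[OF L \<alpha>] by blast
  have e: "wn L k = wn L k powr \<alpha> * wn L k powr (1 - \<alpha>)" for k
    using powr_add[of "wn L k" \<alpha> "1 - \<alpha>"] by simp
  have "?I = (\<integral>\<^sup>+k. (ennreal (wn L k powr \<alpha>) * majorant u v k) * ennreal (wn L k powr (1 - \<alpha>) * norm (w k)) \<partial>count_space UNIV)"
  proof (rule nn_integral_cong)
    fix k
    have "(\<integral>\<^sup>+l. ennreal (wn L k * (norm (u l) * norm (v (k - l))) * norm (w k)) \<partial>count_space UNIV)
      = (\<integral>\<^sup>+l. ennreal (wn L k * norm (w k)) * ennreal (norm (u l) * norm (v (k - l))) \<partial>count_space UNIV)"
      by (intro nn_integral_cong) (simp add: ac_simps flip: ennreal_mult)
    also have "\<dots> = ennreal (wn L k * norm (w k)) * majorant u v k"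
      by (simp add: nn_integral_cmult majorant_def)
    also have "ennreal (wn L k * norm (w k)) = ennreal (wn L k powr \<alpha>) * ennreal (wn L k powr (1 - \<alpha>) * norm (w k))"
      by (subst ennreal_mult[symmetric]) (simp_all add: e[of k, symmetric] mult.assoc[symmetric])
    finally show "(\<integral>\<^sup>+l. ennreal (wn L k * (norm (u l) * norm (v (k - l))) * norm (w k)) \<partial>count_space UNIV)
      = (ennreal (wn L k powr \<alpha>) * majorant u v k) * ennreal (wn L k powr (1 - \<alpha>) * norm (w k))"
      by (simp add: ac_simps)
  qed
  also have "\<dots>\<^sup>2 \<le> (\<integral>\<^sup>+k. (ennreal (wn L k powr \<alpha>) * majorant u v k)\<^sup>2 \<partial>count_space UNIV)
      * (\<integral>\<^sup>+k. (ennreal (wn L k powr (1 - \<alpha>) * norm (w k)))\<^sup>2 \<partial>count_space UNIV)"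
    by (rule Cauchy_Schwarz_nn_integral) auto
  also have "(\<integral>\<^sup>+k. (ennreal (wn L k powr (1 - \<alpha>) * norm (w k)))\<^sup>2 \<partial>count_space UNIV) = sob L (1 - \<alpha>) w"
    by (simp add: sob_def ennreal_power power_mult_distrib powr_square)
  also have "(\<integral>\<^sup>+k. (ennreal (wn L k powr \<alpha>) * majorant u v k)\<^sup>2 \<partial>count_space UNIV) * sob L (1 - \<alpha>) w
    \<le> (ennreal K * (sob L (1 + \<alpha>) u * sob L \<alpha> v)) * sob L (1 - \<alpha>) w"
    by (intro mult_right_mono le[where u = u and v = v] u v) auto
  also have "\<dots> < \<infinity>"
    using u(2) v(2) sob_finite_mono[OF L _ w, of "1 - \<alpha>"] \<alpha> by (simp add: ennreal_mult_less_top)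
  finally have sq: "?I\<^sup>2 < \<infinity>" .
  show ?thesis
  proof (rule ccontr)
    assume "\<not> ?I < \<infinity>"
    then have "?I = \<infinity>" by (simp only: not_less infinity_ennreal_def top_unique)
    with sq show False by (simp add: power2_eq_square)
  qed
qed

text \<open>
  The trilinear form is a limit over truncations. Each truncated form is a finite double sum by
  \<open>b_trig_eq\<close>; the summable majorant allows passing to the limit by dominated convergence, and Fubini's
  theorem collects the double series into the pairing of the convective term with \<open>w\<close>.
\<close>

lemma b_form_eq:
  assumes L: "0 < L" and \<alpha>: "1 / 2 < \<alpha>"
    and u: "solenoidal L u" "sob L (1 + \<alpha>) u < \<infinity>"
    and v: "solenoidal L v" "sob L \<alpha> v < \<infinity>"
    and w: "solenoidal L w" "sob L (1 + \<alpha>) w < \<infinity>"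
  shows "integrable (count_space UNIV) (\<lambda>k. convection L u v k \<bullet> w k)"
    and "b_form L u v w = pairing L (convection L u v) w"
proof -
  define T where "T u v w = (\<lambda>(k, l). ((\<i> * cdot (u l) (freq L k)) *s v (k - l)) \<bullet> w k)" for u v w :: vfield
  define M where "M = (\<lambda>(k, l). wn L k * (norm (u l) * norm (v (k - l))) * norm (w k))"
  have TM: "\<bar>T u v w z\<bar> \<le> wn L (fst z) * (norm (u (snd z)) * norm (v (fst z - snd z))) * norm (w (fst z))"
    for u v w z
    unfolding T_def case_prod_beta
    by (rule order_trans[OF Cauchy_Schwarz_ineq2 mult_right_mono[OF norm_conv_term_le norm_ge_zero]])
  have z: "u 0 = 0" "v 0 = 0" using u v by (simp_all add: sol_zero_mean)
  have M: "integrable (count_space UNIV) M"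
    using b_form_majorant_finite[OF L \<alpha> z(1) u(2) z(2) v(2) w(2)]
      nn_integral_fst_count_space[of "\<lambda>z. ennreal (M z)"]
    by (simp add: integrable_iff_bounded M_def case_prod_beta abs_mult)
  have TN: "b_trig L (trunc N u) (trunc N v) (trunc N w)
      = L ^ 3 * (LINT z|count_space UNIV. T (trunc N u) (trunc N v) (trunc N w) z)" for N
  proof -
    have 0: "T (trunc N u) (trunc N v) (trunc N w) z = 0" if "z \<notin> mode_box N \<times> mode_box N" for z
      using that by (cases z) (auto simp: T_def trunc_mode_box)
    have fin: "finite (mode_box N \<times> mode_box N)" by (intro finite_SigmaI finite_mode_box)
    have "(LINT z|count_space UNIV. T (trunc N u) (trunc N v) (trunc N w) z)
      = (\<Sum>z\<in>mode_box N \<times> mode_box N. T (trunc N u) (trunc N v) (trunc N w) z)"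
    proof (subst lebesgue_integral_count_space_finite_support)
      have sub: "{z \<in> UNIV. T (trunc N u) (trunc N v) (trunc N w) z \<noteq> 0} \<subseteq> mode_box N \<times> mode_box N"
        using 0 by blast
      show "finite {z \<in> UNIV. T (trunc N u) (trunc N v) (trunc N w) z \<noteq> 0}"
        by (rule finite_subset[OF sub fin])
      show "(\<Sum>z | z \<in> UNIV \<and> T (trunc N u) (trunc N v) (trunc N w) z \<noteq> 0. T (trunc N u) (trunc N v) (trunc N w) z)
        = (\<Sum>z\<in>mode_box N \<times> mode_box N. T (trunc N u) (trunc N v) (trunc N w) z)"
        by (rule sum.mono_neutral_left[OF fin sub]) auto
    qed
    also have "\<dots> = (\<Sum>k\<in>mode_box N. \<Sum>l\<in>mode_box N. T (trunc N u) (trunc N v) (trunc N w) (k, l))"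
      by (simp add: sum.cartesian_product)
    finally show ?thesis
      by (subst b_trig_eq[OF L finite_mode_box[of N] uminus_mode_box])
        (simp_all add: sol_trunc u v w trunc_mode_box T_def)
  qed
  have "(\<lambda>N. LINT z|count_space UNIV. T (trunc N u) (trunc N v) (trunc N w) z)
      \<longlonglongrightarrow> (LINT z|count_space UNIV. T u v w z)"
  proof (rule integral_dominated_convergence[OF _ _ M])
    show "AE z in count_space UNIV. (\<lambda>N. T (trunc N u) (trunc N v) (trunc N w) z) \<longlonglongrightarrow> T u v w z"
    proof (rule AE_I2, rule tendsto_eventually)
      fix z :: "(int ^ 3) \<times> (int ^ 3)"
      show "\<forall>\<^sub>F N in sequentially. T (trunc N u) (trunc N v) (trunc N w) z = T u v w z"
        using eventually_trunc[of u "snd z"] eventually_trunc[of v "fst z - snd z"] eventually_trunc[of w "fst z"]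
        by eventually_elim (simp add: T_def case_prod_beta)
    qed
    show "AE z in count_space UNIV. norm (T (trunc N u) (trunc N v) (trunc N w) z) \<le> M z" for N
    proof (rule AE_I2)
      fix z :: "(int ^ 3) \<times> (int ^ 3)"
      have "norm (T (trunc N u) (trunc N v) (trunc N w) z)
        \<le> wn L (fst z) * (norm (trunc N u (snd z)) * norm (trunc N v (fst z - snd z))) * norm (trunc N w (fst z))"
        using TM by simp
      also have "\<dots> \<le> M z"
        unfolding M_def case_prod_beta by (intro mult_mono norm_trunc_le mult_nonneg_nonneg) auto
      finally show "norm (T (trunc N u) (trunc N v) (trunc N w) z) \<le> M z" .
    qed
  qed auto
  then have lim: "(\<lambda>N. b_trig L (trunc N u) (trunc N v) (trunc N w)) \<longlonglongrightarrow> L ^ 3 * (LINT z|count_space UNIV. T u v w z)"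
    unfolding TN by (intro tendsto_mult tendsto_const)
  have T: "integrable (count_space UNIV) (T u v w)"
  proof (rule Bochner_Integration.integrable_bound[OF M])
    show "AE z in count_space UNIV. norm (T u v w z) \<le> norm (M z)"
      using TM[of u v w] by (intro AE_I2) (simp add: M_def case_prod_beta abs_mult)
  qed simp
  interpret pair_sigma_finite "count_space (UNIV :: (int ^ 3) set)" "count_space (UNIV :: (int ^ 3) set)"
    by (intro pair_sigma_finite.intro sigma_finite_measure_count_space_countable) auto
  have cs: "count_space (UNIV :: (int ^ 3) set) \<Otimes>\<^sub>M count_space (UNIV :: (int ^ 3) set) = count_space UNIV"
    by (subst pair_measure_countable) auto
  \<comment> \<open>The Leray projection may be inserted because \<open>w\<close> is divergence-free.\<close>
  have inner: "(LINT l|count_space UNIV. T u v w (k, l)) = convection L u v k \<bullet> w k" for k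
  proof (cases "k = 0")
    case False
    have "(LINT l|count_space UNIV. T u v w (k, l)) = conv L u v k \<bullet> w k"
      unfolding T_def conv_def prod.case
      by (rule integral_inner_left, rule conv_integrable[where u = u and v = v, OF L z(1) _ z(2)])
        (use \<alpha> in \<open>auto intro!: sob_finite_mono[OF L _ u(2)] sob_finite_mono[OF L _ v(2)] simp del: infinity_ennreal_def\<close>)
    then show ?thesis
      using inner_leray[OF False, of "w k" L "conv L u v k"] w by (simp add: convection_def sol_iff)
  qed (simp add: T_def)
  show "integrable (count_space UNIV) (\<lambda>k. convection L u v k \<bullet> w k)"
    using integrable_fst'[of "T u v w"] T by (simp add: cs inner)
  have "(LINT z|count_space UNIV. T u v w z) = (LINT k|count_space UNIV. convection L u v k \<bullet> w k)"
    using integral_fst'[of "T u v w"] T by (simp add: cs inner)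
  with limI[OF lim] show "b_form L u v w = pairing L (convection L u v) w"
    by (simp add: b_form_def pairing_def infsum_eq_LINT)
qed

section \<open>The time interval\<close>

lemma space_time [simp]: "space (time \<mu>) = {0..\<mu>}"
  by (simp add: time_def)

lemma ident_measurable_time [measurable]: "(\<lambda>t. t) \<in> borel_measurable (time \<mu>)"
  using id_borel_measurable_lebesgue_on[of "{0..\<mu>}"] by (simp add: time_def id_def)

lemma finite_measure_time: "finite_measure (time \<mu>)"
  unfolding time_def by (rule finite_measure_lebesgue_on) simp

lemma sigma_finite_measure_time: "sigma_finite_measure (time \<mu>)"
  using finite_measure_time finite_measure.axioms(1) by blast

lemma complete_measure_time: "complete_measure (time \<mu>)"
proof
  fix A B assume "B \<subseteq> A" "A \<in> null_sets (time \<mu>)"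
  then show "B \<in> sets (time \<mu>)"
    using complete_measure.complete2[OF completion.complete_measure_axioms, of B A lborel]
    by (auto simp: time_def null_sets_restrict_space sets_restrict_space_iff intro: null_setsD2)
qed

text \<open>
  The time interval carries the complete Lebesgue measure. Measurability is therefore insensitive to
  changes on null sets, and it passes to almost everywhere limits and to functions such as
  \<open>t \<mapsto> Bop L (\<psi> t) (u t) v\<close> that are known only almost everywhere.
\<close>

lemma measurable_AE_eq_time:
  assumes f: "f \<in> borel_measurable (time \<mu>)" and ae: "AE t in time \<mu>. f t = g t"
  shows "g \<in> borel_measurable (time \<mu>)"
proof (rule measurableI)
  fix A :: "'a set" assume A: "A \<in> sets borel"
  show "g -` A \<inter> space (time \<mu>) \<in> sets (time \<mu>)"
  proof (rule complete_measure.in_sets_AE[OF complete_measure_time])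
    show "f -` A \<inter> space (time \<mu>) \<in> sets (time \<mu>)" using f A by (rule measurable_sets)
    show "AE t in time \<mu>. (t \<in> f -` A \<inter> space (time \<mu>)) = (t \<in> g -` A \<inter> space (time \<mu>))"
      using ae by eventually_elim simp
  qed simp
qed simp

lemma measurable_AE_limit_time:
  fixes f :: "nat \<Rightarrow> real \<Rightarrow> 'a::{metric_space, zero}"
  assumes f: "\<And>n. f n \<in> borel_measurable (time \<mu>)" and ae: "AE t in time \<mu>. (\<lambda>n. f n t) \<longlonglongrightarrow> g t"
  shows "g \<in> borel_measurable (time \<mu>)"
proof -
  obtain N where N: "{t \<in> space (time \<mu>). \<not> (\<lambda>n. f n t) \<longlonglongrightarrow> g t} \<subseteq> N" "N \<in> null_sets (time \<mu>)"
    using ae by (auto elim!: AE_E3[OF _] simp: eventually_ae_filter)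
  have "(\<lambda>t. if t \<in> N then 0 else g t) \<in> borel_measurable (time \<mu>)"
  proof (rule borel_measurable_LIMSEQ_metric)
    show "(\<lambda>t. if t \<in> N then 0 else f n t) \<in> borel_measurable (time \<mu>)" for n
      using f[of n] N(2) by (intro measurable_If_set) auto
    show "(\<lambda>n. if t \<in> N then 0 else f n t) \<longlonglongrightarrow> (if t \<in> N then 0 else g t)" if "t \<in> space (time \<mu>)" for t
      using N(1) that by auto
  qed
  moreover have "AE t in time \<mu>. (if t \<in> N then 0 else g t) = g t"
    using AE_not_in[OF N(2)] by eventually_elim simp
  ultimately show ?thesis by (rule measurable_AE_eq_time)
qed

lemma nn_integral_time: "nn_integral (time \<mu>) f = (\<integral>\<^sup>+t. f t * indicator {0..\<mu>} t \<partial>lborel)"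
  unfolding time_def by (simp add: nn_integral_restrict_space nn_integral_completion)

lemma nn_integral_time_modes:
  assumes "\<And>k. (\<lambda>t. f t k) \<in> borel_measurable (time \<mu>)"
  shows "(\<integral>\<^sup>+t. \<integral>\<^sup>+k. f t k \<partial>count_space (UNIV :: (int ^ 3) set) \<partial>time \<mu>)
    = (\<integral>\<^sup>+k. \<integral>\<^sup>+t. f t k \<partial>time \<mu> \<partial>count_space UNIV)"
  by (rule nn_integral_count_space_nn_integral) (use assms in auto)

lemma borel_measurable_modes:
  fixes f :: "'b \<Rightarrow> int ^ 3 \<Rightarrow> ennreal"
  assumes "\<And>k. (\<lambda>t. f t k) \<in> borel_measurable M"
  shows "(\<lambda>t. \<integral>\<^sup>+k. f t k \<partial>count_space UNIV) \<in> borel_measurable M"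
proof -
  interpret sigma_finite_measure "count_space (UNIV :: (int ^ 3) set)"
    by (rule sigma_finite_measure_count_space_countable) simp
  have "(\<lambda>(t, k). f t k) \<in> borel_measurable (M \<Otimes>\<^sub>M count_space UNIV)"
    by (rule measurable_pair_swap_iff[THEN iffD2], rule measurable_pair_measure_countable1) (use assms in auto)
  then show ?thesis by (rule borel_measurable_nn_integral)
qed

lemma borel_measurable_LINT_modes:
  fixes f :: "'b \<Rightarrow> int ^ 3 \<Rightarrow> 'a::{banach, second_countable_topology}"
  assumes "\<And>k. (\<lambda>t. f t k) \<in> borel_measurable M"
  shows "(\<lambda>t. LINT k|count_space UNIV. f t k) \<in> borel_measurable M"
proof -
  interpret sigma_finite_measure "count_space (UNIV :: (int ^ 3) set)"
    by (rule sigma_finite_measure_count_space_countable) simp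
  have "(\<lambda>(t, k). f t k) \<in> borel_measurable (M \<Otimes>\<^sub>M count_space UNIV)"
    by (rule measurable_pair_swap_iff[THEN iffD2], rule measurable_pair_measure_countable1) (use assms in auto)
  then show ?thesis by (rule borel_measurable_lebesgue_integral)
qed

lemma borel_measurable_sob:
  assumes [measurable]: "\<And>k. (\<lambda>t. u t k) \<in> borel_measurable M"
  shows "(\<lambda>t. sob L s (u t)) \<in> borel_measurable M"
  unfolding sob_def by (rule borel_measurable_modes) measurable

lemma nn_integral_sob:
  assumes [measurable]: "\<And>k. (\<lambda>t. u t k) \<in> borel_measurable (time \<mu>)"
  shows "(\<integral>\<^sup>+t. sob L s (u t) \<partial>time \<mu>)
    = (\<integral>\<^sup>+k. ennreal (wn L k powr (2 * s)) * (\<integral>\<^sup>+t. ennreal ((norm (u t k))\<^sup>2) \<partial>time \<mu>) \<partial>count_space UNIV)"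
  unfolding sob_def
  by (subst nn_integral_time_modes) (auto intro!: nn_integral_cong simp: ennreal_mult nn_integral_cmult)

section \<open>Damped integrals\<close>

text \<open>
  The kernel of the scalar equation \<open>a' + c a = g\<close>.
\<close>

definition heat :: "real \<Rightarrow> real \<Rightarrow> real \<Rightarrow> real" where
  "heat c t s = (if s \<le> t then exp (- (c * (t - s))) else 0)"

lemma heat_nonneg [simp]: "0 \<le> heat c t s"
  by (simp add: heat_def)

lemma heat_measurable [measurable]:
  assumes [measurable]: "f \<in> borel_measurable M" "g \<in> borel_measurable M"
  shows "(\<lambda>x. heat c (f x) (g x)) \<in> borel_measurable M"
  unfolding heat_def by measurable

lemma heat_square: "(heat c t s)\<^sup>2 = heat (2 * c) t s"
  by (simp add: heat_def power2_eq_square flip: exp_add)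

lemma nn_integral_heat_le:
  assumes c: "0 < c"
  shows "(\<integral>\<^sup>+s. ennreal (heat c t s) \<partial>time \<mu>) \<le> ennreal (1 / c)"
proof (cases "0 \<le> t")
  case True
  have "(\<integral>\<^sup>+s. ennreal (heat c t s) \<partial>time \<mu>) \<le> (\<integral>\<^sup>+s. ennreal (exp (- (c * (t - s)))) * indicator {0..t} s \<partial>lborel)"
    unfolding nn_integral_time by (intro nn_integral_mono) (auto simp: heat_def indicator_def)
  also have "\<dots> = ennreal (exp (- (c * (t - t))) / c - exp (- (c * (t - 0))) / c)"
    by (rule nn_integral_FTC_Icc) (use c True in \<open>auto intro!: derivative_eq_intros\<close>)
  also have "\<dots> \<le> ennreal (1 / c)" using c by (intro ennreal_leI) simp
  finally show ?thesis .
next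
  case False
  then have "(\<integral>\<^sup>+s. ennreal (heat c t s) \<partial>time \<mu>) = (\<integral>\<^sup>+s. 0 \<partial>time \<mu>)"
    by (intro nn_integral_cong) (auto simp: heat_def)
  then show ?thesis by simp
qed

lemma nn_integral_heat_le':
  assumes c: "0 < c"
  shows "(\<integral>\<^sup>+t. ennreal (heat c t s) \<partial>time \<mu>) \<le> ennreal (1 / c)"
proof -
  have "(\<integral>\<^sup>+t. ennreal (heat c t s) \<partial>time \<mu>) \<le> (\<integral>\<^sup>+t. ennreal (exp (- (c * (t - s)))) * indicator {s..max s \<mu>} t \<partial>lborel)"
    unfolding nn_integral_time by (intro nn_integral_mono) (auto simp: heat_def indicator_def)
  also have "\<dots> = ennreal (- exp (- (c * (max s \<mu> - s))) / c - (- exp (- (c * (s - s))) / c))"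
    by (rule nn_integral_FTC_Icc) (use c in \<open>auto intro!: derivative_eq_intros\<close>)
  also have "\<dots> \<le> ennreal (1 / c)" using c by (intro ennreal_leI) simp
  finally show ?thesis .
qed

definition duhamel :: "real \<Rightarrow> real \<Rightarrow> (real \<Rightarrow> complex ^ 3) \<Rightarrow> real \<Rightarrow> complex ^ 3" where
  "duhamel \<mu> c g t = (LINT s|time \<mu>. heat c t s *\<^sub>R g s)"

lemma duhamel_measurable:
  assumes [measurable]: "g \<in> borel_measurable (time \<mu>)"
  shows "duhamel \<mu> c g \<in> borel_measurable (time \<mu>)"
proof -
  interpret sigma_finite_measure "time \<mu>" by (rule sigma_finite_measure_time)
  show ?thesis unfolding duhamel_def by measurable
qed

lemma norm_duhamel_le:
  "ennreal (norm (duhamel \<mu> c g t)) \<le> (\<integral>\<^sup>+s. ennreal (heat c t s) * ennreal (norm (g s)) \<partial>time \<mu>)"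
  unfolding duhamel_def
  by (rule order_trans[OF norm_LINT_le_nn_integral]) (simp add: ennreal_mult)

text \<open>
  Cauchy--Schwarz: the square of the kernel is the kernel with rate \<open>2 c\<close>, of mass at most \<open>1 / (2 c)\<close>.
\<close>

lemma duhamel_sup_bound:
  assumes c: "0 < c" and [measurable]: "g \<in> borel_measurable (time \<mu>)"
  shows "ennreal ((norm (duhamel \<mu> c g t))\<^sup>2) \<le> ennreal (1 / (2 * c)) * (\<integral>\<^sup>+s. ennreal ((norm (g s))\<^sup>2) \<partial>time \<mu>)"
proof -
  have "ennreal ((norm (duhamel \<mu> c g t))\<^sup>2) \<le> (\<integral>\<^sup>+s. ennreal (heat c t s) * ennreal (norm (g s)) \<partial>time \<mu>)\<^sup>2"
    using power_mono[OF norm_duhamel_le[of \<mu> c g t], of 2] by (simp add: ennreal_power)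
  also have "\<dots> \<le> (\<integral>\<^sup>+s. (ennreal (heat c t s))\<^sup>2 \<partial>time \<mu>) * (\<integral>\<^sup>+s. (ennreal (norm (g s)))\<^sup>2 \<partial>time \<mu>)"
    by (rule Cauchy_Schwarz_nn_integral) auto
  also have "\<dots> \<le> ennreal (1 / (2 * c)) * (\<integral>\<^sup>+s. (ennreal (norm (g s)))\<^sup>2 \<partial>time \<mu>)"
    using nn_integral_heat_le[of "2 * c" \<mu> t] c by (intro mult_right_mono) (auto simp: ennreal_power heat_square)
  finally show ?thesis by (simp add: ennreal_power)
qed

text \<open>
  Schur's test: the kernel has mass at most \<open>1 / c\<close> in each variable. With \<open>c = \<nu> \<bar>k\<bar>\<^sup>2\<close> this is the
  gain of two derivatives and of the factor \<open>1 / \<nu>\<close>.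
\<close>

lemma duhamel_L2_bound:
  assumes c: "0 < c" and [measurable]: "g \<in> borel_measurable (time \<mu>)"
  shows "(\<integral>\<^sup>+t. ennreal ((norm (duhamel \<mu> c g t))\<^sup>2) \<partial>time \<mu>)
    \<le> ennreal (1 / c\<^sup>2) * (\<integral>\<^sup>+s. ennreal ((norm (g s))\<^sup>2) \<partial>time \<mu>)"
proof -
  interpret sigma_finite_measure "time \<mu>" by (rule sigma_finite_measure_time)
  interpret P: pair_sigma_finite "time \<mu>" "time \<mu>" ..
  let ?h = "\<lambda>t s. ennreal (heat c t s)"
  have "ennreal ((norm (duhamel \<mu> c g t))\<^sup>2) \<le> ennreal (1 / c) * (\<integral>\<^sup>+s. ?h t s * ennreal ((norm (g s))\<^sup>2) \<partial>time \<mu>)" for t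
  proof -
    have "ennreal ((norm (duhamel \<mu> c g t))\<^sup>2) \<le> (\<integral>\<^sup>+s. ?h t s * ennreal (norm (g s)) \<partial>time \<mu>)\<^sup>2"
      using power_mono[OF norm_duhamel_le[of \<mu> c g t], of 2] by (simp add: ennreal_power)
    also have "(\<integral>\<^sup>+s. ?h t s * ennreal (norm (g s)) \<partial>time \<mu>)
      = (\<integral>\<^sup>+s. ennreal (sqrt (heat c t s)) * ennreal (sqrt (heat c t s) * norm (g s)) \<partial>time \<mu>)"
      by (intro nn_integral_cong) (simp add: mult.assoc[symmetric] flip: ennreal_mult)
    also have "\<dots>\<^sup>2 \<le> (\<integral>\<^sup>+s. (ennreal (sqrt (heat c t s)))\<^sup>2 \<partial>time \<mu>)
        * (\<integral>\<^sup>+s. (ennreal (sqrt (heat c t s) * norm (g s)))\<^sup>2 \<partial>time \<mu>)"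
      by (rule Cauchy_Schwarz_nn_integral) auto
    also have "\<dots> = (\<integral>\<^sup>+s. ?h t s \<partial>time \<mu>) * (\<integral>\<^sup>+s. ?h t s * ennreal ((norm (g s))\<^sup>2) \<partial>time \<mu>)"
      by (simp add: ennreal_power power_mult_distrib ennreal_mult)
    also have "\<dots> \<le> ennreal (1 / c) * (\<integral>\<^sup>+s. ?h t s * ennreal ((norm (g s))\<^sup>2) \<partial>time \<mu>)"
      by (intro mult_right_mono nn_integral_heat_le c) simp
    finally show ?thesis .
  qed
  then have "(\<integral>\<^sup>+t. ennreal ((norm (duhamel \<mu> c g t))\<^sup>2) \<partial>time \<mu>)
      \<le> (\<integral>\<^sup>+t. ennreal (1 / c) * (\<integral>\<^sup>+s. ?h t s * ennreal ((norm (g s))\<^sup>2) \<partial>time \<mu>) \<partial>time \<mu>)"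
    by (intro nn_integral_mono)
  also have "\<dots> = ennreal (1 / c) * (\<integral>\<^sup>+t. (\<integral>\<^sup>+s. ?h t s * ennreal ((norm (g s))\<^sup>2) \<partial>time \<mu>) \<partial>time \<mu>)"
    by (rule nn_integral_cmult) measurable
  also have "(\<integral>\<^sup>+t. (\<integral>\<^sup>+s. ?h t s * ennreal ((norm (g s))\<^sup>2) \<partial>time \<mu>) \<partial>time \<mu>)
      = (\<integral>\<^sup>+s. (\<integral>\<^sup>+t. ?h t s * ennreal ((norm (g s))\<^sup>2) \<partial>time \<mu>) \<partial>time \<mu>)"
    by (rule P.Fubini'[symmetric]) measurable
  also have "\<dots> = (\<integral>\<^sup>+s. (\<integral>\<^sup>+t. ?h t s \<partial>time \<mu>) * ennreal ((norm (g s))\<^sup>2) \<partial>time \<mu>)"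
    by (intro nn_integral_cong nn_integral_multc) measurable
  also have "\<dots> \<le> (\<integral>\<^sup>+s. ennreal (1 / c) * ennreal ((norm (g s))\<^sup>2) \<partial>time \<mu>)"
    by (intro nn_integral_mono mult_right_mono nn_integral_heat_le' c) simp
  also have "\<dots> = ennreal (1 / c) * (\<integral>\<^sup>+s. ennreal ((norm (g s))\<^sup>2) \<partial>time \<mu>)"
    by (rule nn_integral_cmult) measurable
  finally show ?thesis
    using c by (simp add: mult_left_mono mult.assoc[symmetric] power2_eq_square flip: ennreal_mult)
qed

text \<open>
  The indefinite integral from \<open>0\<close>, written with a cut-off so that the domain of integration does not
  depend on \<open>t\<close>.
\<close>

definition primitive :: "real \<Rightarrow> (real \<Rightarrow> 'a::{banach, second_countable_topology}) \<Rightarrow> real \<Rightarrow> 'a" where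
  "primitive \<mu> G t = (LINT s|time \<mu>. indicator {..t} s *\<^sub>R G s)"

lemma integrable_cutoff:
  fixes G :: "real \<Rightarrow> 'a::{banach, second_countable_topology}"
  assumes "integrable (time \<mu>) G"
  shows "integrable (time \<mu>) (\<lambda>s. indicator {..t} s *\<^sub>R G s)"
proof -
  have [measurable]: "{..t} \<inter> {0..\<mu>} \<in> sets (time \<mu>)"
    by (auto simp: time_def sets_restrict_space)
  have "(\<lambda>s. indicator {..t} s *\<^sub>R G s) \<in> borel_measurable (time \<mu>)"
    using borel_measurable_integrable[OF assms] by measurable
  then show ?thesis
    by (rule Bochner_Integration.integrable_bound[OF assms]) (auto simp: indicator_def)
qed

lemma primitive_eq_integral:
  fixes G :: "real \<Rightarrow> 'a::euclidean_space"
  assumes G: "integrable (time \<mu>) G" and t: "t \<in> {0..\<mu>}"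
  shows "primitive \<mu> G t = integral {0..t} G" "G integrable_on {0..\<mu>}"
proof -
  show int: "G integrable_on {0..\<mu>}"
    using G unfolding time_def by (rule integrable_on_lebesgue_on) simp
  have "integrable (lebesgue_on {0..\<mu>}) (\<lambda>s. indicator {..t} s *\<^sub>R G s)"
    using integrable_cutoff[OF G] by (simp add: time_def)
  from has_integral_integral_lebesgue_on[OF this]
  have "((\<lambda>s. indicator {..t} s *\<^sub>R G s) has_integral primitive \<mu> G t) {0..\<mu>}"
    by (simp add: primitive_def time_def)
  then have "((\<lambda>s. if s \<in> {0..t} then G s else 0) has_integral primitive \<mu> G t) {0..\<mu>}"
    by (rule has_integral_eq[rotated]) (auto simp: indicator_def)
  then have "(G has_integral primitive \<mu> G t) {0..t}"
    using t by (subst (asm) has_integral_restrict) auto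
  then show "primitive \<mu> G t = integral {0..t} G" by (simp add: integral_unique)
qed

lemma continuous_on_primitive:
  fixes G :: "real \<Rightarrow> 'a::euclidean_space"
  assumes G: "integrable (time \<mu>) G"
  shows "continuous_on {0..\<mu>} (primitive \<mu> G)"
proof (cases "0 \<le> \<mu>")
  case True
  then have "G integrable_on {0..\<mu>}" using primitive_eq_integral(2)[OF G, of 0] by simp
  from indefinite_integral_continuous_1[OF this] show ?thesis
    by (rule continuous_on_eq) (simp add: primitive_eq_integral[OF G])
qed simp

lemma primitive_0:
  fixes G :: "real \<Rightarrow> 'a::euclidean_space"
  assumes "integrable (time \<mu>) G" "0 \<le> \<mu>" shows "primitive \<mu> G 0 = 0"
  using primitive_eq_integral(1)[OF assms(1), of 0] assms(2) by simp

lemma integrable_exp_mult: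
  fixes g :: "real \<Rightarrow> 'a::{banach, second_countable_topology}"
  assumes g: "integrable (time \<mu>) g"
  shows "integrable (time \<mu>) (\<lambda>s. exp (c * s) *\<^sub>R g s)"
proof (rule Bochner_Integration.integrable_bound)
  show "integrable (time \<mu>) (\<lambda>s. exp (\<bar>c\<bar> * \<bar>\<mu>\<bar>) *\<^sub>R g s)" using g by simp
  have [measurable]: "g \<in> borel_measurable (time \<mu>)" using g by simp
  show "(\<lambda>s. exp (c * s) *\<^sub>R g s) \<in> borel_measurable (time \<mu>)" by measurable
  show "AE s in time \<mu>. norm (exp (c * s) *\<^sub>R g s) \<le> norm (exp (\<bar>c\<bar> * \<bar>\<mu>\<bar>) *\<^sub>R g s)"
  proof (rule AE_I2)
    fix s assume "s \<in> space (time \<mu>)"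
    then have "c * s \<le> \<bar>c\<bar> * \<bar>\<mu>\<bar>" by (simp add: mult_mono' order_trans[OF abs_ge_self] abs_mult)
    then show "norm (exp (c * s) *\<^sub>R g s) \<le> norm (exp (\<bar>c\<bar> * \<bar>\<mu>\<bar>) *\<^sub>R g s)"
      by (simp add: mult_right_mono)
  qed
qed

lemma duhamel_eq_primitive:
  "duhamel \<mu> c g t = exp (- (c * t)) *\<^sub>R primitive \<mu> (\<lambda>s. exp (c * s) *\<^sub>R g s) t"
proof -
  have "exp (- (c * t)) *\<^sub>R primitive \<mu> (\<lambda>s. exp (c * s) *\<^sub>R g s) t
    = (LINT s|time \<mu>. exp (- (c * t)) *\<^sub>R (indicator {..t} s *\<^sub>R exp (c * s) *\<^sub>R g s))"
    unfolding primitive_def by (rule integral_scaleR_right[symmetric])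
  also have "\<dots> = duhamel \<mu> c g t"
    unfolding duhamel_def
    by (intro Bochner_Integration.integral_cong) (auto simp: heat_def indicator_def algebra_simps simp flip: exp_add)
  finally show ?thesis by simp
qed

lemma continuous_on_duhamel:
  assumes "integrable (time \<mu>) g"
  shows "continuous_on {0..\<mu>} (duhamel \<mu> c g)"
  unfolding duhamel_eq_primitive[abs_def]
  by (intro continuous_intros continuous_on_primitive integrable_exp_mult assms)

section \<open>The heat semigroup with a source\<close>

text \<open>
  The solution of \<open>u' + \<nu> A u = g\<close>, \<open>u 0 = x0\<close>, given by Duhamel's formula in each mode.
\<close>

definition mild :: "real \<Rightarrow> real \<Rightarrow> real \<Rightarrow> vfield \<Rightarrow> (real \<Rightarrow> vfield) \<Rightarrow> real \<Rightarrow> vfield" where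
  "mild L \<mu> \<nu> x0 g t k =
     exp (- (\<nu> * (wn L k)\<^sup>2 * t)) *\<^sub>R x0 k + duhamel \<mu> (\<nu> * (wn L k)\<^sup>2) (\<lambda>s. g s k) t"

text \<open>
  The right-hand sides for which Duhamel's formula makes sense: square integrable in time with values in
  \<open>V\<^sup>s\<close>. Measurability is required coefficientwise.
\<close>

definition source :: "real \<Rightarrow> real \<Rightarrow> real \<Rightarrow> (real \<Rightarrow> vfield) \<Rightarrow> bool" where
  "source L \<mu> s g \<longleftrightarrow> (\<forall>k. (\<lambda>t. g t k) \<in> borel_measurable (time \<mu>)) \<and>
     (\<integral>\<^sup>+t. sob L s (g t) \<partial>time \<mu>) < \<infinity> \<and> (AE t in time \<mu>. solenoidal L (g t))"

lemma sourceD: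
  assumes "source L \<mu> s g"
  shows "(\<lambda>t. g t k) \<in> borel_measurable (time \<mu>)"
    and "(\<integral>\<^sup>+t. sob L s (g t) \<partial>time \<mu>) < \<infinity>"
    and "AE t in time \<mu>. solenoidal L (g t)"
  using assms by (auto simp: source_def)

lemma integrable_time_of_square:
  fixes g :: "real \<Rightarrow> 'a::{banach, second_countable_topology}"
  assumes [measurable]: "g \<in> borel_measurable (time \<mu>)" and fin: "(\<integral>\<^sup>+t. ennreal ((norm (g t))\<^sup>2) \<partial>time \<mu>) < \<infinity>"
  shows "integrable (time \<mu>) g"
proof (rule Bochner_Integration.integrable_bound)
  interpret finite_measure "time \<mu>" by (rule finite_measure_time)
  have "integrable (time \<mu>) (\<lambda>t. (norm (g t))\<^sup>2)" using fin by (simp add: integrable_iff_bounded)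
  then show "integrable (time \<mu>) (\<lambda>t. 1 + (norm (g t))\<^sup>2)" by simp
  have "x \<le> 1 + x\<^sup>2" for x :: real
  proof -
    have "2 * x \<le> 1 + x\<^sup>2" using sum_squares_bound[of 1 x] by simp
    with zero_le_power2[of x] show ?thesis by linarith
  qed
  then show "AE t in time \<mu>. norm (g t) \<le> norm (1 + (norm (g t))\<^sup>2)" by (intro AE_I2) (simp add: add_nonneg_nonneg)
qed simp

lemma source_integrable:
  assumes L: "0 < L" and g: "source L \<mu> s g"
  shows "integrable (time \<mu>) (\<lambda>t. g t k)"
proof (cases "k = 0")
  case True
  have "AE t in time \<mu>. g t k = 0"
    using sourceD(3)[OF g] by eventually_elim (simp add: True sol_zero_mean)
  then show ?thesis
    by (subst integrable_cong_AE[where g = "\<lambda>t. 0"]) (use sourceD(1)[OF g] in auto)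
next
  case False
  note [measurable] = sourceD(1)[OF g]
  have p: "0 < wn L k powr (2 * s)" using wn_pos[OF L False] by simp
  have "ennreal (wn L k powr (2 * s)) * (\<integral>\<^sup>+t. ennreal ((norm (g t k))\<^sup>2) \<partial>time \<mu>)
    = (\<integral>\<^sup>+t. ennreal (wn L k powr (2 * s) * (norm (g t k))\<^sup>2) \<partial>time \<mu>)"
    by (subst nn_integral_cmult[symmetric]) (auto simp: ennreal_mult)
  also have "\<dots> \<le> (\<integral>\<^sup>+t. sob L s (g t) \<partial>time \<mu>)"
    by (intro nn_integral_mono sob_coefficient_le)
  also have "\<dots> < \<infinity>" by (rule sourceD(2)[OF g])
  finally have "(\<integral>\<^sup>+t. ennreal ((norm (g t k))\<^sup>2) \<partial>time \<mu>) < \<infinity>"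
    using p by (auto simp: ennreal_mult_less_top)
  then show ?thesis by (intro integrable_time_of_square) measurable
qed

lemma mild_measurable:
  assumes [measurable]: "(\<lambda>t. g t k) \<in> borel_measurable (time \<mu>)"
  shows "(\<lambda>t. mild L \<mu> \<nu> x0 g t k) \<in> borel_measurable (time \<mu>)"
proof -
  note duhamel_measurable[OF assms, measurable]
  show ?thesis unfolding mild_def by measurable
qed

text \<open>
  The initial value decays at least at the rate of the smallest nonzero wave number \<open>2 * pi / L\<close>. The
  estimate is kept for single modes, because dominated convergence over the modes also yields the
  continuity of the solution in \<open>V\<^sup>\<alpha>\<close>.
\<close>

lemma mild_mode_sup_bound:
  assumes L: "0 < L" and \<nu>: "0 < \<nu>" and t: "0 \<le> t"
    and g: "(\<lambda>t. g t k) \<in> borel_measurable (time \<mu>)"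
  shows "ennreal (wn L k powr (2 * \<alpha>) * (norm (mild L \<mu> \<nu> x0 g t k))\<^sup>2)
    \<le> ennreal (2 * exp (- (2 * \<nu> * (2 * pi / L)\<^sup>2 * t))) * ennreal (wn L k powr (2 * \<alpha>) * (norm (x0 k))\<^sup>2)
     + ennreal (1 / \<nu>) * (ennreal (wn L k powr (2 * (\<alpha> - 1))) * (\<integral>\<^sup>+s. ennreal ((norm (g s k))\<^sup>2) \<partial>time \<mu>))"
proof (cases "k = 0")
  case False
  define c where "c = \<nu> * (wn L k)\<^sup>2"
  have w: "0 < wn L k" by (rule wn_pos[OF L False])
  have c: "0 < c" using w \<nu> by (simp add: c_def)
  let ?I = "\<integral>\<^sup>+s. ennreal ((norm (g s k))\<^sup>2) \<partial>time \<mu>"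
  let ?d = "duhamel \<mu> c (\<lambda>s. g s k) t"
  have "(2 * pi / L)\<^sup>2 \<le> (wn L k)\<^sup>2" using wn_ge[OF L False] L by (intro power_mono) auto
  then have "2 * (\<nu> * (2 * pi / L)\<^sup>2 * t) \<le> 2 * (c * t)"
    unfolding c_def using \<nu> t by (intro mult_left_mono mult_right_mono) auto
  then have e: "(exp (- (c * t)))\<^sup>2 \<le> exp (- (2 * \<nu> * (2 * pi / L)\<^sup>2 * t))"
    by (simp add: power2_eq_square flip: exp_add)
  have "(norm (mild L \<mu> \<nu> x0 g t k))\<^sup>2 \<le> 2 * (norm (exp (- (c * t)) *\<^sub>R x0 k))\<^sup>2 + 2 * (norm ?d)\<^sup>2"
    unfolding mild_def c_def by (rule norm_add_square_le)
  also have "\<dots> = 2 * ((exp (- (c * t)))\<^sup>2 * (norm (x0 k))\<^sup>2) + 2 * (norm ?d)\<^sup>2"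
    by (simp add: power_mult_distrib)
  also have "\<dots> \<le> 2 * (exp (- (2 * \<nu> * (2 * pi / L)\<^sup>2 * t)) * (norm (x0 k))\<^sup>2) + 2 * (norm ?d)\<^sup>2"
    by (intro add_right_mono mult_left_mono mult_right_mono e) auto
  finally have "wn L k powr (2 * \<alpha>) * (norm (mild L \<mu> \<nu> x0 g t k))\<^sup>2
    \<le> wn L k powr (2 * \<alpha>) * (2 * (exp (- (2 * \<nu> * (2 * pi / L)\<^sup>2 * t)) * (norm (x0 k))\<^sup>2) + 2 * (norm ?d)\<^sup>2)"
    by (rule mult_left_mono) simp
  also have "\<dots> = 2 * exp (- (2 * \<nu> * (2 * pi / L)\<^sup>2 * t)) * (wn L k powr (2 * \<alpha>) * (norm (x0 k))\<^sup>2)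
      + (2 * wn L k powr (2 * \<alpha>)) * (norm ?d)\<^sup>2"
    by (simp add: distrib_left ac_simps)
  finally have "ennreal (wn L k powr (2 * \<alpha>) * (norm (mild L \<mu> \<nu> x0 g t k))\<^sup>2)
    \<le> ennreal (2 * exp (- (2 * \<nu> * (2 * pi / L)\<^sup>2 * t))) * ennreal (wn L k powr (2 * \<alpha>) * (norm (x0 k))\<^sup>2)
      + ennreal (2 * wn L k powr (2 * \<alpha>)) * ennreal ((norm ?d)\<^sup>2)"
    by (simp add: ennreal_leI flip: ennreal_mult' ennreal_plus)
  also have "\<dots> \<le> ennreal (2 * exp (- (2 * \<nu> * (2 * pi / L)\<^sup>2 * t))) * ennreal (wn L k powr (2 * \<alpha>) * (norm (x0 k))\<^sup>2)
      + ennreal (2 * wn L k powr (2 * \<alpha>)) * (ennreal (1 / (2 * c)) * ?I)"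
    by (intro add_left_mono mult_left_mono duhamel_sup_bound c g) simp
  also have "ennreal (2 * wn L k powr (2 * \<alpha>)) * (ennreal (1 / (2 * c)) * ?I)
      = ennreal (1 / \<nu>) * (ennreal (wn L k powr (2 * (\<alpha> - 1))) * ?I)"
  proof -
    have "wn L k powr (2 * \<alpha>) = wn L k powr (2 * (\<alpha> - 1)) * (wn L k)\<^sup>2"
      using w powr_add[of "wn L k" "2 * (\<alpha> - 1)" 2] by (simp add: algebra_simps)
    then have "2 * wn L k powr (2 * \<alpha>) * (1 / (2 * c)) = 1 / \<nu> * wn L k powr (2 * (\<alpha> - 1))"
      using w \<nu> by (simp add: c_def field_simps)
    then show ?thesis using \<nu> c by (simp add: mult.assoc[symmetric] flip: ennreal_mult)
  qed
  finally show ?thesis .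
qed simp

text \<open>
  The counterpart for the integral over time: the damping gains one derivative on the initial value and
  two on the source.
\<close>

lemma mild_mode_L2_bound:
  assumes L: "0 < L" and \<nu>: "0 < \<nu>"
    and g: "(\<lambda>t. g t k) \<in> borel_measurable (time \<mu>)"
  shows "ennreal (wn L k powr (2 * (1 + \<alpha>))) * (\<integral>\<^sup>+t. ennreal ((norm (mild L \<mu> \<nu> x0 g t k))\<^sup>2) \<partial>time \<mu>)
    \<le> ennreal (1 / \<nu>) * ennreal (wn L k powr (2 * \<alpha>) * (norm (x0 k))\<^sup>2)
     + ennreal (2 / \<nu>\<^sup>2) * (ennreal (wn L k powr (2 * (\<alpha> - 1))) * (\<integral>\<^sup>+s. ennreal ((norm (g s k))\<^sup>2) \<partial>time \<mu>))"
proof (cases "k = 0")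
  case False
  define c where "c = \<nu> * (wn L k)\<^sup>2"
  have w: "0 < wn L k" by (rule wn_pos[OF L False])
  have c: "0 < c" using w \<nu> by (simp add: c_def)
  let ?I = "\<integral>\<^sup>+s. ennreal ((norm (g s k))\<^sup>2) \<partial>time \<mu>"
  let ?d = "duhamel \<mu> c (\<lambda>s. g s k)"
  note [measurable] = g duhamel_measurable[OF g]
  have "(\<integral>\<^sup>+t. ennreal ((norm (mild L \<mu> \<nu> x0 g t k))\<^sup>2) \<partial>time \<mu>)
    \<le> (\<integral>\<^sup>+t. ennreal (2 * (norm (x0 k))\<^sup>2) * ennreal (heat (2 * c) t 0) + 2 * ennreal ((norm (?d t))\<^sup>2) \<partial>time \<mu>)"
  proof (rule nn_integral_mono)
    fix t assume "t \<in> space (time \<mu>)"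
    then have t: "0 \<le> t" by simp
    have "(norm (mild L \<mu> \<nu> x0 g t k))\<^sup>2 \<le> 2 * (norm (exp (- (c * t)) *\<^sub>R x0 k))\<^sup>2 + 2 * (norm (?d t))\<^sup>2"
      unfolding mild_def c_def by (rule norm_add_square_le)
    also have "\<dots> = 2 * (norm (x0 k))\<^sup>2 * heat (2 * c) t 0 + 2 * (norm (?d t))\<^sup>2"
      using t by (simp add: power_mult_distrib heat_square[symmetric]) (simp add: heat_def)
    finally show "ennreal ((norm (mild L \<mu> \<nu> x0 g t k))\<^sup>2)
        \<le> ennreal (2 * (norm (x0 k))\<^sup>2) * ennreal (heat (2 * c) t 0) + 2 * ennreal ((norm (?d t))\<^sup>2)"
      by (simp add: ennreal_leI flip: ennreal_numeral ennreal_mult' ennreal_plus)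
  qed
  also have "\<dots> = ennreal (2 * (norm (x0 k))\<^sup>2) * (\<integral>\<^sup>+t. ennreal (heat (2 * c) t 0) \<partial>time \<mu>)
      + 2 * (\<integral>\<^sup>+t. ennreal ((norm (?d t))\<^sup>2) \<partial>time \<mu>)"
    by (simp add: nn_integral_add nn_integral_cmult)
  also have "\<dots> \<le> ennreal (2 * (norm (x0 k))\<^sup>2) * ennreal (1 / (2 * c)) + 2 * (ennreal (1 / c\<^sup>2) * ?I)"
    using c by (intro add_mono mult_left_mono nn_integral_heat_le' duhamel_L2_bound) auto
  finally have "ennreal (wn L k powr (2 * (1 + \<alpha>))) * (\<integral>\<^sup>+t. ennreal ((norm (mild L \<mu> \<nu> x0 g t k))\<^sup>2) \<partial>time \<mu>)
    \<le> ennreal (wn L k powr (2 * (1 + \<alpha>))) * (ennreal (2 * (norm (x0 k))\<^sup>2) * ennreal (1 / (2 * c)) + 2 * (ennreal (1 / c\<^sup>2) * ?I))"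
    by (rule mult_left_mono) simp
  also have "\<dots> = ennreal (1 / \<nu>) * ennreal (wn L k powr (2 * \<alpha>) * (norm (x0 k))\<^sup>2)
     + ennreal (2 / \<nu>\<^sup>2) * (ennreal (wn L k powr (2 * (\<alpha> - 1))) * ?I)"
  proof -
    have p1: "wn L k powr (2 * (1 + \<alpha>)) = wn L k powr (2 * \<alpha>) * (wn L k)\<^sup>2"
      using w powr_add[of "wn L k" "2 * \<alpha>" 2] by (simp add: algebra_simps)
    have p2: "wn L k powr (2 * (1 + \<alpha>)) = wn L k powr (2 * (\<alpha> - 1)) * ((wn L k)\<^sup>2 * (wn L k)\<^sup>2)"
      using w powr_add[of "wn L k" "2 * (\<alpha> - 1)" 4] by (simp add: algebra_simps flip: power_add)
    have q1: "wn L k powr (2 * (1 + \<alpha>)) * (2 * (norm (x0 k))\<^sup>2 * (1 / (2 * c))) = 1 / \<nu> * (wn L k powr (2 * \<alpha>) * (norm (x0 k))\<^sup>2)"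
      unfolding p1 using w \<nu> by (simp add: c_def)
    have q2: "wn L k powr (2 * (1 + \<alpha>)) * (2 * (1 / c\<^sup>2)) = 2 / \<nu>\<^sup>2 * wn L k powr (2 * (\<alpha> - 1))"
      unfolding p2 using w \<nu> by (simp add: c_def power2_eq_square)
    have "ennreal a * (2 * (ennreal b * I)) = ennreal (a * (2 * b)) * I" if "0 \<le> a" "0 \<le> b" for a b I
      using that by (simp add: ennreal_mult mult.assoc)
    from this[of "wn L k powr (2 * (1 + \<alpha>))" "1 / c\<^sup>2"]
    have e2: "ennreal (wn L k powr (2 * (1 + \<alpha>))) * (2 * (ennreal (1 / c\<^sup>2) * ?I))
      = ennreal (wn L k powr (2 * (1 + \<alpha>)) * (2 * (1 / c\<^sup>2))) * ?I"
      by auto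
    have "ennreal a * (ennreal b * ennreal d) = ennreal (a * (b * d))" if "0 \<le> a" "0 \<le> b" "0 \<le> d" for a b d
      using that by (simp add: ennreal_mult mult.assoc)
    from this[of "wn L k powr (2 * (1 + \<alpha>))" "2 * (norm (x0 k))\<^sup>2" "1 / (2 * c)"]
    have e1: "ennreal (wn L k powr (2 * (1 + \<alpha>))) * (ennreal (2 * (norm (x0 k))\<^sup>2) * ennreal (1 / (2 * c)))
      = ennreal (wn L k powr (2 * (1 + \<alpha>)) * (2 * (norm (x0 k))\<^sup>2 * (1 / (2 * c))))"
      using c by (auto simp: mult.assoc)
    have f1: "ennreal (1 / \<nu> * (wn L k powr (2 * \<alpha>) * (norm (x0 k))\<^sup>2))
        = ennreal (1 / \<nu>) * ennreal (wn L k powr (2 * \<alpha>) * (norm (x0 k))\<^sup>2)"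
      using \<nu> by (intro ennreal_mult) auto
    have f2: "ennreal (2 / \<nu>\<^sup>2 * wn L k powr (2 * (\<alpha> - 1))) = ennreal (2 / \<nu>\<^sup>2) * ennreal (wn L k powr (2 * (\<alpha> - 1)))"
      by (intro ennreal_mult) auto
    show ?thesis
      unfolding distrib_left[of "ennreal (wn L k powr (2 * (1 + \<alpha>)))"] e1 e2 q1 q2 f1 f2 by (simp only: mult.assoc)
  qed
  finally show ?thesis .
qed simp

text \<open>
  This estimate and \<open>mild_L2_bound\<close> are the two a priori estimates of the heat equation. The powers of
  \<open>1 / \<nu>\<close> in them are what makes everything contract for large viscosity.
\<close>

lemma mild_sup_bound:
  assumes L: "0 < L" and \<nu>: "0 < \<nu>" and t: "0 \<le> t"
    and g: "\<And>k. (\<lambda>t. g t k) \<in> borel_measurable (time \<mu>)"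
  shows "sob L \<alpha> (mild L \<mu> \<nu> x0 g t)
    \<le> ennreal (2 * exp (- (2 * \<nu> * (2 * pi / L)\<^sup>2 * t))) * sob L \<alpha> x0
     + ennreal (1 / \<nu>) * (\<integral>\<^sup>+s. sob L (\<alpha> - 1) (g s) \<partial>time \<mu>)"
proof -
  have "sob L \<alpha> (mild L \<mu> \<nu> x0 g t) \<le> (\<integral>\<^sup>+k.
      ennreal (2 * exp (- (2 * \<nu> * (2 * pi / L)\<^sup>2 * t))) * ennreal (wn L k powr (2 * \<alpha>) * (norm (x0 k))\<^sup>2)
     + ennreal (1 / \<nu>) * (ennreal (wn L k powr (2 * (\<alpha> - 1))) * (\<integral>\<^sup>+s. ennreal ((norm (g s k))\<^sup>2) \<partial>time \<mu>)) \<partial>count_space UNIV)"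
    unfolding sob_def[of L \<alpha> "mild L \<mu> \<nu> x0 g t"] by (intro nn_integral_mono mild_mode_sup_bound assms)
  also have "\<dots> = ennreal (2 * exp (- (2 * \<nu> * (2 * pi / L)\<^sup>2 * t))) * sob L \<alpha> x0
     + ennreal (1 / \<nu>) * (\<integral>\<^sup>+s. sob L (\<alpha> - 1) (g s) \<partial>time \<mu>)"
    unfolding nn_integral_sob[of g, OF g] by (simp add: nn_integral_add nn_integral_cmult sob_def)
  finally show ?thesis .
qed

lemma mild_L2_bound:
  assumes L: "0 < L" and \<nu>: "0 < \<nu>"
    and g: "\<And>k. (\<lambda>t. g t k) \<in> borel_measurable (time \<mu>)"
  shows "(\<integral>\<^sup>+t. sob L (1 + \<alpha>) (mild L \<mu> \<nu> x0 g t) \<partial>time \<mu>)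
    \<le> ennreal (1 / \<nu>) * sob L \<alpha> x0
     + ennreal (2 / \<nu>\<^sup>2) * (\<integral>\<^sup>+s. sob L (\<alpha> - 1) (g s) \<partial>time \<mu>)"
proof -
  have "(\<integral>\<^sup>+t. sob L (1 + \<alpha>) (mild L \<mu> \<nu> x0 g t) \<partial>time \<mu>) \<le> (\<integral>\<^sup>+k.
      ennreal (1 / \<nu>) * ennreal (wn L k powr (2 * \<alpha>) * (norm (x0 k))\<^sup>2)
     + ennreal (2 / \<nu>\<^sup>2) * (ennreal (wn L k powr (2 * (\<alpha> - 1))) * (\<integral>\<^sup>+s. ennreal ((norm (g s k))\<^sup>2) \<partial>time \<mu>)) \<partial>count_space UNIV)"
    unfolding nn_integral_sob[of "mild L \<mu> \<nu> x0 g", OF mild_measurable[OF g]]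
    by (intro nn_integral_mono mild_mode_L2_bound assms)
  also have "\<dots> = ennreal (1 / \<nu>) * sob L \<alpha> x0
     + ennreal (2 / \<nu>\<^sup>2) * (\<integral>\<^sup>+s. sob L (\<alpha> - 1) (g s) \<partial>time \<mu>)"
    unfolding nn_integral_sob[of g, OF g] by (simp add: nn_integral_add nn_integral_cmult sob_def)
  finally show ?thesis .
qed

lemma mild_diff:
  assumes "integrable (time \<mu>) (\<lambda>s. g s k)" "integrable (time \<mu>) (\<lambda>s. h s k)"
  shows "mild L \<mu> \<nu> x0 g t k - mild L \<mu> \<nu> y0 h t k
    = mild L \<mu> \<nu> (\<lambda>k. x0 k - y0 k) (\<lambda>s k. g s k - h s k) t k"
proof -
  have heat: "integrable (time \<mu>) (\<lambda>s. heat c t s *\<^sub>R w s)" if "integrable (time \<mu>) w" for c and w :: "real \<Rightarrow> complex ^ 3"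
  proof -
    have "(\<lambda>s. exp (- (c * t)) *\<^sub>R (indicator {..t} s *\<^sub>R exp (c * s) *\<^sub>R w s)) = (\<lambda>s. heat c t s *\<^sub>R w s)"
      by (auto simp: heat_def indicator_def algebra_simps simp flip: exp_add)
    with integrable_scaleR_right[OF integrable_cutoff[OF integrable_exp_mult[OF that, of c], of t], of "exp (- (c * t))"]
    show ?thesis by simp
  qed
  show ?thesis
    unfolding mild_def duhamel_def
    using heat[OF assms(1)] heat[OF assms(2)] by (simp add: scaleR_diff_right)
qed

text \<open>
  The defining conditions of solenoidal fields are linear and continuous in the coefficients, so
  they survive integration. The source satisfies them only for almost all times, the result for all.
\<close>

lemma sol_mild:
  assumes L: "0 < L" and x0: "solenoidal L x0" and g: "source L \<mu> s g"
  shows "solenoidal L (mild L \<mu> \<nu> x0 g t)"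
proof -
  note ae = sourceD(3)[OF g]
  have heat: "integrable (time \<mu>) (\<lambda>s. heat c t s *\<^sub>R g s k)" for c k
  proof -
    have "(\<lambda>s. exp (- (c * t)) *\<^sub>R (indicator {..t} s *\<^sub>R exp (c * s) *\<^sub>R g s k)) = (\<lambda>s. heat c t s *\<^sub>R g s k)"
      by (auto simp: heat_def indicator_def algebra_simps simp flip: exp_add)
    with integrable_scaleR_right[OF integrable_cutoff[OF integrable_exp_mult[OF source_integrable[OF L g, of k], of c], of t], of "exp (- (c * t))"]
    show ?thesis by simp
  qed
  have m: "(\<lambda>s. heat c t s *\<^sub>R g s k) \<in> borel_measurable (time \<mu>)" for c k
    using heat by simp
  have 1: "duhamel \<mu> c (\<lambda>s. g s (- k)) t = vcnj (duhamel \<mu> c (\<lambda>s. g s k) t)" for c k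
  proof -
    have "vcnj (duhamel \<mu> c (\<lambda>s. g s k) t) = (LINT s|time \<mu>. vcnj (heat c t s *\<^sub>R g s k))"
      unfolding duhamel_def by (rule integral_bounded_linear[OF bounded_linear_vcnj heat, symmetric])
    also have "\<dots> = duhamel \<mu> c (\<lambda>s. g s (- k)) t"
      unfolding duhamel_def
    proof (rule integral_cong_AE)
      show "(\<lambda>s. vcnj (heat c t s *\<^sub>R g s k)) \<in> borel_measurable (time \<mu>)"
        using integrable_bounded_linear[OF bounded_linear_vcnj heat[of c k]] by simp
      show "AE s in time \<mu>. vcnj (heat c t s *\<^sub>R g s k) = heat c t s *\<^sub>R g s (- k)"
        using ae by eventually_elim (simp add: sol_iff linear_cmul[OF bounded_linear.linear[OF bounded_linear_vcnj]])
    qed (rule m)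
    finally show ?thesis by simp
  qed
  have 2: "cdot (duhamel \<mu> c (\<lambda>s. g s k) t) (freq L k) = 0" for c k
  proof -
    have "cdot (duhamel \<mu> c (\<lambda>s. g s k) t) (freq L k) = (LINT s|time \<mu>. cdot (heat c t s *\<^sub>R g s k) (freq L k))"
      unfolding duhamel_def by (rule integral_bounded_linear[OF bounded_linear_cdot heat, symmetric])
    also have "\<dots> = 0"
      by (rule integral_eq_zero_AE) (use ae in \<open>eventually_elim, simp add: sol_iff cdot_scaleR\<close>)
    finally show ?thesis .
  qed
  have 3: "duhamel \<mu> c (\<lambda>s. g s 0) t = 0" for c
    unfolding duhamel_def
    by (rule integral_eq_zero_AE) (use ae in \<open>eventually_elim, simp add: sol_zero_mean\<close>)
  show ?thesis
    using x0 unfolding sol_iff mild_def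
    by (auto simp: 1 2 3 cdot_add cdot_scaleR linear_cmul[OF bounded_linear.linear[OF bounded_linear_vcnj]]
        linear_add[OF bounded_linear.linear[OF bounded_linear_vcnj]])
qed

lemma continuous_on_mild:
  assumes "0 < L" "source L \<mu> s g"
  shows "continuous_on {0..\<mu>} (\<lambda>t. mild L \<mu> \<nu> x0 g t k)"
  unfolding mild_def by (intro continuous_intros continuous_on_duhamel source_integrable[OF assms])

text \<open>
  Continuity of all coefficients implies continuity in \<open>V\<^sup>\<alpha>\<close> as soon as the modes have a common
  summable majorant, by dominated convergence.
\<close>

lemma continuous_map_VspI:
  fixes u :: "real \<Rightarrow> vfield"
  assumes L: "0 < L" and V: "\<And>t. t \<in> {0..\<mu>} \<Longrightarrow> u t \<in> Vsp L \<alpha>"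
    and cont: "\<And>k. continuous_on {0..\<mu>} (\<lambda>t. u t k)"
    and D: "\<And>t k. t \<in> {0..\<mu>} \<Longrightarrow> ennreal (wn L k powr (2 * \<alpha>) * (norm (u t k))\<^sup>2) \<le> D k"
    and fin: "(\<integral>\<^sup>+k. D k \<partial>count_space UNIV) < \<infinity>"
  shows "continuous_map (top_of_set {0..\<mu>}) (Metric_space.mtopology (Vsp L \<alpha>) (Vdist L \<alpha>)) u"
  unfolding Metric_space.continuous_map_to_metric[OF Metric_space_Vsp[OF L]]
proof (intro ballI allI impI)
  fix x \<epsilon> assume "x \<in> topspace (top_of_set {0..\<mu>})" and \<epsilon>: "(0::real) < \<epsilon>"
  then have x: "x \<in> {0..\<mu>}" by simp
  have lim: "((\<lambda>y. sob L \<alpha> (vdiff (u x) (u y))) \<longlongrightarrow> 0) (at x within {0..\<mu>})"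
  proof (rule tendsto_at_iff_sequentially[THEN iffD2], intro allI impI)
    fix X assume X: "\<forall>i. X i \<in> {0..\<mu>} - {x}" "X \<longlonglongrightarrow> x"
    have "(\<lambda>n. \<integral>\<^sup>+k. ennreal (wn L k powr (2 * \<alpha>) * (norm (u x k - u (X n) k))\<^sup>2) \<partial>count_space UNIV)
       \<longlonglongrightarrow> (\<integral>\<^sup>+k. 0 \<partial>count_space (UNIV :: (int ^ 3) set))"
    proof (rule nn_integral_dominated_convergence[where w = "\<lambda>k. 4 * D k"])
      show "AE k in count_space UNIV. ennreal (wn L k powr (2 * \<alpha>) * (norm (u x k - u (X n) k))\<^sup>2) \<le> 4 * D k" for n
      proof (rule AE_I2)
        fix k
        have "wn L k powr (2 * \<alpha>) * (norm (u x k - u (X n) k))\<^sup>2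
          \<le> wn L k powr (2 * \<alpha>) * (2 * (norm (u x k))\<^sup>2 + 2 * (norm (- u (X n) k))\<^sup>2)"
          using norm_add_square_le[of "u x k" "- u (X n) k"] by (intro mult_left_mono) auto
        also have "\<dots> = 2 * (wn L k powr (2 * \<alpha>) * (norm (u x k))\<^sup>2) + 2 * (wn L k powr (2 * \<alpha>) * (norm (u (X n) k))\<^sup>2)"
          by (simp add: algebra_simps)
        finally have "ennreal (wn L k powr (2 * \<alpha>) * (norm (u x k - u (X n) k))\<^sup>2)
          \<le> 2 * ennreal (wn L k powr (2 * \<alpha>) * (norm (u x k))\<^sup>2) + 2 * ennreal (wn L k powr (2 * \<alpha>) * (norm (u (X n) k))\<^sup>2)"
          by (simp add: ennreal_leI flip: ennreal_numeral ennreal_mult' ennreal_plus)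
        also have "\<dots> \<le> 2 * D k + 2 * D k"
          using X(1) x by (intro add_mono mult_left_mono D) auto
        also have "\<dots> = 4 * D k" by (simp flip: distrib_right)
        finally show "ennreal (wn L k powr (2 * \<alpha>) * (norm (u x k - u (X n) k))\<^sup>2) \<le> 4 * D k" .
      qed
      show "(\<integral>\<^sup>+k. 4 * D k \<partial>count_space UNIV) < \<infinity>"
        using fin by (simp add: nn_integral_cmult ennreal_mult_less_top)
      show "AE k in count_space UNIV. (\<lambda>n. ennreal (wn L k powr (2 * \<alpha>) * (norm (u x k - u (X n) k))\<^sup>2)) \<longlonglongrightarrow> 0"
      proof (rule AE_I2)
        fix k
        have "(\<lambda>n. u (X n) k) \<longlonglongrightarrow> u x k"
          by (rule continuous_on_tendsto_compose[OF cont X(2) x]) (use X(1) in auto)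
        then have "(\<lambda>n. ennreal (wn L k powr (2 * \<alpha>) * (norm (u x k - u (X n) k))\<^sup>2))
           \<longlonglongrightarrow> ennreal (wn L k powr (2 * \<alpha>) * (norm (u x k - u x k))\<^sup>2)"
          by (intro tendsto_intros tendsto_ennrealI)
        then show "(\<lambda>n. ennreal (wn L k powr (2 * \<alpha>) * (norm (u x k - u (X n) k))\<^sup>2)) \<longlonglongrightarrow> 0" by simp
      qed
    qed auto
    then show "((\<lambda>y. sob L \<alpha> (vdiff (u x) (u y))) \<circ> X) \<longlonglongrightarrow> 0"
      by (simp add: sob_def vdiff_def comp_def)
  qed
  define e where "e = \<epsilon>\<^sup>2 / L ^ 3"
  have e: "0 < e" using \<epsilon> L by (simp add: e_def)
  from order_tendstoD(2)[OF lim, of "ennreal e"] e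
  obtain d where d: "0 < d" "\<And>y. y \<in> {0..\<mu>} \<Longrightarrow> y \<noteq> x \<Longrightarrow> dist y x < d \<Longrightarrow> sob L \<alpha> (vdiff (u x) (u y)) < ennreal e"
    unfolding eventually_at by auto
  show "\<exists>U. openin (top_of_set {0..\<mu>}) U \<and> x \<in> U \<and> (\<forall>y\<in>U. u y \<in> Metric_space.mball (Vsp L \<alpha>) (Vdist L \<alpha>) (u x) \<epsilon>)"
  proof (intro exI conjI ballI)
    show "openin (top_of_set {0..\<mu>}) ({0..\<mu>} \<inter> ball x d)" by (rule openin_open_Int) simp
    show "x \<in> {0..\<mu>} \<inter> ball x d" using x d by simp
    fix y assume y: "y \<in> {0..\<mu>} \<inter> ball x d"
    have "sob L \<alpha> (vdiff (u x) (u y)) < ennreal e"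
    proof (cases "y = x")
      case True
      then show ?thesis using e by (simp add: vdiff_def)
    qed (use y d in \<open>auto simp: dist_commute\<close>)
    then have "enn2real (sob L \<alpha> (vdiff (u x) (u y))) < e"
      using e by (cases "sob L \<alpha> (vdiff (u x) (u y))") (auto simp: ennreal_less_iff)
    then have "L ^ 3 * enn2real (sob L \<alpha> (vdiff (u x) (u y))) < \<epsilon>\<^sup>2"
      using L by (simp add: e_def field_simps)
    then have "Vdist L \<alpha> (u x) (u y) < \<epsilon>"
      unfolding Vdist_def Vnorm_eq using \<epsilon> by (intro real_less_lsqrt) auto
    then show "u y \<in> Metric_space.mball (Vsp L \<alpha>) (Vdist L \<alpha>) (u x) \<epsilon>"
      using V x y by (simp add: Metric_space.in_mball[OF Metric_space_Vsp[OF L]])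
  qed
qed

section \<open>Smooth functions of one real variable\<close>

definition smooth :: "(real \<Rightarrow> real) \<Rightarrow> bool" where
  "smooth f \<longleftrightarrow> (\<forall>n t. (deriv ^^ n) f field_differentiable at t)"

lemma test_function_iff: "test_function \<mu> \<phi> \<longleftrightarrow> smooth \<phi> \<and> closure {t. \<phi> t \<noteq> 0} \<subseteq> {0<..<\<mu>}"
  by (simp add: test_function_def smooth_def)

text \<open>
  A family of functions closed under differentiation consists of smooth functions. All the examples
  below are obtained by exhibiting such a family.
\<close>

lemma smooth_coinduct:
  assumes "P f" and step: "\<And>f. P f \<Longrightarrow> \<exists>f'. P f' \<and> (\<forall>t. (f has_real_derivative f' t) (at t))"
  shows "smooth f"
proof -
  have deriv: "P (deriv f)" and diff: "f field_differentiable at t" if Pf: "P f" for f t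
  proof -
    obtain f' where f': "P f'" "\<And>t. (f has_real_derivative f' t) (at t)" using step[OF Pf] by blast
    have "deriv f = f'" using f'(2) DERIV_imp_deriv by blast
    then show "P (deriv f)" using f'(1) by simp
    show "f field_differentiable at t" using f'(2) unfolding field_differentiable_def by blast
  qed
  have "P ((deriv ^^ n) f)" for n by (induction n) (simp_all add: assms(1) deriv)
  then show ?thesis unfolding smooth_def using diff by blast
qed

lemma smooth_deriv: "smooth f \<Longrightarrow> smooth (deriv f)"
  unfolding smooth_def by (metis funpow_Suc_right comp_apply)

lemma smooth_DERIV: "smooth f \<Longrightarrow> (f has_real_derivative deriv f t) (at t)"
  using DERIV_deriv_iff_field_differentiable[of f t] funpow_0[of deriv f] unfolding smooth_def by metis

lemma smooth_primitive:
  assumes "\<And>t. (F has_real_derivative f t) (at t)" "smooth f"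
  shows "smooth F"
  by (rule smooth_coinduct[where P = "\<lambda>g. g = F \<or> smooth g"]) (use assms smooth_deriv smooth_DERIV in blast)+

lemma smooth_continuous_on: "smooth f \<Longrightarrow> continuous_on S f"
  using smooth_DERIV DERIV_isCont by (blast intro: continuous_at_imp_continuous_on)

text \<open>
  The sums of products of smooth functions, a family that the Leibniz rule shows to be closed under
  differentiation.
\<close>

inductive Leibniz_closed :: "(real \<Rightarrow> real) \<Rightarrow> bool" where
  product: "smooth f \<Longrightarrow> smooth g \<Longrightarrow> Leibniz_closed (\<lambda>t. f t * g t)"
| sum: "Leibniz_closed f \<Longrightarrow> Leibniz_closed g \<Longrightarrow> Leibniz_closed (\<lambda>t. f t + g t)"

lemma Leibniz_closed_smooth: "Leibniz_closed f \<Longrightarrow> smooth f"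
proof (erule smooth_coinduct)
  fix f assume "Leibniz_closed f"
  then show "\<exists>f'. Leibniz_closed f' \<and> (\<forall>t. (f has_real_derivative f' t) (at t))"
  proof induction
    case (product f g)
    have "Leibniz_closed (\<lambda>t. f t * deriv g t + deriv f t * g t)"
      by (intro Leibniz_closed.intros product smooth_deriv)
    moreover have "((\<lambda>t. f t * g t) has_real_derivative f t * deriv g t + deriv f t * g t) (at t)" for t
      by (rule DERIV_mult'[OF smooth_DERIV smooth_DERIV]) (rule product)+
    ultimately show ?case by blast
  next
    case (sum f g)
    then obtain f' g' where "Leibniz_closed f'" "\<And>t. (f has_real_derivative f' t) (at t)"
      "Leibniz_closed g'" "\<And>t. (g has_real_derivative g' t) (at t)" by blast
    then show ?case by (intro exI[of _ "\<lambda>t. f' t + g' t"]) (auto intro: Leibniz_closed.sum DERIV_add)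
  qed
qed

lemma smooth_mult: "smooth f \<Longrightarrow> smooth g \<Longrightarrow> smooth (\<lambda>t. f t * g t)"
  by (rule Leibniz_closed_smooth[OF Leibniz_closed.product])

lemma smooth_const: "smooth (\<lambda>t. c)"
proof (rule smooth_coinduct[where P = "\<lambda>f. \<exists>c. f = (\<lambda>t. c)"])
  fix f :: "real \<Rightarrow> real" assume "\<exists>c. f = (\<lambda>t. c)"
  then show "\<exists>f'. (\<exists>c. f' = (\<lambda>t. c)) \<and> (\<forall>t. (f has_real_derivative f' t) (at t))"
    by (intro exI[of _ "\<lambda>t. 0"]) auto
qed blast

lemma smooth_add:
  assumes "smooth f" "smooth g" shows "smooth (\<lambda>t. f t + g t)"
proof -
  have "Leibniz_closed (\<lambda>t. f t * 1 + g t * 1)"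
    by (intro Leibniz_closed.intros smooth_const assms)
  from Leibniz_closed_smooth[OF this] show ?thesis by simp
qed

lemma smooth_diff: "smooth f \<Longrightarrow> smooth g \<Longrightarrow> smooth (\<lambda>t. f t - g t)"
  using smooth_add[OF _ smooth_mult[OF smooth_const[of "-1"]], of f g] by simp

lemma smooth_exp: "smooth (\<lambda>t. exp (c * t))"
proof (rule smooth_coinduct[where P = "\<lambda>f. \<exists>a. f = (\<lambda>t. a * exp (c * t))"])
  show "\<exists>a. (\<lambda>t. exp (c * t)) = (\<lambda>t. a * exp (c * t))" by (rule exI[of _ 1]) simp
  fix f assume "\<exists>a. f = (\<lambda>t. a * exp (c * t))"
  then obtain a where f: "f = (\<lambda>t. a * exp (c * t))" by blast
  have "(f has_real_derivative (a * c) * exp (c * t)) (at t)" for t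
    unfolding f by (rule derivative_eq_intros refl | simp)+
  then show "\<exists>f'. (\<exists>a. f' = (\<lambda>t. a * exp (c * t))) \<and> (\<forall>t. (f has_real_derivative f' t) (at t))"
    by (intro exI[of _ "\<lambda>t. (a * c) * exp (c * t)"]) blast
qed

lemma smooth_affine:
  assumes "smooth f" shows "smooth (\<lambda>t. f (a * t + b))"
proof (rule smooth_coinduct[where P = "\<lambda>g. \<exists>f c. smooth f \<and> g = (\<lambda>t. c * f (a * t + b))"])
  show "\<exists>fa c. smooth fa \<and> (\<lambda>t. f (a * t + b)) = (\<lambda>t. c * fa (a * t + b))"
    by (rule exI[of _ f], rule exI[of _ 1]) (simp add: assms)
  fix g assume "\<exists>f c. smooth f \<and> g = (\<lambda>t. c * f (a * t + b))"
  then obtain f c where f: "smooth f" and g: "g = (\<lambda>t. c * f (a * t + b))" by blast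
  have "(g has_real_derivative (c * a) * deriv f (a * t + b)) (at t)" for t
    unfolding g
    by (rule derivative_eq_intros DERIV_chain2[OF smooth_DERIV[OF f]] refl | simp)+
  then show "\<exists>f'. (\<exists>f c. smooth f \<and> f' = (\<lambda>t. c * f (a * t + b))) \<and> (\<forall>t. (g has_real_derivative f' t) (at t))"
    using smooth_deriv[OF f] by (intro exI[of _ "\<lambda>t. (c * a) * deriv f (a * t + b)"]) blast
qed

lemma tendsto_poly_mult_exp_0:
  fixes p :: "real poly"
  shows "((\<lambda>y. y ^ n * poly p y * exp (- y)) \<longlongrightarrow> 0) at_top"
proof (induction p arbitrary: n)
  case (pCons a p)
  have "((\<lambda>y. a * (y ^ n / exp y) + y ^ Suc n * poly p y * exp (- y)) \<longlongrightarrow> a * 0 + 0) at_top"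
    by (intro tendsto_add tendsto_mult tendsto_const tendsto_power_div_exp_0 pCons.IH)
  then show ?case by (simp add: exp_minus field_simps)
qed simp

text \<open>
  The functions \<open>p(1/t) exp(-1/t)\<close>, extended by \<open>0\<close>. Polynomials in \<open>1/t\<close> are admitted because
  they appear on differentiation.
\<close>

definition flat :: "real poly \<Rightarrow> real \<Rightarrow> real" where
  "flat p t = (if 0 < t then poly p (1 / t) * exp (- (1 / t)) else 0)"

lemma flat_DERIV: "(flat p has_real_derivative flat ([:0, 0, 1:] * (p - pderiv p)) t) (at t)"
proof -
  consider "0 < t" | "t < 0" | "t = 0" by linarith
  then show ?thesis
  proof cases
    case 1
    have "((\<lambda>t. poly p (1 / t) * exp (- (1 / t))) has_real_derivative flat ([:0, 0, 1:] * (p - pderiv p)) t) (at t)"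
      using 1 by (auto intro!: derivative_eq_intros DERIV_chain2[OF poly_DERIV] simp: flat_def field_simps power2_eq_square)
    then show ?thesis
      by (rule has_field_derivative_transform_within_open[of _ _ _ "{0<..}"]) (use 1 in \<open>auto simp: flat_def\<close>)
  next
    case 2
    have "((\<lambda>t. 0) has_real_derivative 0) (at t)" by simp
    then have "(flat p has_real_derivative 0) (at t)"
      by (rule has_field_derivative_transform_within_open[of _ _ _ "{..<0}"]) (use 2 in \<open>auto simp: flat_def\<close>)
    then show ?thesis using 2 by (simp add: flat_def)
  next
    case 3
    have "((\<lambda>h. flat p h / h) \<longlongrightarrow> 0) (at_right 0)"
    proof (rule Lim_transform_eventually)
      show "((\<lambda>h. (\<lambda>y. y ^ 1 * poly p y * exp (- y)) (inverse h)) \<longlongrightarrow> 0) (at_right 0)"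
        by (rule filterlim_compose[OF tendsto_poly_mult_exp_0 filterlim_inverse_at_top_right])
      show "\<forall>\<^sub>F h in at_right 0. inverse h ^ 1 * poly p (inverse h) * exp (- inverse h) = flat p h / h"
        using eventually_at_right_less[of 0] by eventually_elim (simp add: flat_def field_simps)
    qed
    moreover have "((\<lambda>h. flat p h / h) \<longlongrightarrow> 0) (at_left 0)"
      by (rule tendsto_eventually) (auto simp: flat_def eventually_at_filter)
    ultimately have "((\<lambda>h. flat p h / h) \<longlongrightarrow> 0) (at 0)" by (rule filterlim_split_at[rotated])
    then show ?thesis using 3 by (simp add: DERIV_def flat_def)
  qed
qed

lemma smooth_flat: "smooth (flat p)"
  by (rule smooth_coinduct[where P = "\<lambda>f. \<exists>p. f = flat p"]) (use flat_DERIV in blast)+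

text \<open>
  The normalised primitive of a bump function.
\<close>

lemma smooth_step:
  obtains \<sigma> where "smooth \<sigma>" "\<And>t. t \<le> 0 \<Longrightarrow> \<sigma> t = 0" "\<And>t. 1 \<le> t \<Longrightarrow> \<sigma> t = 1" "\<And>t. 0 \<le> deriv \<sigma> t"
    "\<And>t. t \<notin> {0..1} \<Longrightarrow> deriv \<sigma> t = 0"
proof -
  \<comment> \<open>A smooth function that is positive on the open unit interval and zero elsewhere.\<close>
  define \<beta> where "\<beta> t = flat 1 t * flat 1 (- 1 * t + 1)" for t
  have \<beta>: "smooth \<beta>" unfolding \<beta>_def by (intro smooth_mult smooth_flat smooth_affine)
  have \<beta>0: "\<beta> t = 0" if "t \<notin> {0<..<1}" for t using that by (auto simp: \<beta>_def flat_def)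
  have \<beta>pos: "0 < \<beta> t" if "t \<in> {0<..<1}" for t using that by (auto simp: \<beta>_def flat_def)
  have \<beta>nn: "0 \<le> \<beta> t" for t
    using \<beta>0[of t] less_imp_le[OF \<beta>pos[of t]] by (cases "t \<in> {0<..<1}") simp_all
  \<comment> \<open>Starting the integral at \<open>-1\<close> instead of \<open>0\<close> makes \<open>0\<close> an interior point, where the derivative is needed as well.\<close>
  define H where "H x = integral {- 1..x} \<beta>" for x
  have H0: "H x = 0" if "x \<le> 0" for x
    unfolding H_def by (rule integral_unique, rule has_integral_is_0) (use that \<beta>0 in auto)
  have HD: "(H has_real_derivative \<beta> t) (at t)" for t
  proof (cases "t < 0")
    case True
    have "((\<lambda>t. 0) has_real_derivative 0) (at t)" by simp
    then have "(H has_real_derivative 0) (at t)"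
      by (rule has_field_derivative_transform_within_open[of _ _ _ "{..<0}"]) (use True H0 in auto)
    then show ?thesis using True \<beta>0[of t] by simp
  next
    case False
    have "(H has_vector_derivative \<beta> t) (at t within {- 1..t + 1})"
      unfolding H_def by (rule integral_has_vector_derivative) (use False smooth_continuous_on[OF \<beta>] in auto)
    then show ?thesis
      using False by (simp add: has_real_derivative_iff_has_vector_derivative at_within_Icc_at)
  qed
  have "H 0 < H 1"
  proof (rule DERIV_pos_imp_increasing_open[where f = H])
    show "\<exists>y. (H has_real_derivative y) (at x) \<and> 0 < y" if "0 < x" "x < 1" for x
      using HD[of x] \<beta>pos[of x] that by auto
    show "continuous_on {0..1} H"
      using HD DERIV_isCont by (blast intro: continuous_at_imp_continuous_on)
  qed simp
  then have c: "0 < H 1" using H0 by simp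
  have H1: "H x = H 1" if "1 \<le> x" for x
  proof (cases "x = 1")
    case False
    then have "1 < x" using that by simp
    then obtain z where "1 < z" "H x - H 1 = (x - 1) * \<beta> z"
      using MVT2[of 1 x H \<beta>] HD by auto
    then show ?thesis using \<beta>0[of z] by simp
  qed simp
  define \<sigma> where "\<sigma> t = (1 / H 1) * H t" for t
  have D: "(\<sigma> has_real_derivative (1 / H 1) * \<beta> t) (at t)" for t
    unfolding \<sigma>_def by (rule DERIV_cmult[OF HD])
  then have "deriv \<sigma> t = (1 / H 1) * \<beta> t" for t by (rule DERIV_imp_deriv)
  moreover have "smooth \<sigma>"
    by (rule smooth_primitive[OF D]) (intro smooth_mult smooth_const \<beta>)
  moreover have "\<sigma> t = 1" if "1 \<le> t" for t
    using c by (simp add: \<sigma>_def H1[OF that])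
  ultimately show ?thesis
    by (intro that[of \<sigma>]) (use c H0 \<beta>nn \<beta>0 in \<open>auto simp: \<sigma>_def\<close>)
qed

section \<open>Weak derivatives on an interval\<close>

lemma integrable_time_continuous:
  fixes f :: "real \<Rightarrow> 'a::euclidean_space"
  shows "continuous_on {0..\<mu>} f \<Longrightarrow> integrable (time \<mu>) f"
  unfolding time_def by (rule continuous_imp_integrable_real)

lemma integrable_mult_continuous:
  fixes G \<eta> :: "real \<Rightarrow> real"
  assumes G: "integrable (time \<mu>) G" and \<eta>: "continuous_on {0..\<mu>} \<eta>"
  shows "integrable (time \<mu>) (\<lambda>t. G t * \<eta> t)"
proof -
  have "bounded (\<eta> ` {0..\<mu>})" by (intro compact_imp_bounded compact_continuous_image \<eta> compact_Icc)
  then obtain B where "\<forall>x\<in>{0..\<mu>}. norm (\<eta> x) \<le> B" by (auto simp: bounded_iff)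
  then have B: "\<bar>\<eta> t\<bar> \<le> B" if "t \<in> {0..\<mu>}" for t using that by simp
  have [measurable]: "G \<in> borel_measurable (time \<mu>)" "\<eta> \<in> borel_measurable (time \<mu>)"
    using G integrable_time_continuous[OF \<eta>] by auto
  show ?thesis
  proof (rule Bochner_Integration.integrable_bound)
    show "integrable (time \<mu>) (\<lambda>t. G t * B)" using G by simp
    show "AE t in time \<mu>. norm (G t * \<eta> t) \<le> norm (G t * B)"
      by (rule AE_I2) (use B in \<open>auto simp: abs_mult intro!: mult_left_mono order_trans[OF B abs_ge_self]\<close>)
  qed simp
qed

lemma LINT_time_derivative:
  fixes \<eta> \<eta>' :: "real \<Rightarrow> real"
  assumes "\<And>t. (\<eta> has_real_derivative \<eta>' t) (at t)" "continuous_on {0..\<mu>} \<eta>'" "s \<in> {0..\<mu>}"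
  shows "(LINT t|time \<mu>. indicator {..t} s * \<eta>' t) = \<eta> \<mu> - \<eta> s"
proof -
  have i: "integrable (time \<mu>) \<eta>'" by (rule integrable_time_continuous[OF assms(2)])
  have "{t \<in> space (time \<mu>). s \<le> t} \<in> sets (time \<mu>)" by measurable
  then have "integrable (time \<mu>) (\<lambda>t. indicator {..t} s * \<eta>' t)"
    using i by (intro Bochner_Integration.integrable_bound[OF i] borel_measurable_times)
      (auto simp: indicator_def)
  from has_integral_integral_lebesgue_on[OF this[unfolded time_def]]
  have "((\<lambda>t. indicator {..t} s * \<eta>' t) has_integral (LINT t|time \<mu>. indicator {..t} s * \<eta>' t)) {0..\<mu>}"
    by (simp add: time_def)
  then have "((\<lambda>t. if t \<in> {s..\<mu>} then \<eta>' t else 0) has_integral (LINT t|time \<mu>. indicator {..t} s * \<eta>' t)) {0..\<mu>}"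
    by (rule has_integral_eq[rotated]) (auto simp: indicator_def)
  then have "(\<eta>' has_integral (LINT t|time \<mu>. indicator {..t} s * \<eta>' t)) {s..\<mu>}"
    using assms(3) by (subst (asm) has_integral_restrict) auto
  moreover have "(\<eta>' has_integral \<eta> \<mu> - \<eta> s) {s..\<mu>}"
    by (rule fundamental_theorem_of_calculus)
      (use assms in \<open>auto simp: has_real_derivative_iff_has_vector_derivative[symmetric] intro: DERIV_subset\<close>)
  ultimately show ?thesis by (rule has_integral_unique)
qed

text \<open>
  Integration by parts for a primitive that is merely absolutely continuous, by Fubini's theorem. The
  boundary term at \<open>0\<close> vanishes with the primitive, the one at \<open>\<mu>\<close> with \<open>\<eta>\<close>.
\<close>

lemma primitive_by_parts:
  fixes \<eta> \<eta>' G :: "real \<Rightarrow> real"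
  assumes \<eta>: "\<And>t. (\<eta> has_real_derivative \<eta>' t) (at t)" "continuous_on {0..\<mu>} \<eta>'" "\<eta> \<mu> = 0"
    and G: "integrable (time \<mu>) G"
  shows "(LINT t|time \<mu>. primitive \<mu> G t * \<eta>' t) = - (LINT t|time \<mu>. G t * \<eta> t)"
proof -
  interpret finite_measure "time \<mu>" by (rule finite_measure_time)
  interpret P: pair_sigma_finite "time \<mu>" "time \<mu>" ..
  have i: "integrable (time \<mu>) \<eta>'" by (rule integrable_time_continuous[OF \<eta>(2)])
  have [measurable]: "G \<in> borel_measurable (time \<mu>)" "\<eta>' \<in> borel_measurable (time \<mu>)"
    using G i by auto
  have ind: "(indicator {..t} s :: real) = (if s \<le> t then 1 else 0)" for s t :: real by simp
  have int: "integrable (time \<mu> \<Otimes>\<^sub>M time \<mu>) (\<lambda>(t, s). (indicator {..t} s * G s) * \<eta>' t)"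
  proof (rule Bochner_Integration.integrable_bound)
    show "integrable (time \<mu> \<Otimes>\<^sub>M time \<mu>) (\<lambda>(t, s). G s * \<eta>' t)"
      by (rule P.Fubini_integrable) (use G i in \<open>auto simp: abs_mult\<close>)
    show "(\<lambda>(t, s). (indicator {..t} s * G s) * \<eta>' t) \<in> borel_measurable (time \<mu> \<Otimes>\<^sub>M time \<mu>)"
      unfolding ind by measurable
    show "AE z in time \<mu> \<Otimes>\<^sub>M time \<mu>. norm (case z of (t, s) \<Rightarrow> (indicator {..t} s * G s) * \<eta>' t)
        \<le> norm (case z of (t, s) \<Rightarrow> G s * \<eta>' t)"
      by (rule AE_I2) (auto simp: indicator_def)
  qed
  have "(LINT t|time \<mu>. primitive \<mu> G t * \<eta>' t) = (LINT t|time \<mu>. LINT s|time \<mu>. (indicator {..t} s * G s) * \<eta>' t)"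
    unfolding primitive_def by simp
  also have "\<dots> = (LINT s|time \<mu>. LINT t|time \<mu>. (indicator {..t} s * G s) * \<eta>' t)"
    by (rule P.Fubini_integral[OF int, symmetric])
  also have "\<dots> = (LINT s|time \<mu>. - (G s * \<eta> s))"
  proof (rule Bochner_Integration.integral_cong)
    fix s assume "s \<in> space (time \<mu>)"
    then have "(LINT t|time \<mu>. indicator {..t} s * \<eta>' t) = - \<eta> s"
      using LINT_time_derivative[OF \<eta>(1,2), of s] \<eta>(3) by simp
    moreover have "(LINT t|time \<mu>. (indicator {..t} s * G s) * \<eta>' t) = (LINT t|time \<mu>. G s * (indicator {..t} s * \<eta>' t))"
      by (simp add: ac_simps)
    ultimately show "(LINT t|time \<mu>. (indicator {..t} s * G s) * \<eta>' t) = - (G s * \<eta> s)"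
      by simp
  qed simp
  finally show ?thesis by simp
qed

lemma test_functionD:
  assumes "test_function \<mu> \<phi>"
  shows "\<And>t. (\<phi> has_real_derivative deriv \<phi> t) (at t)" "continuous_on S \<phi>" "continuous_on S (deriv \<phi>)"
    "\<phi> 0 = 0" "\<phi> \<mu> = 0"
proof -
  have s: "smooth \<phi>" and c: "closure {t. \<phi> t \<noteq> 0} \<subseteq> {0<..<\<mu>}" using assms by (auto simp: test_function_iff)
  show "\<And>t. (\<phi> has_real_derivative deriv \<phi> t) (at t)" "continuous_on S \<phi>" "continuous_on S (deriv \<phi>)"
    using s smooth_DERIV smooth_continuous_on smooth_deriv by blast+
  show "\<phi> 0 = 0" "\<phi> \<mu> = 0" using c closure_subset[of "{t. \<phi> t \<noteq> 0}"] by force+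
qed

lemma test_function_exp_mult:
  assumes "test_function \<mu> \<phi>"
  shows "test_function \<mu> (\<lambda>t. exp (c * t) * \<phi> t)"
  using assms unfolding test_function_iff by (auto intro: smooth_mult smooth_exp)

text \<open>
  A continuous function whose weak derivative vanishes is constant. The difference of two smooth steps,
  one rising just after \<open>s\<close> and one just after \<open>t\<close>, is a test function; its derivative is the difference
  of two approximate unit masses at \<open>s\<close> and at \<open>t\<close>.
\<close>

lemma du_Bois_Reymond_continuous:
  fixes d :: "real \<Rightarrow> real"
  assumes d: "continuous_on {0..\<mu>} d"
    and zero: "\<And>\<phi>. test_function \<mu> \<phi> \<Longrightarrow> (LINT t|time \<mu>. d t * deriv \<phi> t) = 0"
    and st: "0 < s" "s < t" "t < \<mu>"
  shows "d s = d t"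
proof (rule ccontr)
  assume "d s \<noteq> d t"
  define e where "e = \<bar>d s - d t\<bar> / 3"
  have e: "0 < e" using \<open>d s \<noteq> d t\<close> by (simp add: e_def)
  obtain \<sigma> where \<sigma>: "smooth \<sigma>" "\<And>t. t \<le> 0 \<Longrightarrow> \<sigma> t = 0" "\<And>t. 1 \<le> t \<Longrightarrow> \<sigma> t = 1" "\<And>t. 0 \<le> deriv \<sigma> t"
    "\<And>t. t \<notin> {0..1} \<Longrightarrow> deriv \<sigma> t = 0" using smooth_step by blast
  obtain \<delta>1 where \<delta>1: "0 < \<delta>1" "\<And>x. x \<in> {0..\<mu>} \<Longrightarrow> dist x s < \<delta>1 \<Longrightarrow> dist (d x) (d s) < e"
    using d[unfolded continuous_on_iff, rule_format, of s e] e st by auto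
  obtain \<delta>2 where \<delta>2: "0 < \<delta>2" "\<And>x. x \<in> {0..\<mu>} \<Longrightarrow> dist x t < \<delta>2 \<Longrightarrow> dist (d x) (d t) < e"
    using d[unfolded continuous_on_iff, rule_format, of t e] e st by auto
  \<comment> \<open>The steps have width \<open>\<epsilon>\<close>; the second one must be completed before \<open>\<mu>\<close>.\<close>
  define \<epsilon> where "\<epsilon> = min (\<mu> - t) (min \<delta>1 \<delta>2) / 2"
  have \<epsilon>: "0 < \<epsilon>" "\<epsilon> < \<mu> - t" "\<epsilon> < \<delta>1" "\<epsilon> < \<delta>2" using \<delta>1 \<delta>2 st by (auto simp: \<epsilon>_def min_def)
  define S where "S r x = \<sigma> ((1 / \<epsilon>) * x + - r / \<epsilon>)" for r x
  have arg: "(1 / \<epsilon>) * x + - r / \<epsilon> = (x - r) / \<epsilon>" for x r by (simp add: diff_divide_distrib)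
  have S: "smooth (S r)" for r unfolding S_def by (rule smooth_affine[OF \<sigma>(1)])
  have SD: "(S r has_real_derivative (1 / \<epsilon>) * deriv \<sigma> ((x - r) / \<epsilon>)) (at x)" for r x
  proof -
    have "((\<lambda>x. (1 / \<epsilon>) * x + - r / \<epsilon>) has_real_derivative 1 / \<epsilon>) (at x)"
      by (rule derivative_eq_intros refl | simp)+
    from DERIV_chain2[OF smooth_DERIV[OF \<sigma>(1)] this] show ?thesis
      unfolding S_def arg by (simp only: mult.commute)
  qed
  have S': "deriv (S r) x = (1 / \<epsilon>) * deriv \<sigma> ((x - r) / \<epsilon>)" for r x by (rule DERIV_imp_deriv[OF SD])
  have S'nn: "0 \<le> deriv (S r) x" for r x using \<epsilon>(1) \<sigma>(4) by (simp add: S')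
  have S'0: "deriv (S r) x = 0" if "x \<notin> {r..r + \<epsilon>}" for r x
    unfolding S' using \<sigma>(5)[of "(x - r) / \<epsilon>"] that \<epsilon>(1) by (auto simp: field_simps)
  have Sl: "S r x = 0" if "x \<le> r" for r x unfolding S_def arg using that \<epsilon>(1) by (intro \<sigma>(2)) (simp add: field_simps)
  have Sr: "S r x = 1" if "r + \<epsilon> \<le> x" for r x unfolding S_def arg using that \<epsilon>(1) by (intro \<sigma>(3)) (simp add: field_simps)
  have cS': "continuous_on {0..\<mu>} (deriv (S r))" for r by (intro smooth_continuous_on smooth_deriv S)
  have int: "integrable (time \<mu>) (\<lambda>x. d x * deriv (S r) x)" "integrable (time \<mu>) (deriv (S r))" for r
    by (intro integrable_time_continuous continuous_on_mult d cS')+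
  have one: "(LINT x|time \<mu>. deriv (S r) x) = 1" if "0 \<le> r" "r + \<epsilon> \<le> \<mu>" for r
  proof -
    have "(LINT x|time \<mu>. deriv (S r) x) = (LINT x|time \<mu>. indicator {..x} 0 * deriv (S r) x)"
      by (rule Bochner_Integration.integral_cong) auto
    also have "\<dots> = S r \<mu> - S r 0"
      by (rule LINT_time_derivative[OF smooth_DERIV[OF S] cS']) (use st in auto)
    also have "\<dots> = 1" using Sl[of 0 r] Sr[of r \<mu>] that by simp
    finally show ?thesis .
  qed
  have close: "\<bar>(LINT x|time \<mu>. d x * deriv (S r) x) - d r\<bar> \<le> e"
    if r: "0 \<le> r" "r + \<epsilon> \<le> \<mu>" and near: "\<And>x. x \<in> {0..\<mu>} \<Longrightarrow> dist x r \<le> \<epsilon> \<Longrightarrow> dist (d x) (d r) < e" for r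
  proof -
    have "(LINT x|time \<mu>. d x * deriv (S r) x) - d r = (LINT x|time \<mu>. d x * deriv (S r) x) - (LINT x|time \<mu>. d r * deriv (S r) x)"
      using one[OF r] by simp
    also have "\<dots> = (LINT x|time \<mu>. (d x - d r) * deriv (S r) x)"
      using int by (simp add: left_diff_distrib)
    also have "\<bar>\<dots>\<bar> \<le> (LINT x|time \<mu>. e * deriv (S r) x)"
    proof (rule order_trans[OF integral_abs_bound], rule integral_mono)
      show "integrable (time \<mu>) (\<lambda>x. \<bar>(d x - d r) * deriv (S r) x\<bar>)"
        using int by (simp add: left_diff_distrib)
      show "integrable (time \<mu>) (\<lambda>x. e * deriv (S r) x)" using int by simp
      fix x assume x: "x \<in> space (time \<mu>)"
      show "\<bar>(d x - d r) * deriv (S r) x\<bar> \<le> e * deriv (S r) x"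
      proof (cases "x \<in> {r..r + \<epsilon>}")
        case True
        then have "\<bar>d x - d r\<bar> \<le> e" using near[of x] x by (auto simp: dist_real_def)
        then show ?thesis using S'nn by (simp add: abs_mult mult_right_mono)
      qed (simp add: S'0)
    qed
    also have "\<dots> = e" using one[OF r] by simp
    finally show ?thesis .
  qed
  have "test_function \<mu> (\<lambda>x. S s x - S t x)"
  proof -
    have "{x. S s x - S t x \<noteq> 0} \<subseteq> {s..t + \<epsilon>}"
    proof
      fix x assume "x \<in> {x. S s x - S t x \<noteq> 0}"
      then show "x \<in> {s..t + \<epsilon>}" using Sl[of x s] Sl[of x t] Sr[of s x] Sr[of t x] st by force
    qed
    then have "closure {x. S s x - S t x \<noteq> 0} \<subseteq> {s..t + \<epsilon>}" by (rule closure_minimal) simp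
    then show ?thesis using st \<epsilon> unfolding test_function_iff by (auto intro: smooth_diff S)
  qed
  from zero[OF this] have "(LINT x|time \<mu>. d x * (deriv (S s) x - deriv (S t) x)) = 0"
    by (subst (asm) DERIV_imp_deriv[OF DERIV_diff[OF smooth_DERIV[OF S] smooth_DERIV[OF S]]])
  then have eq: "(LINT x|time \<mu>. d x * deriv (S s) x) = (LINT x|time \<mu>. d x * deriv (S t) x)"
    using int by (simp add: right_diff_distrib)
  have "\<bar>(LINT x|time \<mu>. d x * deriv (S s) x) - d s\<bar> \<le> e"
    by (rule close) (use st \<epsilon> \<delta>1 in auto)
  moreover have "\<bar>(LINT x|time \<mu>. d x * deriv (S t) x) - d t\<bar> \<le> e"
    by (rule close) (use st \<epsilon> \<delta>2 in auto)
  ultimately have "\<bar>d s - d t\<bar> \<le> 2 * e" unfolding eq by linarith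
  then show False using e by (simp add: e_def)
qed

text \<open>
  The difference of \<open>b\<close> and the primitive has weak derivative \<open>0\<close>, so it is constant on the open
  interval, and by continuity on the closed one.
\<close>

lemma weak_derivative_imp_primitive:
  fixes b G :: "real \<Rightarrow> real"
  assumes \<mu>: "0 < \<mu>" and b: "continuous_on {0..\<mu>} b" and G: "integrable (time \<mu>) G"
    and weak: "\<And>\<phi>. test_function \<mu> \<phi> \<Longrightarrow> - (LINT t|time \<mu>. b t * deriv \<phi> t) = (LINT t|time \<mu>. G t * \<phi> t)"
    and t: "t \<in> {0..\<mu>}"
  shows "b t = b 0 + primitive \<mu> G t"
proof -
  define d where "d t = b t - primitive \<mu> G t" for t
  have d: "continuous_on {0..\<mu>} d" unfolding d_def by (intro continuous_intros b continuous_on_primitive G)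
  have "(LINT t|time \<mu>. d t * deriv \<phi> t) = 0" if "test_function \<mu> \<phi>" for \<phi>
  proof -
    note \<phi> = test_functionD[OF that]
    have "(LINT t|time \<mu>. d t * deriv \<phi> t) = (LINT t|time \<mu>. b t * deriv \<phi> t) - (LINT t|time \<mu>. primitive \<mu> G t * deriv \<phi> t)"
      unfolding d_def left_diff_distrib
      by (intro Bochner_Integration.integral_diff integrable_time_continuous continuous_on_mult b continuous_on_primitive G \<phi>)
    also have "\<dots> = 0" using weak[OF that] primitive_by_parts[OF \<phi>(1,3,5) G] by simp
    finally show ?thesis .
  qed
  then have eq: "d x = d y" if "0 < x" "x < y" "y < \<mu>" for x y
    by (rule du_Bois_Reymond_continuous[OF d _ that])
  have c: "d x = d (\<mu> / 2)" if x: "x \<in> {0<..<\<mu>}" for x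
  proof (cases x "\<mu> / 2" rule: linorder_cases)
    case less
    then show ?thesis using x \<mu> by (intro eq) auto
  next
    case greater
    then have "d (\<mu> / 2) = d x" using x \<mu> by (intro eq) auto
    then show ?thesis by simp
  qed (rule arg_cong[where f = d])
  have cl: "closure {0<..<\<mu>} = {0..\<mu>}" using \<mu> by simp
  have "d x = d (\<mu> / 2)" if "x \<in> {0..\<mu>}" for x
    by (rule continuous_constant_on_closure[of "{0<..<\<mu>}" d]) (simp_all only: cl d c that)
  from this[OF t] this[of 0] show ?thesis
    using \<mu> primitive_0[OF G] by (simp add: d_def)
qed

text \<open>
  The integrating factor \<open>exp (c * t)\<close> may be absorbed into the test function; this reduces the equation
  \<open>a' + c a = g\<close> to \<open>(exp (c * t) a)' = exp (c * t) g\<close>.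
\<close>

lemma weak_decay_imp_mild:
  fixes a g :: "real \<Rightarrow> real"
  assumes \<mu>: "0 < \<mu>" and a: "continuous_on {0..\<mu>} a" and g: "integrable (time \<mu>) g"
    and weak: "\<And>\<phi>. test_function \<mu> \<phi> \<Longrightarrow>
       - (LINT t|time \<mu>. a t * deriv \<phi> t) + (LINT t|time \<mu>. c * a t * \<phi> t) = (LINT t|time \<mu>. g t * \<phi> t)"
    and t: "t \<in> {0..\<mu>}"
  shows "a t = exp (- (c * t)) * a 0 + exp (- (c * t)) * primitive \<mu> (\<lambda>s. exp (c * s) * g s) t"
proof -
  have G: "integrable (time \<mu>) (\<lambda>s. exp (c * s) * g s)" using integrable_exp_mult[OF g, of c] by simp
  have "exp (c * t) * a t = exp (c * 0) * a 0 + primitive \<mu> (\<lambda>s. exp (c * s) * g s) t"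
  proof (rule weak_derivative_imp_primitive[OF \<mu> _ G _ t])
    show "continuous_on {0..\<mu>} (\<lambda>t. exp (c * t) * a t)" by (intro continuous_intros a)
    fix \<phi> assume \<phi>: "test_function \<mu> \<phi>"
    note \<phi>' = test_functionD[OF \<phi>]
    have D: "deriv (\<lambda>t. exp (c * t) * \<phi> t) t = exp (c * t) * deriv \<phi> t + c * (exp (c * t) * \<phi> t)" for t
      by (rule DERIV_imp_deriv) (rule derivative_eq_intros \<phi>' refl | simp)+
    have "- (LINT t|time \<mu>. a t * (exp (c * t) * deriv \<phi> t + c * (exp (c * t) * \<phi> t)))
       + (LINT t|time \<mu>. c * a t * (exp (c * t) * \<phi> t)) = (LINT t|time \<mu>. g t * (exp (c * t) * \<phi> t))"
      using weak[OF test_function_exp_mult[OF \<phi>, of c]] unfolding D .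
    moreover have "(LINT t|time \<mu>. a t * (exp (c * t) * deriv \<phi> t + c * (exp (c * t) * \<phi> t)))
      = (LINT t|time \<mu>. exp (c * t) * a t * deriv \<phi> t) + (LINT t|time \<mu>. c * a t * (exp (c * t) * \<phi> t))"
      by (subst Bochner_Integration.integral_add[symmetric])
        (auto intro!: integrable_time_continuous continuous_intros a \<phi>' simp: algebra_simps)
    ultimately show "- (LINT t|time \<mu>. exp (c * t) * a t * deriv \<phi> t) = (LINT t|time \<mu>. exp (c * t) * g t * \<phi> t)"
      by (simp add: ac_simps)
  qed
  then have "exp (- (c * t)) * (exp (c * t) * a t) = exp (- (c * t)) * (a 0 + primitive \<mu> (\<lambda>s. exp (c * s) * g s) t)"
    by simp
  then show ?thesis by (simp add: mult.assoc[symmetric] distrib_left flip: exp_add)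
qed

lemma mild_imp_weak_decay:
  fixes a g :: "real \<Rightarrow> real"
  assumes a: "\<And>t. t \<in> {0..\<mu>} \<Longrightarrow> a t = exp (- (c * t)) * a0 + exp (- (c * t)) * primitive \<mu> (\<lambda>s. exp (c * s) * g s) t"
    and g: "integrable (time \<mu>) g" and \<phi>: "test_function \<mu> \<phi>"
  shows "- (LINT t|time \<mu>. a t * deriv \<phi> t) + (LINT t|time \<mu>. c * a t * \<phi> t) = (LINT t|time \<mu>. g t * \<phi> t)"
proof -
  note \<phi>' = test_functionD[OF \<phi>]
  define P where "P = primitive \<mu> (\<lambda>s. exp (c * s) * g s)"
  define \<eta> where "\<eta> t = exp (- (c * t)) * \<phi> t" for t
  define \<eta>' where "\<eta>' t = exp (- (c * t)) * deriv \<phi> t - c * \<eta> t" for t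
  have G: "integrable (time \<mu>) (\<lambda>s. exp (c * s) * g s)" using integrable_exp_mult[OF g, of c] by simp
  have cP: "continuous_on {0..\<mu>} P" unfolding P_def by (rule continuous_on_primitive[OF G])
  have \<eta>D: "(\<eta> has_real_derivative \<eta>' t) (at t)" for t
    unfolding \<eta>_def \<eta>'_def by (rule derivative_eq_intros \<phi>' refl | simp)+
  have c\<eta>': "continuous_on {0..\<mu>} \<eta>'" unfolding \<eta>'_def \<eta>_def by (intro continuous_intros \<phi>')
  have ca: "continuous_on {0..\<mu>} a"
    by (rule continuous_on_eq[of _ "\<lambda>t. exp (- (c * t)) * a0 + exp (- (c * t)) * P t"])
      (auto intro!: continuous_intros cP[unfolded P_def] simp: a P_def)
  have "- (LINT t|time \<mu>. a t * deriv \<phi> t) + (LINT t|time \<mu>. c * a t * \<phi> t)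
     = - (LINT t|time \<mu>. a t * deriv \<phi> t - c * a t * \<phi> t)"
    by (subst Bochner_Integration.integral_diff)
      (auto intro!: integrable_time_continuous continuous_intros ca \<phi>')
  also have "(LINT t|time \<mu>. a t * deriv \<phi> t - c * a t * \<phi> t) = (LINT t|time \<mu>. a0 * \<eta>' t + P t * \<eta>' t)"
    by (rule Bochner_Integration.integral_cong) (simp_all add: a \<eta>'_def \<eta>_def P_def algebra_simps)
  also have "\<dots> = a0 * (LINT t|time \<mu>. \<eta>' t) + (LINT t|time \<mu>. P t * \<eta>' t)"
    by (subst Bochner_Integration.integral_add) (auto intro!: integrable_time_continuous continuous_intros cP c\<eta>')
  also have "(LINT t|time \<mu>. P t * \<eta>' t) = - (LINT t|time \<mu>. exp (c * t) * g t * \<eta> t)"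
    unfolding P_def by (rule primitive_by_parts[OF \<eta>D c\<eta>' _ G]) (simp add: \<eta>_def \<phi>')
  also have "(LINT t|time \<mu>. exp (c * t) * g t * \<eta> t) = (LINT t|time \<mu>. g t * \<phi> t)"
    by (rule Bochner_Integration.integral_cong) (simp_all add: \<eta>_def exp_minus field_simps)
  also have "(LINT t|time \<mu>. \<eta>' t) = 0"
  proof (cases "0 \<le> \<mu>")
    case True
    have "(LINT t|time \<mu>. \<eta>' t) = (LINT t|time \<mu>. indicator {..t} 0 * \<eta>' t)"
      by (rule Bochner_Integration.integral_cong) auto
    also have "\<dots> = \<eta> \<mu> - \<eta> 0" by (rule LINT_time_derivative[OF \<eta>D c\<eta>']) (use True in auto)
    finally show ?thesis by (simp add: \<eta>_def \<phi>')
  next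
    case False
    then show ?thesis by (intro Bochner_Integration.integral_empty) simp
  qed
  finally show ?thesis by simp
qed

section \<open>Square integrable functions with values in a Sobolev space\<close>

lemma Vnorm_nonneg: "0 < L \<Longrightarrow> 0 \<le> Vnorm L s u"
  by (simp add: Vnorm_eq)

lemma Vnorm_square: "0 < L \<Longrightarrow> (Vnorm L s u)\<^sup>2 = L ^ 3 * enn2real (sob L s u)"
  by (simp add: Vnorm_eq)

lemma ennreal_Vnorm_square:
  assumes "0 < L" "sob L s u < \<infinity>"
  shows "ennreal ((Vnorm L s u)\<^sup>2) = ennreal (L ^ 3) * sob L s u"
  using assms by (simp add: Vnorm_square ennreal_mult)

text \<open>
  Convergence in \<open>V\<^sup>s\<close> implies convergence of each coefficient; this transfers measurability and
  continuity from curves in \<open>V\<^sup>s\<close> to the coefficients.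
\<close>

lemma coefficient_le_Vnorm:
  assumes L: "0 < L" and fin: "sob L s u < \<infinity>"
  shows "sqrt (L ^ 3) * wn L k powr s * norm (u k) \<le> Vnorm L s u"
proof -
  have "ennreal (wn L k powr (2 * s) * (norm (u k))\<^sup>2) \<le> ennreal (enn2real (sob L s u))"
    using sob_coefficient_le[of L k s u] fin by simp
  then have "wn L k powr (2 * s) * (norm (u k))\<^sup>2 \<le> enn2real (sob L s u)" by (simp add: ennreal_le_iff)
  then have "(wn L k powr s * norm (u k))\<^sup>2 \<le> enn2real (sob L s u)"
    by (simp add: power_mult_distrib powr_square)
  then have "wn L k powr s * norm (u k) \<le> sqrt (enn2real (sob L s u))" by (rule real_le_rsqrt)
  then have "sqrt (L ^ 3) * (wn L k powr s * norm (u k)) \<le> sqrt (L ^ 3) * sqrt (enn2real (sob L s u))"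
    using L by (intro mult_left_mono) auto
  then show ?thesis by (simp add: Vnorm_eq real_sqrt_mult mult.assoc)
qed

lemma Vsp_diff: "0 < L \<Longrightarrow> u \<in> Vsp L s \<Longrightarrow> v \<in> Vsp L s \<Longrightarrow> vdiff u v \<in> Vsp L s"
  using sob_diff_finite[of L s u v] sol_diff[of L u v] by (simp add: Vsp_iff vdiff_def)

lemma tendsto_coefficient:
  assumes L: "0 < L" and S: "\<And>n. S n \<in> Vsp L s" and u: "u \<in> Vsp L s"
    and lim: "(\<lambda>n. Vdist L s (S n) u) \<longlonglongrightarrow> 0"
  shows "(\<lambda>n. S n k) \<longlonglongrightarrow> u k"
proof (cases "k = 0")
  case True
  have "S n 0 = 0" for n using S[of n] by (simp add: Vsp_def zero_mean_def)
  moreover have "u 0 = 0" using u by (simp add: Vsp_def zero_mean_def)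
  ultimately show ?thesis using True by simp
next
  case False
  define c where "c = sqrt (L ^ 3) * wn L k powr s"
  have c: "0 < c" using L wn_pos[OF L False] by (simp add: c_def)
  have "norm (S n k - u k) \<le> Vdist L s (S n) u / c" for n
    using coefficient_le_Vnorm[OF L, of s "vdiff (S n) u" k] Vsp_diff[OF L S[of n] u] c
    by (simp add: Vdist_def Vsp_iff[OF L] vdiff_def c_def field_simps)
  then have le: "\<forall>\<^sub>F n in sequentially. norm (S n k - u k) \<le> Vdist L s (S n) u / c"
    by (intro always_eventually allI)
  have "(\<lambda>n. Vdist L s (S n) u / c) \<longlonglongrightarrow> 0 / c"
    by (intro tendsto_divide lim tendsto_const) (use c in simp)
  then have "(\<lambda>n. Vdist L s (S n) u / c) \<longlonglongrightarrow> 0" by (simp only: div_0)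
  from Lim_null_comparison[OF le this] show ?thesis by (rule LIM_zero_cancel)
qed

text \<open>
  The coefficients of the approximating simple functions converge almost everywhere.
\<close>

lemma L2fun_measurable:
  assumes L: "0 < L" and \<psi>: "\<psi> \<in> L2fun L \<mu> s"
  shows "(\<lambda>t. \<psi> t k) \<in> borel_measurable (time \<mu>)"
proof -
  have V: "AE t in time \<mu>. \<psi> t \<in> Vsp L s" and "strongly_measurable L \<mu> s \<psi>"
    using \<psi> by (auto simp: L2fun_def)
  then obtain S where S: "\<And>n. simple_function (time \<mu>) (S n)" "\<And>n t. t \<in> {0..\<mu>} \<Longrightarrow> S n t \<in> Vsp L s"
    and lim: "AE t in time \<mu>. (\<lambda>n. Vdist L s (S n t) (\<psi> t)) \<longlonglongrightarrow> 0"
    unfolding strongly_measurable_def by blast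
  show ?thesis
  proof (rule measurable_AE_limit_time)
    show "(\<lambda>t. S n t k) \<in> borel_measurable (time \<mu>)" for n
      by (intro borel_measurable_simple_function simple_function_compose1[OF S(1), of "\<lambda>u. u k"])
    show "AE t in time \<mu>. (\<lambda>n. S n t k) \<longlonglongrightarrow> \<psi> t k"
      using V lim AE_space
    proof eventually_elim
      case (elim t)
      then show ?case by (intro tendsto_coefficient[OF L _ elim(1)] S) auto
    qed
  qed
qed

text \<open>
  Rounding of all real coordinates to multiples of \<open>1 / q\<close>. It turns a bounded measurable function into
  a simple function that is uniformly close to it.
\<close>

definition grid_floor :: "real \<Rightarrow> complex ^ 3 \<Rightarrow> complex ^ 3" where
  "grid_floor q x = (\<Sum>b\<in>Basis. (of_int \<lfloor>q * (x \<bullet> b)\<rfloor> / q) *\<^sub>R b)"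

lemma abs_divide_diff_le:
  assumes q: "0 < (q::real)" and "\<bar>a - q * y\<bar> \<le> 1" shows "\<bar>a / q - y\<bar> \<le> 1 / q"
proof -
  have e: "a / q - y = (a - q * y) / q" using q by (simp add: diff_divide_distrib)
  have "\<bar>a / q - y\<bar> = \<bar>a - q * y\<bar> / q" unfolding e using q by (simp only: abs_divide abs_of_pos)
  also have "\<dots> \<le> 1 / q" using assms by (intro divide_right_mono) auto
  finally show ?thesis .
qed

lemma norm_grid_floor_diff:
  assumes q: "0 < q"
  shows "norm (grid_floor q x - x) \<le> real DIM(complex ^ 3) / q"
proof -
  have "grid_floor q x - x = (\<Sum>b\<in>Basis. (of_int \<lfloor>q * (x \<bullet> b)\<rfloor> / q - x \<bullet> b) *\<^sub>R b)"
    unfolding grid_floor_def by (subst (2) euclidean_representation[of x, symmetric]) (simp add: scaleR_diff_left sum_subtractf)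
  also have "norm \<dots> \<le> (\<Sum>b\<in>Basis. norm ((of_int \<lfloor>q * (x \<bullet> b)\<rfloor> / q - x \<bullet> b) *\<^sub>R b))" by (rule norm_sum)
  also have "\<dots> \<le> (\<Sum>b\<in>(Basis :: (complex ^ 3) set). 1 / q)"
  proof (rule sum_mono)
    fix b :: "complex ^ 3" assume b: "b \<in> Basis"
    have "\<bar>of_int \<lfloor>q * (x \<bullet> b)\<rfloor> - q * (x \<bullet> b)\<bar> \<le> 1" by linarith
    then have "\<bar>of_int \<lfloor>q * (x \<bullet> b)\<rfloor> / q - x \<bullet> b\<bar> \<le> 1 / q"
      by (rule abs_divide_diff_le[OF q])
    then show "norm ((of_int \<lfloor>q * (x \<bullet> b)\<rfloor> / q - x \<bullet> b) *\<^sub>R b) \<le> 1 / q" using b by simp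
  qed
  also have "\<dots> = real DIM(complex ^ 3) / q" by simp
  finally show ?thesis .
qed

lemma finite_grid_floor_image:
  assumes q: "0 < q"
  shows "finite (grid_floor q ` cball 0 M)"
proof -
  define Z where "Z = {\<lfloor>- (q * M)\<rfloor>..\<lfloor>q * M\<rfloor>}"
  have "grid_floor q ` cball 0 M \<subseteq> (\<lambda>f. \<Sum>b\<in>Basis. (of_int (f b) / q) *\<^sub>R b) ` (Basis \<rightarrow>\<^sub>E Z)"
  proof
    fix y assume "y \<in> grid_floor q ` cball 0 M"
    then obtain x where x: "norm x \<le> M" and y: "y = grid_floor q x" by auto
    have "\<lfloor>q * (x \<bullet> b)\<rfloor> \<in> Z" if b: "b \<in> Basis" for b
    proof -
      have "\<bar>x \<bullet> b\<bar> \<le> M" using Basis_le_norm[OF b, of x] x by linarith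
      then have "q * - M \<le> q * (x \<bullet> b)" "q * (x \<bullet> b) \<le> q * M" using q by (intro mult_left_mono; linarith)+
      then show ?thesis unfolding Z_def by (simp add: floor_mono)
    qed
    then have "(\<lambda>b\<in>Basis. \<lfloor>q * (x \<bullet> b)\<rfloor>) \<in> Basis \<rightarrow>\<^sub>E Z" by auto
    then show "y \<in> (\<lambda>f. \<Sum>b\<in>Basis. (of_int (f b) / q) *\<^sub>R b) ` (Basis \<rightarrow>\<^sub>E Z)"
      by (rule rev_image_eqI) (simp add: y grid_floor_def)
  qed
  then show ?thesis by (rule finite_subset) (intro finite_imageI finite_PiE, auto simp: Z_def)
qed

lemma simple_function_grid_floor:
  assumes [measurable]: "f \<in> borel_measurable N" and bd: "\<And>t. t \<in> space N \<Longrightarrow> norm (f t) \<le> M" and q: "0 < q"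
  shows "simple_function N (\<lambda>t. grid_floor q (f t))"
proof (rule simple_function_borel_measurable)
  note [measurable] = borel_measurable_real_floor
  show "(\<lambda>t. grid_floor q (f t)) \<in> borel_measurable N"
    unfolding grid_floor_def
    by (intro borel_measurable_sum borel_measurable_scaleR borel_measurable_divide borel_measurable_const
        measurable_compose[OF _ borel_measurable_real_floor] borel_measurable_times borel_measurable_inner assms(1))
  have "(\<lambda>t. grid_floor q (f t)) ` space N \<subseteq> grid_floor q ` cball 0 M" using bd by auto
  then show "finite ((\<lambda>t. grid_floor q (f t)) ` space N)"
    by (rule finite_subset[OF _ finite_grid_floor_image[OF q]])
qed

lemma simple_function_restrict:
  assumes I: "finite I" and f: "\<And>i. i \<in> I \<Longrightarrow> simple_function N (f i)"
  shows "simple_function N (\<lambda>t. \<lambda>i\<in>I. f i t)"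
  unfolding simple_function_def
proof (intro conjI ballI)
  have "(\<lambda>t. \<lambda>i\<in>I. f i t) ` space N \<subseteq> (\<Pi>\<^sub>E i\<in>I. f i ` space N)" by auto
  then show "finite ((\<lambda>t. \<lambda>i\<in>I. f i t) ` space N)"
    by (rule finite_subset) (intro finite_PiE I simple_functionD(1) f)
  fix y assume "y \<in> (\<lambda>t. \<lambda>i\<in>I. f i t) ` space N"
  then have y: "y \<in> extensional I" by auto
  have "(\<lambda>t. \<lambda>i\<in>I. f i t) -` {y} \<inter> space N = {t \<in> space N. \<forall>i\<in>I. f i t = y i}"
    using y by (auto simp: fun_eq_iff extensional_def restrict_def)
  also have "\<dots> \<in> sets N"
  proof (rule sets.sets_Collect_finite_All[OF _ I])
    fix i assume "i \<in> I"
    from simple_functionD(2)[OF f[OF this], of "{y i}"]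
    show "{t \<in> space N. f i t = y i} \<in> sets N" by (simp add: vimage_def Int_def conj_commute)
  qed
  finally show "(\<lambda>t. \<lambda>i\<in>I. f i t) -` {y} \<inter> space N \<in> sets N" .
qed

lemma sob_finite_support:
  assumes "finite S" "\<And>k. k \<notin> S \<Longrightarrow> u k = 0"
  shows "sob L s u < \<infinity>"
proof -
  have "sob L s u = (\<Sum>k\<in>S. ennreal (wn L k powr (2 * s) * (norm (u k))\<^sup>2))"
    unfolding sob_def using assms by (intro nn_integral_count_space') auto
  then show ?thesis by simp
qed

text \<open>
  Rounded coefficients need not belong to a real divergence-free field. This projection repairs that; it
  is the identity on solenoidal fields and increases distances by a bounded factor only.
\<close>

definition sol_project :: "real \<Rightarrow> vfield \<Rightarrow> vfield" where
  "sol_project L c k = leray L k ((1 / 2) *\<^sub>R (c k + vcnj (c (- k))))"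

lemma vcnj_simps [simp]: "vcnj (vcnj x) = x" "vcnj (x + y) = vcnj x + vcnj y" "vcnj (x - y) = vcnj x - vcnj y"
  "vcnj (r *\<^sub>R x) = r *\<^sub>R vcnj x" "vcnj 0 = 0"
  by (simp_all add: vcnj_def vec_eq_iff)

lemma sol_sol_project: "0 < L \<Longrightarrow> solenoidal L (sol_project L c)"
  unfolding sol_iff sol_project_def by (simp add: cdot_leray leray_vcnj[symmetric] add.commute)

lemma sol_project_id:
  assumes "solenoidal L u" shows "sol_project L u k = u k"
proof (cases "k = 0")
  case True
  then show ?thesis using assms by (simp add: sol_project_def sol_iff)
next
  case False
  have "u (- k) = vcnj (u k)" using assms by (simp add: sol_iff)
  then have "(1 / 2) *\<^sub>R (u k + vcnj (u (- k))) = u k" by (simp add: scaleR_2[symmetric])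
  then show ?thesis using assms False by (simp add: sol_project_def leray_id sol_iff)
qed

lemma norm_sol_project_diff:
  assumes L: "0 < L"
  shows "norm (sol_project L c k - sol_project L d k) \<le> norm (c k - d k) + norm (c (- k) - d (- k))"
proof -
  have "sol_project L c k - sol_project L d k = leray L k ((1 / 2) *\<^sub>R ((c k - d k) + vcnj (c (- k) - d (- k))))"
    unfolding sol_project_def leray_diff[symmetric] by (simp add: algebra_simps)
  also have "norm \<dots> \<le> 2 * norm ((1 / 2) *\<^sub>R ((c k - d k) + vcnj (c (- k) - d (- k))))"
    by (rule norm_leray_le[OF L])
  also have "\<dots> = norm ((c k - d k) + vcnj (c (- k) - d (- k)))" by simp
  also have "\<dots> \<le> norm (c k - d k) + norm (vcnj (c (- k) - d (- k)))" by (rule norm_triangle_ineq)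
  finally show ?thesis by (simp only: norm_vcnj)
qed

text \<open>
  Coefficientwise measurability is enough for strong measurability. The coefficients in the box of size
  \<open>N\<close> are rounded and projected to solenoidal fields. The error consists of the tail outside the box,
  which tends to \<open>0\<close> because \<open>u t\<close> is in \<open>V\<^sup>s\<close>, and of the rounding errors inside.
\<close>

lemma strongly_measurableI:
  assumes L: "0 < L" and m: "\<And>k. (\<lambda>t. u t k) \<in> borel_measurable (time \<mu>)"
    and bd: "\<And>t k. t \<in> {0..\<mu>} \<Longrightarrow> norm (u t k) \<le> M"
    and V: "AE t in time \<mu>. u t \<in> Vsp L s"
  shows "strongly_measurable L \<mu> s u"
proof -
  define W where "W N = (\<Sum>k\<in>mode_box N. wn L k powr (2 * s))" for N
  have W0: "0 \<le> W N" for N unfolding W_def by (intro sum_nonneg) simp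
  define D where "D = real DIM(complex ^ 3)"
  \<comment> \<open>The grid is so fine that the rounding errors, weighted by \<open>W N\<close>, add up to at most \<open>1 / (N + 1)\<close>.\<close>
  define q where "q N = 2 * D * (real N + 1) * (1 + W N)" for N
  have D: "0 < D" by (simp add: D_def)
  have q: "0 < q N" for N using W0[of N] D by (simp add: q_def add_pos_nonneg)
  define c where "c N t k = (if k \<in> mode_box N then grid_floor (q N) (u t k) else 0)" for N t k
  define S where "S N t = sol_project L (c N t)" for N t
  have neg: "- k \<in> mode_box N \<longleftrightarrow> k \<in> mode_box N" for k N by (auto simp: mode_box_def)
  have S0: "S N t k = 0" if "k \<notin> mode_box N" for N t k
    using that by (simp add: S_def sol_project_def c_def neg leray_def)
  have SV: "S N t \<in> Vsp L s" for N t
    unfolding Vsp_iff[OF L] using sob_finite_support[OF finite_mode_box[of N] S0] sol_sol_project[OF L]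
    by (auto simp: S_def)
  have simple: "simple_function (time \<mu>) (S N)" for N
  proof -
    have "simple_function (time \<mu>) (\<lambda>t. \<lambda>k\<in>mode_box N. grid_floor (q N) (u t k))"
      by (intro simple_function_restrict finite_mode_box simple_function_grid_floor[of _ _ M] m q) (simp add: bd)
    from simple_function_compose1[OF this, of "\<lambda>g. sol_project L (\<lambda>k. if k \<in> mode_box N then g k else 0)"]
    show ?thesis by (simp add: S_def[abs_def] c_def[abs_def] cong: if_cong)
  qed
  have lim: "(\<lambda>N. Vdist L s (S N t) (u t)) \<longlonglongrightarrow> 0" if t: "t \<in> {0..\<mu>}" and ut: "u t \<in> Vsp L s" for t
  proof -
    have solenoidal: "solenoidal L (u t)" and fin: "sob L s (u t) < \<infinity>" using ut by (auto simp: Vsp_iff[OF L])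
    define tail where "tail N = (\<integral>\<^sup>+k. (if k \<in> mode_box N then 0 else ennreal (wn L k powr (2 * s) * (norm (u t k))\<^sup>2)) \<partial>count_space UNIV)" for N
    have tail: "tail \<longlonglongrightarrow> 0"
    proof -
      have "tail \<longlonglongrightarrow> (\<integral>\<^sup>+k. 0 \<partial>count_space (UNIV :: (int ^ 3) set))"
        unfolding tail_def
      proof (rule nn_integral_dominated_convergence[where w = "\<lambda>k. ennreal (wn L k powr (2 * s) * (norm (u t k))\<^sup>2)"])
        show "AE k in count_space UNIV. (\<lambda>N. if k \<in> mode_box N then 0 else ennreal (wn L k powr (2 * s) * (norm (u t k))\<^sup>2)) \<longlonglongrightarrow> 0"
        proof (rule AE_I2, rule tendsto_eventually)
          fix k :: "int ^ 3"
          show "\<forall>\<^sub>F N in sequentially. (if k \<in> mode_box N then 0 else ennreal (wn L k powr (2 * s) * (norm (u t k))\<^sup>2)) = 0"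
            using eventually_mode_box[of k] by eventually_elim simp
        qed
      qed (use fin in \<open>auto simp: sob_def\<close>)
      then show ?thesis by simp
    qed
    have le: "sob L s (vdiff (S N t) (u t)) \<le> ennreal (1 / (real N + 1)) + tail N" for N
    proof -
      have close: "norm (S N t k - u t k) \<le> 2 * D / q N" if k: "k \<in> mode_box N" for k
      proof -
        have "norm (S N t k - u t k) \<le> norm (c N t k - u t k) + norm (c N t (- k) - u t (- k))"
          using norm_sol_project_diff[OF L, of "c N t" k "u t"] by (simp add: S_def sol_project_id[OF solenoidal])
        also have "\<dots> \<le> D / q N + D / q N"
          unfolding c_def D_def using k neg[of k N] norm_grid_floor_diff[OF q[of N]]
          by (intro add_mono) simp_all
        finally show ?thesis by simp
      qed
      have small: "W N * (2 * D / q N)\<^sup>2 \<le> 1 / (real N + 1)"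
      proof -
        define r where "r = (real N + 1) * (1 + W N)"
        have r12: "real N + 1 \<le> r" "1 + W N \<le> r"
          using mult_left_mono[of 1 "1 + W N" "real N + 1"] mult_right_mono[of 1 "real N + 1" "1 + W N"] W0[of N]
          by (auto simp: r_def)
        have r: "real N + 1 \<le> r" "1 + W N \<le> r" "1 \<le> r"
          using r12 W0[of N] by linarith+
        have "2 * D / q N = 1 / r" using D by (simp add: q_def r_def)
        then have "W N * (2 * D / q N)\<^sup>2 = W N / r * (1 / r)" by (simp add: power2_eq_square)
        also have "\<dots> \<le> 1 * (1 / (real N + 1))"
        proof (rule mult_mono)
          have "W N \<le> r" "0 < r" using r12 W0[of N] by linarith+
          then show "W N / r \<le> 1" by (simp only: divide_le_eq_1_pos)
          show "1 / r \<le> 1 / (real N + 1)" by (rule frac_le) (use r12 in linarith)+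
          show "0 \<le> 1 / r" using \<open>0 < r\<close> by simp
        qed simp
        finally show ?thesis by simp
      qed
      have "sob L s (vdiff (S N t) (u t)) \<le> (\<integral>\<^sup>+k. (if k \<in> mode_box N then ennreal (wn L k powr (2 * s) * (2 * D / q N)\<^sup>2) else 0)
          + (if k \<in> mode_box N then 0 else ennreal (wn L k powr (2 * s) * (norm (u t k))\<^sup>2)) \<partial>count_space UNIV)"
        unfolding sob_def vdiff_def
      proof (rule nn_integral_mono)
        fix k
        show "ennreal (wn L k powr (2 * s) * (norm (S N t k - u t k))\<^sup>2)
          \<le> (if k \<in> mode_box N then ennreal (wn L k powr (2 * s) * (2 * D / q N)\<^sup>2) else 0)
            + (if k \<in> mode_box N then 0 else ennreal (wn L k powr (2 * s) * (norm (u t k))\<^sup>2))"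
        proof (cases "k \<in> mode_box N")
          case True
          then show ?thesis by (simp add: ennreal_leI mult_left_mono power_mono[OF close])
        qed (simp add: S0)
      qed
      also have "\<dots> = (\<integral>\<^sup>+k. (if k \<in> mode_box N then ennreal (wn L k powr (2 * s) * (2 * D / q N)\<^sup>2) else 0) \<partial>count_space UNIV) + tail N"
        unfolding tail_def by (rule nn_integral_add) auto
      also have "(\<integral>\<^sup>+k. (if k \<in> mode_box N then ennreal (wn L k powr (2 * s) * (2 * D / q N)\<^sup>2) else 0) \<partial>count_space UNIV)
          = (\<Sum>k\<in>mode_box N. ennreal (wn L k powr (2 * s) * (2 * D / q N)\<^sup>2))"
        by (subst nn_integral_count_space'[of "mode_box N"]) (auto simp: finite_mode_box)
      also have "\<dots> = ennreal (W N * (2 * D / q N)\<^sup>2)"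
        by (simp add: W_def sum_distrib_right)
      also have "\<dots> \<le> ennreal (1 / (real N + 1))" by (rule ennreal_leI[OF small])
      finally show ?thesis by (simp add: add_right_mono)
    qed
    have "(\<lambda>N. ennreal (1 / (real N + 1)) + tail N) \<longlonglongrightarrow> ennreal 0 + 0"
      by (intro tendsto_add tail tendsto_ennrealI) (use LIMSEQ_inverse_real_of_nat in \<open>simp add: inverse_eq_divide add.commute\<close>)
    then have "(\<lambda>N. sob L s (vdiff (S N t) (u t))) \<longlonglongrightarrow> 0"
      by (intro tendsto_sandwich[OF _ always_eventually[OF allI[OF le]] tendsto_const]) simp_all
    then have "(\<lambda>N. enn2real (sob L s (vdiff (S N t) (u t)))) \<longlonglongrightarrow> 0"
      by (intro tendsto_enn2real) auto
    then have "(\<lambda>N. sqrt (L ^ 3 * enn2real (sob L s (vdiff (S N t) (u t))))) \<longlonglongrightarrow> sqrt (L ^ 3 * 0)"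
      by (intro tendsto_real_sqrt tendsto_mult tendsto_const)
    then show ?thesis by (simp add: Vdist_def Vnorm_eq)
  qed
  have "AE t in time \<mu>. (\<lambda>N. Vdist L s (S N t) (u t)) \<longlonglongrightarrow> 0"
    using V AE_space by eventually_elim (rule lim, auto)
  then show ?thesis
    unfolding strongly_measurable_def by (intro exI[of _ S] conjI allI ballI simple SV)
qed

lemma borel_measurable_Vnorm:
  assumes "\<And>k. (\<lambda>t. u t k) \<in> borel_measurable M"
  shows "(\<lambda>t. Vnorm L s (u t)) \<in> borel_measurable M"
proof -
  note [measurable] = borel_measurable_sob[OF assms]
  show ?thesis unfolding Vnorm_eq by measurable
qed

text \<open>
  The bound on the coefficients is harmless: it will be applied to curves that are bounded in \<open>V\<^sup>\<alpha>\<close>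
  with \<open>\<alpha> \<ge> 0\<close>.
\<close>

lemma L2funI:
  assumes L: "0 < L" and m: "\<And>k. (\<lambda>t. u t k) \<in> borel_measurable (time \<mu>)"
    and bd: "\<And>t k. t \<in> {0..\<mu>} \<Longrightarrow> norm (u t k) \<le> M"
    and solenoidal: "AE t in time \<mu>. solenoidal L (u t)" and fin: "(\<integral>\<^sup>+t. sob L s (u t) \<partial>time \<mu>) < \<infinity>"
  shows "u \<in> L2fun L \<mu> s"
proof -
  note [measurable] = borel_measurable_sob[OF m] borel_measurable_Vnorm[OF m]
  have ae: "AE t in time \<mu>. sob L s (u t) \<noteq> \<infinity>"
    using fin by (intro nn_integral_PInf_AE) auto
  have V: "AE t in time \<mu>. u t \<in> Vsp L s"
    using ae solenoidal by eventually_elim (simp add: Vsp_iff[OF L] less_top)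
  have "(\<integral>\<^sup>+t. ennreal ((Vnorm L s (u t))\<^sup>2) \<partial>time \<mu>) = (\<integral>\<^sup>+t. ennreal (L ^ 3) * sob L s (u t) \<partial>time \<mu>)"
  proof (rule nn_integral_cong_AE)
    show "AE t in time \<mu>. ennreal ((Vnorm L s (u t))\<^sup>2) = ennreal (L ^ 3) * sob L s (u t)"
      using ae by eventually_elim (simp add: ennreal_Vnorm_square L less_top)
  qed
  also have "\<dots> < \<infinity>" using fin by (simp add: nn_integral_cmult ennreal_mult_less_top)
  finally have "integrable (time \<mu>) (\<lambda>t. (Vnorm L s (u t))\<^sup>2)"
    by (simp add: integrable_iff_bounded)
  with V strongly_measurableI[OF L m bd V] show ?thesis by (simp add: L2fun_def)
qed

lemma L2fun_Vsp: "\<psi> \<in> L2fun L \<mu> s \<Longrightarrow> AE t in time \<mu>. \<psi> t \<in> Vsp L s"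
  by (simp add: L2fun_def)

lemma L2fun_nn_integral_sob:
  assumes L: "0 < L" and \<psi>: "\<psi> \<in> L2fun L \<mu> s"
  shows "ennreal (L ^ 3) * (\<integral>\<^sup>+t. sob L s (\<psi> t) \<partial>time \<mu>) = ennreal (LINT t|time \<mu>. (Vnorm L s (\<psi> t))\<^sup>2)"
proof -
  note [measurable] = borel_measurable_sob[OF L2fun_measurable[OF assms]]
  have "ennreal (L ^ 3) * (\<integral>\<^sup>+t. sob L s (\<psi> t) \<partial>time \<mu>) = (\<integral>\<^sup>+t. ennreal (L ^ 3) * sob L s (\<psi> t) \<partial>time \<mu>)"
    by (simp add: nn_integral_cmult)
  also have "\<dots> = (\<integral>\<^sup>+t. ennreal ((Vnorm L s (\<psi> t))\<^sup>2) \<partial>time \<mu>)"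
  proof (rule nn_integral_cong_AE)
    show "AE t in time \<mu>. ennreal (L ^ 3) * sob L s (\<psi> t) = ennreal ((Vnorm L s (\<psi> t))\<^sup>2)"
      using L2fun_Vsp[OF \<psi>] by eventually_elim (simp add: ennreal_Vnorm_square L Vsp_iff)
  qed
  also have "\<dots> = ennreal (LINT t|time \<mu>. (Vnorm L s (\<psi> t))\<^sup>2)"
    using \<psi> by (intro nn_integral_eq_integral) (auto simp: L2fun_def)
  finally show ?thesis .
qed

lemma L2fun_sob_finite:
  assumes L: "0 < L" and \<psi>: "\<psi> \<in> L2fun L \<mu> s"
  shows "(\<integral>\<^sup>+t. sob L s (\<psi> t) \<partial>time \<mu>) < \<infinity>"
proof -
  have "ennreal (L ^ 3) * (\<integral>\<^sup>+t. sob L s (\<psi> t) \<partial>time \<mu>) < \<infinity>"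
    unfolding L2fun_nn_integral_sob[OF assms] by simp
  then show ?thesis using L by (auto simp: ennreal_mult_less_top)
qed

section \<open>The phase space is a metric space\<close>

lemma equiv_L2rel: "equiv (L2fun L \<mu> s) (L2rel L \<mu> s)"
proof (rule equivI)
  show "refl_on (L2fun L \<mu> s) (L2rel L \<mu> s)" by (auto simp: refl_on_def L2rel_def)
  show "sym (L2rel L \<mu> s)" by (auto simp: sym_def L2rel_def elim!: eventually_mono)
  show "trans (L2rel L \<mu> s)"
    unfolding trans_def L2rel_def by (auto elim!: eventually_elim2)
qed (auto simp: L2rel_def)

lemma rep_L2sp:
  assumes "X \<in> L2sp L \<mu> s"
  shows "rep X \<in> L2fun L \<mu> s" "L2class L \<mu> s (rep X) = X"
proof -
  obtain \<psi> where \<psi>: "\<psi> \<in> L2fun L \<mu> s" "X = L2rel L \<mu> s `` {\<psi>}"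
    using assms unfolding L2sp_def by (rule quotientE)
  then have "\<psi> \<in> X" using equiv_class_self[OF equiv_L2rel] by blast
  then have r: "rep X \<in> X" unfolding rep_def by (rule someI[of "\<lambda>\<psi>. \<psi> \<in> X"])
  then have rel: "(\<psi>, rep X) \<in> L2rel L \<mu> s" using \<psi>(2) by simp
  then show "rep X \<in> L2fun L \<mu> s" by (simp add: L2rel_def)
  show "L2class L \<mu> s (rep X) = X"
    unfolding L2class_def \<psi>(2)
    using equiv_class_eq[OF equiv_L2rel rel] \<psi>(2) by simp
qed

lemma L2class_L2sp: "\<psi> \<in> L2fun L \<mu> s \<Longrightarrow> L2class L \<mu> s \<psi> \<in> L2sp L \<mu> s"
  unfolding L2class_def L2sp_def by (rule quotientI)

lemma L2class_eqI:
  "\<psi> \<in> L2fun L \<mu> s \<Longrightarrow> \<phi> \<in> L2fun L \<mu> s \<Longrightarrow> (AE t in time \<mu>. \<psi> t = \<phi> t) \<Longrightarrow> L2class L \<mu> s \<psi> = L2class L \<mu> s \<phi>"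
  unfolding L2class_def by (rule equiv_class_eq[OF equiv_L2rel]) (simp add: L2rel_def)

lemma AE_rep_L2class:
  assumes "\<psi> \<in> L2fun L \<mu> s"
  shows "AE t in time \<mu>. rep (L2class L \<mu> s \<psi>) t = \<psi> t"
proof -
  have "L2class L \<mu> s (rep (L2class L \<mu> s \<psi>)) = L2class L \<mu> s \<psi>"
    by (rule rep_L2sp(2)[OF L2class_L2sp[OF assms]])
  then have "(rep (L2class L \<mu> s \<psi>), \<psi>) \<in> L2rel L \<mu> s"
    unfolding L2class_def using assms
    by (intro eq_equiv_class[OF _ equiv_L2rel]) (simp_all add: L2class_def)
  then show ?thesis by (simp add: L2rel_def)
qed

lemma L2dist_integrable:
  assumes L: "0 < L" and \<psi>: "\<psi> \<in> L2fun L \<mu> s" and \<phi>: "\<phi> \<in> L2fun L \<mu> s"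
  shows "(\<lambda>t. Vdist L s (\<psi> t) (\<phi> t)) \<in> borel_measurable (time \<mu>)"
    and "integrable (time \<mu>) (\<lambda>t. (Vdist L s (\<psi> t) (\<phi> t))\<^sup>2)"
    and "ennreal (L ^ 3) * (\<integral>\<^sup>+t. sob L s (vdiff (\<psi> t) (\<phi> t)) \<partial>time \<mu>) = ennreal (LINT t|time \<mu>. (Vdist L s (\<psi> t) (\<phi> t))\<^sup>2)"
proof -
  note m = L2fun_measurable[OF L \<psi>] L2fun_measurable[OF L \<phi>]
  have md: "\<And>k. (\<lambda>t. vdiff (\<psi> t) (\<phi> t) k) \<in> borel_measurable (time \<mu>)"
    unfolding vdiff_def by (intro borel_measurable_diff m)
  note [measurable] = borel_measurable_sob[OF md] borel_measurable_sob[OF m(1)] borel_measurable_sob[OF m(2)]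
  show mm[measurable]: "(\<lambda>t. Vdist L s (\<psi> t) (\<phi> t)) \<in> borel_measurable (time \<mu>)"
    unfolding Vdist_def by (rule borel_measurable_Vnorm[OF md])
  have e: "(\<integral>\<^sup>+t. ennreal ((Vdist L s (\<psi> t) (\<phi> t))\<^sup>2) \<partial>time \<mu>) = ennreal (L ^ 3) * (\<integral>\<^sup>+t. sob L s (vdiff (\<psi> t) (\<phi> t)) \<partial>time \<mu>)"
  proof -
    have "(\<integral>\<^sup>+t. ennreal ((Vdist L s (\<psi> t) (\<phi> t))\<^sup>2) \<partial>time \<mu>) = (\<integral>\<^sup>+t. ennreal (L ^ 3) * sob L s (vdiff (\<psi> t) (\<phi> t)) \<partial>time \<mu>)"
    proof (rule nn_integral_cong_AE)
      show "AE t in time \<mu>. ennreal ((Vdist L s (\<psi> t) (\<phi> t))\<^sup>2) = ennreal (L ^ 3) * sob L s (vdiff (\<psi> t) (\<phi> t))"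
        using L2fun_Vsp[OF \<psi>] L2fun_Vsp[OF \<phi>]
      proof eventually_elim
        case (elim t)
        then show ?case
          using Vsp_diff[OF L elim] unfolding Vdist_def by (intro ennreal_Vnorm_square L) (simp add: Vsp_iff[OF L])
      qed
    qed
    then show ?thesis by (simp add: nn_integral_cmult)
  qed
  have "(\<integral>\<^sup>+t. sob L s (vdiff (\<psi> t) (\<phi> t)) \<partial>time \<mu>) \<le> (\<integral>\<^sup>+t. 2 * sob L s (\<psi> t) + 2 * sob L s (\<phi> t) \<partial>time \<mu>)"
    unfolding vdiff_def by (intro nn_integral_mono sob_diff_le)
  also have "\<dots> < \<infinity>"
    using L2fun_sob_finite[OF L \<psi>] L2fun_sob_finite[OF L \<phi>]
    by (simp add: nn_integral_add nn_integral_cmult ennreal_mult_less_top)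
  finally show i: "integrable (time \<mu>) (\<lambda>t. (Vdist L s (\<psi> t) (\<phi> t))\<^sup>2)"
    using e by (simp add: integrable_iff_bounded ennreal_mult_less_top)
  show "ennreal (L ^ 3) * (\<integral>\<^sup>+t. sob L s (vdiff (\<psi> t) (\<phi> t)) \<partial>time \<mu>) = ennreal (LINT t|time \<mu>. (Vdist L s (\<psi> t) (\<phi> t))\<^sup>2)"
    unfolding e[symmetric] by (rule nn_integral_eq_integral[OF i]) simp
qed

text \<open>
  The triangle inequality combines the one in \<open>V\<^sup>s\<close> with Minkowski's inequality in time.
\<close>

lemma Metric_space_L2sp:
  assumes L: "0 < L"
  shows "Metric_space (L2sp L \<mu> s) (L2dist L \<mu> s)"
proof
  show "0 \<le> L2dist L \<mu> s x y" for x y by (simp add: L2dist_def)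
  show "L2dist L \<mu> s x y = L2dist L \<mu> s y x" for x y
    unfolding L2dist_def Metric_space.commute[OF Metric_space_Vsp[OF L], of s "rep x _"] ..
  fix x y z assume x: "x \<in> L2sp L \<mu> s" and y: "y \<in> L2sp L \<mu> s"
  note rx = rep_L2sp(1)[OF x] and ry = rep_L2sp(1)[OF y]
  note m = L2fun_measurable[OF L rx] L2fun_measurable[OF L ry]
  have [measurable]: "(\<lambda>t. sob L s (vdiff (rep x t) (rep y t))) \<in> borel_measurable (time \<mu>)"
    unfolding vdiff_def by (intro borel_measurable_sob borel_measurable_diff m)
  have "L2dist L \<mu> s x y = 0 \<longleftrightarrow> ennreal (L ^ 3) * (\<integral>\<^sup>+t. sob L s (vdiff (rep x t) (rep y t)) \<partial>time \<mu>) = 0"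
    unfolding L2dist_integrable(3)[OF L rx ry] L2dist_def by (simp add: ennreal_eq_0_iff antisym_conv)
  also have "\<dots> \<longleftrightarrow> (AE t in time \<mu>. sob L s (vdiff (rep x t) (rep y t)) = 0)"
    using L by (simp add: nn_integral_0_iff_AE)
  also have "\<dots> \<longleftrightarrow> (AE t in time \<mu>. rep x t = rep y t)"
  proof -
    have "AE t in time \<mu>. sob L s (vdiff (rep x t) (rep y t)) = 0 \<longleftrightarrow> rep x t = rep y t"
      using L2fun_Vsp[OF rx] L2fun_Vsp[OF ry]
    proof eventually_elim
      case (elim t)
      then show ?case
        by (subst sob_eq_0_iff[OF L]) (auto simp: vdiff_def fun_eq_iff Vsp_iff[OF L] sol_zero_mean)
    qed
    then show ?thesis by (rule eventually_subst)
  qed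
  also have "\<dots> \<longleftrightarrow> x = y"
  proof
    assume "AE t in time \<mu>. rep x t = rep y t"
    from L2class_eqI[OF rx ry this] show "x = y" using rep_L2sp(2)[OF x] rep_L2sp(2)[OF y] by simp
  qed simp
  finally show "L2dist L \<mu> s x y = 0 \<longleftrightarrow> x = y" .
  assume z: "z \<in> L2sp L \<mu> s"
  note rz = rep_L2sp(1)[OF z]
  show "L2dist L \<mu> s x z \<le> L2dist L \<mu> s x y + L2dist L \<mu> s y z"
    unfolding L2dist_def
  proof (rule Minkowski_integral)
    show "AE t in time \<mu>. \<bar>Vdist L s (rep x t) (rep z t)\<bar> \<le> \<bar>Vdist L s (rep x t) (rep y t)\<bar> + \<bar>Vdist L s (rep y t) (rep z t)\<bar>"
      using L2fun_Vsp[OF rx] L2fun_Vsp[OF ry] L2fun_Vsp[OF rz]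
    proof eventually_elim
      case (elim t)
      then show ?case
        using Metric_space.triangle[OF Metric_space_Vsp[OF L] elim(1,2,3)] Metric_space.nonneg[OF Metric_space_Vsp[OF L]]
        by simp
    qed
  qed (intro L2dist_integrable L rx ry rz)+
qed

section \<open>Geometrically convergent sequences of fields\<close>

lemma sob_diff_eq_0D:
  assumes L: "0 < L" and u: "solenoidal L u" and v: "solenoidal L v" and z: "sob L s (\<lambda>k. u k - v k) = 0"
  shows "u = v"
proof
  fix k
  have "(\<lambda>k. u k - v k) = (\<lambda>k. 0)"
    by (rule iffD1[OF sob_eq_0_iff[OF L] z]) (simp add: sol_zero_mean[OF u] sol_zero_mean[OF v])
  from fun_cong[OF this, of k] show "u k = v k" by simp
qed

lemma sob_telescope:
  fixes x :: "nat \<Rightarrow> vfield"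
  assumes "\<And>n. sob L s (\<lambda>k. x (Suc n) k - x n k) \<le> ennreal (C * (1 / 16) ^ n)" and C: "0 \<le> C"
  shows "sob L s (\<lambda>k. x (n + j) k - x n k) \<le> ennreal (4 * C * (1 / 16) ^ n)"
proof (induction j arbitrary: n)
  case (Suc j)
  have "sob L s (\<lambda>k. x (n + Suc j) k - x n k)
    = sob L s (\<lambda>k. (x (Suc n + j) k - x (Suc n) k) + (x (Suc n) k - x n k))" by simp
  also have "\<dots> \<le> 2 * ennreal (4 * C * (1 / 16) ^ Suc n) + 2 * ennreal (C * (1 / 16) ^ n)"
    by (rule order_trans[OF sob_add_le]) (intro add_mono mult_left_mono Suc.IH assms(1), auto)
  also have "\<dots> = ennreal (2 * (4 * C * (1 / 16) ^ Suc n) + 2 * (C * (1 / 16) ^ n))"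
  proof -
    have two: "2 * ennreal a + 2 * ennreal b = ennreal (2 * a + 2 * b)" if "0 \<le> a" "0 \<le> b" for a b
      using that by (simp add: ennreal_mult)
    show ?thesis by (rule two) (use C in simp_all)
  qed
  also have "\<dots> \<le> ennreal (4 * C * (1 / 16) ^ n)"
    using C by (intro ennreal_leI) (simp add: mult_nonneg_nonneg)
  finally show ?case .
qed (simp add: sob_def)

text \<open>
  A substitute for completeness: a sequence with geometrically decreasing increments converges in every
  coefficient, and Fatou's lemma yields the rate of convergence in the norm. It is used for the
  evolution, at each time separately, and for the steady state.
\<close>

lemma sob_geometric_limit:
  fixes x :: "nat \<Rightarrow> vfield"
  assumes L: "0 < L" and C: "0 \<le> C" and x0: "\<And>n. x n 0 = 0"
    and step: "\<And>n. sob L s (\<lambda>k. x (Suc n) k - x n k) \<le> ennreal (C * (1 / 16) ^ n)"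
  shows "(\<lambda>n. x n k) \<longlonglongrightarrow> lim (\<lambda>n. x n k)"
    and "sob L s (\<lambda>k. lim (\<lambda>n. x n k) - x n k) \<le> ennreal (4 * C * (1 / 16) ^ n)"
proof -
  note tel = sob_telescope[of L s x, OF step C]
  have conv: "(\<lambda>n. x n k) \<longlonglongrightarrow> lim (\<lambda>n. x n k)" for k
  proof (cases "k = 0")
    case False
    have w: "0 < wn L k powr (2 * s)" using wn_pos[OF L False] by simp
    define A where "A = 4 * C / wn L k powr (2 * s)"
    have "(norm (x (n + j) k - x n k))\<^sup>2 \<le> A * (1 / 16) ^ n" for n j
    proof -
      have "ennreal (wn L k powr (2 * s) * (norm (x (n + j) k - x n k))\<^sup>2) \<le> ennreal (4 * C * (1 / 16) ^ n)"
        by (rule order_trans[OF sob_coefficient_le tel])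
      then have "wn L k powr (2 * s) * (norm (x (n + j) k - x n k))\<^sup>2 \<le> 4 * C * (1 / 16) ^ n"
        using C by (subst (asm) ennreal_le_iff) auto
      then show ?thesis using w by (simp add: A_def field_simps)
    qed
    then have le: "norm (x (n + j) k - x n k) \<le> sqrt (A * (1 / 16) ^ n)" for n j
      by (intro real_le_rsqrt)
    have "(\<lambda>n. sqrt (A * (1 / 16) ^ n)) \<longlonglongrightarrow> sqrt (A * 0)"
      by (intro tendsto_real_sqrt tendsto_mult tendsto_const LIMSEQ_power_zero) simp
    then have lim0: "(\<lambda>n. sqrt (A * (1 / 16) ^ n)) \<longlonglongrightarrow> 0" by simp
    have "Cauchy (\<lambda>n. x n k)"
      unfolding Cauchy_altdef2
    proof (intro allI impI)
      fix e :: real assume "0 < e"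
      then have "\<forall>\<^sub>F n in sequentially. sqrt (A * (1 / 16) ^ n) < e" by (rule order_tendstoD(2)[OF lim0])
      then obtain N where N: "sqrt (A * (1 / 16) ^ N) < e" by (auto simp: eventually_sequentially)
      show "\<exists>N. \<forall>n\<ge>N. dist (x n k) (x N k) < e"
      proof (intro exI[of _ N] allI impI)
        fix n assume "N \<le> n"
        then obtain j where "n = N + j" by (auto simp: le_iff_add)
        then show "dist (x n k) (x N k) < e" using le[of N j] N by (simp add: dist_norm)
      qed
    qed
    then show ?thesis by (simp add: Cauchy_convergent_iff convergent_LIMSEQ_iff)
  qed (simp add: x0)
  then show "(\<lambda>n. x n k) \<longlonglongrightarrow> lim (\<lambda>n. x n k)" .
  define F where "F m k = ennreal (wn L k powr (2 * s) * (norm (x (n + m) k - x n k))\<^sup>2)" for m k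
  have "(\<lambda>m. F m k) \<longlonglongrightarrow> ennreal (wn L k powr (2 * s) * (norm (lim (\<lambda>n. x n k) - x n k))\<^sup>2)" for k
    unfolding F_def
    by (intro tendsto_ennrealI tendsto_intros) (use LIMSEQ_ignore_initial_segment[OF conv[of k], of n] in \<open>simp add: add.commute\<close>)
  then have "liminf (\<lambda>m. F m k) = ennreal (wn L k powr (2 * s) * (norm (lim (\<lambda>n. x n k) - x n k))\<^sup>2)" for k
    by (intro lim_imp_Liminf trivial_limit_sequentially)
  then have "sob L s (\<lambda>k. lim (\<lambda>n. x n k) - x n k) = (\<integral>\<^sup>+k. liminf (\<lambda>m. F m k) \<partial>count_space UNIV)"
    unfolding sob_def by simp
  also have "\<dots> \<le> liminf (\<lambda>m. \<integral>\<^sup>+k. F m k \<partial>count_space UNIV)"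
    by (rule nn_integral_liminf) simp
  also have "\<dots> \<le> ennreal (4 * C * (1 / 16) ^ n)"
    by (rule Liminf_le) (use tel[of n] in \<open>auto simp: F_def sob_def\<close>)
  finally show "sob L s (\<lambda>k. lim (\<lambda>n. x n k) - x n k) \<le> ennreal (4 * C * (1 / 16) ^ n)" .
qed

lemma sol_limit:
  assumes x: "\<And>n. solenoidal L (x n)" and lim: "\<And>k. (\<lambda>n. x n k) \<longlonglongrightarrow> y k"
  shows "solenoidal L y"
  unfolding sol_iff
proof (intro conjI allI)
  fix k
  have "(\<lambda>n. vcnj (x n k)) \<longlonglongrightarrow> vcnj (y k)" by (rule bounded_linear.tendsto[OF bounded_linear_vcnj lim])
  moreover have "vcnj (x n k) = x n (- k)" for n using x[of n] by (simp add: sol_iff)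
  ultimately show "y (- k) = vcnj (y k)" using LIMSEQ_unique[OF lim[of "- k"]] by simp
  have "(\<lambda>n. cdot (x n k) (freq L k)) \<longlonglongrightarrow> cdot (y k) (freq L k)"
    by (rule bounded_linear.tendsto[OF bounded_linear_cdot lim])
  moreover have "cdot (x n k) (freq L k) = 0" for n using x[of n] by (simp add: sol_iff)
  ultimately show "cdot (y k) (freq L k) = 0" using LIMSEQ_unique[OF tendsto_const[of 0 sequentially]] by simp
next
  have "x n 0 = 0" for n using x[of n] by (simp add: sol_iff)
  then show "y 0 = 0" using LIMSEQ_unique[OF lim[of 0]] by simp
qed

section \<open>The convective term along curves\<close>

lemma continuous_on_smult_vec: "continuous_on UNIV (\<lambda>z :: complex \<times> (complex ^ 3). fst z *s snd z)"
  unfolding vector_scalar_mult_def by (intro continuous_intros)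

lemma borel_measurable_smult_vec:
  fixes f :: "'b \<Rightarrow> complex" and g :: "'b \<Rightarrow> complex ^ 3"
  assumes "f \<in> borel_measurable M" "g \<in> borel_measurable M"
  shows "(\<lambda>x. f x *s g x) \<in> borel_measurable M"
  by (rule borel_measurable_continuous_Pair[OF assms continuous_on_smult_vec])

lemma borel_measurable_bounded_linear:
  fixes T :: "'b::real_normed_vector \<Rightarrow> 'c::real_normed_vector"
  assumes "bounded_linear T" "f \<in> borel_measurable M"
  shows "(\<lambda>x. T (f x)) \<in> borel_measurable M"
  by (rule measurable_compose[OF assms(2) borel_measurable_continuous_onI]) (rule linear_continuous_on[OF assms(1)])

lemma convection_measurable:
  assumes L: "0 < L" and u: "\<And>k. (\<lambda>t. u t k) \<in> borel_measurable M" and v: "\<And>k. (\<lambda>t. v t k) \<in> borel_measurable M"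
  shows "(\<lambda>t. convection L (u t) (v t) k) \<in> borel_measurable M"
  unfolding convection_def conv_def
  by (intro borel_measurable_bounded_linear[OF bounded_linear_leray[OF L]] borel_measurable_LINT_modes
      borel_measurable_smult_vec borel_measurable_times borel_measurable_const
      borel_measurable_bounded_linear[OF bounded_linear_cdot] u v)

text \<open>
  The space in which the evolution is solved. Only the supremum of the norm in \<open>V\<^sup>\<alpha>\<close> is controlled;
  continuity in time and square integrability in \<open>V\<^sup>1\<^sup>+\<^sup>\<alpha>\<close> follow for fixed points.
\<close>

definition bounded_curve :: "real \<Rightarrow> real \<Rightarrow> real \<Rightarrow> (real \<Rightarrow> vfield) \<Rightarrow> bool" where
  "bounded_curve L \<mu> \<alpha> u \<longleftrightarrow> (\<forall>k. (\<lambda>t. u t k) \<in> borel_measurable (time \<mu>)) \<and>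
     (\<forall>t\<in>{0..\<mu>}. solenoidal L (u t)) \<and> (\<exists>M. \<forall>t\<in>{0..\<mu>}. sob L \<alpha> (u t) \<le> ennreal M)"

lemma bounded_curveD:
  assumes "bounded_curve L \<mu> \<alpha> u"
  shows "(\<lambda>t. u t k) \<in> borel_measurable (time \<mu>)" "t \<in> {0..\<mu>} \<Longrightarrow> solenoidal L (u t)"
    "t \<in> {0..\<mu>} \<Longrightarrow> sob L \<alpha> (u t) < \<infinity>"
proof -
  obtain M where M: "\<forall>t\<in>{0..\<mu>}. sob L \<alpha> (u t) \<le> ennreal M" using assms by (auto simp: bounded_curve_def)
  show "sob L \<alpha> (u t) < \<infinity>" if "t \<in> {0..\<mu>}"
    by (rule le_less_trans[OF M[rule_format, OF that]]) simp
qed (use assms in \<open>auto simp: bounded_curve_def\<close>)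

lemma bounded_curve_diff:
  assumes u: "bounded_curve L \<mu> \<alpha> u" and v: "bounded_curve L \<mu> \<alpha> v"
  shows "bounded_curve L \<mu> \<alpha> (\<lambda>t k. u t k - v t k)"
proof -
  obtain M N where M: "\<forall>t\<in>{0..\<mu>}. sob L \<alpha> (u t) \<le> ennreal M" and N: "\<forall>t\<in>{0..\<mu>}. sob L \<alpha> (v t) \<le> ennreal N"
    using u v by (auto simp: bounded_curve_def)
  have "sob L \<alpha> (\<lambda>k. u t k - v t k) \<le> ennreal (2 * max 0 M + 2 * max 0 N)" if "t \<in> {0..\<mu>}" for t
  proof -
    have "sob L \<alpha> (\<lambda>k. u t k - v t k) \<le> 2 * ennreal (max 0 M) + 2 * ennreal (max 0 N)"
      using M N that by (intro order_trans[OF sob_diff_le] add_mono mult_left_mono) (auto simp: ennreal_max_0)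
    then show ?thesis by (simp add: ennreal_plus ennreal_mult)
  qed
  then show ?thesis
    using bounded_curveD(1)[OF u] bounded_curveD(1)[OF v] bounded_curveD(2)[OF u] bounded_curveD(2)[OF v]
    unfolding bounded_curve_def by (intro conjI allI ballI borel_measurable_diff sol_diff exI[of _ "2 * max 0 M + 2 * max 0 N"])
qed

lemma bounded_curve_coefficient_bound:
  assumes L: "0 < L" and \<alpha>: "0 \<le> \<alpha>" and u: "bounded_curve L \<mu> \<alpha> u"
  obtains B where "\<And>t k. t \<in> {0..\<mu>} \<Longrightarrow> norm (u t k) \<le> B"
proof -
  obtain M where M: "\<forall>t\<in>{0..\<mu>}. sob L \<alpha> (u t) \<le> ennreal M" using u by (auto simp: bounded_curve_def)
  define B where "B = sqrt (max 0 M / (2 * pi / L) powr (2 * \<alpha>))"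
  have p: "0 < (2 * pi / L) powr (2 * \<alpha>)" using L by simp
  have "norm (u t k) \<le> B" if t: "t \<in> {0..\<mu>}" for t k
  proof (cases "k = 0")
    case True
    then show ?thesis using sol_zero_mean[OF bounded_curveD(2)[OF u t]] p by (simp add: B_def)
  next
    case False
    have "ennreal ((2 * pi / L) powr (2 * \<alpha>) * (norm (u t k))\<^sup>2) \<le> ennreal (wn L k powr (2 * \<alpha>) * (norm (u t k))\<^sup>2)"
      using wn_ge[OF L False] L \<alpha> by (intro ennreal_leI mult_right_mono powr_mono2) auto
    also have "\<dots> \<le> ennreal (max 0 M)"
      using order_trans[OF sob_coefficient_le M[rule_format, OF t]] by (simp add: ennreal_max_0)
    finally have "(2 * pi / L) powr (2 * \<alpha>) * (norm (u t k))\<^sup>2 \<le> max 0 M" by (simp add: ennreal_le_iff)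
    then have "(norm (u t k))\<^sup>2 \<le> max 0 M / (2 * pi / L) powr (2 * \<alpha>)" using p by (simp add: pos_le_divide_eq mult.commute)
    then show ?thesis unfolding B_def by (rule real_le_rsqrt)
  qed
  then show ?thesis using that by blast
qed

section \<open>The linearised equations as a fixed point problem\<close>

definition forcing :: "real \<Rightarrow> vfield \<Rightarrow> (real \<Rightarrow> vfield) \<Rightarrow> (real \<Rightarrow> vfield) \<Rightarrow> real \<Rightarrow> vfield" where
  "forcing L f \<psi> u t k = f k - convection L (\<psi> t) (u t) k"

text \<open>
  The data of the system together with a constant for the convective term; such a constant exists by
  \<open>convection_estimate\<close>.
\<close>

locale linearised_NSE =
  fixes L \<mu> \<alpha> \<nu> K :: real and f :: vfield
  assumes L: "0 < L" and \<mu>: "0 < \<mu>" and \<alpha>: "1 / 2 < \<alpha>" and \<nu>: "0 < \<nu>" and f: "f \<in> Vsp L \<alpha>"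
    and K: "0 < K" and convection_le: "\<And>u v. u 0 = 0 \<Longrightarrow> v 0 = 0 \<Longrightarrow>
       sob L (\<alpha> - 1) (convection L u v) \<le> ennreal K * (sob L (1 + \<alpha>) u * sob L \<alpha> v)"
begin

lemma sol_f: "solenoidal L f" and sob_f: "sob L \<alpha> f < \<infinity>" "sob L (\<alpha> - 1) f < \<infinity>"
  using f sob_finite_mono[OF L, of "\<alpha> - 1" \<alpha> f] by (auto simp: Vsp_iff[OF L])

lemma L2fun_facts:
  assumes "\<psi> \<in> L2fun L \<mu> (1 + \<alpha>)"
  shows "(\<lambda>t. \<psi> t k) \<in> borel_measurable (time \<mu>)"
    "AE t in time \<mu>. solenoidal L (\<psi> t) \<and> sob L (1 + \<alpha>) (\<psi> t) < \<infinity> \<and> sob L 0 (\<psi> t) < \<infinity>"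
    "(\<integral>\<^sup>+t. sob L (1 + \<alpha>) (\<psi> t) \<partial>time \<mu>) < \<infinity>"
proof -
  show "AE t in time \<mu>. solenoidal L (\<psi> t) \<and> sob L (1 + \<alpha>) (\<psi> t) < \<infinity> \<and> sob L 0 (\<psi> t) < \<infinity>"
    using L2fun_Vsp[OF assms]
  proof eventually_elim
    case (elim t)
    then show ?case using sob_finite_mono[OF L, of 0 "1 + \<alpha>" "\<psi> t"] \<alpha> by (simp add: Vsp_iff[OF L])
  qed
qed (rule L2fun_measurable[OF L assms] L2fun_sob_finite[OF L assms])+

text \<open>
  The drift is integrated over time and the transported curve is bounded in time, so the product
  estimate can be integrated.
\<close>

lemma convection_time_bound:
  assumes \<psi>: "\<And>k. (\<lambda>t. \<psi> t k) \<in> borel_measurable (time \<mu>)" "AE t in time \<mu>. solenoidal L (\<psi> t)"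
    and u: "bounded_curve L \<mu> \<alpha> u" and S: "\<And>t. t \<in> {0..\<mu>} \<Longrightarrow> sob L \<alpha> (u t) \<le> S"
  shows "(\<integral>\<^sup>+t. sob L (\<alpha> - 1) (convection L (\<psi> t) (u t)) \<partial>time \<mu>)
    \<le> ennreal K * ((\<integral>\<^sup>+t. sob L (1 + \<alpha>) (\<psi> t) \<partial>time \<mu>) * S)"
proof -
  note [measurable] = borel_measurable_sob[OF \<psi>(1)]
  have "(\<integral>\<^sup>+t. sob L (\<alpha> - 1) (convection L (\<psi> t) (u t)) \<partial>time \<mu>)
    \<le> (\<integral>\<^sup>+t. ennreal K * (sob L (1 + \<alpha>) (\<psi> t) * S) \<partial>time \<mu>)"
  proof (rule nn_integral_mono_AE)
    show "AE t in time \<mu>. sob L (\<alpha> - 1) (convection L (\<psi> t) (u t)) \<le> ennreal K * (sob L (1 + \<alpha>) (\<psi> t) * S)"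
      using \<psi>(2) AE_space
    proof eventually_elim
      case (elim t)
      then have t: "t \<in> {0..\<mu>}" by simp
      have "sob L (\<alpha> - 1) (convection L (\<psi> t) (u t)) \<le> ennreal K * (sob L (1 + \<alpha>) (\<psi> t) * sob L \<alpha> (u t))"
        by (rule convection_le[where u = "\<psi> t" and v = "u t", OF sol_zero_mean[OF elim(1)] sol_zero_mean[OF bounded_curveD(2)[OF u t]]])
      also have "\<dots> \<le> ennreal K * (sob L (1 + \<alpha>) (\<psi> t) * S)" by (intro mult_left_mono S t) auto
      finally show ?case .
    qed
  qed
  also have "\<dots> = ennreal K * ((\<integral>\<^sup>+t. sob L (1 + \<alpha>) (\<psi> t) \<partial>time \<mu>) * S)"
    by (simp add: nn_integral_cmult nn_integral_multc)
  finally show ?thesis .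
qed

lemma bounded_curve_sob_0: "bounded_curve L \<mu> \<alpha> u \<Longrightarrow> t \<in> {0..\<mu>} \<Longrightarrow> sob L 0 (u t) < \<infinity>"
  using sob_finite_mono[OF L, of 0 \<alpha> "u t"] bounded_curveD(3)[of L \<mu> \<alpha> u t] \<alpha> by simp

lemma AE_sol_convection:
  assumes \<psi>: "\<psi> \<in> L2fun L \<mu> (1 + \<alpha>)" and u: "bounded_curve L \<mu> \<alpha> u"
  shows "AE t in time \<mu>. solenoidal L (convection L (\<psi> t) (u t))"
  using L2fun_facts(2)[OF \<psi>] AE_space
proof eventually_elim
  case (elim t)
  then show ?case
    using bounded_curveD(2)[OF u, of t] bounded_curve_sob_0[OF u, of t] by (intro sol_convection[OF L]) auto
qed

lemma convection_time_finite:
  assumes \<psi>: "\<psi> \<in> L2fun L \<mu> (1 + \<alpha>)" and u: "bounded_curve L \<mu> \<alpha> u"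
  shows "(\<integral>\<^sup>+t. sob L (\<alpha> - 1) (convection L (\<psi> t) (u t)) \<partial>time \<mu>) < \<infinity>"
proof -
  obtain M where M: "\<forall>t\<in>{0..\<mu>}. sob L \<alpha> (u t) \<le> ennreal M" using u by (auto simp: bounded_curve_def)
  have "AE t in time \<mu>. solenoidal L (\<psi> t)" using L2fun_facts(2)[OF \<psi>] by eventually_elim simp
  from convection_time_bound[OF L2fun_facts(1)[OF \<psi>] this u, of "ennreal M"] M
  have "(\<integral>\<^sup>+t. sob L (\<alpha> - 1) (convection L (\<psi> t) (u t)) \<partial>time \<mu>)
    \<le> ennreal K * ((\<integral>\<^sup>+t. sob L (1 + \<alpha>) (\<psi> t) \<partial>time \<mu>) * ennreal M)" by auto
  also have "\<dots> < \<infinity>" using L2fun_facts(3)[OF \<psi>] by (simp add: ennreal_mult_less_top)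
  finally show ?thesis .
qed

lemma source_convection:
  assumes \<psi>: "\<psi> \<in> L2fun L \<mu> (1 + \<alpha>)" and u: "bounded_curve L \<mu> \<alpha> u"
  shows "source L \<mu> (\<alpha> - 1) (\<lambda>t. convection L (\<psi> t) (u t))"
  unfolding source_def
  by (intro conjI allI convection_measurable[OF L] L2fun_facts(1)[OF \<psi>] bounded_curveD(1)[OF u]
      convection_time_finite AE_sol_convection assms)

lemma source_forcing:
  assumes \<psi>: "\<psi> \<in> L2fun L \<mu> (1 + \<alpha>)" and u: "bounded_curve L \<mu> \<alpha> u"
  shows "source L \<mu> (\<alpha> - 1) (forcing L f \<psi> u)"
  unfolding source_def
proof (intro conjI allI)
  note c = sourceD[OF source_convection[OF assms]]
  note [measurable] = borel_measurable_sob[OF c(1)]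
  interpret finite_measure "time \<mu>" by (rule finite_measure_time)
  show "(\<lambda>t. forcing L f \<psi> u t k) \<in> borel_measurable (time \<mu>)" for k
    unfolding forcing_def by (intro borel_measurable_diff borel_measurable_const c(1))
  have "(\<integral>\<^sup>+t. sob L (\<alpha> - 1) (forcing L f \<psi> u t) \<partial>time \<mu>)
    \<le> (\<integral>\<^sup>+t. 2 * sob L (\<alpha> - 1) f + 2 * sob L (\<alpha> - 1) (convection L (\<psi> t) (u t)) \<partial>time \<mu>)"
    unfolding forcing_def by (intro nn_integral_mono sob_diff_le)
  also have "\<dots> = 2 * sob L (\<alpha> - 1) f * emeasure (time \<mu>) (space (time \<mu>))
      + 2 * (\<integral>\<^sup>+t. sob L (\<alpha> - 1) (convection L (\<psi> t) (u t)) \<partial>time \<mu>)"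
    by (simp add: nn_integral_add nn_integral_cmult del: space_time)
  also have "\<dots> < \<infinity>"
    using c(2) sob_f(2) by (simp add: ennreal_mult_less_top emeasure_eq_measure del: space_time)
  finally show "(\<integral>\<^sup>+t. sob L (\<alpha> - 1) (forcing L f \<psi> u t) \<partial>time \<mu>) < \<infinity>" .
  show "AE t in time \<mu>. solenoidal L (forcing L f \<psi> u t)"
    using c(3) unfolding forcing_def by eventually_elim (rule sol_diff[OF sol_f])
qed

text \<open>
  One Picard step: the heat equation with the convective term evaluated at the given curve.
\<close>

definition evolve :: "(real \<Rightarrow> vfield) \<Rightarrow> vfield \<Rightarrow> (real \<Rightarrow> vfield) \<Rightarrow> real \<Rightarrow> vfield" where
  "evolve \<psi> u0 u = mild L \<mu> \<nu> u0 (forcing L f \<psi> u)"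

lemma bounded_curve_evolve:
  assumes \<psi>: "\<psi> \<in> L2fun L \<mu> (1 + \<alpha>)" and u: "bounded_curve L \<mu> \<alpha> u" and u0: "u0 \<in> Vsp L \<alpha>"
  shows "bounded_curve L \<mu> \<alpha> (evolve \<psi> u0 u)"
proof -
  note s = source_forcing[OF \<psi> u]
  have x0: "solenoidal L u0" "sob L \<alpha> u0 < \<infinity>" using u0 by (auto simp: Vsp_iff[OF L])
  define B where "B = 2 * sob L \<alpha> u0 + ennreal (1 / \<nu>) * (\<integral>\<^sup>+s. sob L (\<alpha> - 1) (forcing L f \<psi> u s) \<partial>time \<mu>)"
  have B: "B < \<infinity>" unfolding B_def using x0(2) sourceD(2)[OF s] by (simp add: ennreal_mult_less_top)
  have "sob L \<alpha> (evolve \<psi> u0 u t) \<le> B" if "t \<in> {0..\<mu>}" for t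
  proof -
    have "sob L \<alpha> (evolve \<psi> u0 u t) \<le> ennreal (2 * exp (- (2 * \<nu> * (2 * pi / L)\<^sup>2 * t))) * sob L \<alpha> u0
     + ennreal (1 / \<nu>) * (\<integral>\<^sup>+s. sob L (\<alpha> - 1) (forcing L f \<psi> u s) \<partial>time \<mu>)"
      unfolding evolve_def using that by (intro mild_sup_bound[OF L \<nu>] sourceD(1)[OF s]) auto
    also have "\<dots> \<le> B"
      unfolding B_def
    proof (intro add_right_mono mult_right_mono)
      have "ennreal (2 * exp (- (2 * \<nu> * (2 * pi / L)\<^sup>2 * t))) \<le> ennreal 2"
        using \<nu> that by (intro ennreal_leI) simp
      then show "ennreal (2 * exp (- (2 * \<nu> * (2 * pi / L)\<^sup>2 * t))) \<le> 2" by simp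
    qed simp
    finally show ?thesis .
  qed
  then have "\<forall>t\<in>{0..\<mu>}. sob L \<alpha> (evolve \<psi> u0 u t) \<le> ennreal (enn2real B)"
    using B by simp
  moreover have "solenoidal L (evolve \<psi> u0 u t)" for t unfolding evolve_def by (rule sol_mild[OF L x0(1) s])
  moreover have "(\<lambda>t. evolve \<psi> u0 u t k) \<in> borel_measurable (time \<mu>)" for k
    unfolding evolve_def by (rule mild_measurable[OF sourceD(1)[OF s]])
  ultimately show ?thesis unfolding bounded_curve_def by blast
qed

text \<open>
  The difference of the convective terms is \<open>B(\<psi>, u - v) + B(\<psi> - \<psi>', v)\<close>.
\<close>

lemma forcing_difference_bound:
  assumes \<psi>: "\<psi> \<in> L2fun L \<mu> (1 + \<alpha>)" and \<psi>': "\<psi>' \<in> L2fun L \<mu> (1 + \<alpha>)"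
    and u: "bounded_curve L \<mu> \<alpha> u" and v: "bounded_curve L \<mu> \<alpha> v"
    and S: "\<And>t. t \<in> {0..\<mu>} \<Longrightarrow> sob L \<alpha> (\<lambda>k. u t k - v t k) \<le> S"
    and S': "\<And>t. t \<in> {0..\<mu>} \<Longrightarrow> sob L \<alpha> (v t) \<le> S'"
  shows "(\<integral>\<^sup>+t. sob L (\<alpha> - 1) (\<lambda>k. forcing L f \<psi> u t k - forcing L f \<psi>' v t k) \<partial>time \<mu>)
    \<le> 2 * ennreal K * ((\<integral>\<^sup>+t. sob L (1 + \<alpha>) (\<psi> t) \<partial>time \<mu>) * S
        + (\<integral>\<^sup>+t. sob L (1 + \<alpha>) (vdiff (\<psi> t) (\<psi>' t)) \<partial>time \<mu>) * S')"
proof -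
  let ?w = "\<lambda>t k. u t k - v t k" and ?\<chi> = "\<lambda>t. vdiff (\<psi> t) (\<psi>' t)"
  have w: "bounded_curve L \<mu> \<alpha> ?w" by (rule bounded_curve_diff[OF u v])
  have m\<chi>: "(\<lambda>t. ?\<chi> t k) \<in> borel_measurable (time \<mu>)" for k
    unfolding vdiff_def by (intro borel_measurable_diff L2fun_facts(1) \<psi> \<psi>')
  have s\<psi>: "AE t in time \<mu>. solenoidal L (\<psi> t)" using L2fun_facts(2)[OF \<psi>] by eventually_elim simp
  have s\<chi>: "AE t in time \<mu>. solenoidal L (?\<chi> t)"
    using L2fun_facts(2)[OF \<psi>] L2fun_facts(2)[OF \<psi>'] by eventually_elim (simp add: vdiff_def sol_diff)
  have mc: "(\<lambda>t. convection L (\<psi> t) (?w t) k) \<in> borel_measurable (time \<mu>)"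
    "(\<lambda>t. convection L (?\<chi> t) (v t) k) \<in> borel_measurable (time \<mu>)" for k
    by (intro convection_measurable[OF L] L2fun_facts(1)[OF \<psi>] m\<chi> bounded_curveD(1)[OF w] bounded_curveD(1)[OF v])+
  note [measurable] = borel_measurable_sob[OF mc(1)] borel_measurable_sob[OF mc(2)]
  have "(\<integral>\<^sup>+t. sob L (\<alpha> - 1) (\<lambda>k. forcing L f \<psi> u t k - forcing L f \<psi>' v t k) \<partial>time \<mu>)
    \<le> (\<integral>\<^sup>+t. 2 * sob L (\<alpha> - 1) (convection L (\<psi> t) (?w t)) + 2 * sob L (\<alpha> - 1) (convection L (?\<chi> t) (v t)) \<partial>time \<mu>)"
  proof (rule nn_integral_mono_AE)
    show "AE t in time \<mu>. sob L (\<alpha> - 1) (\<lambda>k. forcing L f \<psi> u t k - forcing L f \<psi>' v t k)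
      \<le> 2 * sob L (\<alpha> - 1) (convection L (\<psi> t) (?w t)) + 2 * sob L (\<alpha> - 1) (convection L (?\<chi> t) (v t))"
      using L2fun_facts(2)[OF \<psi>] L2fun_facts(2)[OF \<psi>'] AE_space
    proof eventually_elim
      case (elim t)
      then have t: "t \<in> {0..\<mu>}" by simp
      have "convection L (\<psi> t) (u t) k - convection L (\<psi>' t) (v t) k
        = convection L (\<psi> t) (?w t) k + convection L (?\<chi> t) (v t) k" for k
        unfolding vdiff_def
        by (intro convection_difference[OF L] sol_zero_mean[OF bounded_curveD(2)[OF u t]]
            sol_zero_mean[OF bounded_curveD(2)[OF v t]] bounded_curve_sob_0[OF u t] bounded_curve_sob_0[OF v t])
          (use elim in \<open>auto intro: sol_zero_mean\<close>)
      then have "(\<lambda>k. forcing L f \<psi> u t k - forcing L f \<psi>' v t k)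
         = (\<lambda>k. - (convection L (\<psi> t) (?w t) k + convection L (?\<chi> t) (v t) k))"
        by (intro ext) (simp add: forcing_def algebra_simps)
      then have "sob L (\<alpha> - 1) (\<lambda>k. forcing L f \<psi> u t k - forcing L f \<psi>' v t k)
        = sob L (\<alpha> - 1) (\<lambda>k. convection L (\<psi> t) (?w t) k + convection L (?\<chi> t) (v t) k)"
        by (simp only: sob_uminus)
      also have "\<dots> \<le> 2 * sob L (\<alpha> - 1) (convection L (\<psi> t) (?w t)) + 2 * sob L (\<alpha> - 1) (convection L (?\<chi> t) (v t))"
        by (rule sob_add_le)
      finally show ?case .
    qed
  qed
  also have "\<dots> = 2 * (\<integral>\<^sup>+t. sob L (\<alpha> - 1) (convection L (\<psi> t) (?w t)) \<partial>time \<mu>)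
      + 2 * (\<integral>\<^sup>+t. sob L (\<alpha> - 1) (convection L (?\<chi> t) (v t)) \<partial>time \<mu>)"
    by (simp add: nn_integral_add nn_integral_cmult)
  also have "\<dots> \<le> 2 * (ennreal K * ((\<integral>\<^sup>+t. sob L (1 + \<alpha>) (\<psi> t) \<partial>time \<mu>) * S))
      + 2 * (ennreal K * ((\<integral>\<^sup>+t. sob L (1 + \<alpha>) (?\<chi> t) \<partial>time \<mu>) * S'))"
    by (intro add_mono mult_left_mono convection_time_bound L2fun_facts(1)[OF \<psi>] s\<psi> s\<chi> m\<chi> w v S S') auto
  finally show ?thesis by (simp add: distrib_left mult.assoc)
qed

text \<open>
  The basic stability estimate. With equal data it shows that \<open>evolve\<close> is a contraction; with the steady
  state in place of \<open>v\<close> it yields the attraction.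
\<close>

lemma evolve_difference:
  assumes \<psi>: "\<psi> \<in> L2fun L \<mu> (1 + \<alpha>)" and \<psi>': "\<psi>' \<in> L2fun L \<mu> (1 + \<alpha>)"
    and u: "bounded_curve L \<mu> \<alpha> u" and v: "bounded_curve L \<mu> \<alpha> v"
    and S: "\<And>t. t \<in> {0..\<mu>} \<Longrightarrow> sob L \<alpha> (\<lambda>k. u t k - v t k) \<le> S"
    and S': "\<And>t. t \<in> {0..\<mu>} \<Longrightarrow> sob L \<alpha> (v t) \<le> S'"
  defines "F \<equiv> 2 * ennreal K * ((\<integral>\<^sup>+t. sob L (1 + \<alpha>) (\<psi> t) \<partial>time \<mu>) * S
        + (\<integral>\<^sup>+t. sob L (1 + \<alpha>) (vdiff (\<psi> t) (\<psi>' t)) \<partial>time \<mu>) * S')"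
  shows "t \<in> {0..\<mu>} \<Longrightarrow> sob L \<alpha> (\<lambda>k. evolve \<psi> u0 u t k - evolve \<psi>' v0 v t k)
      \<le> ennreal (2 * exp (- (2 * \<nu> * (2 * pi / L)\<^sup>2 * t))) * sob L \<alpha> (\<lambda>k. u0 k - v0 k) + ennreal (1 / \<nu>) * F"
    and "(\<integral>\<^sup>+t. sob L (1 + \<alpha>) (\<lambda>k. evolve \<psi> u0 u t k - evolve \<psi>' v0 v t k) \<partial>time \<mu>)
      \<le> ennreal (1 / \<nu>) * sob L \<alpha> (\<lambda>k. u0 k - v0 k) + ennreal (2 / \<nu>\<^sup>2) * F"
proof -
  let ?g = "\<lambda>t k. forcing L f \<psi> u t k - forcing L f \<psi>' v t k"
  note s = source_forcing[OF \<psi> u] source_forcing[OF \<psi>' v]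
  have eq: "(\<lambda>k. evolve \<psi> u0 u t k - evolve \<psi>' v0 v t k) = mild L \<mu> \<nu> (\<lambda>k. u0 k - v0 k) ?g t" for t
    unfolding evolve_def
    by (intro ext mild_diff[OF source_integrable[OF L s(1)] source_integrable[OF L s(2)]])
  have m: "(\<lambda>t. ?g t k) \<in> borel_measurable (time \<mu>)" for k
    by (intro borel_measurable_diff sourceD(1)[OF s(1)] sourceD(1)[OF s(2)])
  have le: "(\<integral>\<^sup>+t. sob L (\<alpha> - 1) (?g t) \<partial>time \<mu>) \<le> F"
    unfolding F_def by (rule forcing_difference_bound[OF \<psi> \<psi>' u v S S'])
  show "sob L \<alpha> (\<lambda>k. evolve \<psi> u0 u t k - evolve \<psi>' v0 v t k)
      \<le> ennreal (2 * exp (- (2 * \<nu> * (2 * pi / L)\<^sup>2 * t))) * sob L \<alpha> (\<lambda>k. u0 k - v0 k) + ennreal (1 / \<nu>) * F"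
    if "t \<in> {0..\<mu>}"
    unfolding eq using that
    by (intro order_trans[OF mild_sup_bound[OF L \<nu> _ m]] add_left_mono mult_left_mono le) auto
  show "(\<integral>\<^sup>+t. sob L (1 + \<alpha>) (\<lambda>k. evolve \<psi> u0 u t k - evolve \<psi>' v0 v t k) \<partial>time \<mu>)
      \<le> ennreal (1 / \<nu>) * sob L \<alpha> (\<lambda>k. u0 k - v0 k) + ennreal (2 / \<nu>\<^sup>2) * F"
    unfolding eq by (intro order_trans[OF mild_L2_bound[OF L \<nu> m]] add_left_mono mult_left_mono le) auto
qed

text \<open>
  Together with \<open>evolve_difference\<close> this makes \<open>evolve\<close> a contraction with factor \<open>1 / 16\<close> for the
  squared norms, that is, \<open>1 / 4\<close> for the norms.
\<close>

definition small_drift :: "(real \<Rightarrow> vfield) \<Rightarrow> bool" where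
  "small_drift \<psi> \<longleftrightarrow> ennreal (2 * K / \<nu>) * (\<integral>\<^sup>+t. sob L (1 + \<alpha>) (\<psi> t) \<partial>time \<mu>) \<le> ennreal (1 / 16)"

lemma evolve_contraction:
  assumes \<psi>: "\<psi> \<in> L2fun L \<mu> (1 + \<alpha>)" and small: "small_drift \<psi>"
    and u: "bounded_curve L \<mu> \<alpha> u" and v: "bounded_curve L \<mu> \<alpha> v"
    and S: "\<And>t. t \<in> {0..\<mu>} \<Longrightarrow> sob L \<alpha> (\<lambda>k. u t k - v t k) \<le> S"
    and t: "t \<in> {0..\<mu>}"
  shows "sob L \<alpha> (\<lambda>k. evolve \<psi> u0 u t k - evolve \<psi> u0 v t k) \<le> ennreal (1 / 16) * S"
proof -
  let ?P = "\<integral>\<^sup>+t. sob L (1 + \<alpha>) (\<psi> t) \<partial>time \<mu>"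
  have "sob L \<alpha> (\<lambda>k. evolve \<psi> u0 u t k - evolve \<psi> u0 v t k) \<le> ennreal (1 / \<nu>) * (2 * ennreal K * (?P * S))"
    using evolve_difference(1)[OF \<psi> \<psi> u v S, of \<infinity> t u0 u0] t by (simp add: vdiff_def)
  also have "\<dots> = (ennreal (2 * K / \<nu>) * ?P) * S"
  proof -
    have "ennreal (2 * K / \<nu>) = ennreal (1 / \<nu>) * (2 * ennreal K)"
      using K \<nu> by (simp add: ennreal_mult[symmetric] flip: ennreal_numeral)
    then show ?thesis by (simp only: mult.assoc)
  qed
  also have "\<dots> \<le> ennreal (1 / 16) * S"
    using small unfolding small_drift_def by (rule mult_right_mono) simp
  finally show ?thesis .
qed

text \<open>
  The supremum of the squared distance is finite and at most a sixteenth of itself.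
\<close>

lemma evolve_fixed_point_unique:
  assumes \<psi>: "\<psi> \<in> L2fun L \<mu> (1 + \<alpha>)" and small: "small_drift \<psi>"
    and u: "bounded_curve L \<mu> \<alpha> u" "\<And>t. t \<in> {0..\<mu>} \<Longrightarrow> u t = evolve \<psi> u0 u t"
    and v: "bounded_curve L \<mu> \<alpha> v" "\<And>t. t \<in> {0..\<mu>} \<Longrightarrow> v t = evolve \<psi> u0 v t"
    and t: "t \<in> {0..\<mu>}"
  shows "u t = v t"
proof -
  define S where "S = (SUP t\<in>{0..\<mu>}. sob L \<alpha> (\<lambda>k. u t k - v t k))"
  obtain M where M: "\<forall>t\<in>{0..\<mu>}. sob L \<alpha> (\<lambda>k. u t k - v t k) \<le> ennreal M"
    using bounded_curve_diff[OF u(1) v(1)] by (auto simp: bounded_curve_def)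
  have "S \<le> ennreal M" unfolding S_def using M by (intro SUP_least) auto
  then have fin: "S < \<infinity>" by (rule le_less_trans) simp
  have S: "sob L \<alpha> (\<lambda>k. u t k - v t k) \<le> S" if "t \<in> {0..\<mu>}" for t
    unfolding S_def using that by (rule SUP_upper)
  have "sob L \<alpha> (\<lambda>k. u t k - v t k) \<le> ennreal (1 / 16) * S" if "t \<in> {0..\<mu>}" for t
    using evolve_contraction[OF \<psi> small u(1) v(1) S that, of u0] u(2)[OF that] v(2)[OF that] by simp
  then have le: "S \<le> ennreal (1 / 16) * S" unfolding S_def by (rule SUP_least)
  have "S = 0"
  proof (cases S)
    case (real s)
    then have "ennreal s \<le> ennreal (1 / 16 * s)" by (subst ennreal_mult) (use real le in auto)
    then have "s \<le> 1 / 16 * s" using real by (subst (asm) ennreal_le_iff) auto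
    then show ?thesis using real by simp
  qed (use fin in auto)
  then have "sob L \<alpha> (\<lambda>k. u t k - v t k) = 0" using S[OF t] by simp
  then show ?thesis
    by (rule sob_diff_eq_0D[OF L bounded_curveD(2)[OF u(1) t] bounded_curveD(2)[OF v(1) t]])
qed

lemma ennreal_geometric_0:
  assumes "\<And>n. e \<le> ennreal (c * (1 / 16) ^ n)"
  shows "e = 0"
proof -
  have "(\<lambda>n. ennreal (c * (1 / 16) ^ n)) \<longlonglongrightarrow> ennreal (c * 0)"
    by (intro tendsto_ennrealI tendsto_mult tendsto_const LIMSEQ_power_zero) simp
  then have "e \<le> ennreal (c * 0)" by (rule LIMSEQ_le_const) (use assms in blast)
  then show ?thesis by simp
qed

lemma evolve_fixed_point_exists:
  assumes \<psi>: "\<psi> \<in> L2fun L \<mu> (1 + \<alpha>)" and small: "small_drift \<psi>" and u0: "u0 \<in> Vsp L \<alpha>"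
  obtains u where "bounded_curve L \<mu> \<alpha> u" "\<And>t. t \<in> {0..\<mu>} \<Longrightarrow> u t = evolve \<psi> u0 u t"
proof -
  define x where "x n = (evolve \<psi> u0 ^^ n) (\<lambda>t k. 0)" for n
  have x_Suc: "x (Suc n) = evolve \<psi> u0 (x n)" and x_0: "x 0 = (\<lambda>t k. 0)" for n by (simp_all add: x_def)
  have "bounded_curve L \<mu> \<alpha> (\<lambda>t k. 0)"
    unfolding bounded_curve_def by (simp add: sol_zero)
  then have bx: "bounded_curve L \<mu> \<alpha> (x n)" for n
    by (induction n) (simp_all add: x_Suc x_0 bounded_curve_evolve[OF \<psi> _ u0])
  obtain M' where M': "\<forall>t\<in>{0..\<mu>}. sob L \<alpha> (\<lambda>k. x 1 t k - x 0 t k) \<le> ennreal M'"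
    using bounded_curve_diff[OF bx[of 1] bx[of 0]] by (auto simp: bounded_curve_def)
  define M where "M = max 0 M'"
  have M: "0 \<le> M" "\<And>t. t \<in> {0..\<mu>} \<Longrightarrow> sob L \<alpha> (\<lambda>k. x 1 t k - x 0 t k) \<le> ennreal M"
    using M' by (auto simp: M_def ennreal_max_0)
  have step: "sob L \<alpha> (\<lambda>k. x (Suc n) t k - x n t k) \<le> ennreal (M * (1 / 16) ^ n)" if "t \<in> {0..\<mu>}" for n t
    using that
  proof (induction n arbitrary: t)
    case (Suc n)
    have "sob L \<alpha> (\<lambda>k. x (Suc (Suc n)) t k - x (Suc n) t k) \<le> ennreal (1 / 16) * ennreal (M * (1 / 16) ^ n)"
      unfolding x_Suc[of "Suc n"] x_Suc[of n] unfolding x_Suc[of n, symmetric]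
      by (subst (2) x_Suc) (rule evolve_contraction[OF \<psi> small bx bx Suc.IH Suc.prems])
    also have "\<dots> = ennreal (M * (1 / 16) ^ Suc n)"
      using M(1) by (subst ennreal_mult[symmetric]) auto
    finally show ?case .
  qed (use M(2) in simp)
  have x00: "x n t 0 = 0" if "t \<in> {0..\<mu>}" for n t
    using sol_zero_mean[OF bounded_curveD(2)[OF bx that]] .
  define y where "y t k = lim (\<lambda>n. x n t k)" for t k
  have lim: "(\<lambda>n. x n t k) \<longlonglongrightarrow> y t k" if t: "t \<in> {0..\<mu>}" for t k
    unfolding y_def by (rule sob_geometric_limit(1)[OF L M(1), of "\<lambda>n. x n t"]) (use x00 step t in auto)
  have near: "sob L \<alpha> (\<lambda>k. y t k - x n t k) \<le> ennreal (4 * M * (1 / 16) ^ n)" if t: "t \<in> {0..\<mu>}" for t n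
    unfolding y_def by (rule sob_geometric_limit(2)[OF L M(1), of "\<lambda>n. x n t"]) (use x00 step t in auto)
  have y: "bounded_curve L \<mu> \<alpha> y"
    unfolding bounded_curve_def
  proof (intro conjI allI ballI exI)
    show "(\<lambda>t. y t k) \<in> borel_measurable (time \<mu>)" for k
    proof (rule borel_measurable_LIMSEQ_metric)
      show "(\<lambda>t. x n t k) \<in> borel_measurable (time \<mu>)" for n by (rule bounded_curveD(1)[OF bx])
      show "(\<lambda>n. x n t k) \<longlonglongrightarrow> y t k" if "t \<in> space (time \<mu>)" for t using lim that by simp
    qed
    show "solenoidal L (y t)" if "t \<in> {0..\<mu>}" for t
      by (rule sol_limit[OF bounded_curveD(2)[OF bx that] lim[OF that]])
    show "sob L \<alpha> (y t) \<le> ennreal (4 * M)" if "t \<in> {0..\<mu>}" for t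
      using near[OF that, of 0] by (simp add: x_0)
  qed
  have "y t = evolve \<psi> u0 y t" if t: "t \<in> {0..\<mu>}" for t
  proof -
    have ey: "bounded_curve L \<mu> \<alpha> (evolve \<psi> u0 y)" by (rule bounded_curve_evolve[OF \<psi> y u0])
    have "sob L \<alpha> (\<lambda>k. y t k - evolve \<psi> u0 y t k) \<le> ennreal (16 * M * (1 / 16) ^ n)" for n
    proof -
      have "sob L \<alpha> (\<lambda>k. y t k - evolve \<psi> u0 y t k)
        = sob L \<alpha> (\<lambda>k. (y t k - x (Suc n) t k) - (evolve \<psi> u0 y t k - evolve \<psi> u0 (x n) t k))"
        by (simp add: x_Suc)
      also have "\<dots> \<le> 2 * ennreal (4 * M * (1 / 16) ^ Suc n) + 2 * (ennreal (1 / 16) * ennreal (4 * M * (1 / 16) ^ n))"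
        by (rule order_trans[OF sob_diff_le])
          (intro add_mono mult_left_mono near t evolve_contraction[OF \<psi> small y bx near t], auto)
      also have "\<dots> = ennreal (2 * (4 * M * (1 / 16) ^ Suc n) + 2 * (1 / 16 * (4 * M * (1 / 16) ^ n)))"
      proof -
        have two: "2 * ennreal a + 2 * (ennreal c * ennreal b) = ennreal (2 * a + 2 * (c * b))"
          if "0 \<le> a" "0 \<le> b" "0 \<le> c" for a b c
          using that by (simp add: ennreal_mult)
        show ?thesis by (rule two) (use M(1) in simp_all)
      qed
      also have "\<dots> \<le> ennreal (16 * M * (1 / 16) ^ n)"
        using M(1) by (intro ennreal_leI) (simp add: mult_nonneg_nonneg)
      finally show ?thesis .
    qed
    then have "sob L \<alpha> (\<lambda>k. y t k - evolve \<psi> u0 y t k) = 0" by (rule ennreal_geometric_0)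
    then show ?thesis
      by (rule sob_diff_eq_0D[OF L bounded_curveD(2)[OF y t] bounded_curveD(2)[OF ey t]])
  qed
  with y that show ?thesis by blast
qed

end

section \<open>Pairings of curves with test fields\<close>

lemma pairing_LINT: "pairing L u v = L ^ 3 * (LINT k|count_space UNIV. u k \<bullet> v k)"
  by (simp add: pairing_def infsum_eq_LINT)

text \<open>
  The duality of \<open>V\<^sup>s\<close> and \<open>V\<^sup>-\<^sup>s\<close>.
\<close>

lemma nn_integral_inner_le:
  assumes L: "0 < L" and x0: "x 0 = 0"
  shows "(\<integral>\<^sup>+k. ennreal \<bar>x k \<bullet> y k\<bar> \<partial>count_space UNIV) \<le> sob L s x + sob L (- s) y"
proof -
  have "\<bar>x k \<bullet> y k\<bar> \<le> wn L k powr (2 * s) * (norm (x k))\<^sup>2 + wn L k powr (2 * - s) * (norm (y k))\<^sup>2" for k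
  proof (cases "k = 0")
    case False
    have w: "0 < wn L k" by (rule wn_pos[OF L False])
    define a where "a = wn L k powr s * norm (x k)"
    define b where "b = wn L k powr - s * norm (y k)"
    have "wn L k powr s * wn L k powr - s = 1" using w by (simp add: powr_minus)
    then have "norm (x k) * norm (y k) = a * b" by (simp add: a_def b_def mult.assoc mult.left_commute)
    moreover have "2 * (a * b) \<le> a\<^sup>2 + b\<^sup>2" using sum_squares_bound[of a b] by simp
    moreover have "0 \<le> a * b" by (simp add: a_def b_def)
    ultimately have "norm (x k) * norm (y k) \<le> a\<^sup>2 + b\<^sup>2" by linarith
    moreover have "a\<^sup>2 = wn L k powr (2 * s) * (norm (x k))\<^sup>2" "b\<^sup>2 = wn L k powr (2 * - s) * (norm (y k))\<^sup>2"
      unfolding a_def b_def power_mult_distrib powr_square[OF wn_nonneg] by (rule refl)+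
    ultimately show ?thesis using Cauchy_Schwarz_ineq2[of "x k" "y k"] by linarith
  qed (simp add: x0)
  then have "(\<integral>\<^sup>+k. ennreal \<bar>x k \<bullet> y k\<bar> \<partial>count_space UNIV)
    \<le> (\<integral>\<^sup>+k. ennreal (wn L k powr (2 * s) * (norm (x k))\<^sup>2) + ennreal (wn L k powr (2 * - s) * (norm (y k))\<^sup>2) \<partial>count_space UNIV)"
    by (intro nn_integral_mono) (simp add: ennreal_leI flip: ennreal_plus)
  also have "\<dots> = sob L s x + sob L (- s) y" by (simp add: sob_def nn_integral_add)
  finally show ?thesis .
qed

text \<open>
  Fubini's theorem for the sum over the modes and the integral against a function of time. It splits the
  weak equation into equations for the single modes and reassembles it from them.
\<close>

lemma pairing_time:
  fixes \<phi> :: "real \<Rightarrow> real"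
  assumes L: "0 < L" and m: "\<And>k. (\<lambda>t. x t k) \<in> borel_measurable (time \<mu>)"
    and x0: "AE t in time \<mu>. x t 0 = 0" and fin: "(\<integral>\<^sup>+t. sob L s (x t) \<partial>time \<mu>) < \<infinity>"
    and y: "sob L (- s) y < \<infinity>" and \<phi>: "continuous_on {0..\<mu>} \<phi>"
  shows "integrable (time \<mu>) (\<lambda>t. pairing L (x t) y * \<phi> t)"
    and "integrable (count_space UNIV) (\<lambda>k. LINT t|time \<mu>. (x t k \<bullet> y k) * \<phi> t)"
    and "(LINT t|time \<mu>. pairing L (x t) y * \<phi> t)
      = L ^ 3 * (LINT k|count_space UNIV. LINT t|time \<mu>. (x t k \<bullet> y k) * \<phi> t)"
proof -
  interpret T: finite_measure "time \<mu>" by (rule finite_measure_time)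
  interpret C: sigma_finite_measure "count_space (UNIV :: (int ^ 3) set)"
    by (rule sigma_finite_measure_count_space_countable) simp
  interpret P: pair_sigma_finite "time \<mu>" "count_space (UNIV :: (int ^ 3) set)" ..
  define F where "F = (\<lambda>(t, k). (x t k \<bullet> y k) * \<phi> t)"
  have [measurable]: "\<phi> \<in> borel_measurable (time \<mu>)" using integrable_time_continuous[OF \<phi>] by simp
  note [measurable] = m borel_measurable_sob[OF m]
  have FM: "F \<in> borel_measurable (time \<mu> \<Otimes>\<^sub>M count_space UNIV)"
    unfolding F_def by (rule measurable_pair_swap_iff[THEN iffD2], rule measurable_pair_measure_countable1) auto
  have "bounded (\<phi> ` {0..\<mu>})" by (intro compact_imp_bounded compact_continuous_image \<phi> compact_Icc)
  then obtain B where "\<forall>t\<in>{0..\<mu>}. norm (\<phi> t) \<le> B" by (auto simp: bounded_iff)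
  then have B: "\<bar>\<phi> t\<bar> \<le> max 0 B" if "t \<in> {0..\<mu>}" for t using that by (simp add: le_max_iff_disj)
  have FI: "integrable (time \<mu> \<Otimes>\<^sub>M count_space UNIV) F"
    unfolding integrable_iff_bounded
  proof (intro conjI FM)
    have "(\<integral>\<^sup>+z. ennreal (norm (F z)) \<partial>(time \<mu> \<Otimes>\<^sub>M count_space UNIV))
      = (\<integral>\<^sup>+t. \<integral>\<^sup>+k. ennreal (norm (F (t, k))) \<partial>count_space UNIV \<partial>time \<mu>)"
    proof (rule C.nn_integral_fst[symmetric])
      have "(\<lambda>z. norm (F z)) \<in> borel_measurable (time \<mu> \<Otimes>\<^sub>M count_space UNIV)" by (rule measurable_compose[OF FM borel_measurable_norm])
      then show "(\<lambda>z. ennreal (norm (F z))) \<in> borel_measurable (time \<mu> \<Otimes>\<^sub>M count_space UNIV)" by (rule measurable_compose[OF _ measurable_ennreal])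
    qed
    also have "\<dots> \<le> (\<integral>\<^sup>+t. ennreal (max 0 B) * (sob L s (x t) + sob L (- s) y) \<partial>time \<mu>)"
    proof (rule nn_integral_mono_AE)
      show "AE t in time \<mu>. (\<integral>\<^sup>+k. ennreal (norm (F (t, k))) \<partial>count_space UNIV) \<le> ennreal (max 0 B) * (sob L s (x t) + sob L (- s) y)"
        using x0 AE_space
      proof eventually_elim
        case (elim t)
        have "(\<integral>\<^sup>+k. ennreal (norm (F (t, k))) \<partial>count_space UNIV)
          \<le> (\<integral>\<^sup>+k. ennreal (max 0 B) * ennreal \<bar>x t k \<bullet> y k\<bar> \<partial>count_space UNIV)"
        proof (rule nn_integral_mono)
          fix k
          have "\<bar>x t k \<bullet> y k\<bar> * \<bar>\<phi> t\<bar> \<le> \<bar>x t k \<bullet> y k\<bar> * max 0 B"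
            using B[of t] elim by (intro mult_left_mono) auto
          then show "ennreal (norm (F (t, k))) \<le> ennreal (max 0 B) * ennreal \<bar>x t k \<bullet> y k\<bar>"
            by (subst ennreal_mult[symmetric]) (auto simp: F_def abs_mult mult.commute intro!: ennreal_leI)
        qed
        also have "\<dots> = ennreal (max 0 B) * (\<integral>\<^sup>+k. ennreal \<bar>x t k \<bullet> y k\<bar> \<partial>count_space UNIV)"
          by (simp add: nn_integral_cmult)
        also have "\<dots> \<le> ennreal (max 0 B) * (sob L s (x t) + sob L (- s) y)"
          by (intro mult_left_mono nn_integral_inner_le L elim) simp
        finally show ?case .
      qed
    qed
    also have "\<dots> = ennreal (max 0 B) * ((\<integral>\<^sup>+t. sob L s (x t) \<partial>time \<mu>) + sob L (- s) y * emeasure (time \<mu>) (space (time \<mu>)))"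
      by (simp add: nn_integral_cmult nn_integral_add del: space_time)
    also have "\<dots> < \<infinity>" using fin y by (simp add: ennreal_mult_less_top T.emeasure_eq_measure del: space_time)
    finally show "(\<integral>\<^sup>+z. ennreal (norm (F z)) \<partial>(time \<mu> \<Otimes>\<^sub>M count_space UNIV)) < \<infinity>" .
  qed
  have FI': "integrable (time \<mu> \<Otimes>\<^sub>M count_space UNIV) (case_prod (\<lambda>t k. (x t k \<bullet> y k) * \<phi> t))"
    using FI by (simp add: F_def)
  have p: "pairing L (x t) y * \<phi> t = L ^ 3 * (LINT k|count_space UNIV. (x t k \<bullet> y k) * \<phi> t)" for t
    by (simp add: pairing_LINT)
  show "integrable (time \<mu>) (\<lambda>t. pairing L (x t) y * \<phi> t)"
    unfolding p using P.integrable_fst[OF FI'] by simp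
  show "integrable (count_space UNIV) (\<lambda>k. LINT t|time \<mu>. (x t k \<bullet> y k) * \<phi> t)"
    using P.integrable_snd[OF FI'] .
  show "(LINT t|time \<mu>. pairing L (x t) y * \<phi> t)
      = L ^ 3 * (LINT k|count_space UNIV. LINT t|time \<mu>. (x t k \<bullet> y k) * \<phi> t)"
    unfolding p using P.Fubini_integral[OF FI'] by simp
qed

lemma duhamel_inner:
  assumes G: "integrable (time \<mu>) G"
  shows "duhamel \<mu> c G t \<bullet> p = exp (- (c * t)) * primitive \<mu> (\<lambda>s. exp (c * s) * (G s \<bullet> p)) t"
proof -
  have "primitive \<mu> (\<lambda>s. exp (c * s) *\<^sub>R G s) t \<bullet> p = (LINT s|time \<mu>. (indicator {..t} s *\<^sub>R exp (c * s) *\<^sub>R G s) \<bullet> p)"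
    unfolding primitive_def
    by (rule integral_inner_left[symmetric]) (rule integrable_cutoff[OF integrable_exp_mult[OF G]])
  then show ?thesis by (simp add: duhamel_eq_primitive primitive_def mult.assoc)
qed

lemma sob_stokes: "0 < L \<Longrightarrow> sob L (s - 1) (stokes L u) = sob L (1 + s) u"
  unfolding sob_def
proof (rule nn_integral_cong)
  fix k assume L: "0 < L"
  show "ennreal (wn L k powr (2 * (s - 1)) * (norm (stokes L u k))\<^sup>2) = ennreal (wn L k powr (2 * (1 + s)) * (norm (u k))\<^sup>2)"
  proof (cases "k = 0")
    case False
    then have w: "0 < wn L k" by (rule wn_pos[OF L])
    have "wn L k powr (2 * (1 + s)) = wn L k powr (2 * (s - 1)) * (wn L k ^ 4)"
      using w powr_add[of "wn L k" "2 * (s - 1)" 4] by (simp add: algebra_simps)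
    moreover have "(norm (stokes L u k))\<^sup>2 = wn L k ^ 4 * (norm (u k))\<^sup>2"
      by (simp add: stokes_def wn_def[symmetric] power_mult_distrib)
    ultimately show ?thesis by (simp add: mult.assoc)
  qed simp
qed

section \<open>Weak solutions are mild solutions\<close>

text \<open>
  A test field supported on one frequency. The coefficient at \<open>- k\<close> is needed to make it real.
\<close>

definition mode_field :: "int ^ 3 \<Rightarrow> complex ^ 3 \<Rightarrow> vfield" where
  "mode_field k p = (\<lambda>j. if j = k then p else if j = - k then vcnj p else 0)"

lemma vec_eq_uminus_iff: "k = - k \<longleftrightarrow> k = 0" for k :: "int ^ 3"
  by (auto simp: vec_eq_iff)

lemma sol_mode_field:
  assumes "k \<noteq> 0" "cdot p (freq L k) = 0"
  shows "solenoidal L (mode_field k p)"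
proof -
  have "- j = k \<longleftrightarrow> j = - k" for j :: "int ^ 3" by auto
  moreover have "k \<noteq> - k" using vec_eq_uminus_iff[of k] assms(1) by simp
  ultimately show ?thesis
    unfolding sol_iff mode_field_def using assms
    by (auto simp: freq_uminus cdot_uminus_right cdot_vcnj)
qed

lemma inner_vcnj: "vcnj x \<bullet> vcnj y = x \<bullet> y"
  by (simp add: inner_vec_def vcnj_def inner_complex_def)

lemma pairing_mode_field:
  assumes "k \<noteq> 0" and w: "w (- k) = vcnj (w k)"
  shows "pairing L w (mode_field k p) = 2 * L ^ 3 * (w k \<bullet> p)"
proof -
  have ne: "k \<noteq> - k" using vec_eq_uminus_iff[of k] assms(1) by simp
  have "(LINT j|count_space UNIV. w j \<bullet> mode_field k p j) = (\<Sum>j\<in>{k, - k}. w j \<bullet> mode_field k p j)"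
  proof (subst lebesgue_integral_count_space_finite_support)
    have sub: "{j \<in> UNIV. w j \<bullet> mode_field k p j \<noteq> 0} \<subseteq> {k, - k}"
      by (auto simp: mode_field_def split: if_splits)
    show "finite {j \<in> UNIV. w j \<bullet> mode_field k p j \<noteq> 0}" by (rule finite_subset[OF sub]) simp
    show "(\<Sum>j | j \<in> UNIV \<and> w j \<bullet> mode_field k p j \<noteq> 0. w j \<bullet> mode_field k p j) = (\<Sum>j\<in>{k, - k}. w j \<bullet> mode_field k p j)"
      by (rule sum.mono_neutral_left[OF _ sub]) auto
  qed
  also have "\<dots> = 2 * (w k \<bullet> p)" using ne by (simp add: mode_field_def w inner_vcnj)
  finally show ?thesis by (simp add: pairing_LINT)
qed

lemma mode_field_Vsp:
  assumes "0 < L" "k \<noteq> 0" "cdot p (freq L k) = 0"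
  shows "mode_field k p \<in> Vsp L s"
proof -
  have "sob L s (mode_field k p) < \<infinity>"
    by (rule sob_finite_support[of "{k, - k}"]) (auto simp: mode_field_def)
  with sol_mode_field[OF assms(2,3)] show ?thesis by (simp add: Vsp_iff[OF assms(1)])
qed

text \<open>
  The bound on the norms holds since the image of the compact time interval is compact, hence bounded.
\<close>

lemma continuous_map_Vsp_coefficient:
  fixes u :: "real \<Rightarrow> vfield"
  assumes L: "0 < L" and c: "continuous_map (top_of_set {0..\<mu>}) (Metric_space.mtopology (Vsp L \<alpha>) (Vdist L \<alpha>)) u"
  shows "continuous_on {0..\<mu>} (\<lambda>t. u t k)"
    and "t \<in> {0..\<mu>} \<Longrightarrow> u t \<in> Vsp L \<alpha>"
    and "\<exists>M. \<forall>t\<in>{0..\<mu>}. sob L \<alpha> (u t) \<le> ennreal M"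
proof -
  interpret M: Metric_space "Vsp L \<alpha>" "Vdist L \<alpha>" by (rule Metric_space_Vsp[OF L])
  show V: "u t \<in> Vsp L \<alpha>" if "t \<in> {0..\<mu>}" for t
    using c that by (auto simp: continuous_map_def)
  show "continuous_on {0..\<mu>} (\<lambda>t. u t k)"
  proof (cases "k = 0")
    case True
    have "u t k = 0" if "t \<in> {0..\<mu>}" for t
      using V[OF that] by (simp add: True Vsp_def zero_mean_def)
    then have "continuous_on {0..\<mu>} (\<lambda>t. u t k) \<longleftrightarrow> continuous_on {0..\<mu>} (\<lambda>t. 0 :: complex ^ 3)"
      by (intro continuous_on_cong) auto
    then show ?thesis by simp
  next
    case False
    define d where "d = sqrt (L ^ 3) * wn L k powr \<alpha>"
    have d: "0 < d" using L wn_pos[OF L False] by (simp add: d_def)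
    show ?thesis
      unfolding continuous_on_iff
    proof (intro ballI allI impI)
      fix x and e :: real assume x: "x \<in> {0..\<mu>}" and e: "0 < e"
      have "0 < d * e" using d e by simp
      then obtain U where U: "openin (top_of_set {0..\<mu>}) U" "x \<in> U" "\<forall>y\<in>U. u y \<in> M.mball (u x) (d * e)"
        using c[unfolded M.continuous_map_to_metric] x by (metis topspace_euclidean_subtopology)
      then obtain r where r: "0 < r" "ball x r \<inter> {0..\<mu>} \<subseteq> U" by (auto simp: openin_contains_ball)
      have "dist (u y k) (u x k) < e" if y: "y \<in> {0..\<mu>}" "dist y x < r" for y
      proof -
        have "u y \<in> M.mball (u x) (d * e)" using U(3) r(2) y by (auto simp: dist_commute)
        then have "Vdist L \<alpha> (u x) (u y) < d * e" by simp
        moreover have "d * norm (u x k - u y k) \<le> Vdist L \<alpha> (u x) (u y)"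
          using coefficient_le_Vnorm[OF L, of \<alpha> "vdiff (u x) (u y)" k] Vsp_diff[OF L V[OF x] V[OF y(1)]]
          by (simp add: Vdist_def Vsp_iff[OF L] vdiff_def d_def)
        ultimately have "d * norm (u x k - u y k) < d * e" by linarith
        then show ?thesis using d by (simp add: dist_norm norm_minus_commute)
      qed
      then show "\<exists>r>0. \<forall>y\<in>{0..\<mu>}. dist y x < r \<longrightarrow> dist (u y k) (u x k) < e" using r(1) by blast
    qed
  qed
  have "compactin M.mtopology (u ` {0..\<mu>})"
    by (rule image_compactin[OF _ c]) (simp add: compactin_subtopology)
  then have "M.mbounded (u ` {0..\<mu>})" by (rule M.compactin_imp_mbounded)
  moreover have z: "(\<lambda>k. 0) \<in> Vsp L \<alpha>" by (simp add: Vsp_iff[OF L] sol_zero)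
  ultimately have "M.mbounded (insert (\<lambda>k. 0) (u ` {0..\<mu>}))" by (simp add: M.mbounded_insert)
  then obtain B where B: "\<And>x y. x \<in> insert (\<lambda>k. 0) (u ` {0..\<mu>}) \<Longrightarrow> y \<in> insert (\<lambda>k. 0) (u ` {0..\<mu>}) \<Longrightarrow> Vdist L \<alpha> x y \<le> B"
    unfolding M.mbounded_alt by blast
  have "sob L \<alpha> (u t) \<le> ennreal (B\<^sup>2 / L ^ 3)" if t: "t \<in> {0..\<mu>}" for t
  proof -
    have "Vdist L \<alpha> (u t) (\<lambda>k. 0) \<le> B" by (rule B) (use t in auto)
    then have "(Vnorm L \<alpha> (u t))\<^sup>2 \<le> B\<^sup>2"
      by (intro power_mono) (simp_all add: Vdist_def vdiff_def Vnorm_nonneg[OF L])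
    then have "enn2real (sob L \<alpha> (u t)) \<le> B\<^sup>2 / L ^ 3"
      using L by (simp add: Vnorm_square field_simps)
    then have "ennreal (enn2real (sob L \<alpha> (u t))) \<le> ennreal (B\<^sup>2 / L ^ 3)" by (rule ennreal_leI)
    moreover have "sob L \<alpha> (u t) < \<infinity>" using V[OF t] by (simp add: Vsp_iff[OF L])
    ultimately show ?thesis by simp
  qed
  then show "\<exists>M. \<forall>t\<in>{0..\<mu>}. sob L \<alpha> (u t) \<le> ennreal M" by blast
qed

context linearised_NSE
begin

lemma Bop_AE:
  assumes \<psi>: "\<psi> \<in> L2fun L \<mu> (1 + \<alpha>)" and u: "bounded_curve L \<mu> \<alpha> u" and v: "v \<in> Vsp L (1 + \<alpha>)"
  shows "AE t in time \<mu>. Bop L (\<psi> t) (u t) v = pairing L (convection L (\<psi> t) (u t)) v"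
  using L2fun_facts(2)[OF \<psi>] AE_space
proof eventually_elim
  case (elim t)
  then show ?case
    unfolding Bop_def using bounded_curveD(2,3)[OF u, of t] v
    by (intro b_form_eq(2)[OF L \<alpha>]) (auto simp: Vsp_iff[OF L])
qed

text \<open>
  Tested with \<open>mode_field k p\<close>, the weak equation becomes a scalar equation for \<open>u t k \<bullet> p\<close>, which
  \<open>weak_decay_imp_mild\<close> solves. Only vectors \<open>p\<close> orthogonal to the wave vector are admissible, but the
  difference of the two sides is itself such a vector.
\<close>

lemma weak_solution_imp_fixed_point:
  assumes \<psi>: "\<psi> \<in> L2fun L \<mu> (1 + \<alpha>)" and weak: "weak_solution L \<mu> \<nu> \<alpha> f \<psi> u0 u"
  shows "bounded_curve L \<mu> \<alpha> u" and "t \<in> {0..\<mu>} \<Longrightarrow> u t = evolve \<psi> u0 u t"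
proof -
  have c: "continuous_map (top_of_set {0..\<mu>}) (Metric_space.mtopology (Vsp L \<alpha>) (Vdist L \<alpha>)) u"
    and u0: "u 0 = u0"
    and eq: "\<And>v \<phi>. v \<in> Vsp L (1 + \<alpha>) \<Longrightarrow> test_function \<mu> \<phi> \<Longrightarrow>
        - (LINT t|time \<mu>. pairing L (u t) v * deriv \<phi> t)
        + (LINT t|time \<mu>. (\<nu> * pairing L (stokes L (u t)) v + Bop L (\<psi> t) (u t) v) * \<phi> t)
        = (LINT t|time \<mu>. pairing L f v * \<phi> t)"
    using weak by (auto simp: weak_solution_def)
  note uc = continuous_map_Vsp_coefficient[OF L c]
  have mu: "(\<lambda>t. u t k) \<in> borel_measurable (time \<mu>)" for k
    using integrable_time_continuous[OF uc(1)] by simp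
  show u: "bounded_curve L \<mu> \<alpha> u"
    unfolding bounded_curve_def using mu uc(2,3) by (auto simp: Vsp_iff[OF L])
  have u0V: "u0 \<in> Vsp L \<alpha>" using uc(2)[of 0] \<mu> u0 by simp
  note s = source_forcing[OF \<psi> u] source_convection[OF \<psi> u]
  have sol_ev: "solenoidal L (evolve \<psi> u0 u t)" for t
    unfolding evolve_def using u0V by (intro sol_mild[OF L _ s(1)]) (simp add: Vsp_iff[OF L])
  assume t: "t \<in> {0..\<mu>}"
  show "u t = evolve \<psi> u0 u t"
  proof
    fix k
    show "u t k = evolve \<psi> u0 u t k"
    proof (cases "k = 0")
      case True
      then show ?thesis using sol_zero_mean[OF sol_ev] sol_zero_mean[OF bounded_curveD(2)[OF u t]] by simp
    next
      case False
      \<comment> \<open>The range of the Leray projection parametrises the admissible vectors.\<close>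
      have key: "u t k \<bullet> leray L k e = evolve \<psi> u0 u t k \<bullet> leray L k e" for e
      proof -
        define p where "p = leray L k e"
        define v where "v = mode_field k p"
        have p: "cdot p (freq L k) = 0" unfolding p_def by (rule cdot_leray[OF L])
        have v: "v \<in> Vsp L (1 + \<alpha>)" unfolding v_def by (rule mode_field_Vsp[OF L False p])
        define c where "c = \<nu> * (wn L k)\<^sup>2"
        have ca: "continuous_on {0..\<mu>} (\<lambda>t. u t k \<bullet> p)" by (intro continuous_intros uc(1))
        have gi: "integrable (time \<mu>) (\<lambda>t. forcing L f \<psi> u t k \<bullet> p)"
          using source_integrable[OF L s(1)] by simp
        have ci: "integrable (time \<mu>) (\<lambda>t. convection L (\<psi> t) (u t) k \<bullet> p)"
          using source_integrable[OF L s(2)] by simp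
        have pair: "pairing L w v = 2 * L ^ 3 * (w k \<bullet> p)" if "w (- k) = vcnj (w k)" for w
          unfolding v_def by (rule pairing_mode_field[OF False that])
        have pu: "pairing L (u t) v = 2 * L ^ 3 * (u t k \<bullet> p)"
          "pairing L (stokes L (u t)) v = 2 * L ^ 3 * ((wn L k)\<^sup>2 * (u t k \<bullet> p))" if "t \<in> {0..\<mu>}" for t
        proof -
          have r: "u t (- k) = vcnj (u t k)" using bounded_curveD(2)[OF u that] by (simp add: sol_iff)
          show "pairing L (u t) v = 2 * L ^ 3 * (u t k \<bullet> p)" by (rule pair[OF r])
          have "stokes L (u t) (- k) = vcnj (stokes L (u t) k)" by (simp add: stokes_def freq_uminus r)
          from pair[OF this] show "pairing L (stokes L (u t)) v = 2 * L ^ 3 * ((wn L k)\<^sup>2 * (u t k \<bullet> p))"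
            by (simp add: stokes_def wn_def)
        qed
        have pf: "pairing L f v = 2 * L ^ 3 * (f k \<bullet> p)"
          using sol_f by (intro pair) (simp add: sol_iff)
        have Bae: "AE t in time \<mu>. Bop L (\<psi> t) (u t) v = 2 * L ^ 3 * (convection L (\<psi> t) (u t) k \<bullet> p)"
          using Bop_AE[OF \<psi> u v] AE_sol_convection[OF \<psi> u]
        proof eventually_elim
          case (elim t)
          then show ?case using pair[of "convection L (\<psi> t) (u t)"] by (simp add: sol_iff)
        qed
        have "u t k \<bullet> p = exp (- (c * t)) * (u 0 k \<bullet> p) + exp (- (c * t)) * primitive \<mu> (\<lambda>s. exp (c * s) * (forcing L f \<psi> u s k \<bullet> p)) t"
        proof (rule weak_decay_imp_mild[OF \<mu> ca gi _ t])
          fix \<phi> assume \<phi>: "test_function \<mu> \<phi>"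
          note \<phi>' = test_functionD[OF \<phi>]
          have i1: "integrable (time \<mu>) (\<lambda>t. c * (u t k \<bullet> p) * \<phi> t)"
            by (intro integrable_time_continuous continuous_intros uc(1) \<phi>')
          have i2: "integrable (time \<mu>) (\<lambda>t. (convection L (\<psi> t) (u t) k \<bullet> p) * \<phi> t)"
            by (rule integrable_mult_continuous[OF ci \<phi>'(2)])
          have i3: "integrable (time \<mu>) (\<lambda>t. (f k \<bullet> p) * \<phi> t)"
            by (intro integrable_time_continuous continuous_intros \<phi>')
          have e1: "(LINT t|time \<mu>. pairing L (u t) v * deriv \<phi> t) = 2 * L ^ 3 * (LINT t|time \<mu>. (u t k \<bullet> p) * deriv \<phi> t)"
            by (subst integral_mult_right_zero[symmetric], rule Bochner_Integration.integral_cong) (simp_all add: pu)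
          have ae: "AE t in time \<mu>. 2 * L ^ 3 * (c * (u t k \<bullet> p) * \<phi> t + (convection L (\<psi> t) (u t) k \<bullet> p) * \<phi> t)
            = (\<nu> * pairing L (stokes L (u t)) v + Bop L (\<psi> t) (u t) v) * \<phi> t"
            using Bae AE_space by eventually_elim (simp add: pu c_def algebra_simps)
          have m: "(\<lambda>t. 2 * L ^ 3 * (c * (u t k \<bullet> p) * \<phi> t + (convection L (\<psi> t) (u t) k \<bullet> p) * \<phi> t)) \<in> borel_measurable (time \<mu>)"
            by (rule borel_measurable_times[OF borel_measurable_const borel_measurable_add[OF borel_measurable_integrable[OF i1] borel_measurable_integrable[OF i2]]])
          have "(LINT t|time \<mu>. (\<nu> * pairing L (stokes L (u t)) v + Bop L (\<psi> t) (u t) v) * \<phi> t)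
            = (LINT t|time \<mu>. 2 * L ^ 3 * (c * (u t k \<bullet> p) * \<phi> t + (convection L (\<psi> t) (u t) k \<bullet> p) * \<phi> t))"
            using ae by (intro integral_cong_AE m measurable_AE_eq_time[OF m ae]) auto
          also have "\<dots> = 2 * L ^ 3 * ((LINT t|time \<mu>. c * (u t k \<bullet> p) * \<phi> t) + (LINT t|time \<mu>. (convection L (\<psi> t) (u t) k \<bullet> p) * \<phi> t))"
            using i1 i2 by simp
          finally have e2: "(LINT t|time \<mu>. (\<nu> * pairing L (stokes L (u t)) v + Bop L (\<psi> t) (u t) v) * \<phi> t)
            = 2 * L ^ 3 * ((LINT t|time \<mu>. c * (u t k \<bullet> p) * \<phi> t) + (LINT t|time \<mu>. (convection L (\<psi> t) (u t) k \<bullet> p) * \<phi> t))" .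
          have e3: "(LINT t|time \<mu>. pairing L f v * \<phi> t) = 2 * L ^ 3 * (LINT t|time \<mu>. (f k \<bullet> p) * \<phi> t)"
            by (simp add: pf mult.assoc)
          have e4: "(LINT t|time \<mu>. (forcing L f \<psi> u t k \<bullet> p) * \<phi> t)
            = (LINT t|time \<mu>. (f k \<bullet> p) * \<phi> t) - (LINT t|time \<mu>. (convection L (\<psi> t) (u t) k \<bullet> p) * \<phi> t)"
            using i2 i3 by (subst Bochner_Integration.integral_diff[symmetric]) (simp_all add: forcing_def inner_diff_left left_diff_distrib)
          have "2 * L ^ 3 * (- (LINT t|time \<mu>. (u t k \<bullet> p) * deriv \<phi> t) + (LINT t|time \<mu>. c * (u t k \<bullet> p) * \<phi> t)
             + (LINT t|time \<mu>. (convection L (\<psi> t) (u t) k \<bullet> p) * \<phi> t)) = 2 * L ^ 3 * (LINT t|time \<mu>. (f k \<bullet> p) * \<phi> t)"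
            using eq[OF v \<phi>] unfolding e1 e2 e3 by (simp only: distrib_left mult_minus_right add.assoc)
          then have "- (LINT t|time \<mu>. (u t k \<bullet> p) * deriv \<phi> t) + (LINT t|time \<mu>. c * (u t k \<bullet> p) * \<phi> t)
             + (LINT t|time \<mu>. (convection L (\<psi> t) (u t) k \<bullet> p) * \<phi> t) = (LINT t|time \<mu>. (f k \<bullet> p) * \<phi> t)"
            using L by (subst (asm) mult_cancel_left) auto
          then show "- (LINT t|time \<mu>. (u t k \<bullet> p) * deriv \<phi> t) + (LINT t|time \<mu>. c * (u t k \<bullet> p) * \<phi> t)
            = (LINT t|time \<mu>. (forcing L f \<psi> u t k \<bullet> p) * \<phi> t)"
            unfolding e4 by linarith
        qed
        then have "u t k \<bullet> p = evolve \<psi> u0 u t k \<bullet> p"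
          unfolding evolve_def mild_def inner_add_left duhamel_inner[OF source_integrable[OF L s(1)]]
          by (simp add: c_def u0)
        then show ?thesis by (simp add: p_def)
      qed
      define d where "d = u t k - evolve \<psi> u0 u t k"
      have "cdot d (freq L k) = 0"
        using bounded_curveD(2)[OF u t] sol_ev[of t] by (simp add: d_def cdot_diff sol_iff)
      then have "leray L k d = d" by (rule leray_id[OF False])
      then have "d \<bullet> d = 0" using key[of d] by (simp add: d_def inner_diff_left)
      then show ?thesis by (simp add: d_def)
    qed
  qed
qed

lemma fixed_point_imp_L2fun:
  assumes \<psi>: "\<psi> \<in> L2fun L \<mu> (1 + \<alpha>)" and u0: "u0 \<in> Vsp L \<alpha>"
    and u: "bounded_curve L \<mu> \<alpha> u" and fp: "\<And>t. t \<in> {0..\<mu>} \<Longrightarrow> u t = evolve \<psi> u0 u t"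
  shows "u \<in> L2fun L \<mu> (1 + \<alpha>)"
proof -
  note s = source_forcing[OF \<psi> u]
  obtain B where B: "\<And>t k. t \<in> {0..\<mu>} \<Longrightarrow> norm (u t k) \<le> B"
    using bounded_curve_coefficient_bound[OF L _ u] \<alpha> by auto
  have "(\<integral>\<^sup>+t. sob L (1 + \<alpha>) (u t) \<partial>time \<mu>) = (\<integral>\<^sup>+t. sob L (1 + \<alpha>) (evolve \<psi> u0 u t) \<partial>time \<mu>)"
    by (intro nn_integral_cong) (simp flip: fp)
  also have "\<dots> \<le> ennreal (1 / \<nu>) * sob L \<alpha> u0 + ennreal (2 / \<nu>\<^sup>2) * (\<integral>\<^sup>+t. sob L (\<alpha> - 1) (forcing L f \<psi> u t) \<partial>time \<mu>)"
    unfolding evolve_def by (rule mild_L2_bound[OF L \<nu> sourceD(1)[OF s]])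
  also have "\<dots> < \<infinity>" using u0 sourceD(2)[OF s] by (simp add: Vsp_iff[OF L] ennreal_mult_less_top)
  finally have fin: "(\<integral>\<^sup>+t. sob L (1 + \<alpha>) (u t) \<partial>time \<mu>) < \<infinity>" .
  show ?thesis
    by (rule L2funI[OF L bounded_curveD(1)[OF u] B _ fin]) (use bounded_curveD(2)[OF u] in \<open>auto intro!: AE_I2\<close>)
qed

lemma fixed_point_imp_continuous:
  assumes \<psi>: "\<psi> \<in> L2fun L \<mu> (1 + \<alpha>)" and u0: "u0 \<in> Vsp L \<alpha>"
    and u: "bounded_curve L \<mu> \<alpha> u" and fp: "\<And>t. t \<in> {0..\<mu>} \<Longrightarrow> u t = evolve \<psi> u0 u t"
  shows "continuous_map (top_of_set {0..\<mu>}) (Metric_space.mtopology (Vsp L \<alpha>) (Vdist L \<alpha>)) u"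
proof -
  note s = source_forcing[OF \<psi> u]
  define D where "D k = 2 * ennreal (wn L k powr (2 * \<alpha>) * (norm (u0 k))\<^sup>2)
     + ennreal (1 / \<nu>) * (ennreal (wn L k powr (2 * (\<alpha> - 1))) * (\<integral>\<^sup>+s. ennreal ((norm (forcing L f \<psi> u s k))\<^sup>2) \<partial>time \<mu>))" for k
  show ?thesis
  proof (rule continuous_map_VspI[OF L])
    show "u t \<in> Vsp L \<alpha>" if "t \<in> {0..\<mu>}" for t
      using bounded_curveD(2,3)[OF u that] by (simp add: Vsp_iff[OF L])
    show "continuous_on {0..\<mu>} (\<lambda>t. u t k)" for k
      by (rule continuous_on_eq[OF continuous_on_mild[OF L s, of \<nu> u0]]) (simp add: fp[unfolded evolve_def, symmetric])
    show "ennreal (wn L k powr (2 * \<alpha>) * (norm (u t k))\<^sup>2) \<le> D k" if t: "t \<in> {0..\<mu>}" for t k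
    proof -
      have "ennreal (wn L k powr (2 * \<alpha>) * (norm (u t k))\<^sup>2)
        \<le> ennreal (2 * exp (- (2 * \<nu> * (2 * pi / L)\<^sup>2 * t))) * ennreal (wn L k powr (2 * \<alpha>) * (norm (u0 k))\<^sup>2)
         + ennreal (1 / \<nu>) * (ennreal (wn L k powr (2 * (\<alpha> - 1))) * (\<integral>\<^sup>+s. ennreal ((norm (forcing L f \<psi> u s k))\<^sup>2) \<partial>time \<mu>))"
        using t by (subst fp[OF t], unfold evolve_def) (intro mild_mode_sup_bound[OF L \<nu>] sourceD(1)[OF s], simp)
      also have "\<dots> \<le> D k"
        unfolding D_def
      proof (intro add_right_mono mult_right_mono)
        have "ennreal (2 * exp (- (2 * \<nu> * (2 * pi / L)\<^sup>2 * t))) \<le> ennreal 2"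
          using \<nu> t by (intro ennreal_leI) simp
        then show "ennreal (2 * exp (- (2 * \<nu> * (2 * pi / L)\<^sup>2 * t))) \<le> 2" by simp
      qed simp
      finally show ?thesis .
    qed
    have "(\<integral>\<^sup>+k. D k \<partial>count_space UNIV) = 2 * sob L \<alpha> u0 + ennreal (1 / \<nu>) * (\<integral>\<^sup>+t. sob L (\<alpha> - 1) (forcing L f \<psi> u t) \<partial>time \<mu>)"
      unfolding D_def nn_integral_sob[OF sourceD(1)[OF s]] by (simp add: nn_integral_add nn_integral_cmult sob_def)
    also have "\<dots> < \<infinity>" using u0 sourceD(2)[OF s] by (simp add: Vsp_iff[OF L] ennreal_mult_less_top)
    finally show "(\<integral>\<^sup>+k. D k \<partial>count_space UNIV) < \<infinity>" .
  qed
qed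

text \<open>
  The converse direction: the equation holds in each mode, and summing over the modes is justified by
  \<open>pairing_time\<close>. The functions \<open>u\<close>, \<open>A u\<close> and \<open>B(\<psi>,u)\<close> are all square integrable in time with
  values in \<open>V\<^sup>\<alpha>\<^sup>-\<^sup>1\<close>, and the test field belongs to the dual space \<open>V\<^sup>1\<^sup>-\<^sup>\<alpha>\<close>.
\<close>

lemma fixed_point_imp_weak_solution:
  assumes \<psi>: "\<psi> \<in> L2fun L \<mu> (1 + \<alpha>)" and u0: "u0 \<in> Vsp L \<alpha>"
    and u: "bounded_curve L \<mu> \<alpha> u" and fp: "\<And>t. t \<in> {0..\<mu>} \<Longrightarrow> u t = evolve \<psi> u0 u t"
  shows "weak_solution L \<mu> \<nu> \<alpha> f \<psi> u0 u"
  unfolding weak_solution_def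
proof (intro conjI ballI allI impI)
  show "continuous_map (top_of_set {0..\<mu>}) (Metric_space.mtopology (Vsp L \<alpha>) (Vdist L \<alpha>)) u"
    by (rule fixed_point_imp_continuous[OF assms])
  show uL: "u \<in> L2fun L \<mu> (1 + \<alpha>)" by (rule fixed_point_imp_L2fun[OF assms])
  note s = source_forcing[OF \<psi> u] source_convection[OF \<psi> u]
  show "u 0 = u0"
  proof
    fix k
    have "duhamel \<mu> (\<nu> * (wn L k)\<^sup>2) (\<lambda>s. forcing L f \<psi> u s k) 0 = 0"
      using \<mu> by (simp add: duhamel_eq_primitive primitive_0[OF integrable_exp_mult[OF source_integrable[OF L s(1)]]])
    then show "u 0 k = u0 k" using fp[of 0] \<mu> by (simp add: evolve_def mild_def)
  qed
  fix v \<phi> assume v: "v \<in> Vsp L (1 + \<alpha>)" and \<phi>: "test_function \<mu> \<phi>"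
  note \<phi>' = test_functionD[OF \<phi>]
  note um = bounded_curveD(1)[OF u]
  have v': "sob L (- (\<alpha> - 1)) v < \<infinity>"
    using sob_finite_mono[OF L, of "- (\<alpha> - 1)" "1 + \<alpha>" v] v \<alpha> by (simp add: Vsp_iff[OF L])
  have u0AE: "AE t in time \<mu>. u t 0 = 0"
    using sol_zero_mean[OF bounded_curveD(2)[OF u]] by (intro AE_I2) simp
  have fin_u: "(\<integral>\<^sup>+t. sob L (\<alpha> - 1) (u t) \<partial>time \<mu>) < \<infinity>"
  proof -
    note [measurable] = borel_measurable_sob[OF um]
    have "(\<integral>\<^sup>+t. sob L (\<alpha> - 1) (u t) \<partial>time \<mu>)
      \<le> (\<integral>\<^sup>+t. ennreal ((2 * pi / L) powr (2 * (\<alpha> - 1 - (1 + \<alpha>)))) * sob L (1 + \<alpha>) (u t) \<partial>time \<mu>)"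
      by (intro nn_integral_mono sob_mono[OF L]) simp
    also have "\<dots> < \<infinity>" using L2fun_facts(3)[OF uL] by (simp add: nn_integral_cmult ennreal_mult_less_top)
    finally show ?thesis .
  qed
  have stokes_m: "(\<lambda>t. stokes L (u t) k) \<in> borel_measurable (time \<mu>)" for k
    unfolding stokes_def by (intro borel_measurable_scaleR borel_measurable_const um)
  have fin_st: "(\<integral>\<^sup>+t. sob L (\<alpha> - 1) (stokes L (u t)) \<partial>time \<mu>) < \<infinity>"
    using L2fun_facts(3)[OF uL] by (simp add: sob_stokes[OF L])
  have fin_f: "(\<integral>\<^sup>+t. sob L (\<alpha> - 1) f \<partial>time \<mu>) < \<infinity>"
  proof -
    interpret finite_measure "time \<mu>" by (rule finite_measure_time)
    show ?thesis using sob_f(2) by (simp add: ennreal_mult_less_top emeasure_eq_measure del: space_time)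
  qed
  have cv0: "AE t in time \<mu>. convection L (\<psi> t) (u t) 0 = 0" by simp
  note A = pairing_time[OF L um u0AE fin_u v' \<phi>'(3)]
  note S = pairing_time[OF L stokes_m _ fin_st v' \<phi>'(2)]
  note C = pairing_time[OF L sourceD(1)[OF s(2)] cv0 sourceD(2)[OF s(2)] v' \<phi>'(2)]
  note F = pairing_time[OF L borel_measurable_const _ fin_f v' \<phi>'(2)]
  have st0: "AE t in time \<mu>. stokes L (u t) 0 = 0" by (simp add: stokes_def)
  have f0: "AE t in time \<mu>. f 0 = 0" using sol_zero_mean[OF sol_f] by simp
  note S = S[OF st0] and F = F[OF f0]
  let ?A = "\<lambda>k. LINT t|time \<mu>. (u t k \<bullet> v k) * deriv \<phi> t"
  let ?S = "\<lambda>k. LINT t|time \<mu>. (stokes L (u t) k \<bullet> v k) * \<phi> t"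
  let ?C = "\<lambda>k. LINT t|time \<mu>. (convection L (\<psi> t) (u t) k \<bullet> v k) * \<phi> t"
  let ?F = "\<lambda>k. LINT t|time \<mu>. (f k \<bullet> v k) * \<phi> t"
  have mode: "- ?A k + \<nu> * ?S k = ?F k - ?C k" for k
  proof -
    define c where "c = \<nu> * (wn L k)\<^sup>2"
    have gi: "integrable (time \<mu>) (\<lambda>t. forcing L f \<psi> u t k \<bullet> v k)"
      using source_integrable[OF L s(1)] by simp
    have ci: "integrable (time \<mu>) (\<lambda>t. convection L (\<psi> t) (u t) k \<bullet> v k)"
      using source_integrable[OF L s(2)] by simp
    have i3: "integrable (time \<mu>) (\<lambda>t. (f k \<bullet> v k) * \<phi> t)"
      by (intro integrable_time_continuous continuous_intros \<phi>'(2))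
    have "- (LINT t|time \<mu>. (u t k \<bullet> v k) * deriv \<phi> t) + (LINT t|time \<mu>. c * (u t k \<bullet> v k) * \<phi> t)
      = (LINT t|time \<mu>. (forcing L f \<psi> u t k \<bullet> v k) * \<phi> t)"
    proof (rule mild_imp_weak_decay[OF _ gi \<phi>])
      fix t assume t: "t \<in> {0..\<mu>}"
      show "u t k \<bullet> v k = exp (- (c * t)) * (u0 k \<bullet> v k) + exp (- (c * t)) * primitive \<mu> (\<lambda>s. exp (c * s) * (forcing L f \<psi> u s k \<bullet> v k)) t"
        by (subst fp[OF t], unfold evolve_def mild_def inner_add_left duhamel_inner[OF source_integrable[OF L s(1)]])
          (simp add: c_def)
    qed
    moreover have "(LINT t|time \<mu>. c * (u t k \<bullet> v k) * \<phi> t) = \<nu> * ?S k"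
      by (simp add: c_def stokes_def wn_def mult.assoc)
    moreover have "(LINT t|time \<mu>. (forcing L f \<psi> u t k \<bullet> v k) * \<phi> t) = ?F k - ?C k"
      using integrable_mult_continuous[OF ci \<phi>'(2)] i3
      by (subst Bochner_Integration.integral_diff[symmetric])
        (simp_all add: forcing_def inner_diff_left left_diff_distrib)
    ultimately show ?thesis by simp
  qed
  have total: "- (LINT k|count_space UNIV. ?A k) + \<nu> * (LINT k|count_space UNIV. ?S k)
     = (LINT k|count_space UNIV. ?F k) - (LINT k|count_space UNIV. ?C k)"
  proof -
    have "- (LINT k|count_space UNIV. ?A k) + \<nu> * (LINT k|count_space UNIV. ?S k) = (LINT k|count_space UNIV. - ?A k + \<nu> * ?S k)"
      using A(2) S(2) by simp
    also have "\<dots> = (LINT k|count_space UNIV. ?F k) - (LINT k|count_space UNIV. ?C k)"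
      unfolding mode using F(2) C(2) by simp
    finally show ?thesis .
  qed
  have m: "(\<lambda>t. \<nu> * (pairing L (stokes L (u t)) v * \<phi> t) + pairing L (convection L (\<psi> t) (u t)) v * \<phi> t) \<in> borel_measurable (time \<mu>)"
    using S(1) C(1) by (intro borel_measurable_add borel_measurable_times borel_measurable_const borel_measurable_integrable)
  have ae: "AE t in time \<mu>. \<nu> * (pairing L (stokes L (u t)) v * \<phi> t) + pairing L (convection L (\<psi> t) (u t)) v * \<phi> t
    = (\<nu> * pairing L (stokes L (u t)) v + Bop L (\<psi> t) (u t) v) * \<phi> t"
    using Bop_AE[OF \<psi> u v] by eventually_elim (simp add: algebra_simps)
  have "(LINT t|time \<mu>. (\<nu> * pairing L (stokes L (u t)) v + Bop L (\<psi> t) (u t) v) * \<phi> t)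
    = (LINT t|time \<mu>. \<nu> * (pairing L (stokes L (u t)) v * \<phi> t) + pairing L (convection L (\<psi> t) (u t)) v * \<phi> t)"
    using ae by (intro integral_cong_AE m measurable_AE_eq_time[OF m ae]) auto
  also have "\<dots> = \<nu> * (LINT t|time \<mu>. pairing L (stokes L (u t)) v * \<phi> t) + (LINT t|time \<mu>. pairing L (convection L (\<psi> t) (u t)) v * \<phi> t)"
    using S(1) C(1) by simp
  finally have mid: "(LINT t|time \<mu>. (\<nu> * pairing L (stokes L (u t)) v + Bop L (\<psi> t) (u t) v) * \<phi> t)
    = L ^ 3 * (\<nu> * (LINT k|count_space UNIV. ?S k) + (LINT k|count_space UNIV. ?C k))"
    unfolding S(3) C(3) by (simp add: algebra_simps)
  have "L ^ 3 * (- (LINT k|count_space UNIV. ?A k) + \<nu> * (LINT k|count_space UNIV. ?S k) + (LINT k|count_space UNIV. ?C k))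
    = L ^ 3 * (LINT k|count_space UNIV. ?F k)"
    unfolding total by simp
  then show "- (LINT t|time \<mu>. pairing L (u t) v * deriv \<phi> t)
     + (LINT t|time \<mu>. (\<nu> * pairing L (stokes L (u t)) v + Bop L (\<psi> t) (u t) v) * \<phi> t)
     = (LINT t|time \<mu>. pairing L f v * \<phi> t)"
    unfolding mid A(3) F(3) by (simp only: distrib_left mult_minus_right add.assoc)
qed

text \<open>
  Only the values on the time interval matter. This allows restricting a fixed point to an extensional
  function, the form in which \<open>solution\<close> is normalised.
\<close>

lemma evolve_cong:
  assumes "\<And>t. t \<in> {0..\<mu>} \<Longrightarrow> u t = u' t" shows "evolve \<psi> u0 u = evolve \<psi> u0 u'"
proof -
  have "duhamel \<mu> c (\<lambda>s. forcing L f \<psi> u s k) t = duhamel \<mu> c (\<lambda>s. forcing L f \<psi> u' s k) t" for c k t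
    unfolding duhamel_def forcing_def by (rule Bochner_Integration.integral_cong) (simp_all add: assms)
  then show ?thesis unfolding evolve_def mild_def by (intro ext) simp
qed

lemma bounded_curve_cong:
  assumes "\<And>t. t \<in> {0..\<mu>} \<Longrightarrow> u t = u' t" "bounded_curve L \<mu> \<alpha> u"
  shows "bounded_curve L \<mu> \<alpha> u'"
proof -
  have "(\<lambda>t. u' t k) \<in> borel_measurable (time \<mu>)" for k
    using bounded_curveD(1)[OF assms(2), of k] by (rule measurable_cong[THEN iffD1, rotated]) (simp add: assms(1))
  then show ?thesis using assms unfolding bounded_curve_def by auto
qed

text \<open>
  The definite description in \<open>solution\<close> is resolved by existence and uniqueness of the fixed point.
\<close>

lemma solution_fixed_point:
  assumes \<psi>: "\<psi> \<in> L2fun L \<mu> (1 + \<alpha>)" and small: "small_drift \<psi>" and u0: "u0 \<in> Vsp L \<alpha>"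
  defines "u \<equiv> solution L \<mu> \<nu> \<alpha> f \<psi> u0"
  shows "bounded_curve L \<mu> \<alpha> u" and "t \<in> {0..\<mu>} \<Longrightarrow> u t = evolve \<psi> u0 u t" and "u \<in> extensional {0..\<mu>}"
proof -
  obtain w where w: "bounded_curve L \<mu> \<alpha> w" "\<And>t. t \<in> {0..\<mu>} \<Longrightarrow> w t = evolve \<psi> u0 w t"
    using evolve_fixed_point_exists[OF \<psi> small u0] by blast
  define r where "r = restrict w {0..\<mu>}"
  have rw: "w t = r t" if "t \<in> {0..\<mu>}" for t using that by (simp add: r_def)
  have rb: "bounded_curve L \<mu> \<alpha> r" by (rule bounded_curve_cong[OF rw w(1)])
  have rf: "r t = evolve \<psi> u0 r t" if "t \<in> {0..\<mu>}" for t
    using w(2)[OF that] rw[OF that] evolve_cong[OF rw] by simp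
  have rr: "r \<in> extensional {0..\<mu>} \<and> weak_solution L \<mu> \<nu> \<alpha> f \<psi> u0 r"
  proof
    show "r \<in> extensional {0..\<mu>}" by (simp add: r_def)
    show "weak_solution L \<mu> \<nu> \<alpha> f \<psi> u0 r" by (rule fixed_point_imp_weak_solution[OF \<psi> u0 rb rf])
  qed
  have "u = r"
    unfolding u_def solution_def
  proof (rule the_equality)
    show "r \<in> extensional {0..\<mu>} \<and> weak_solution L \<mu> \<nu> \<alpha> f \<psi> u0 r" by (rule rr)
    fix z assume z: "z \<in> extensional {0..\<mu>} \<and> weak_solution L \<mu> \<nu> \<alpha> f \<psi> u0 z"
    then have zw: "weak_solution L \<mu> \<nu> \<alpha> f \<psi> u0 z" by simp
    note zf = weak_solution_imp_fixed_point[OF \<psi> zw]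
    have "z t = r t" if "t \<in> {0..\<mu>}" for t
      by (rule evolve_fixed_point_unique[OF \<psi> small zf(1) zf(2) rb rf that])
    then show "z = r" using z rr by (intro extensionalityI[of _ "{0..\<mu>}"]) auto
  qed
  then show "bounded_curve L \<mu> \<alpha> u" "t \<in> {0..\<mu>} \<Longrightarrow> u t = evolve \<psi> u0 u t" "u \<in> extensional {0..\<mu>}"
    using rb rf rr by auto
qed

end

section \<open>Steady states at large viscosity\<close>

lemma sob_embedding:
  assumes "0 < L"
  shows "sob L \<alpha> u \<le> ennreal ((L / (2 * pi))\<^sup>2) * sob L (1 + \<alpha>) u"
proof -
  have "(2 * pi / L) powr (2 * (\<alpha> - (1 + \<alpha>))) = (L / (2 * pi))\<^sup>2"
    using assms by (simp add: powr_minus power_divide)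
  then show ?thesis using sob_mono[OF assms, of \<alpha> "1 + \<alpha>" u] by simp
qed

text \<open>
  The inverse of \<open>\<nu> A\<close> on fields without mean. At \<open>k = 0\<close> the division by zero yields \<open>0\<close>, as it
  should.
\<close>

definition stokes_inverse :: "real \<Rightarrow> real \<Rightarrow> vfield \<Rightarrow> vfield" where
  "stokes_inverse L \<nu> g k = (1 / (\<nu> * (wn L k)\<^sup>2)) *\<^sub>R g k"

lemma sob_stokes_inverse:
  assumes L: "0 < L" and \<nu>: "0 < \<nu>"
  shows "sob L (1 + s) (stokes_inverse L \<nu> g) = ennreal (1 / \<nu>\<^sup>2) * sob L (s - 1) g"
proof -
  have "wn L k powr (2 * (1 + s)) * (norm (stokes_inverse L \<nu> g k))\<^sup>2
    = 1 / \<nu>\<^sup>2 * (wn L k powr (2 * (s - 1)) * (norm (g k))\<^sup>2)" for k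
  proof (cases "k = 0")
    case False
    have w: "0 < wn L k" by (rule wn_pos[OF L False])
    have "wn L k powr (2 * (1 + s)) = wn L k powr (2 * (s - 1)) * wn L k ^ 4"
      using w powr_add[of "wn L k" "2 * (s - 1)" 4] by (simp add: algebra_simps)
    moreover have "(norm (stokes_inverse L \<nu> g k))\<^sup>2 = (norm (g k))\<^sup>2 / (\<nu>\<^sup>2 * wn L k ^ 4)"
      by (simp add: stokes_inverse_def power_divide power_mult_distrib)
    ultimately show ?thesis using w by simp
  qed simp
  then have "ennreal (wn L k powr (2 * (1 + s)) * (norm (stokes_inverse L \<nu> g k))\<^sup>2)
    = ennreal (1 / \<nu>\<^sup>2) * ennreal (wn L k powr (2 * (s - 1)) * (norm (g k))\<^sup>2)" for k
    by (subst ennreal_mult[symmetric]) simp_all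
  then show ?thesis
    unfolding sob_def by (simp only: nn_integral_cmult borel_measurable_count_space)
qed

lemma sol_stokes_inverse: "solenoidal L g \<Longrightarrow> solenoidal L (stokes_inverse L \<nu> g)"
  by (simp add: sol_iff stokes_inverse_def cdot_scaleR vcnj_simps)

context linearised_NSE
begin

text \<open>
  The fixed points of this map are the steady states \<open>\<nu> A u + B(u,u) = f\<close>.
\<close>

definition steady :: "vfield \<Rightarrow> vfield" where
  "steady u = stokes_inverse L \<nu> (\<lambda>k. f k - convection L u u k)"

lemma sob_lower_finite:
  assumes "sob L (1 + \<alpha>) u \<le> ennreal \<rho>"
  shows "sob L (1 + \<alpha>) u < \<infinity>" "sob L \<alpha> u < \<infinity>" "sob L 0 u < \<infinity>"
proof -
  show 1: "sob L (1 + \<alpha>) u < \<infinity>" by (rule le_less_trans[OF assms]) simp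
  show "sob L \<alpha> u < \<infinity>" "sob L 0 u < \<infinity>"
    using sob_finite_mono[OF L _ 1, of \<alpha>] sob_finite_mono[OF L _ 1, of 0] \<alpha> by auto
qed

lemma sob_embedding_ball:
  assumes "sob L (1 + \<alpha>) u \<le> ennreal \<rho>"
  shows "sob L \<alpha> u \<le> ennreal ((L / (2 * pi))\<^sup>2 * \<rho>)"
proof -
  have "sob L \<alpha> u \<le> ennreal ((L / (2 * pi))\<^sup>2) * ennreal \<rho>"
    by (rule order_trans[OF sob_embedding[OF L] mult_left_mono[OF assms]]) simp
  then show ?thesis by (subst ennreal_mult') simp_all
qed

lemma sol_steady:
  assumes u: "solenoidal L u" "sob L (1 + \<alpha>) u \<le> ennreal \<rho>"
  shows "solenoidal L (steady u)"
  unfolding steady_def using sob_lower_finite[OF u(2)]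
  by (intro sol_stokes_inverse sol_diff sol_f sol_convection[OF L u(1) _ u(1)])

lemma steady_ball:
  assumes u: "solenoidal L u" "sob L (1 + \<alpha>) u \<le> ennreal \<rho>" and \<rho>: "0 \<le> \<rho>"
    and large: "2 * enn2real (sob L (\<alpha> - 1) f) + 2 * K * (L / (2 * pi))\<^sup>2 * \<rho>\<^sup>2 \<le> \<nu>\<^sup>2 * \<rho>"
  shows "sob L (1 + \<alpha>) (steady u) \<le> ennreal \<rho>"
proof -
  define \<phi> where "\<phi> = enn2real (sob L (\<alpha> - 1) f)"
  define c where "c = (L / (2 * pi))\<^sup>2"
  have \<phi>: "0 \<le> \<phi>" "sob L (\<alpha> - 1) f = ennreal \<phi>" and c: "0 \<le> c"
    using sob_f(2) by (auto simp: \<phi>_def c_def)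
  have "sob L (\<alpha> - 1) (convection L u u) \<le> ennreal K * (sob L (1 + \<alpha>) u * sob L \<alpha> u)"
    using sol_zero_mean[OF u(1)] by (intro convection_le)
  also have "\<dots> \<le> ennreal K * (ennreal \<rho> * ennreal (c * \<rho>))"
    unfolding c_def by (intro mult_left_mono mult_mono u(2) sob_embedding_ball) auto
  also have "\<dots> = ennreal (K * (\<rho> * (c * \<rho>)))"
    using K \<rho> c by (simp add: ennreal_mult)
  finally have cv: "sob L (\<alpha> - 1) (convection L u u) \<le> ennreal (K * (\<rho> * (c * \<rho>)))" .
  have "sob L (1 + \<alpha>) (steady u) \<le> ennreal (1 / \<nu>\<^sup>2) * (2 * ennreal \<phi> + 2 * ennreal (K * (\<rho> * (c * \<rho>))))"
    unfolding steady_def sob_stokes_inverse[OF L \<nu>]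
    by (intro mult_left_mono order_trans[OF sob_diff_le] add_mono cv) (simp_all add: \<phi>)
  also have "\<dots> = ennreal (1 / \<nu>\<^sup>2 * (2 * \<phi> + 2 * (K * (\<rho> * (c * \<rho>)))))"
  proof -
    have lin: "ennreal a * (2 * ennreal x + 2 * ennreal y) = ennreal (a * (2 * x + 2 * y))"
      if "0 \<le> a" "0 \<le> x" "0 \<le> y" for a x y
      using that by (simp add: ennreal_mult)
    show ?thesis by (rule lin) (use K \<rho> c \<phi>(1) in simp_all)
  qed
  also have "\<dots> \<le> ennreal \<rho>"
  proof (rule ennreal_leI)
    have "2 * \<phi> + 2 * (K * (\<rho> * (c * \<rho>))) \<le> \<nu>\<^sup>2 * \<rho>"
      using large by (simp add: \<phi>_def c_def power2_eq_square mult_ac)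
    then show "1 / \<nu>\<^sup>2 * (2 * \<phi> + 2 * (K * (\<rho> * (c * \<rho>)))) \<le> \<rho>"
      using \<nu> by (simp add: pos_divide_le_eq mult.commute)
  qed
  finally show ?thesis .
qed

text \<open>
  \<open>B(u,u) - B(v,v) = B(u, u - v) + B(u - v, v)\<close>, and both terms carry the factor \<open>1 / \<nu>\<^sup>2\<close> for squared
  norms.
\<close>

lemma steady_contraction:
  assumes u: "solenoidal L u" "sob L (1 + \<alpha>) u \<le> ennreal \<rho>" and v: "solenoidal L v" "sob L (1 + \<alpha>) v \<le> ennreal \<rho>"
    and \<rho>: "0 \<le> \<rho>" and large: "64 * K * (L / (2 * pi))\<^sup>2 * \<rho> \<le> \<nu>\<^sup>2"
  shows "sob L (1 + \<alpha>) (\<lambda>k. steady u k - steady v k) \<le> ennreal (1 / 16) * sob L (1 + \<alpha>) (\<lambda>k. u k - v k)"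
proof -
  define c where "c = (L / (2 * pi))\<^sup>2"
  let ?w = "\<lambda>k. u k - v k" let ?D = "sob L (1 + \<alpha>) (\<lambda>k. u k - v k)"
  have c: "0 \<le> c" by (simp add: c_def)
  note z = sol_zero_mean[OF u(1)] sol_zero_mean[OF v(1)]
  have eq: "(\<lambda>k. steady u k - steady v k)
    = stokes_inverse L \<nu> (\<lambda>k. - (convection L u ?w k + convection L ?w v k))"
  proof
    fix k
    have "convection L u u k - convection L v v k = convection L u ?w k + convection L ?w v k"
      using sob_lower_finite[OF u(2)] sob_lower_finite[OF v(2)] by (intro convection_difference[OF L] z)
    then show "steady u k - steady v k = stokes_inverse L \<nu> (\<lambda>k. - (convection L u ?w k + convection L ?w v k)) k"
      unfolding steady_def stokes_inverse_def scaleR_diff_right[symmetric]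
      by (simp add: algebra_simps)
  qed
  have a: "sob L (\<alpha> - 1) (convection L u ?w) \<le> ennreal K * (ennreal \<rho> * (ennreal c * ?D))"
  proof -
    have "sob L (\<alpha> - 1) (convection L u ?w) \<le> ennreal K * (sob L (1 + \<alpha>) u * sob L \<alpha> ?w)"
      by (intro convection_le) (simp_all add: z)
    also have "\<dots> \<le> ennreal K * (ennreal \<rho> * (ennreal c * ?D))"
      unfolding c_def by (intro mult_left_mono mult_mono u(2) sob_embedding[OF L]) auto
    finally show ?thesis .
  qed
  have b: "sob L (\<alpha> - 1) (convection L ?w v) \<le> ennreal K * (?D * ennreal (c * \<rho>))"
  proof -
    have "sob L (\<alpha> - 1) (convection L ?w v) \<le> ennreal K * (?D * sob L \<alpha> v)"
      by (intro convection_le) (simp_all add: z)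
    also have "\<dots> \<le> ennreal K * (?D * ennreal (c * \<rho>))"
      unfolding c_def by (intro mult_left_mono sob_embedding_ball v(2)) auto
    finally show ?thesis .
  qed
  have e1: "ennreal K * (ennreal \<rho> * (ennreal c * ?D)) = ennreal (K * \<rho> * c) * ?D"
    using K \<rho> c by (simp add: ennreal_mult mult.assoc)
  have e2: "ennreal K * (?D * ennreal (c * \<rho>)) = ennreal (K * \<rho> * c) * ?D"
    using K \<rho> c by (simp add: ennreal_mult mult_ac)
  have "sob L (1 + \<alpha>) (\<lambda>k. steady u k - steady v k)
    \<le> ennreal (1 / \<nu>\<^sup>2) * (2 * (ennreal (K * \<rho> * c) * ?D) + 2 * (ennreal (K * \<rho> * c) * ?D))"
    unfolding eq sob_stokes_inverse[OF L \<nu>] sob_uminus using a b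
    by (intro mult_left_mono order_trans[OF sob_add_le] add_mono) (simp_all only: e1 e2, simp_all)
  also have "\<dots> = ennreal (1 / \<nu>\<^sup>2) * (4 * ennreal (K * \<rho> * c)) * ?D"
  proof -
    have "2 * x + 2 * x = 4 * x" for x :: ennreal
      using distrib_right[of "2 :: ennreal" 2 x] by simp
    then show ?thesis by (simp only: mult.assoc)
  qed
  also have "ennreal (1 / \<nu>\<^sup>2) * (4 * ennreal (K * \<rho> * c)) = ennreal (1 / \<nu>\<^sup>2 * (4 * (K * \<rho> * c)))"
  proof -
    have lin: "ennreal a * (4 * ennreal x) = ennreal (a * (4 * x))" if "0 \<le> a" "0 \<le> x" for a x
      using that by (simp add: ennreal_mult)
    show ?thesis by (rule lin) (use K \<rho> c in simp_all)
  qed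
  also have "\<dots> * ?D \<le> ennreal (1 / 16) * ?D"
  proof (intro mult_right_mono ennreal_leI)
    have "4 * (K * \<rho> * c) * 16 \<le> \<nu>\<^sup>2" using large by (simp add: c_def mult_ac)
    then show "1 / \<nu>\<^sup>2 * (4 * (K * \<rho> * c)) \<le> 1 / 16" using \<nu> by (simp add: pos_divide_le_eq)
  qed simp
  finally show ?thesis .
qed

text \<open>
  Banach's fixed point argument. The iterates stay in the ball where the squared norm is at most \<open>r\<close>,
  but the limit is only known to satisfy the bound \<open>4 * r\<close>, so the contraction is required on the larger
  ball.
\<close>

lemma steady_state_exists:
  assumes r: "0 < r"
    and force: "2 * enn2real (sob L (\<alpha> - 1) f) + 2 * K * (L / (2 * pi))\<^sup>2 * r\<^sup>2 \<le> \<nu>\<^sup>2 * r"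
    and large: "64 * K * (L / (2 * pi))\<^sup>2 * (4 * r) \<le> \<nu>\<^sup>2"
  obtains w where "solenoidal L w" "sob L (1 + \<alpha>) w \<le> ennreal (4 * r)" "steady w = w"
proof -
  define x where "x n = (steady ^^ n) (\<lambda>k. 0)" for n
  have x_Suc: "x (Suc n) = steady (x n)" and x_0: "x 0 = (\<lambda>k. 0)" for n by (simp_all add: x_def)
  have x: "solenoidal L (x n) \<and> sob L (1 + \<alpha>) (x n) \<le> ennreal r" for n
  proof (induction n)
    case (Suc n)
    then show ?case
      unfolding x_Suc using r force by (auto intro!: sol_steady[where \<rho> = r] steady_ball)
  qed (simp add: x_0 sol_zero)
  then have xs: "solenoidal L (x n)" and xr: "sob L (1 + \<alpha>) (x n) \<le> ennreal r" for n by auto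
  have x4: "sob L (1 + \<alpha>) (x n) \<le> ennreal (4 * r)" for n
    by (rule order_trans[OF xr ennreal_leI]) (use r in simp)
  have step: "sob L (1 + \<alpha>) (\<lambda>k. x (Suc n) k - x n k) \<le> ennreal (r * (1 / 16) ^ n)" for n
  proof (induction n)
    case (Suc n)
    have "sob L (1 + \<alpha>) (\<lambda>k. x (Suc (Suc n)) k - x (Suc n) k)
      \<le> ennreal (1 / 16) * sob L (1 + \<alpha>) (\<lambda>k. x (Suc n) k - x n k)"
      using steady_contraction[OF xs x4 xs x4 _ large, of "Suc n" n] r by (simp only: x_Suc)
    also have "\<dots> \<le> ennreal (1 / 16) * ennreal (r * (1 / 16) ^ n)" by (intro mult_left_mono Suc.IH) simp
    also have "\<dots> = ennreal (r * (1 / 16) ^ Suc n)" using r by (subst ennreal_mult[symmetric]) auto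
    finally show ?case .
  qed (use xr[of 1] in \<open>simp add: x_0\<close>)
  define w where "w k = lim (\<lambda>n. x n k)" for k
  note geo = sob_geometric_limit[of L r x "1 + \<alpha>", OF L less_imp_le[OF r] sol_zero_mean[OF xs] step]
  have lim: "(\<lambda>n. x n k) \<longlonglongrightarrow> w k" for k unfolding w_def by (rule geo(1))
  have near: "sob L (1 + \<alpha>) (\<lambda>k. w k - x n k) \<le> ennreal (4 * r * (1 / 16) ^ n)" for n
    unfolding w_def by (rule geo(2))
  have ws: "solenoidal L w" by (rule sol_limit[OF xs lim])
  have w4: "sob L (1 + \<alpha>) w \<le> ennreal (4 * r)" using near[of 0] by (simp add: x_0)
  have "sob L (1 + \<alpha>) (\<lambda>k. steady w k - w k) \<le> ennreal (r * (1 / 16) ^ n)" for n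
  proof -
    have c: "sob L (1 + \<alpha>) (\<lambda>k. steady w k - steady (x n) k) \<le> ennreal (1 / 16) * ennreal (4 * r * (1 / 16) ^ n)"
      using r by (intro order_trans[OF steady_contraction[OF ws w4 xs x4 _ large] mult_left_mono[OF near]]) auto
    have "sob L (1 + \<alpha>) (\<lambda>k. steady w k - w k)
      = sob L (1 + \<alpha>) (\<lambda>k. (steady w k - steady (x n) k) - (w k - x (Suc n) k))"
      by (simp add: x_Suc)
    also have "\<dots> \<le> 2 * (ennreal (1 / 16) * ennreal (4 * r * (1 / 16) ^ n)) + 2 * ennreal (4 * r * (1 / 16) ^ Suc n)"
      by (rule order_trans[OF sob_diff_le]) (intro add_mono mult_left_mono c near, auto)
    also have "\<dots> = ennreal (2 * (1 / 16 * (4 * r * (1 / 16) ^ n)) + 2 * (4 * r * (1 / 16) ^ Suc n))"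
    proof -
      have two: "2 * (ennreal d * ennreal a) + 2 * ennreal b = ennreal (2 * (d * a) + 2 * b)"
        if "0 \<le> a" "0 \<le> b" "0 \<le> d" for a b d
        using that by (simp add: ennreal_mult)
      show ?thesis by (rule two) (use r in simp_all)
    qed
    also have "\<dots> = ennreal (r * (1 / 16) ^ n)" by (rule arg_cong[where f = ennreal]) simp
    finally show ?thesis .
  qed
  then have "sob L (1 + \<alpha>) (\<lambda>k. steady w k - w k) = 0" by (rule ennreal_geometric_0)
  then have "steady w = w" by (rule sob_diff_eq_0D[OF L sol_steady[OF ws w4] ws])
  with ws w4 that show ?thesis by blast
qed

text \<open>
  The forcing of the constant curve is \<open>\<nu> A w\<close>, and \<open>exp (- c t) w + \<integral> exp (- c (t - s)) c w ds = w\<close>.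
\<close>

lemma steady_state_evolve:
  assumes w: "solenoidal L w" "steady w = w" and t: "t \<in> {0..\<mu>}"
  shows "evolve (\<lambda>t. w) w (\<lambda>t. w) t = w"
proof
  fix k
  define c where "c = \<nu> * (wn L k)\<^sup>2"
  have force: "forcing L f (\<lambda>t. w) (\<lambda>t. w) s k = c *\<^sub>R w k" for s
  proof (cases "k = 0")
    case True
    then show ?thesis by (simp add: forcing_def c_def sol_zero_mean[OF sol_f])
  next
    case False
    have "w k = (1 / c) *\<^sub>R (f k - convection L w w k)"
      using fun_cong[OF w(2), of k] by (simp add: steady_def stokes_inverse_def c_def)
    moreover have "c \<noteq> 0" using wn_pos[OF L False] \<nu> by (simp add: c_def)
    ultimately show ?thesis by (simp add: forcing_def)
  qed
  have int: "integrable (time \<mu>) (\<lambda>s. exp (c * s) *\<^sub>R c *\<^sub>R w k)"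
    by (intro integrable_time_continuous continuous_intros)
  have "((\<lambda>s. exp (c * s) *\<^sub>R c *\<^sub>R w k) has_integral (exp (c * t) *\<^sub>R w k - exp (c * 0) *\<^sub>R w k)) {0..t}"
  proof (rule fundamental_theorem_of_calculus)
    fix s
    have "((\<lambda>s. exp (c * s)) has_vector_derivative exp (c * s) * c) (at s within {0..t})"
      unfolding has_real_derivative_iff_has_vector_derivative[symmetric]
      by (auto intro!: derivative_eq_intros)
    then show "((\<lambda>s. exp (c * s) *\<^sub>R w k) has_vector_derivative exp (c * s) *\<^sub>R c *\<^sub>R w k) (at s within {0..t})"
      using bounded_linear.has_vector_derivative[OF bounded_linear_scaleR_left] by fastforce
  qed (use t in simp)
  then have "primitive \<mu> (\<lambda>s. exp (c * s) *\<^sub>R c *\<^sub>R w k) t = exp (c * t) *\<^sub>R w k - w k"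
    unfolding primitive_eq_integral(1)[OF int t] by (simp add: integral_unique)
  then have "duhamel \<mu> c (\<lambda>s. c *\<^sub>R w k) t = w k - exp (- (c * t)) *\<^sub>R w k"
    by (simp add: duhamel_eq_primitive scaleR_diff_right flip: exp_add)
  then show "evolve (\<lambda>t. w) w (\<lambda>t. w) t k = w k"
    by (simp add: evolve_def mild_def force flip: c_def)
qed

end

section \<open>Distances in the phase space\<close>

lemma L2dist_class_square:
  assumes L: "0 < L" and \<psi>: "\<psi> \<in> L2fun L \<mu> s" and \<phi>: "\<phi> \<in> L2fun L \<mu> s"
  shows "ennreal ((L2dist L \<mu> s (L2class L \<mu> s \<psi>) (L2class L \<mu> s \<phi>))\<^sup>2)
    = ennreal (L ^ 3) * (\<integral>\<^sup>+t. sob L s (vdiff (\<psi> t) (\<phi> t)) \<partial>time \<mu>)"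
proof -
  note r = rep_L2sp(1)[OF L2class_L2sp[OF \<psi>]] rep_L2sp(1)[OF L2class_L2sp[OF \<phi>]]
  have "ennreal ((L2dist L \<mu> s (L2class L \<mu> s \<psi>) (L2class L \<mu> s \<phi>))\<^sup>2)
    = ennreal (L ^ 3) * (\<integral>\<^sup>+t. sob L s (vdiff (rep (L2class L \<mu> s \<psi>) t) (rep (L2class L \<mu> s \<phi>) t)) \<partial>time \<mu>)"
    unfolding L2dist_integrable(3)[OF L r] L2dist_def by simp
  also have "(\<integral>\<^sup>+t. sob L s (vdiff (rep (L2class L \<mu> s \<psi>) t) (rep (L2class L \<mu> s \<phi>) t)) \<partial>time \<mu>)
    = (\<integral>\<^sup>+t. sob L s (vdiff (\<psi> t) (\<phi> t)) \<partial>time \<mu>)"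
    by (rule nn_integral_cong_AE) (use AE_rep_L2class[OF \<psi>] AE_rep_L2class[OF \<phi>] in \<open>eventually_elim, simp\<close>)
  finally show ?thesis .
qed

lemma Vdist_square:
  assumes "0 < L" "u \<in> Vsp L s" "v \<in> Vsp L s"
  shows "ennreal ((Vdist L s u v)\<^sup>2) = ennreal (L ^ 3) * sob L s (\<lambda>k. u k - v k)"
  using ennreal_Vnorm_square[OF assms(1), of s "vdiff u v"] Vsp_diff[OF assms] Vsp_iff[OF assms(1)]
  by (simp add: Vdist_def vdiff_def)

lemma Xdist_square:
  assumes L: "0 < L" and "\<psi> \<in> L2fun L \<mu> (1 + \<alpha>)" "\<phi> \<in> L2fun L \<mu> (1 + \<alpha>)" "u \<in> Vsp L \<alpha>" "v \<in> Vsp L \<alpha>"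
  shows "ennreal ((Xdist L \<mu> \<alpha> (L2class L \<mu> (1 + \<alpha>) \<psi>, u) (L2class L \<mu> (1 + \<alpha>) \<phi>, v))\<^sup>2)
    = ennreal (L ^ 3) * ((\<integral>\<^sup>+t. sob L (1 + \<alpha>) (vdiff (\<psi> t) (\<phi> t)) \<partial>time \<mu>) + sob L \<alpha> (\<lambda>k. u k - v k))"
  by (simp add: Xdist_def prod_dist_def distrib_left L2dist_class_square Vdist_square assms)

lemma Metric_space_Xsp: "0 < L \<Longrightarrow> Metric_space (Xsp L \<mu> \<alpha>) (Xdist L \<mu> \<alpha>)"
  unfolding Xsp_def Xdist_def
  by (intro Metric_space12.prod_metric Metric_space12.intro Metric_space_L2sp Metric_space_Vsp)

lemma constant_L2fun:
  assumes L: "0 < L" and w: "w \<in> Vsp L s" and s: "0 \<le> s"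
  shows "(\<lambda>t. w) \<in> L2fun L \<mu> s"
proof -
  interpret finite_measure "time \<mu>" by (rule finite_measure_time)
  have fin: "sob L s w < \<infinity>" and solenoidal: "solenoidal L w" using w by (auto simp: Vsp_iff[OF L])
  then have "sob L s w \<le> ennreal (enn2real (sob L s w))" by simp
  then have "bounded_curve L \<mu> s (\<lambda>t. w)" unfolding bounded_curve_def using solenoidal by auto
  then obtain B where B: "\<And>t k. t \<in> {0..\<mu>} \<Longrightarrow> norm (w k) \<le> B"
    using bounded_curve_coefficient_bound[OF L s] by blast
  show ?thesis
  proof (rule L2funI[OF L _ B])
    show "(\<integral>\<^sup>+t. sob L s w \<partial>time \<mu>) < \<infinity>"
      using fin by (simp add: ennreal_mult_less_top emeasure_eq_measure del: space_time)
  qed (simp_all add: solenoidal)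
qed

section \<open>A contraction has its fixed point as local attractor\<close>

text \<open>
  The point \<open>p\<close> is fixed because the distance of its image to \<open>p\<close> is at most a quarter of the distance
  of \<open>p\<close> to itself. The distances of the iterates to \<open>p\<close> decrease geometrically, uniformly on \<open>B\<close>.
\<close>

lemma local_attractor_fixed_point:
  assumes M: "Metric_space X d" and B: "B \<subseteq> X" and p: "p \<in> B"
    and inv: "\<And>x. x \<in> B \<Longrightarrow> S x \<in> B" and contr: "\<And>x. x \<in> B \<Longrightarrow> d (S x) p \<le> 1 / 4 * d x p"
    and bd: "\<And>x. x \<in> B \<Longrightarrow> d x p \<le> C"
  shows "local_attractor X d (\<lambda>n. S ^^ n) B {p}"
proof -
  interpret Metric_space X d by (rule M)
  have pX: "p \<in> X" using p B by blast
  have "d (S p) p \<le> 0" using contr[OF p] mdist_zero[OF pX] by simp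
  then have "d (S p) p = 0" using nonneg[of "S p" p] by linarith
  then have Sp: "S p = p" using zero[of "S p" p] inv[OF p] p B by blast
  have iter: "(S ^^ n) x \<in> B \<and> d ((S ^^ n) x) p \<le> C * (1 / 4) ^ n" if x: "x \<in> B" for n x
  proof (induction n)
    case (Suc n)
    then show ?case using inv[of "(S ^^ n) x"] contr[of "(S ^^ n) x"] by simp
  qed (use x bd in simp)
  have le: "(SUP x\<in>B. INF a\<in>{p}. ennreal (d ((S ^^ n) x) a)) \<le> ennreal (C * (1 / 4) ^ n)" for n
    using iter by (intro SUP_least) (simp add: ennreal_leI)
  have "(\<lambda>n. ennreal (C * (1 / 4) ^ n)) \<longlonglongrightarrow> ennreal (C * 0)"
    by (intro tendsto_ennrealI tendsto_mult tendsto_const LIMSEQ_power_zero) simp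
  then have lim: "(\<lambda>n. ennreal (C * (1 / 4) ^ n)) \<longlonglongrightarrow> 0" by simp
  have "(\<lambda>n. SUP x\<in>B. INF a\<in>{p}. ennreal (d ((S ^^ n) x) a)) \<longlonglongrightarrow> 0"
    by (rule tendsto_sandwich[OF _ _ tendsto_const lim]) (auto intro!: always_eventually le simp del: INF_insert ccINF_insert image_insert image_empty)
  moreover have "compactin mtopology {p}" using pX by (intro finite_imp_compactin) auto
  ultimately show ?thesis unfolding local_attractor_def using p Sp by simp
qed

section \<open>Attraction to the steady state\<close>

lemma ennreal_linear_combination:
  "0 \<le> a \<Longrightarrow> 0 \<le> x \<Longrightarrow> 0 \<le> b \<Longrightarrow> 0 \<le> y \<Longrightarrow>
    ennreal a * ennreal x + ennreal b * ennreal y = ennreal (a * x + b * y)"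
  by (simp add: ennreal_mult)

text \<open>
  A steady state \<open>w\<close> and the precise meaning of large viscosity. The first inequality puts \<open>w\<close> into the
  ball of radius \<open>1 / 3\<close>. The lower bounds on \<open>\<nu>\<close> make the following quantities small, in this order:
  the smoothed initial value, the exponential factor, the action \<open>B(\<psi>, z)\<close> of a drift from the unit ball
  on the deviation \<open>z\<close> from \<open>w\<close>, and the term \<open>B(\<psi> - w, w)\<close>.
\<close>

locale large_viscosity = linearised_NSE +
  fixes r :: real and w :: vfield
  assumes r: "0 < r" and w: "solenoidal L w" "sob L (1 + \<alpha>) w \<le> ennreal (4 * r)" "steady w = w"
    and small_state: "36 * L ^ 3 * r * ((L / (2 * pi))\<^sup>2 + \<mu>) \<le> 1"
    and \<nu>_ge: "64 \<le> \<nu>" and damping: "64 \<le> \<nu> * (2 * pi / L)\<^sup>2 * \<mu>"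
    and small_ball: "1024 * K \<le> \<nu> * L ^ 3" and small_coupling: "1024 * K * (L / (2 * pi))\<^sup>2 * r \<le> \<nu>"
begin

lemma w_Vsp: "w \<in> Vsp L (1 + \<alpha>)" "w \<in> Vsp L \<alpha>"
  using w sob_lower_finite[OF w(2)] by (auto simp: Vsp_iff[OF L])

lemma sob_w: "sob L \<alpha> w \<le> ennreal ((L / (2 * pi))\<^sup>2 * (4 * r))"
  by (rule sob_embedding_ball[OF w(2)])

lemma w_L2fun: "(\<lambda>t. w) \<in> L2fun L \<mu> (1 + \<alpha>)"
  by (rule constant_L2fun[OF L w_Vsp(1)]) (use \<alpha> in simp)

lemma bounded_curve_w: "bounded_curve L \<mu> \<alpha> (\<lambda>t. w)"
  unfolding bounded_curve_def using w(1) sob_w by auto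

lemma decay_factor: "2 * exp (- (2 * \<nu> * (2 * pi / L)\<^sup>2 * \<mu>)) \<le> 1 / 64"
proof -
  let ?x = "2 * \<nu> * (2 * pi / L)\<^sup>2 * \<mu>"
  have "?x = 2 * (\<nu> * (2 * pi / L)\<^sup>2 * \<mu>)" by simp
  then have "128 \<le> exp ?x" using exp_ge_add_one_self[of ?x] damping by linarith
  then show ?thesis by (simp add: exp_minus field_simps)
qed

text \<open>
  The hypothesis says that the norm of the drift is at most \<open>1\<close>. The constant is better than what
  \<open>small_drift\<close> requires because the same number enters the attraction estimate.
\<close>

lemma small_drift_ball:
  assumes P: "ennreal (L ^ 3) * (\<integral>\<^sup>+t. sob L (1 + \<alpha>) (\<psi> t) \<partial>time \<mu>) \<le> 1"
  obtains p where "(\<integral>\<^sup>+t. sob L (1 + \<alpha>) (\<psi> t) \<partial>time \<mu>) = ennreal p" "0 \<le> p" "2 * K / \<nu> * p \<le> 1 / 512"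
proof -
  have L3: "0 < L ^ 3" using L by simp
  have "(\<integral>\<^sup>+t. sob L (1 + \<alpha>) (\<psi> t) \<partial>time \<mu>) \<noteq> \<infinity>"
    using P L3 by (auto simp: ennreal_mult_top top_unique)
  then obtain p where p: "(\<integral>\<^sup>+t. sob L (1 + \<alpha>) (\<psi> t) \<partial>time \<mu>) = ennreal p" "0 \<le> p"
    by (cases "\<integral>\<^sup>+t. sob L (1 + \<alpha>) (\<psi> t) \<partial>time \<mu>") auto
  have "ennreal (L ^ 3 * p) \<le> 1" using P L3 p by (simp add: ennreal_mult)
  then have Lp: "L ^ 3 * p \<le> 1" by simp
  have "1024 * K * p \<le> \<nu> * (L ^ 3 * p)" using mult_right_mono[OF small_ball p(2)] by (simp add: mult_ac)
  also have "\<dots> \<le> \<nu> * 1" using \<nu> Lp by (intro mult_left_mono) auto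
  finally have "2 * K / \<nu> * p \<le> 1 / 512" using \<nu> by (simp add: field_simps)
  with p that show ?thesis by blast
qed

text \<open>
  The estimate behind the theorem, for squared norms. Let \<open>e\<close> and \<open>q\<close> be the squared distances of the
  initial values and of the drifts, and \<open>s\<close> the supremum of that of the solutions. First \<open>s\<close> is bounded
  by \<open>e\<close> and \<open>q\<close>, where the contribution of \<open>B(\<psi>, u - w)\<close> is absorbed. Inserting this bound shows that
  the total forcing is at most \<open>\<nu> (e + q) / 64\<close>; then each of the two components of the new distance is at
  most \<open>(e + q) / 32\<close>.
\<close>

lemma distance_to_steady_state:
  assumes \<psi>: "\<psi> \<in> L2fun L \<mu> (1 + \<alpha>)"
    and P: "ennreal (L ^ 3) * (\<integral>\<^sup>+t. sob L (1 + \<alpha>) (\<psi> t) \<partial>time \<mu>) \<le> 1"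
    and u0: "u0 \<in> Vsp L \<alpha>"
    and u: "bounded_curve L \<mu> \<alpha> u" and fp: "\<And>t. t \<in> {0..\<mu>} \<Longrightarrow> u t = evolve \<psi> u0 u t"
  defines "D \<equiv> (\<integral>\<^sup>+t. sob L (1 + \<alpha>) (vdiff (\<psi> t) w) \<partial>time \<mu>) + sob L \<alpha> (\<lambda>k. u0 k - w k)"
  shows "(\<integral>\<^sup>+t. sob L (1 + \<alpha>) (vdiff (u t) w) \<partial>time \<mu>) + sob L \<alpha> (\<lambda>k. u \<mu> k - w k) \<le> ennreal (1 / 16) * D"
proof -
  obtain p where p: "(\<integral>\<^sup>+t. sob L (1 + \<alpha>) (\<psi> t) \<partial>time \<mu>) = ennreal p" "0 \<le> p" "2 * K / \<nu> * p \<le> 1 / 512"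
    by (rule small_drift_ball[OF P])
  have "sob L \<alpha> (\<lambda>k. u0 k - w k) < \<infinity>"
    using u0 w_Vsp(2) sob_diff_finite by (simp add: Vsp_iff[OF L])
  then obtain e where e: "sob L \<alpha> (\<lambda>k. u0 k - w k) = ennreal e" "0 \<le> e"
    by (cases "sob L \<alpha> (\<lambda>k. u0 k - w k)") auto
  have "ennreal (L ^ 3) * (\<integral>\<^sup>+t. sob L (1 + \<alpha>) (vdiff (\<psi> t) w) \<partial>time \<mu>) < \<infinity>"
    using L2dist_integrable(3)[OF L \<psi> w_L2fun] by simp
  then have "(\<integral>\<^sup>+t. sob L (1 + \<alpha>) (vdiff (\<psi> t) w) \<partial>time \<mu>) < \<infinity>"
    using L by (auto simp: ennreal_mult_less_top)
  then obtain q where q: "(\<integral>\<^sup>+t. sob L (1 + \<alpha>) (vdiff (\<psi> t) w) \<partial>time \<mu>) = ennreal q" "0 \<le> q"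
    by (cases "\<integral>\<^sup>+t. sob L (1 + \<alpha>) (vdiff (\<psi> t) w) \<partial>time \<mu>") auto
  define s' where "s' = (L / (2 * pi))\<^sup>2 * (4 * r)"
  have s': "0 \<le> s'" "2 * K / \<nu> * s' \<le> 1 / 128"
    using r \<nu> small_coupling by (simp_all add: s'_def field_simps)
  define S where "S = (SUP t\<in>{0..\<mu>}. sob L \<alpha> (\<lambda>k. u t k - w k))"
  obtain M where M: "\<forall>t\<in>{0..\<mu>}. sob L \<alpha> (\<lambda>k. u t k - w k) \<le> ennreal M"
    using bounded_curve_diff[OF u bounded_curve_w] by (auto simp: bounded_curve_def)
  have "S \<le> ennreal M" unfolding S_def using M by (intro SUP_least) auto
  then have "S < \<infinity>" by (rule le_less_trans) simp
  then obtain s where s: "S = ennreal s" "0 \<le> s" by (cases S) auto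
  have S: "sob L \<alpha> (\<lambda>k. u t k - w k) \<le> ennreal s" if "t \<in> {0..\<mu>}" for t
    unfolding s(1)[symmetric] S_def using that by (rule SUP_upper)
  \<comment> \<open>The bound of \<open>evolve_difference\<close> for the forcing, as a real number.\<close>
  define F where "F = 2 * K * (p * s + q * s')"
  have F0: "0 \<le> F" using K p(2) s(2) q(2) s'(1) by (simp add: F_def add_nonneg_nonneg)
  have F: "2 * ennreal K * (ennreal p * ennreal s + ennreal q * ennreal s') = ennreal F"
  proof -
    have "0 \<le> p * s + q * s'" using p(2) s(2) q(2) s'(1) by simp
    then have "ennreal F = ennreal (2 * K) * ennreal (p * s + q * s')" using K by (simp add: F_def ennreal_mult'')
    also have "ennreal (p * s + q * s') = ennreal p * ennreal s + ennreal q * ennreal s'"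
      using p(2) s(2) q(2) s'(1) by (simp add: ennreal_mult)
    also have "ennreal (2 * K) = 2 * ennreal K" using K by (simp add: ennreal_mult)
    finally show ?thesis ..
  qed
  have sup: "sob L \<alpha> (\<lambda>k. u t k - w k) \<le> ennreal (2 * exp (- (2 * \<nu> * (2 * pi / L)\<^sup>2 * t)) * e + 1 / \<nu> * F)"
    if t: "t \<in> {0..\<mu>}" for t
  proof -
    have "sob L \<alpha> (\<lambda>k. evolve \<psi> u0 u t k - evolve (\<lambda>t. w) w (\<lambda>t. w) t k)
      \<le> ennreal (2 * exp (- (2 * \<nu> * (2 * pi / L)\<^sup>2 * t))) * sob L \<alpha> (\<lambda>k. u0 k - w k)
        + ennreal (1 / \<nu>) * (2 * ennreal K * (ennreal p * ennreal s + ennreal q * ennreal s'))"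
      unfolding p(1)[symmetric] q(1)[symmetric]
      by (rule evolve_difference(1)[OF \<psi> w_L2fun u bounded_curve_w S _ t]) (use sob_w in \<open>auto simp: s'_def\<close>)
    also have "\<dots> = ennreal (2 * exp (- (2 * \<nu> * (2 * pi / L)\<^sup>2 * t)) * e + 1 / \<nu> * F)"
      unfolding e(1) F by (rule ennreal_linear_combination) (use e(2) F0 \<nu> in simp_all)
    finally show ?thesis unfolding steady_state_evolve[OF w(1,3) t] fp[OF t, symmetric] .
  qed
  \<comment> \<open>For the supremum the damping of the initial value is ignored.\<close>
  have "S \<le> ennreal (2 * e + 1 / \<nu> * F)"
    unfolding S_def
  proof (rule SUP_least)
    fix t assume t: "t \<in> {0..\<mu>}"
    have "exp (- (2 * \<nu> * (2 * pi / L)\<^sup>2 * t)) \<le> 1" using \<nu> t by simp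
    then have "2 * exp (- (2 * \<nu> * (2 * pi / L)\<^sup>2 * t)) * e \<le> 2 * e" using e(2) by (intro mult_right_mono) auto
    then show "sob L \<alpha> (\<lambda>k. u t k - w k) \<le> ennreal (2 * e + 1 / \<nu> * F)"
      by (intro order_trans[OF sup[OF t] ennreal_leI]) simp
  qed
  then have s_le: "s \<le> 2 * e + 1 / \<nu> * F"
    unfolding s(1) using e(2) F0 \<nu> by (subst (asm) ennreal_le_iff) auto
  have F_eq: "1 / \<nu> * F = (2 * K / \<nu> * p) * s + (2 * K / \<nu> * s') * q"
    using \<nu> by (simp add: F_def field_simps)
  have F_le: "1 / \<nu> * F \<le> 1 / 512 * s + 1 / 128 * q"
    unfolding F_eq using mult_right_mono[OF p(3) s(2)] mult_right_mono[OF s'(2) q(2)] by linarith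
  have F_small: "1 / \<nu> * F \<le> 1 / 64 * (e + q)" using s_le F_le e(2) q(2) by argo
  \<comment> \<open>At the final time the damping is fully effective.\<close>
  have "sob L \<alpha> (\<lambda>k. u \<mu> k - w k) \<le> ennreal (2 * exp (- (2 * \<nu> * (2 * pi / L)\<^sup>2 * \<mu>)) * e + 1 / \<nu> * F)"
    using \<mu> by (intro sup) auto
  also have "\<dots> \<le> ennreal (1 / 32 * (e + q))"
  proof (rule ennreal_leI)
    show "2 * exp (- (2 * \<nu> * (2 * pi / L)\<^sup>2 * \<mu>)) * e + 1 / \<nu> * F \<le> 1 / 32 * (e + q)"
      using mult_right_mono[OF decay_factor e(2)] F_small q(2) by argo
  qed
  finally have end_le: "sob L \<alpha> (\<lambda>k. u \<mu> k - w k) \<le> ennreal (1 / 32 * (e + q))" .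
  have "(\<integral>\<^sup>+t. sob L (1 + \<alpha>) (vdiff (u t) w) \<partial>time \<mu>)
    = (\<integral>\<^sup>+t. sob L (1 + \<alpha>) (\<lambda>k. evolve \<psi> u0 u t k - evolve (\<lambda>t. w) w (\<lambda>t. w) t k) \<partial>time \<mu>)"
    by (intro nn_integral_cong) (simp add: vdiff_def steady_state_evolve[OF w(1,3)] flip: fp)
  also have "\<dots> \<le> ennreal (1 / \<nu>) * sob L \<alpha> (\<lambda>k. u0 k - w k)
      + ennreal (2 / \<nu>\<^sup>2) * (2 * ennreal K * (ennreal p * ennreal s + ennreal q * ennreal s'))"
    unfolding p(1)[symmetric] q(1)[symmetric]
    by (rule evolve_difference(2)[OF \<psi> w_L2fun u bounded_curve_w S]) (use sob_w in \<open>auto simp: s'_def\<close>)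
  also have "\<dots> = ennreal (1 / \<nu> * e + 2 / \<nu>\<^sup>2 * F)"
    unfolding e(1) F by (rule ennreal_linear_combination) (use e(2) F0 \<nu> in simp_all)
  also have "\<dots> \<le> ennreal (1 / 32 * (e + q))"
  proof (rule ennreal_leI)
    have i: "1 / \<nu> \<le> 1 / 64" using \<nu>_ge by (intro divide_left_mono) auto
    have "1 / \<nu> * (1 / \<nu> * F) \<le> 1 / 64 * (1 / 64 * (e + q))"
      by (rule mult_mono[OF i F_small]) (use F0 \<nu> in simp_all)
    moreover have "2 / \<nu>\<^sup>2 * F = 2 * (1 / \<nu> * (1 / \<nu> * F))" by (simp add: power2_eq_square)
    moreover have "1 / \<nu> * e \<le> 1 / 64 * e" by (rule mult_right_mono[OF i e(2)])
    ultimately show "1 / \<nu> * e + 2 / \<nu>\<^sup>2 * F \<le> 1 / 32 * (e + q)" using e(2) q(2) by argo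
  qed
  finally have int_le: "(\<integral>\<^sup>+t. sob L (1 + \<alpha>) (vdiff (u t) w) \<partial>time \<mu>) \<le> ennreal (1 / 32 * (e + q))" .
  have "ennreal (1 / 32 * (e + q)) + ennreal (1 / 32 * (e + q)) = ennreal (1 / 16) * (ennreal q + ennreal e)"
    using e(2) q(2) by (simp add: ennreal_mult[symmetric] field_simps flip: ennreal_plus)
  with add_mono[OF int_le end_le] show ?thesis by (simp add: D_def e(1) q(1))
qed

text \<open>
  The point of the phase space that consists of the steady state as drift and as initial value.
\<close>

abbreviation rest :: phase where
  "rest \<equiv> (L2class L \<mu> (1 + \<alpha>) (\<lambda>t. w), w)"

lemma zero_L2fun: "(\<lambda>t k. 0) \<in> L2fun L \<mu> (1 + \<alpha>)"
  by (rule constant_L2fun[OF L]) (use \<alpha> in \<open>simp_all add: Vsp_iff[OF L] sol_zero\<close>)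

lemma Xball_iff:
  "(\<Psi>, u0) \<in> Xball L \<mu> \<alpha> 1 1 \<longleftrightarrow> \<Psi> \<in> L2sp L \<mu> (1 + \<alpha>) \<and> u0 \<in> Vsp L \<alpha> \<and>
     L2dist L \<mu> (1 + \<alpha>) (L2class L \<mu> (1 + \<alpha>) (\<lambda>t k. 0)) \<Psi> \<le> 1 \<and> Vdist L \<alpha> (\<lambda>k. 0) u0 \<le> 1"
  using L2class_L2sp[OF zero_L2fun]
  by (auto simp: Xball_def Metric_space.in_mcball[OF Metric_space_L2sp[OF L]]
      Metric_space.in_mcball[OF Metric_space_Vsp[OF L]] Vsp_iff[OF L] sol_zero)

text \<open>
  Both components inherit the smallness of \<open>w\<close>: the squared norm of the drift is multiplied by the length
  \<open>\<mu>\<close> of the time interval, that of the initial value by the constant of the embedding.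
\<close>

lemma rest_near_0:
  "L2dist L \<mu> (1 + \<alpha>) (L2class L \<mu> (1 + \<alpha>) (\<lambda>t k. 0)) (fst rest) \<le> 1 / 3"
  "Vdist L \<alpha> (\<lambda>k. 0) w \<le> 1 / 3"
proof -
  have z: "(\<lambda>k. 0) \<in> Vsp L \<alpha>" by (simp add: Vsp_iff[OF L] sol_zero)
  define x where "x = L ^ 3 * (4 * r * \<mu>)"
  define y where "y = L ^ 3 * ((L / (2 * pi))\<^sup>2 * (4 * r))"
  have "0 \<le> x" "0 \<le> y" using L r \<mu> by (simp_all add: x_def y_def)
  moreover have "9 * (x + y) \<le> 1"
  proof -
    have "9 * (x + y) = 36 * L ^ 3 * r * ((L / (2 * pi))\<^sup>2 + \<mu>)" unfolding x_def y_def by algebra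
    then show ?thesis using small_state by simp
  qed
  ultimately have "9 * x \<le> 1" "9 * y \<le> 1" by (simp_all add: distrib_left)
  then have parts: "L ^ 3 * (4 * r * \<mu>) \<le> (1 / 3)\<^sup>2" "L ^ 3 * ((L / (2 * pi))\<^sup>2 * (4 * r)) \<le> (1 / 3)\<^sup>2"
    unfolding x_def[symmetric] y_def[symmetric] by (simp_all add: power_divide)
  have "ennreal ((L2dist L \<mu> (1 + \<alpha>) (L2class L \<mu> (1 + \<alpha>) (\<lambda>t k. 0)) (fst rest))\<^sup>2)
    = ennreal (L ^ 3) * (\<integral>\<^sup>+t. sob L (1 + \<alpha>) w \<partial>time \<mu>)"
    by (simp add: L2dist_class_square[OF L zero_L2fun w_L2fun] vdiff_def)
  also have "\<dots> = ennreal (L ^ 3) * (sob L (1 + \<alpha>) w * ennreal \<mu>)"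
    using \<mu> by (simp add: time_def emeasure_restrict_space)
  also have "\<dots> \<le> ennreal (L ^ 3) * (ennreal (4 * r) * ennreal \<mu>)"
    by (intro mult_left_mono mult_right_mono w(2)) auto
  also have "\<dots> = ennreal (L ^ 3 * (4 * r * \<mu>))" using L r \<mu> by (simp add: ennreal_mult)
  also have "\<dots> \<le> ennreal ((1 / 3)\<^sup>2)" by (rule ennreal_leI[OF parts(1)])
  finally have "(L2dist L \<mu> (1 + \<alpha>) (L2class L \<mu> (1 + \<alpha>) (\<lambda>t k. 0)) (fst rest))\<^sup>2 \<le> (1 / 3)\<^sup>2"
    by (subst (asm) ennreal_le_iff) auto
  then show "L2dist L \<mu> (1 + \<alpha>) (L2class L \<mu> (1 + \<alpha>) (\<lambda>t k. 0)) (fst rest) \<le> 1 / 3"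
    by (rule power2_le_imp_le) simp
  have "ennreal ((Vdist L \<alpha> (\<lambda>k. 0) w)\<^sup>2) = ennreal (L ^ 3) * sob L \<alpha> w"
    by (simp add: Vdist_square[OF L z w_Vsp(2)])
  also have "\<dots> \<le> ennreal (L ^ 3) * ennreal ((L / (2 * pi))\<^sup>2 * (4 * r))"
    by (intro mult_left_mono sob_w) auto
  also have "\<dots> = ennreal (L ^ 3 * ((L / (2 * pi))\<^sup>2 * (4 * r)))" using L r by (simp add: ennreal_mult')
  also have "\<dots> \<le> ennreal ((1 / 3)\<^sup>2)" by (rule ennreal_leI[OF parts(2)])
  finally have "(Vdist L \<alpha> (\<lambda>k. 0) w)\<^sup>2 \<le> (1 / 3)\<^sup>2" by (subst (asm) ennreal_le_iff) auto
  then show "Vdist L \<alpha> (\<lambda>k. 0) w \<le> 1 / 3" by (rule power2_le_imp_le) simp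
qed

text \<open>
  In squared distances this is \<open>distance_to_steady_state\<close>: the factor \<open>1 / 16\<close> becomes \<open>1 / 4\<close>.
\<close>

lemma U1_contraction:
  assumes x: "x \<in> Xball L \<mu> \<alpha> 1 1"
  shows "U1 L \<mu> \<nu> \<alpha> f x \<in> Xsp L \<mu> \<alpha>" and "Xdist L \<mu> \<alpha> (U1 L \<mu> \<nu> \<alpha> f x) rest \<le> 1 / 4 * Xdist L \<mu> \<alpha> x rest"
proof -
  interpret X: Metric_space "Xsp L \<mu> \<alpha>" "Xdist L \<mu> \<alpha>" by (rule Metric_space_Xsp[OF L])
  obtain \<Psi> u0 where xe: "x = (\<Psi>, u0)" by (cases x)
  note x' = x[unfolded xe Xball_iff]
  then have \<Psi>: "\<Psi> \<in> L2sp L \<mu> (1 + \<alpha>)" and u0: "u0 \<in> Vsp L \<alpha>"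
    and n: "L2dist L \<mu> (1 + \<alpha>) (L2class L \<mu> (1 + \<alpha>) (\<lambda>t k. 0)) \<Psi> \<le> 1" by auto
  define \<psi> where "\<psi> = rep \<Psi>"
  have \<psi>: "\<psi> \<in> L2fun L \<mu> (1 + \<alpha>)" and cl: "L2class L \<mu> (1 + \<alpha>) \<psi> = \<Psi>"
    using rep_L2sp[OF \<Psi>] by (auto simp: \<psi>_def)
  have "ennreal (L ^ 3) * (\<integral>\<^sup>+t. sob L (1 + \<alpha>) (\<psi> t) \<partial>time \<mu>)
    = ennreal ((L2dist L \<mu> (1 + \<alpha>) (L2class L \<mu> (1 + \<alpha>) (\<lambda>t k. 0)) \<Psi>)\<^sup>2)"
    unfolding cl[symmetric] L2dist_class_square[OF L zero_L2fun \<psi>] by (simp add: vdiff_def)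
  also have "\<dots> \<le> ennreal 1"
    using n Metric_space.nonneg[OF Metric_space_L2sp[OF L]] by (intro ennreal_leI power_le_one) auto
  finally have P: "ennreal (L ^ 3) * (\<integral>\<^sup>+t. sob L (1 + \<alpha>) (\<psi> t) \<partial>time \<mu>) \<le> 1" by simp
  obtain p where p: "(\<integral>\<^sup>+t. sob L (1 + \<alpha>) (\<psi> t) \<partial>time \<mu>) = ennreal p" "0 \<le> p" "2 * K / \<nu> * p \<le> 1 / 512"
    by (rule small_drift_ball[OF P])
  have small: "small_drift \<psi>"
  proof -
    have "ennreal (2 * K / \<nu>) * ennreal p = ennreal (2 * K / \<nu> * p)" by (rule ennreal_mult[symmetric]) (use K \<nu> p(2) in simp_all)
    also have "\<dots> \<le> ennreal (1 / 16)" by (rule ennreal_leI) (use p(3) in linarith)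
    finally show ?thesis by (simp add: small_drift_def p(1))
  qed
  define u where "u = solution L \<mu> \<nu> \<alpha> f \<psi> u0"
  note u = solution_fixed_point[OF \<psi> small u0, folded u_def]
  have uL: "u \<in> L2fun L \<mu> (1 + \<alpha>)" by (rule fixed_point_imp_L2fun[OF \<psi> u0 u(1,2)])
  have u\<mu>: "u \<mu> \<in> Vsp L \<alpha>" using bounded_curveD(2,3)[OF u(1), of \<mu>] \<mu> by (simp add: Vsp_iff[OF L])
  have U1x: "U1 L \<mu> \<nu> \<alpha> f x = (L2class L \<mu> (1 + \<alpha>) u, u \<mu>)"
    by (simp add: U1_def xe u_def \<psi>_def Let_def)
  then show "U1 L \<mu> \<nu> \<alpha> f x \<in> Xsp L \<mu> \<alpha>" using L2class_L2sp[OF uL] u\<mu> by (simp add: Xsp_def)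
  define D where "D = (\<integral>\<^sup>+t. sob L (1 + \<alpha>) (vdiff (\<psi> t) w) \<partial>time \<mu>) + sob L \<alpha> (\<lambda>k. u0 k - w k)"
  have "ennreal ((Xdist L \<mu> \<alpha> (U1 L \<mu> \<nu> \<alpha> f x) rest)\<^sup>2)
    = ennreal (L ^ 3) * ((\<integral>\<^sup>+t. sob L (1 + \<alpha>) (vdiff (u t) w) \<partial>time \<mu>) + sob L \<alpha> (\<lambda>k. u \<mu> k - w k))"
    unfolding U1x by (rule Xdist_square[OF L uL w_L2fun u\<mu> w_Vsp(2)])
  also have "\<dots> \<le> ennreal (L ^ 3) * (ennreal (1 / 16) * D)"
    unfolding D_def by (intro mult_left_mono distance_to_steady_state[OF \<psi> P u0 u(1,2)]) auto
  also have "\<dots> = ennreal (1 / 16) * (ennreal (L ^ 3) * D)" by (simp add: mult_ac)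
  also have "ennreal (L ^ 3) * D = ennreal ((Xdist L \<mu> \<alpha> x rest)\<^sup>2)"
    unfolding xe cl[symmetric] D_def by (rule Xdist_square[OF L \<psi> w_L2fun u0 w_Vsp(2), symmetric])
  also have "ennreal (1 / 16) * ennreal ((Xdist L \<mu> \<alpha> x rest)\<^sup>2) = ennreal ((1 / 4 * Xdist L \<mu> \<alpha> x rest)\<^sup>2)"
    by (subst ennreal_mult[symmetric]) (simp_all add: power_mult_distrib power_divide)
  finally have "(Xdist L \<mu> \<alpha> (U1 L \<mu> \<nu> \<alpha> f x) rest)\<^sup>2 \<le> (1 / 4 * Xdist L \<mu> \<alpha> x rest)\<^sup>2"
    by (subst (asm) ennreal_le_iff) auto
  then show "Xdist L \<mu> \<alpha> (U1 L \<mu> \<nu> \<alpha> f x) rest \<le> 1 / 4 * Xdist L \<mu> \<alpha> x rest"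
    by (rule power2_le_imp_le) (simp add: X.nonneg)
qed

text \<open>
  The points of the ball have distance at most \<open>(1 + 1/3) + (1 + 1/3) = 8/3\<close> from the rest point. After
  one step this is at most \<open>2/3\<close>, and the rest point has components of norm at most \<open>1/3\<close>: the ball of
  radius \<open>1\<close> is invariant.
\<close>

lemma rest_attractor: "local_attractor (Xsp L \<mu> \<alpha>) (Xdist L \<mu> \<alpha>) (U L \<mu> \<nu> \<alpha> f) (Xball L \<mu> \<alpha> 1 1) {rest}"
proof -
  interpret L2: Metric_space "L2sp L \<mu> (1 + \<alpha>)" "L2dist L \<mu> (1 + \<alpha>)" by (rule Metric_space_L2sp[OF L])
  interpret V: Metric_space "Vsp L \<alpha>" "Vdist L \<alpha>" by (rule Metric_space_Vsp[OF L])
  let ?O = "L2class L \<mu> (1 + \<alpha>) (\<lambda>t k. 0)"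
  have O: "?O \<in> L2sp L \<mu> (1 + \<alpha>)" by (rule L2class_L2sp[OF zero_L2fun])
  have z: "(\<lambda>k. 0) \<in> Vsp L \<alpha>" by (simp add: Vsp_iff[OF L] sol_zero)
  have W: "fst rest \<in> L2sp L \<mu> (1 + \<alpha>)" using L2class_L2sp[OF w_L2fun] by simp
  have bd: "Xdist L \<mu> \<alpha> x rest \<le> 8 / 3" if x: "x \<in> Xball L \<mu> \<alpha> 1 1" for x
  proof -
    obtain \<Psi> u0 where xe: "x = (\<Psi>, u0)" by (cases x)
    have \<Psi>: "\<Psi> \<in> L2sp L \<mu> (1 + \<alpha>)" "L2dist L \<mu> (1 + \<alpha>) ?O \<Psi> \<le> 1"
      and u0: "u0 \<in> Vsp L \<alpha>" "Vdist L \<alpha> (\<lambda>k. 0) u0 \<le> 1"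
      using x[unfolded xe Xball_iff] by blast+
    have "L2dist L \<mu> (1 + \<alpha>) \<Psi> (fst rest) \<le> 1 + 1 / 3"
      using L2.triangle[OF \<Psi>(1) O W] \<Psi>(2) rest_near_0(1) L2.commute[of \<Psi> ?O] by linarith
    moreover have "Vdist L \<alpha> u0 w \<le> 1 + 1 / 3"
      using V.triangle[OF u0(1) z w_Vsp(2)] u0(2) rest_near_0(2) V.commute[of u0 "\<lambda>k. 0"] by linarith
    moreover have "Xdist L \<mu> \<alpha> x rest \<le> L2dist L \<mu> (1 + \<alpha>) \<Psi> (fst rest) + Vdist L \<alpha> u0 w"
      unfolding xe Xdist_def using L2.nonneg V.nonneg by (simp add: prod_dist_def sqrt_sum_squares_le_sum)
    ultimately show ?thesis by linarith
  qed
  have "local_attractor (Xsp L \<mu> \<alpha>) (Xdist L \<mu> \<alpha>) (\<lambda>n. U1 L \<mu> \<nu> \<alpha> f ^^ n) (Xball L \<mu> \<alpha> 1 1) {rest}"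
  proof (rule local_attractor_fixed_point[where X = "Xsp L \<mu> \<alpha>" and d = "Xdist L \<mu> \<alpha>" and p = rest
        and S = "U1 L \<mu> \<nu> \<alpha> f" and B = "Xball L \<mu> \<alpha> 1 1" and C = "8 / 3"])
    show "Metric_space (Xsp L \<mu> \<alpha>) (Xdist L \<mu> \<alpha>)" by (rule Metric_space_Xsp[OF L])
    show "Xball L \<mu> \<alpha> 1 1 \<subseteq> Xsp L \<mu> \<alpha>"
    proof
      fix x assume "x \<in> Xball L \<mu> \<alpha> 1 1"
      then show "x \<in> Xsp L \<mu> \<alpha>" by (cases x) (simp add: Xball_iff Xsp_def)
    qed
    show "rest \<in> Xball L \<mu> \<alpha> 1 1"
      using rest_near_0 W w_Vsp(2) by (simp add: Xball_iff)
    fix x assume x: "x \<in> Xball L \<mu> \<alpha> 1 1"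
    show "Xdist L \<mu> \<alpha> (U1 L \<mu> \<nu> \<alpha> f x) rest \<le> 1 / 4 * Xdist L \<mu> \<alpha> x rest" by (rule U1_contraction(2)[OF x])
    show "Xdist L \<mu> \<alpha> x rest \<le> 8 / 3" by (rule bd[OF x])
    obtain \<Phi> v where y: "U1 L \<mu> \<nu> \<alpha> f x = (\<Phi>, v)" by (cases "U1 L \<mu> \<nu> \<alpha> f x")
    have d: "Xdist L \<mu> \<alpha> (\<Phi>, v) rest \<le> 2 / 3"
      using U1_contraction(2)[OF x] bd[OF x] unfolding y by linarith
    have mem: "\<Phi> \<in> L2sp L \<mu> (1 + \<alpha>)" "v \<in> Vsp L \<alpha>" using U1_contraction(1)[OF x] by (auto simp: y Xsp_def)
    have "L2dist L \<mu> (1 + \<alpha>) \<Phi> (fst rest) \<le> 2 / 3" "Vdist L \<alpha> v w \<le> 2 / 3"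
      using real_sqrt_sum_squares_ge1[of "L2dist L \<mu> (1 + \<alpha>) \<Phi> (fst rest)" "Vdist L \<alpha> v w"]
        real_sqrt_sum_squares_ge2[of "Vdist L \<alpha> v w" "L2dist L \<mu> (1 + \<alpha>) \<Phi> (fst rest)"] d
      unfolding Xdist_def prod_dist_def case_prod_conv fst_conv by linarith+
    then have "L2dist L \<mu> (1 + \<alpha>) ?O \<Phi> \<le> 1" "Vdist L \<alpha> (\<lambda>k. 0) v \<le> 1"
      using L2.triangle[OF O W mem(1)] V.triangle[OF z w_Vsp(2) mem(2)] rest_near_0
        L2.commute[of \<Phi> "fst rest"] V.commute[of v w] by linarith+
    then show "U1 L \<mu> \<nu> \<alpha> f x \<in> Xball L \<mu> \<alpha> 1 1" unfolding y using mem by (simp add: Xball_iff)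
  qed
  then show ?thesis by (simp add: U_def[abs_def])
qed

end

theorem theorem5p4:
  fixes L \<mu> \<alpha> :: real and f :: vfield
  assumes "L > 0" and "\<mu> > 0" and "\<alpha> > 1 / 2" and "f \<in> Vsp L \<alpha>"
  shows "\<exists>\<nu>\<^sub>0 > 0. \<forall>\<nu> \<ge> \<nu>\<^sub>0. \<exists>R > 0. \<exists>\<rho> > 0. \<exists>\<A>.
           local_attractor (Xsp L \<mu> \<alpha>) (Xdist L \<mu> \<alpha>) (U L \<mu> \<nu> \<alpha> f) (Xball L \<mu> \<alpha> R \<rho>) \<A>"
proof -
  obtain K where K: "0 < K" and K_le: "\<And>u v. u 0 = 0 \<Longrightarrow> v 0 = 0 \<Longrightarrow>
       sob L (\<alpha> - 1) (convection L u v) \<le> ennreal K * (sob L (1 + \<alpha>) u * sob L \<alpha> v)"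
    using convection_estimate[OF assms(1,3)] by blast
  define c where "c = (L / (2 * pi))\<^sup>2"
  \<comment> \<open>The size of the steady state is fixed first, independently of \<open>\<nu>\<close>; it makes \<open>small_state\<close> an equality.\<close>
  define r where "r = 1 / (36 * L ^ 3 * (c + \<mu>))"
  define \<phi> where "\<phi> = enn2real (sob L (\<alpha> - 1) f)"
  define d where "d = (2 * pi / L)\<^sup>2 * \<mu>"
  have c: "0 < c" and d: "0 < d" using assms by (simp_all add: c_def d_def)
  then have r: "0 < r" using assms by (simp add: r_def)
  have \<phi>: "0 \<le> \<phi>" by (simp add: \<phi>_def)
  \<comment> \<open>The viscosity from which on \<open>steady\<close> preserves the ball of size \<open>r\<close>.\<close>
  define a where "a = (2 * \<phi> + 2 * K * c * r\<^sup>2) / r"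
  have nonneg: "0 \<le> a" "0 \<le> 64 / d" "0 \<le> 1024 * K / L ^ 3" "0 \<le> 1024 * K * c * r"
    using assms \<phi> K c r d by (simp_all add: a_def)
  define \<nu>\<^sub>0 where "\<nu>\<^sub>0 = 64 + a + 64 / d + 1024 * K / L ^ 3 + 1024 * K * c * r"
  have "0 < \<nu>\<^sub>0" using nonneg unfolding \<nu>\<^sub>0_def by linarith
  moreover have "\<exists>R > 0. \<exists>\<rho> > 0. \<exists>\<A>.
           local_attractor (Xsp L \<mu> \<alpha>) (Xdist L \<mu> \<alpha>) (U L \<mu> \<nu> \<alpha> f) (Xball L \<mu> \<alpha> R \<rho>) \<A>" if \<nu>: "\<nu>\<^sub>0 \<le> \<nu>" for \<nu>
  proof -
    have ge: "64 \<le> \<nu>" "a \<le> \<nu>" "64 / d \<le> \<nu>" "1024 * K / L ^ 3 \<le> \<nu>" "1024 * K * c * r \<le> \<nu>"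
      using \<nu> nonneg unfolding \<nu>\<^sub>0_def by linarith+
    \<comment> \<open>The steady state needs lower bounds for \<open>\<nu>\<^sup>2\<close>, which follow from those for \<open>\<nu>\<close> as \<open>\<nu> \<ge> 1\<close>.\<close>
    have sq: "\<nu> \<le> \<nu>\<^sup>2" using ge(1) by (simp add: power2_eq_square)
    interpret linearised_NSE L \<mu> \<alpha> \<nu> K f
      using assms K K_le ge(1) by unfold_locales auto
    have "2 * \<phi> + 2 * K * c * r\<^sup>2 \<le> \<nu>\<^sup>2 * r"
    proof -
      have "2 * \<phi> + 2 * K * c * r\<^sup>2 = a * r" using r by (simp add: a_def)
      also have "\<dots> \<le> \<nu>\<^sup>2 * r" using ge(2) sq r by (intro mult_right_mono) auto
      finally show ?thesis .
    qed
    moreover have "64 * K * c * (4 * r) \<le> \<nu>\<^sup>2"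
      using ge(5) sq nonneg(4) by linarith
    ultimately obtain w where w: "solenoidal L w" "sob L (1 + \<alpha>) w \<le> ennreal (4 * r)" "steady w = w"
      using steady_state_exists[OF r] unfolding \<phi>_def c_def by blast
    interpret large_viscosity L \<mu> \<alpha> \<nu> K f r w
    proof
      show "36 * L ^ 3 * r * ((L / (2 * pi))\<^sup>2 + \<mu>) \<le> 1"
        using c assms by (simp add: r_def flip: c_def)
      show "64 \<le> \<nu> * (2 * pi / L)\<^sup>2 * \<mu>" using ge(3) d by (simp add: pos_divide_le_eq d_def mult.assoc)
      show "1024 * K \<le> \<nu> * L ^ 3" using ge(4) assms by (simp add: pos_divide_le_eq)
      show "1024 * K * (L / (2 * pi))\<^sup>2 * r \<le> \<nu>" using ge(5) by (simp add: c_def)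
    qed (use r w ge(1) in auto)
    show ?thesis using rest_attractor zero_less_one by blast
  qed
  ultimately show ?thesis by blast
qed

end
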